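(* Suppose that $0<1/n\ll\varepsilon_0\ll\varepsilon\ll\lambda,1/K\ll1$, that $D\ge n-2\lfloor n/4\rfloor-1$, that $0\le\phi\ll1$ and that $n,K,m,\lambda n/K^2,(D-\phi n)/(400K^2)\in\mathbb{N}$. Suppose that the following conditions hold: (i) $G$ is a $D$-regular graph on $n$ vertices. (ii) $\mathcal{P}$ is a $(K,m,\varepsilon_0)$-partition of $V(G)$ such that $e_G(A',B')\ge D$ and $\Delta(G[A',B'])\le D/2$. Furthermore, $G$ is critical (with respect to $A',B'$ and $D$). (In particular, $e_G(A',B')<n$ and $D=(n-1)/2$ or $D=n/2-1$.) (iii) $G_0$ is a subgraph of $G$ such that $G[A_0]+G[B_0]\subseteq G_0$, $e_{G_0}(A',B')\le\phi n$ and $d_{G_0}(v)=\phi n$ for all $v\in V_0$. (iv) Let $G^{\diamond}:=G-G[A]-G[B]-G_0$. Then $e_{G^{\diamond}}(A',B')$ is even and $(G^{\diamond},\mathcal{P})$ is a $(K,m,\varepsilon_0,\varepsilon)$-exceptional scheme. (v) Let $w_1$ and $w_2$ be (fixed) vertices such that $d_{G[A',B']}(w_1)\ge d_{G[A',B']}(w_2)\ge d_{G[A',B']}(v)$ for all $v\in V(G)\setminus\{w_1,w_2\}$. Suppose that $$d_{G^{\diamond}[A',B']}(w_1),\ d_{G^{\diamond}[A',B']}(w_2)\le (D-\phi n)/2.$$ Then there exists a set $\mathcal{J}$ consisting of $(D-\phi n)/2$ edge-disjoint Hamilton exceptional systems with parameter $\varepsilon_0$ in $G^{\diamond}$ which satisfies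 the following properties: (a) Together the Hamilton exceptional systems in $\mathcal{J}$ cover all edges of $G^{\diamond}$. (b) For each $1\le i,i'\le K$, the set $\mathcal{J}$ contains $(D-(\phi+2\lambda)n)/(2K^2)$ $(i,i')$-HES. Moreover, $\lambda n/K^2$ of these $(i,i')$-HES $J$ are such that (b$_1$) $e_J(A',B')=2$ and (b$_2$) $d_{J[A',B']}(w)=1$ for all $w\in\{w_1,w_2\}$ with $d_{G[A',B']}(w)\ge 11D/40$.
   Context: Constants. The hierarchy $0<1/n\ll\varepsilon_0\ll\varepsilon\ll\lambda,1/K\ll1$ means that constants are chosen from right to left: there are non-decreasing functions $(0,1]\to(0,1]$ such that the result holds whenever each constant is at most the corresponding function of the constant(s) to its right ($\varepsilon$ must be small with respect to both $\lambda$ and $1/K$, while $\lambda$ and $1/K$ are each at most some absolute constant, with no relation between them). $0\le\phi\ll1$ means that $\phi$ is non-negative and at most a sufficiently small absolute constant. $a=b\pm c$ means $b-c\le a\le b+c$. Graph notation. Graphs are finite and simple. $e(G)$ is the number of edges, $\Delta(G)$ the maximum degree; $d_G(v)$ is the degree of $v$ and $d_G(v,X)$ the number of neighbours of $v$ in $X$; $e_G(X)$ is the number of edges with both endvertices in $X$; $e_G(X,Y)$ is the number of edges with one endvertex in $X$ and the other in $Y$ (subscripts are omitted if clear). $G[X]$ is the induced subgraph on $X$; for disjoint $X,Y$, $G[X,Y]$ is the bipartite subgraph with classes $X,Y$ and all edges of $G$ between $X$ and $Y$. For edge-disjoint $G,H$, $G+H$ has vertex set $V(G)\cup V(H)$ and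 edge set $E(G)\cup E(H)$. $G-H$ is obtained from $G$ by deleting the edges in $E(G)\cap E(H)$. A path system is a graph which is a union of vertex-disjoint paths (some possibly trivial, i.e. single vertices). Partitions. A $(K,m,\varepsilon_0)$-partition $\mathcal{P}$ of a vertex set $V$ is a partition of $V$ into sets $A_0,A_1,\dots,A_K$ and $B_0,B_1,\dots,B_K$ such that $|A_i|=|B_i|=m$ for all $i\ge1$ and $|A_0\cup B_0|\le\varepsilon_0|V|$. Write $V_0:=A_0\cup B_0$, $A:=A_1\cup\dots\cup A_K$, $B:=B_1\cup\dots\cup B_K$, $A':=A_0\cup A$, $B':=B_0\cup B$. Critical. A $D$-regular graph $G$ with a partition $A',B'$ of $V(G)$ is critical (with respect to $A',B'$ and $D$) if both $\Delta(G[A',B'])\ge 11D/40$ and $e(H)\le 41D/40$ for all subgraphs $H$ of $G[A',B']$ with $\Delta(H)\le 11D/40$. Exceptional schemes. For a graph $G$ on $n$ vertices and a partition $\mathcal{P}$ of $V(G)$, $(G,\mathcal{P})$ is a $(K,m,\varepsilon_0,\varepsilon)$-exceptional scheme if: (ESch1) $\mathcal{P}$ is a $(K,m,\varepsilon_0)$-partition of $V(G)$; (ESch2) $e(A)=e(B)=0$; (ESch3) if $v\in A$ then $d(v,B')<\varepsilon_0n$ and if $v\in B$ then $d(v,A')<\varepsilon_0n$; (ESch4) for all $v\in V(G)$ and all $1\le i\le K$, $d(v,A_i)=(d(v,A)\pm\varepsilon n)/K$ and $d(v,B_i)=(d(v,B)\pm\varepsilon n)/K$; (ESch5) for all $1\le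 i,i'\le K$: $e(A_0,A_i)=(e(A_0,A)\pm\varepsilon\max\{e(A_0,A),n\})/K$, $e(B_0,A_i)=(e(B_0,A)\pm\varepsilon\max\{e(B_0,A),n\})/K$, $e(A_0,B_i)=(e(A_0,B)\pm\varepsilon\max\{e(A_0,B),n\})/K$, $e(B_0,B_i)=(e(B_0,B)\pm\varepsilon\max\{e(B_0,B),n\})/K$, and $e(A_i,B_{i'})=(e(A,B)\pm\varepsilon\max\{e(A,B),n\})/K^2$. Hamilton exceptional systems. Let $A,A_0,B,B_0$ partition a set $V$ of $n$ vertices with $|A|=|B|$. An exceptional cover $J$ is a path system with $V_0\subseteq V(J)\subseteq V$, such that $d_J(v)=2$ for every $v\in V_0$, $d_J(v)\le1$ for every $v\in V(J)\setminus V_0$, and $e_J(A)=e_J(B)=0$. A Hamilton exceptional system (HES) with parameter $\varepsilon_0$ is an exceptional cover $J$ such that the number of $AB$-paths in $J$ (paths with one endvertex in $A$ and the other in $B$; these are automatically components of $J$) is even, positive and at most $\sqrt{\varepsilon_0}\,n$. For $1\le i,i'\le K$, an $(i,i')$-HES is a Hamilton exceptional system $J$ with $V(J)\subseteq V_0\cup A_i\cup B_{i'}$. $d_{J[A',B']}(w)$ is the number of edges of $J$ between $A'$ and $B'$ which are incident to $w$. *)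

theory Defs
  imports Complex_Main
begin

section \<open>Finite simple graphs\<close>

text \<open>An edge is the two-element set of its endvertices; well-formedness is the predicate
  \<open>simple_graph\<close>.\<close>

datatype 'a graph = Graph (verts: "'a set") (edges: "'a set set")

definition simple_graph :: "'a graph \<Rightarrow> bool" where
  "simple_graph G \<longleftrightarrow> finite (verts G) \<and>
     (\<forall>e\<in>edges G. \<exists>u v. u \<in> verts G \<and> v \<in> verts G \<and> u \<noteq> v \<and> e = {u, v})"

definition subgraph :: "'a graph \<Rightarrow> 'a graph \<Rightarrow> bool" where
  "subgraph H G \<longleftrightarrow> simple_graph H \<and> verts H \<subseteq> verts G \<and> edges H \<subseteq> edges G"

definition e_graph :: "'a graph \<Rightarrow> nat" where
  "e_graph G = card (edges G)"

definition e_within :: "'a graph \<Rightarrow> 'a set \<Rightarrow> nat" where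
  "e_within G X = card {e \<in> edges G. e \<subseteq> X}"

definition e_between :: "'a graph \<Rightarrow> 'a set \<Rightarrow> 'a set \<Rightarrow> nat" where
  "e_between G X Y = card {e \<in> edges G. \<exists>x\<in>X. \<exists>y\<in>Y. e = {x, y}}"

definition deg_in :: "'a graph \<Rightarrow> 'a \<Rightarrow> 'a set \<Rightarrow> nat" where
  "deg_in G v X = card {u \<in> X. {u, v} \<in> edges G}"

definition deg :: "'a graph \<Rightarrow> 'a \<Rightarrow> nat" where
  "deg G v = deg_in G v (verts G)"

text \<open>The inserted \<open>0\<close> gives the graph without vertices maximum degree \<open>0\<close>.\<close>

definition max_deg :: "'a graph \<Rightarrow> nat" where
  "max_deg G = Max (insert 0 (deg G ` verts G))"

definition regular :: "nat \<Rightarrow> 'a graph \<Rightarrow> bool" where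
  "regular D G \<longleftrightarrow> (\<forall>v\<in>verts G. deg G v = D)"

definition induced :: "'a graph \<Rightarrow> 'a set \<Rightarrow> 'a graph" where
  "induced G X = Graph (verts G \<inter> X) {e \<in> edges G. e \<subseteq> X}"

definition bip :: "'a graph \<Rightarrow> 'a set \<Rightarrow> 'a set \<Rightarrow> 'a graph" where
  "bip G X Y = Graph (verts G \<inter> (X \<union> Y)) {e \<in> edges G. \<exists>x\<in>X. \<exists>y\<in>Y. e = {x, y}}"

definition graph_plus :: "'a graph \<Rightarrow> 'a graph \<Rightarrow> 'a graph" where
  "graph_plus G H = Graph (verts G \<union> verts H) (edges G \<union> edges H)"

text \<open>Only edges are deleted; the vertex set stays that of the first graph.\<close>

definition graph_minus :: "'a graph \<Rightarrow> 'a graph \<Rightarrow> 'a graph" where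
  "graph_minus G H = Graph (verts G) (edges G - edges H)"


section \<open>Paths and path systems\<close>

text \<open>The path visiting the vertices of a nonempty distinct list in order; a singleton list gives
  a trivial path.\<close>

definition path_of :: "'a list \<Rightarrow> 'a graph" where
  "path_of xs = Graph (set xs) {{xs ! i, xs ! Suc i} | i. Suc i < length xs}"

definition is_path :: "'a graph \<Rightarrow> bool" where
  "is_path P \<longleftrightarrow> (\<exists>xs. xs \<noteq> [] \<and> distinct xs \<and> P = path_of xs)"

definition path_system :: "'a graph \<Rightarrow> bool" where
  "path_system J \<longleftrightarrow> simple_graph J \<and>
     (\<exists>Ps. (\<forall>P\<in>Ps. is_path P) \<and>
           (\<forall>P\<in>Ps. \<forall>Q\<in>Ps. P \<noteq> Q \<longrightarrow> verts P \<inter> verts Q = {}) \<and>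
           verts J = (\<Union>P\<in>Ps. verts P) \<and> edges J = (\<Union>P\<in>Ps. edges P))"

definition paths_between :: "'a graph \<Rightarrow> 'a set \<Rightarrow> 'a set \<Rightarrow> 'a graph set" where
  "paths_between J X Y =
     {path_of xs | xs. xs \<noteq> [] \<and> distinct xs \<and> hd xs \<in> X \<and> last xs \<in> Y \<and>
                       subgraph (path_of xs) J}"


section \<open>Partitions, critical graphs and exceptional schemes\<close>

text \<open>A partition is given by two families \<open>A, B :: nat \<Rightarrow> 'a set\<close>, of which only the members with
  index at most \<open>K\<close> are relevant. Then \<open>clusters K A\<close> is $A_1 \cup \dots \cup A_K$ and \<open>side K A\<close> is
  $A' = A_0 \cup A_1 \cup \dots \cup A_K$.\<close>

definition clusters :: "nat \<Rightarrow> (nat \<Rightarrow> 'a set) \<Rightarrow> 'a set" where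
  "clusters K A = (\<Union>i\<in>{1..K}. A i)"

definition side :: "nat \<Rightarrow> (nat \<Rightarrow> 'a set) \<Rightarrow> 'a set" where
  "side K A = A 0 \<union> clusters K A"

definition Kme_partition ::
  "nat \<Rightarrow> nat \<Rightarrow> real \<Rightarrow> (nat \<Rightarrow> 'a set) \<Rightarrow> (nat \<Rightarrow> 'a set) \<Rightarrow> 'a set \<Rightarrow> bool" where
  "Kme_partition K m \<epsilon>\<^sub>0 A B V \<longleftrightarrow>
     V = side K A \<union> side K B \<and>
     (\<forall>i\<le>K. \<forall>j\<le>K. i \<noteq> j \<longrightarrow> A i \<inter> A j = {} \<and> B i \<inter> B j = {}) \<and>
     (\<forall>i\<le>K. \<forall>j\<le>K. A i \<inter> B j = {}) \<and>
     (\<forall>i\<in>{1..K}. card (A i) = m \<and> card (B i) = m) \<and>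
     real (card (A 0 \<union> B 0)) \<le> \<epsilon>\<^sub>0 * real (card V)"

definition critical :: "'a graph \<Rightarrow> 'a set \<Rightarrow> 'a set \<Rightarrow> nat \<Rightarrow> bool" where
  "critical G A' B' D \<longleftrightarrow>
     real (max_deg (bip G A' B')) \<ge> 11 * real D / 40 \<and>
     (\<forall>H. subgraph H (bip G A' B') \<and> real (max_deg H) \<le> 11 * real D / 40
            \<longrightarrow> real (e_graph H) \<le> 41 * real D / 40)"

text \<open>\<open>pm a b c\<close> is $a = b \pm c$; below, $a = (b \pm c)/K$ becomes \<open>pm a (b / K) (c / K)\<close>.\<close>

definition pm :: "real \<Rightarrow> real \<Rightarrow> real \<Rightarrow> bool" where
  "pm a b c \<longleftrightarrow> b - c \<le> a \<and> a \<le> b + c"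

definition exceptional_scheme ::
  "nat \<Rightarrow> nat \<Rightarrow> real \<Rightarrow> real \<Rightarrow> 'a graph \<Rightarrow> (nat \<Rightarrow> 'a set) \<Rightarrow> (nat \<Rightarrow> 'a set) \<Rightarrow> bool" where
  "exceptional_scheme K m \<epsilon>\<^sub>0 \<epsilon> G A B \<longleftrightarrow>
    (let n = real (card (verts G)); k = real K;
         cA = clusters K A; cB = clusters K B;
         d = (\<lambda>v X. real (deg_in G v X));
         e = (\<lambda>X Y. real (e_between G X Y))
     in
       Kme_partition K m \<epsilon>\<^sub>0 A B (verts G) \<and>
       (e_within G cA = 0 \<and> e_within G cB = 0) \<and>
       ((\<forall>v\<in>cA. d v (side K B) < \<epsilon>\<^sub>0 * n) \<and>
        (\<forall>v\<in>cB. d v (side K A) < \<epsilon>\<^sub>0 * n)) \<and>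
       (\<forall>v\<in>verts G. \<forall>i\<in>{1..K}.
          pm (d v (A i)) (d v cA / k) (\<epsilon> * n / k) \<and>
          pm (d v (B i)) (d v cB / k) (\<epsilon> * n / k)) \<and>
       (\<forall>i\<in>{1..K}. \<forall>i'\<in>{1..K}.
          pm (e (A 0) (A i)) (e (A 0) cA / k) (\<epsilon> * max (e (A 0) cA) n / k) \<and>
          pm (e (B 0) (A i)) (e (B 0) cA / k) (\<epsilon> * max (e (B 0) cA) n / k) \<and>
          pm (e (A 0) (B i)) (e (A 0) cB / k) (\<epsilon> * max (e (A 0) cB) n / k) \<and>
          pm (e (B 0) (B i)) (e (B 0) cB / k) (\<epsilon> * max (e (B 0) cB) n / k) \<and>
          pm (e (A i) (B i')) (e cA cB / k\<^sup>2) (\<epsilon> * max (e cA cB) n / k\<^sup>2)))"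


section \<open>Hamilton exceptional systems\<close>

text \<open>The sets \<open>A, A0, B, B0\<close> are meant to partition the ambient vertex set \<open>V\<close>, which is therefore
  written as their union, and \<open>A\<close> and \<open>B\<close> to have equal size.\<close>

definition exceptional_cover ::
  "'a set \<Rightarrow> 'a set \<Rightarrow> 'a set \<Rightarrow> 'a set \<Rightarrow> 'a graph \<Rightarrow> bool" where
  "exceptional_cover A A0 B B0 J \<longleftrightarrow>
     path_system J \<and>
     A0 \<union> B0 \<subseteq> verts J \<and> verts J \<subseteq> A \<union> A0 \<union> B \<union> B0 \<and>
     (\<forall>v \<in> A0 \<union> B0. deg J v = 2) \<and>
     (\<forall>v \<in> verts J - (A0 \<union> B0). deg J v \<le> 1) \<and>
     e_within J A = 0 \<and> e_within J B = 0"

definition hamilton_exceptional_system ::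
  "real \<Rightarrow> 'a set \<Rightarrow> 'a set \<Rightarrow> 'a set \<Rightarrow> 'a set \<Rightarrow> 'a graph \<Rightarrow> bool" where
  "hamilton_exceptional_system \<epsilon>\<^sub>0 A A0 B B0 J \<longleftrightarrow>
     exceptional_cover A A0 B B0 J \<and>
     even (card (paths_between J A B)) \<and>
     card (paths_between J A B) > 0 \<and>
     real (card (paths_between J A B)) \<le> sqrt \<epsilon>\<^sub>0 * real (card (A \<union> A0 \<union> B \<union> B0))"

abbreviation HES ::
  "real \<Rightarrow> nat \<Rightarrow> (nat \<Rightarrow> 'a set) \<Rightarrow> (nat \<Rightarrow> 'a set) \<Rightarrow> 'a graph \<Rightarrow> bool" where
  "HES \<epsilon>\<^sub>0 K A B J \<equiv>
     hamilton_exceptional_system \<epsilon>\<^sub>0 (clusters K A) (A 0) (clusters K B) (B 0) J"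

definition local_HES ::
  "real \<Rightarrow> nat \<Rightarrow> (nat \<Rightarrow> 'a set) \<Rightarrow> (nat \<Rightarrow> 'a set) \<Rightarrow> nat \<Rightarrow> nat \<Rightarrow> 'a graph \<Rightarrow> bool" where
  "local_HES \<epsilon>\<^sub>0 K A B i i' J \<longleftrightarrow>
     HES \<epsilon>\<^sub>0 K A B J \<and> verts J \<subseteq> (A 0 \<union> B 0) \<union> A i \<union> B i'"


section \<open>Hierarchies of constants\<close>

text \<open>The functions implicit in a relation \<open>a << b\<close>, which stands for \<open>a \<le> f b\<close>.\<close>

definition hierarchy_fun :: "(real \<Rightarrow> real) \<Rightarrow> bool" where
  "hierarchy_fun f \<longleftrightarrow> mono_on {0<..1} f \<and> f ` {0<..1} \<subseteq> {0<..1}"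

end

theory Submission
  imports Defs
begin

text \<open>
  Put \<open>N = (D - \<phi> n)/2\<close>, the number of systems wanted. In \<open>Gd\<close> every exceptional vertex has degree
  exactly \<open>2 N\<close>, and the edges of \<open>Gd\<close> are of two kinds: the crossing edges \<open>H\<close> between \<open>A'\<close> and \<open>B'\<close>,
  and the edges joining \<open>A\<^sub>0\<close> to \<open>A\<close> or \<open>B\<^sub>0\<close> to \<open>B\<close>. A system uses two edges at each exceptional vertex,
  so a decomposition into \<open>N\<close> systems is a decomposition of \<open>H\<close> into \<open>N\<close> crossing parts together with a
  way of completing each of them by edges of the second kind.

  As crossing parts we use \<^emph>\<open>pieces\<close>: a matching of two or four edges, possibly together with two
  further edges that share an exceptional vertex and are disjoint from the matching. If every exceptional
  vertex of crossing degree less than two is given the missing number of private neighbours in its own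
  side, off the piece, the result is a path system (locale \<open>completion\<close>). Each matching edge becomes an
  \<open>AB\<close>-path, and every other component returns to the side it came from. Hence there are two or four
  \<open>AB\<close>-paths, and the result is a Hamilton exceptional system (\<open>completed_HES\<close>).

  \<^bold>\<open>Decomposing the crossing edges.\<close> Write \<open>e(H) = 2 N + 2 q\<close>, an even number, so we let \<open>q\<close> of the
  pieces have four edges and the rest two. We remove pieces greedily while maintaining that, when \<open>s\<close> pieces
  are still to be removed, all degrees are at most about \<open>s\<close>. Only vertices for which this bound is
  nearly tight have to be hit, and counting edges shows that there are at most two of them when a pair
  is removed, and at most three when a four-edge piece is removed; a four-edge piece can hit three
  vertices, one of them twice. Criticality enters here: at most three vertices have crossing degree at
  least \<open>11 D/40\<close>, and \<open>e(H)\<close> is at most about \<open>1.7 D\<close>, so \<open>q\<close> is well below \<open>N\<close>. Of the heavy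
  vertices, \<open>w\<^sub>1\<close> and \<open>w\<^sub>2\<close> have degree at most \<open>N\<close> in \<open>H\<close> by hypothesis. The third one, \<open>y\<close>, may exceed \<open>N\<close>,
  but then all three have large degree, \<open>q\<close> is large, and \<open>y\<close> is hit twice by the four-edge pieces.

  \<^bold>\<open>Localisation.\<close> Every crossing edge is assigned to a cell \<open>(i, i')\<close> so that its nonexceptional ends lie
  in \<open>A\<^sub>i \<union> B\<^sub>i\<^sub>'\<close> and every cell receives its share \<open>1/K\<^sup>2\<close> of \<open>H\<close> and of every exceptional degree, up to
  a small error \<open>\<eta>\<close> (\<open>cell_split\<close>). From each cell we remove \<open>M - T\<close> pieces, where \<open>M = N/K\<^sup>2\<close> and
  \<open>T = \<lambda> n/K\<^sup>2\<close>; the first \<open>T\<close> of them are pairs hitting the heavy vertices among \<open>w\<^sub>1, w\<^sub>2\<close>. Since \<open>T\<close> is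
  much larger than \<open>\<eta>\<close>, the rounding errors are absorbed by what is left over in the cells. The union of
  the leftovers is decomposed into the remaining \<open>K\<^sup>2 T\<close> pieces with no restriction on location
  (\<open>cross_decomposition\<close>).

  \<^bold>\<open>Completing the pieces.\<close> The edges from an exceptional vertex \<open>v\<close> into its own side must be handed to
  the pieces, \<open>2 - d(v)\<close> to a piece in which \<open>v\<close> has degree \<open>d(v)\<close>. A piece of the cell \<open>(i, i')\<close> accepts only
  neighbours in \<open>A\<^sub>i \<union> B\<^sub>i\<^sub>'\<close>, the unrestricted pieces accept any. The neighbours given to different exceptional vertices of one piece must be distinct
  and must avoid the piece. The exceptional vertices are treated one after the other, and at each of
  them Hall's theorem applies, because only few choices are forbidden and the unrestricted pieces leave
  enough room (\<open>vertex_assignment\<close>, \<open>star_assignment\<close>).\<close>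

section \<open>Edge sets of bipartite graphs\<close>

definition dg :: "'a set set \<Rightarrow> 'a \<Rightarrow> nat" where
  "dg F v = card {e \<in> F. v \<in> e}"

definition bipart :: "'a set \<Rightarrow> 'a set \<Rightarrow> 'a set set \<Rightarrow> bool" where
  "bipart P Q F \<longleftrightarrow> finite F \<and> P \<inter> Q = {} \<and> (\<forall>e\<in>F. \<exists>x\<in>P. \<exists>y\<in>Q. e = {x, y})"

definition matching :: "'a set set \<Rightarrow> bool" where
  "matching M \<longleftrightarrow> (\<forall>e\<in>M. \<forall>f\<in>M. e \<noteq> f \<longrightarrow> e \<inter> f = {})"

lemma bipart_subset: "bipart P Q F \<Longrightarrow> F' \<subseteq> F \<Longrightarrow> bipart P Q F'"
  unfolding bipart_def by (simp add: finite_subset subset_iff)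

lemma bipart_finite: "bipart P Q F \<Longrightarrow> finite F"
  unfolding bipart_def by simp

lemma bipart_edgeE:
  assumes "bipart P Q F" "e \<in> F"
  obtains x y where "e = {x, y}" "x \<in> P" "y \<in> Q" "x \<notin> Q" "y \<notin> P" "x \<noteq> y"
proof -
  obtain x y where xy: "x \<in> P" "y \<in> Q" "e = {x, y}" using assms unfolding bipart_def by metis
  moreover have "P \<inter> Q = {}" using assms(1) unfolding bipart_def by simp
  ultimately have "x \<notin> Q" "y \<notin> P" by auto
  then show thesis using that[of x y] xy by auto
qed

lemma bipart_edge_finite:
  assumes "bipart P Q F" "e \<in> F"
  shows "finite e" "card e = 2"
  by (rule bipart_edgeE[OF assms]; simp)+

lemma bipart_edge_eq:
  assumes "bipart P Q F" "e \<in> F" "u \<in> e" "v \<in> e" "u \<noteq> v"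
  shows "e = {u, v}"
  by (rule bipart_edgeE[OF assms(1,2)]) (use assms in auto)

lemma bipart_same_class:
  assumes "bipart P Q F" "e \<in> F" "u \<in> e" "v \<in> e" "u \<in> P \<longleftrightarrow> v \<in> P"
  shows "u = v"
  by (rule bipart_edgeE[OF assms(1,2)]) (use assms in auto)

lemma dg_mono: "finite F \<Longrightarrow> F' \<subseteq> F \<Longrightarrow> dg F' v \<le> dg F v"
  unfolding dg_def by (rule card_mono) auto

lemma dg_le_card: "finite F \<Longrightarrow> dg F v \<le> card F"
  unfolding dg_def by (rule card_mono) auto

lemma dg_Un_disjoint:
  assumes "finite F" "finite F'" "F \<inter> F' = {}"
  shows "dg (F \<union> F') v = dg F v + dg F' v"
proof -
  have "{e \<in> F \<union> F'. v \<in> e} = {e \<in> F. v \<in> e} \<union> {e \<in> F'. v \<in> e}" by blast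
  moreover have "card ({e \<in> F. v \<in> e} \<union> {e \<in> F'. v \<in> e}) = card {e \<in> F. v \<in> e} + card {e \<in> F'. v \<in> e}"
  proof (rule card_Un_disjoint)
    show "{e \<in> F. v \<in> e} \<inter> {e \<in> F'. v \<in> e} = {}" using assms(3) by blast
  qed (use assms in simp_all)
  ultimately show ?thesis unfolding dg_def by argo
qed

lemma dg_Diff:
  assumes "finite F" "P \<subseteq> F"
  shows "dg (F - P) v = dg F v - dg P v"
proof -
  have "dg ((F - P) \<union> P) v = dg (F - P) v + dg P v"
    by (rule dg_Un_disjoint) (use assms in \<open>auto intro: finite_subset\<close>)
  moreover have "(F - P) \<union> P = F" using assms(2) by blast
  ultimately show ?thesis by simp
qed

lemma dg_pos_iff: "finite F \<Longrightarrow> 0 < dg F v \<longleftrightarrow> (\<exists>e\<in>F. v \<in> e)"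
  unfolding dg_def by (auto simp: card_gt_0_iff)

lemma dg_UN_disjoint:
  assumes "finite I" "\<And>i. i \<in> I \<Longrightarrow> finite (F i)"
    "\<And>i j. i \<in> I \<Longrightarrow> j \<in> I \<Longrightarrow> i \<noteq> j \<Longrightarrow> F i \<inter> F j = {}"
  shows "dg (\<Union>i\<in>I. F i) v = (\<Sum>i\<in>I. dg (F i) v)"
proof -
  have "{e \<in> (\<Union>i\<in>I. F i). v \<in> e} = (\<Union>i\<in>I. {e \<in> F i. v \<in> e})" by auto
  moreover have "card (\<Union>i\<in>I. {e \<in> F i. v \<in> e}) = (\<Sum>i\<in>I. card {e \<in> F i. v \<in> e})"
  proof (rule card_UN_disjoint[OF assms(1)])
    show "\<forall>i\<in>I. finite {e \<in> F i. v \<in> e}" using assms(2) by simp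
    show "\<forall>i\<in>I. \<forall>j\<in>I. i \<noteq> j \<longrightarrow> {e \<in> F i. v \<in> e} \<inter> {e \<in> F j. v \<in> e} = {}"
      using assms(3) by blast
  qed
  ultimately show ?thesis unfolding dg_def by simp
qed

lemma card_edges_meeting:
  assumes "bipart P Q F" "v \<notin> e" "finite e"
  shows "card {f \<in> F. v \<in> f \<and> f \<inter> e \<noteq> {}} \<le> card e"
proof -
  have "{f \<in> F. v \<in> f \<and> f \<inter> e \<noteq> {}} \<subseteq> (\<lambda>x. {v, x}) ` e"
  proof
    fix f assume "f \<in> {f \<in> F. v \<in> f \<and> f \<inter> e \<noteq> {}}"
    then obtain x where "f \<in> F" "v \<in> f" "x \<in> f" "x \<in> e" by auto
    then show "f \<in> (\<lambda>x. {v, x}) ` e" using bipart_edge_eq[OF assms(1)] assms(2) by blast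
  qed
  then show ?thesis using assms(3) by (meson card_image_le card_mono finite_imageI le_trans)
qed

lemma edge_at_avoiding:
  assumes "bipart P Q F" "v \<notin> S" "finite S" "card S < dg F v"
  shows "\<exists>f\<in>F. v \<in> f \<and> f \<inter> S = {}"
proof (rule ccontr)
  assume "\<not> ?thesis"
  then have "{e \<in> F. v \<in> e} = {f \<in> F. v \<in> f \<and> f \<inter> S \<noteq> {}}" by blast
  then show False using card_edges_meeting[OF assms(1-3)] assms(4) unfolding dg_def by simp
qed

definition edges_meeting :: "'a set set \<Rightarrow> 'a set \<Rightarrow> 'a set set" where
  "edges_meeting F X = {e \<in> F. e \<inter> X \<noteq> {}}"

lemma edges_meeting_subset: "edges_meeting F X \<subseteq> F"
  unfolding edges_meeting_def by auto

text \<open>Adding a vertex \<open>v\<close> to \<open>X\<close> covers all edges at \<open>v\<close> except those that go to \<open>X\<close>, of which there is at most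
  one for each vertex of \<open>X\<close>.\<close>

lemma card_edges_meeting_insert:
  assumes "bipart P Q F" "finite X" "v \<notin> X"
  shows "card (edges_meeting F X) + dg F v \<le> card (edges_meeting F (insert v X)) + card X"
proof -
  have fin: "finite F" using assms(1) by (rule bipart_finite)
  let ?S = "{e \<in> F. v \<in> e}"
  have "edges_meeting F (insert v X) = edges_meeting F X \<union> ?S" unfolding edges_meeting_def by auto
  moreover have "card (edges_meeting F X) + card ?S = card (edges_meeting F X \<union> ?S) + card (edges_meeting F X \<inter> ?S)"
    using fin unfolding edges_meeting_def by (intro card_Un_Int) auto
  moreover have "edges_meeting F X \<inter> ?S = {f \<in> F. v \<in> f \<and> f \<inter> X \<noteq> {}}" unfolding edges_meeting_def by auto
  moreover have "card {f \<in> F. v \<in> f \<and> f \<inter> X \<noteq> {}} \<le> card X"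
    by (rule card_edges_meeting[OF assms(1,3,2)])
  ultimately show ?thesis unfolding dg_def by simp
qed

lemma card_edges_meeting_single: "card (edges_meeting F {v}) = dg F v"
  unfolding edges_meeting_def dg_def by (rule arg_cong[where f=card]) auto

lemma dg_sum2_same_class:
  assumes "bipart P Q F" "u \<noteq> v" "u \<in> P \<longleftrightarrow> v \<in> P"
  shows "dg F u + dg F v \<le> card (edges_meeting F {u,v})"
proof -
  have fin: "finite F" using assms(1) by (rule bipart_finite)
  have "edges_meeting F {u,v} = {e \<in> F. u \<in> e} \<union> {e \<in> F. v \<in> e}" unfolding edges_meeting_def by auto
  moreover have "{e \<in> F. u \<in> e} \<inter> {e \<in> F. v \<in> e} = {}"
    using bipart_same_class[OF assms(1)] assms(2,3) by blast
  ultimately show ?thesis unfolding dg_def using fin by (simp add: card_Un_disjoint)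
qed

text \<open>Of three vertices two lie in the same class, so they span at most two edges.\<close>

lemma dg_sum3:
  assumes b: "bipart P Q F" and d: "u \<noteq> v" "u \<noteq> w" "v \<noteq> w"
  shows "dg F u + dg F v + dg F w \<le> card F + 2"
proof -
  have fin: "finite F" using b by (rule bipart_finite)
  have *: "dg F a + dg F b' + dg F c \<le> card F + 2"
    if "a \<noteq> b'" "a \<noteq> c" "b' \<noteq> c" "a \<in> P \<longleftrightarrow> b' \<in> P" for a b' c
  proof -
    have "card (edges_meeting F {a,b'}) + dg F c \<le> card (edges_meeting F (insert c {a,b'})) + card {a,b'}"
      by (rule card_edges_meeting_insert[OF b]) (use that in auto)
    moreover have "card {a,b'} = 2" using that by simp
    moreover have "card (edges_meeting F (insert c {a,b'})) \<le> card F"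
      by (rule card_mono[OF fin edges_meeting_subset])
    ultimately show ?thesis using dg_sum2_same_class[OF b that(1,4)] by linarith
  qed
  consider "u \<in> P \<longleftrightarrow> v \<in> P" | "u \<in> P \<longleftrightarrow> w \<in> P" | "v \<in> P \<longleftrightarrow> w \<in> P" by blast
  then show ?thesis using *[of u v w] *[of u w v] *[of v w u] d by cases auto
qed

text \<open>Four vertices span at most \<open>0 + 1 + 2 + 3\<close> edges, counted as the vertices are added one at a time.\<close>

lemma dg_sum4:
  assumes b: "bipart P Q F" and d: "distinct [u, v, w, z]"
  shows "dg F u + dg F v + dg F w + dg F z \<le> card (edges_meeting F {u,v,w,z}) + 6"
proof -
  have 1: "card (edges_meeting F {z}) + dg F w \<le> card (edges_meeting F {w,z}) + 1"
    using card_edges_meeting_insert[OF b, of "{z}" w] d by auto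
  have 2: "card (edges_meeting F {w,z}) + dg F v \<le> card (edges_meeting F {v,w,z}) + 2"
    using card_edges_meeting_insert[OF b, of "{w,z}" v] d by auto
  have 3: "card (edges_meeting F {v,w,z}) + dg F u \<le> card (edges_meeting F {u,v,w,z}) + 3"
    using card_edges_meeting_insert[OF b, of "{v,w,z}" u] d by auto
  from 1 2 3 show ?thesis by (simp add: card_edges_meeting_single)
qed

lemma three_of_card:
  assumes "3 \<le> card X"
  obtains u v w where "u \<in> X" "v \<in> X" "w \<in> X" "u \<noteq> v" "u \<noteq> w" "v \<noteq> w"
proof -
  obtain Y where "Y \<subseteq> X" "card Y = 3" using obtain_subset_with_card_n[OF assms] by metis
  then show ?thesis using that unfolding card_3_iff by blast
qed

lemma four_of_card:
  assumes "4 \<le> card X"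
  obtains u v w z where "u \<in> X" "v \<in> X" "w \<in> X" "z \<in> X" "distinct [u, v, w, z]"
proof -
  obtain Y where Y: "Y \<subseteq> X" "card Y = 4" "finite Y"
    using obtain_subset_with_card_n[OF assms] by metis
  then obtain l where l: "set l = Y" "distinct l" using finite_distinct_list by blast
  then have "length l = 4" using Y distinct_card by metis
  then obtain u v w z where "l = [u,v,w,z]"
    by (auto simp: numeral_eq_Suc length_Suc_conv)
  then show ?thesis using that[of u v w z] l Y by auto
qed

lemma finite_heavy:
  assumes "bipart P Q F" "0 < t"
  shows "finite {v. t \<le> dg F v}"
proof -
  have fin: "finite F" using assms(1) by (rule bipart_finite)
  have "{v. t \<le> dg F v} \<subseteq> \<Union>F"
  proof
    fix v assume "v \<in> {v. t \<le> dg F v}"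
    then have "0 < dg F v" using assms(2) by auto
    then show "v \<in> \<Union>F" using dg_pos_iff[OF fin] by auto
  qed
  then show ?thesis using fin bipart_edge_finite(1)[OF assms(1)] finite_subset by blast
qed

section \<open>Extracting one piece\<close>

text \<open>This is the basic greedy step. With \<open>X\<close> empty it says that a bipartite graph without two disjoint edges
  is a star, as it contains no triangle; the star is excluded by the degree bound. For nonempty \<open>X\<close>, a vertex
  of degree three always has an edge that avoids the two ends of another edge.\<close>

lemma disjoint_pair_covering:
  assumes b: "bipart P Q F" and star: "\<And>v. dg F v < card F"
    and X: "finite X" "card X \<le> 2" "\<And>v. v \<in> X \<Longrightarrow> 3 \<le> dg F v"
  shows "\<exists>e\<in>F. \<exists>f\<in>F. e \<inter> f = {} \<and> X \<subseteq> e \<union> f"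
proof -
  have fin: "finite F" using b by (rule bipart_finite)
  have other: "\<exists>f\<in>F. v \<notin> f" for v
  proof (rule ccontr)
    assume "\<not> ?thesis"
    then have "{e \<in> F. v \<in> e} = F" by auto
    then show False using star[of v] unfolding dg_def by simp
  qed
  have avoid: "\<exists>f\<in>F. v \<in> f \<and> f \<inter> e = {}" if "v \<notin> e" "e \<in> F" "3 \<le> dg F v" for v e
    using edge_at_avoiding[OF b that(1)] bipart_edge_finite[OF b that(2)] that(3) by simp
  consider "X = {}" | u where "X = {u}" | u v where "X = {u,v}" "u \<noteq> v"
  proof -
    consider "card X = 0" | "card X = 1" | "card X = 2" using X(2) by linarith
    then show ?thesis
    proof cases
      case 1
      then show ?thesis using that(1) X(1) by simp
    next
      case 2
      then show ?thesis using that(2) by (meson card_1_singletonE)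
    next
      case 3
      then show ?thesis using that(3) unfolding card_2_iff by blast
    qed
  qed
  then show ?thesis
  proof cases
    case 1
    show ?thesis
    proof (rule ccontr)
      assume neg: "\<not> ?thesis"
      then have meet: "e \<inter> f \<noteq> {}" if "e \<in> F" "f \<in> F" for e f using that 1 by blast
      obtain e where e: "e \<in> F" using other by blast
      obtain x y where xy: "e = {x,y}" "x \<in> P" "y \<in> Q" "x \<notin> Q" "y \<notin> P"
        by (rule bipart_edgeE[OF b e])
      obtain f where f: "f \<in> F" "x \<notin> f" using other by blast
      obtain g where g: "g \<in> F" "y \<notin> g" using other by blast
      have yf: "y \<in> f" using meet[OF e f(1)] xy f by auto
      have xg: "x \<in> g" using meet[OF e g(1)] xy g by auto
      obtain v where v: "v \<in> f" "v \<in> g" using meet[OF f(1) g(1)] by blast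
      have "v = y" if "v \<in> P \<longleftrightarrow> y \<in> P" using bipart_same_class[OF b f(1) v(1) yf that] .
      moreover have "v = x" if "v \<in> P \<longleftrightarrow> x \<in> P" using bipart_same_class[OF b g(1) v(2) xg that] .
      ultimately have "v = x \<or> v = y" using xy by blast
      then show False using v f(2) g(2) by blast
    qed
  next
    case (2 u)
    obtain f where "f \<in> F" "u \<notin> f" using other by blast
    moreover then obtain e where "e \<in> F" "u \<in> e" "e \<inter> f = {}" using avoid[of u f] X(3) 2 by auto
    ultimately show ?thesis using 2 by blast
  next
    case (3 u v)
    have "3 \<le> dg F u" "3 \<le> dg F v" using X(3) 3 by auto
    then have "\<exists>e\<in>F. u \<in> e \<and> e \<inter> {v} = {}"
      by (intro edge_at_avoiding[OF b]) (use 3 in auto)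
    then obtain e where e: "e \<in> F" "u \<in> e" "v \<notin> e" by blast
    then obtain f where "f \<in> F" "v \<in> f" "f \<inter> e = {}" using avoid[of v e] \<open>3 \<le> dg F v\<close> by auto
    then show ?thesis using e 3 by blast
  qed
qed

definition star_edges :: "'a set set \<Rightarrow> 'a set \<Rightarrow> 'a set set \<Rightarrow> bool" where
  "star_edges M U S \<longleftrightarrow> (\<exists>z\<in>U. \<exists>g1 g2. S = {g1, g2} \<and> g1 \<noteq> g2 \<and> g1 \<inter> g2 = {z} \<and>
      (\<forall>e\<in>M. e \<inter> (g1 \<union> g2) = {}))"

text \<open>The crossing part of one system. The matching edges are the crossing edges of the \<open>AB\<close>-paths, hence two or
  four of them. A star consists of two edges with a common end, which must be exceptional because all other
  vertices have degree at most one in a system.\<close>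

definition piece :: "'a set \<Rightarrow> 'a set set \<Rightarrow> bool" where
  "piece U R \<longleftrightarrow> (\<exists>M S. R = M \<union> S \<and> matching M \<and> card M \<in> {2, 4} \<and>
      (S = {} \<or> star_edges M U S))"

lemma matching_pair: "e \<inter> f = {} \<Longrightarrow> matching {e, f}"
  unfolding matching_def by auto

lemma piece_pair:
  assumes "e \<inter> f = {}" "e \<noteq> {}"
  shows "piece U {e, f}" "card {e, f} = 2"
proof -
  have "e \<noteq> f" using assms by auto
  then show "card {e,f} = 2" by simp
  then show "piece U {e, f}" unfolding piece_def using matching_pair[OF assms(1)]
    by (intro exI[of _ "{e,f}"] exI[of _ "{}"]) auto
qed

text \<open>A four-edge piece can hit three vertices and one of them, \<open>z\<close>, twice: the two disjoint edges are found
  after deleting all edges at \<open>z\<close>, and the star at \<open>z\<close> is then chosen to avoid their four ends. The bound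
  on \<open>dg F u + dg F z\<close> says that what remains after deleting \<open>z\<close> is not a star at \<open>u\<close>.\<close>

lemma star_piece_covering:
  assumes b: "bipart P Q F" and zU: "z \<in> U" and dz: "6 \<le> dg F z"
    and big: "\<And>u. u \<noteq> z \<Longrightarrow> dg F u + dg F z < card F"
    and X: "finite X" "card (X - {z}) \<le> 2" "\<And>v. v \<in> X \<Longrightarrow> 4 \<le> dg F v"
  shows "\<exists>R\<subseteq>F. piece U R \<and> card R = 4 \<and> (\<forall>v\<in>X. 1 \<le> dg R v) \<and> dg R z = 2"
proof -
  have fin: "finite F" using b by (rule bipart_finite)
  let ?Z = "{e \<in> F. z \<in> e}"
  let ?F = "F - ?Z"
  have b': "bipart P Q ?F" using bipart_subset[OF b] by blast
  have cF: "card ?F = card F - dg F z" unfolding dg_def using fin by (intro card_Diff_subset) auto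
  have dZ: "dg ?Z v \<le> 1" if "v \<noteq> z" for v
  proof -
    have "{e \<in> ?Z. v \<in> e} \<subseteq> {{z,v}}" using bipart_edge_eq[OF b] that by blast
    then show ?thesis unfolding dg_def using card_mono[of "{{z,v}}"] by simp
  qed
  have "{e \<in> ?F. z \<in> e} = {}" by blast
  then have zero: "dg ?F z = 0" unfolding dg_def by (simp only: card.empty)
  have fstar: "dg ?F v < card ?F" for v
  proof (cases "v = z")
    case True
    obtain u where "u \<noteq> z" "dg F u + dg F z < card F"
    proof -
      have "?Z \<noteq> {}"
      proof
        assume "?Z = {}"
        then have "dg F z = 0" unfolding dg_def by (simp only: card.empty)
        then show False using dz by simp
      qed
      then obtain e where e: "e \<in> F" "z \<in> e" by blast
      obtain x y where "e = {x,y}" "x \<noteq> y" by (rule bipart_edgeE[OF b e(1)])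
      then obtain u where "u \<noteq> z" using that by metis
      then show ?thesis using that big by blast
    qed
    then show ?thesis using zero True cF by simp
  next
    case False
    have "dg ?F v \<le> dg F v" by (rule dg_mono[OF fin]) auto
    then show ?thesis using big[OF False] cF by linarith
  qed
  have fdeg: "3 \<le> dg ?F v" if "v \<in> X - {z}" for v
  proof -
    have "dg ?F v = dg F v - dg ?Z v" by (rule dg_Diff[OF fin]) auto
    then show ?thesis using X(3)[of v] dZ[of v] that by auto
  qed
  have finX: "finite (X - {z})" using X(1) by simp
  have "\<exists>e\<in>?F. \<exists>f\<in>?F. e \<inter> f = {} \<and> X - {z} \<subseteq> e \<union> f"
    by (rule disjoint_pair_covering[OF b' fstar finX X(2) fdeg])
  then obtain e f where ef: "e \<in> ?F" "f \<in> ?F" "e \<inter> f = {}" "X - {z} \<subseteq> e \<union> f" by blast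
  have zef: "z \<notin> e" "z \<notin> f" using ef(1,2) by blast+
  have fine: "finite (e \<union> f)" using ef bipart_edge_finite[OF b] by auto
  have ce: "card (e \<union> f) \<le> 4"
    using card_Un_le[of e f] bipart_edge_finite[OF b] ef by auto
  have "\<exists>g\<in>F. z \<in> g \<and> g \<inter> (e \<union> f) = {}"
    by (rule edge_at_avoiding[OF b]) (use ef fine ce dz in auto)
  then obtain g1 where g1: "g1 \<in> F" "z \<in> g1" "g1 \<inter> (e \<union> f) = {}" by blast
  obtain a where a: "g1 = {z, a}" "a \<noteq> z"
  proof -
    obtain x y where "g1 = {x,y}" "x \<noteq> y" by (rule bipart_edgeE[OF b g1(1)])
    then show ?thesis using that[of x] that[of y] g1(2) by (auto simp: insert_commute)
  qed
  have "\<exists>g\<in>F. z \<in> g \<and> g \<inter> insert a (e \<union> f) = {}"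
  proof (rule edge_at_avoiding[OF b])
    show "z \<notin> insert a (e \<union> f)" using zef a(2) by simp
    show "finite (insert a (e \<union> f))" using fine by simp
    have "card (insert a (e \<union> f)) \<le> Suc (card (e \<union> f))" by (rule card_insert_le_m1) simp_all
    then show "card (insert a (e \<union> f)) < dg F z" using ce dz by linarith
  qed
  then obtain g2 where g2: "g2 \<in> F" "z \<in> g2" "g2 \<inter> insert a (e \<union> f) = {}" by blast
  have dist: "e \<noteq> f" "g1 \<noteq> g2" "e \<noteq> g1" "e \<noteq> g2" "f \<noteq> g1" "f \<noteq> g2"
  proof -
    have "e \<noteq> {}" using ef(1) bipart_edge_finite[OF b, of e] by auto
    then show "e \<noteq> f" using ef(3) by auto
    have "a \<in> g1" "a \<notin> g2" using a g2(3) by auto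
    then show "g1 \<noteq> g2" by blast
  qed (use zef g1(2) g2(2) in blast)+
  have gz: "g1 \<inter> g2 = {z}" using a(1) g2(2,3) by blast
  let ?R = "{e,f} \<union> {g1,g2}"
  have "piece U ?R"
    unfolding piece_def star_edges_def
  proof (intro exI conjI disjI2 bexI)
    show "matching {e,f}" using ef by (intro matching_pair)
    show "card {e,f} \<in> {2,4}" using dist by simp
    show "\<forall>e'\<in>{e,f}. e' \<inter> (g1 \<union> g2) = {}" using g1(3) g2(3) by blast
    show "{g1,g2} = {g1,g2}" "?R = {e,f} \<union> {g1,g2}" by (rule refl)+
  qed (fact dist gz zU)+
  moreover have "card ?R = 4" using dist by simp
  moreover have "?R \<subseteq> F" using ef(1,2) g1(1) g2(1) by blast
  moreover have "1 \<le> dg ?R v" if "v \<in> X" for v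
  proof -
    have "\<exists>e'\<in>?R. v \<in> e'" using ef(4) that g1(2) by blast
    then have "0 < dg ?R v" by (subst dg_pos_iff) auto
    then show ?thesis by simp
  qed
  moreover have "dg ?R z = 2"
  proof -
    have "{e' \<in> ?R. z \<in> e'} = {g1,g2}" using zef g1(2) g2(2) by blast
    then show ?thesis unfolding dg_def using dist by simp
  qed
  ultimately show ?thesis by blast
qed

text \<open>If all degrees are small, two disjoint edges meet at most \<open>4 * d\<close> edges, and the others are too many to form
  a star.\<close>

lemma four_matching_exists:
  assumes b: "bipart P Q F" and d: "\<And>v. dg F v \<le> d" and big: "5 * d < card F"
  shows "\<exists>R\<subseteq>F. piece U R \<and> card R = 4"
proof -
  have fin: "finite F" using b by (rule bipart_finite)
  have "dg F v < card F" for v using d[of v] big by linarith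
  then obtain e f where ef: "e \<in> F" "f \<in> F" "e \<inter> f = {}"
    using disjoint_pair_covering[OF b, of "{}"] by auto
  let ?F = "F - edges_meeting F (e \<union> f)"
  have b': "bipart P Q ?F" using bipart_subset[OF b] by blast
  have "edges_meeting F (e \<union> f) \<subseteq> (\<Union>v\<in>e \<union> f. {g \<in> F. v \<in> g})" unfolding edges_meeting_def by auto
  moreover have fe: "finite (e \<union> f)" using ef bipart_edge_finite[OF b] by auto
  ultimately have "card (edges_meeting F (e \<union> f)) \<le> card (\<Union>v\<in>e \<union> f. {g \<in> F. v \<in> g})"
    using fin by (intro card_mono) auto
  also have "\<dots> \<le> (\<Sum>v\<in>e \<union> f. card {g \<in> F. v \<in> g})" by (rule card_UN_le[OF fe])
  also have "\<dots> \<le> card (e \<union> f) * d" using d unfolding dg_def by (intro sum_bounded_above[where K=d, simplified]) auto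
  also have "\<dots> \<le> 4 * d"
    using card_Un_le[of e f] bipart_edge_finite[OF b] ef by (intro mult_right_mono) auto
  finally have "card (edges_meeting F (e \<union> f)) \<le> 4 * d" .
  moreover have "card ?F = card F - card (edges_meeting F (e \<union> f))"
    using fin edges_meeting_subset[of F] by (intro card_Diff_subset) (auto intro: finite_subset)
  moreover have "dg ?F v \<le> d" for v using dg_mono[OF fin, of ?F v] d[of v] by auto
  ultimately have "d < card ?F" "dg ?F v \<le> d" for v using big by auto
  then have "dg ?F v < card ?F" for v by (meson le_less_trans)
  then obtain g h where gh: "g \<in> ?F" "h \<in> ?F" "g \<inter> h = {}"
    using disjoint_pair_covering[OF b', of "{}"] by auto
  have ne: "x \<noteq> {}" if "x \<in> F" for x using bipart_edgeE[OF b that] by blast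
  have disj: "g \<inter> (e \<union> f) = {}" "h \<inter> (e \<union> f) = {}" using gh unfolding edges_meeting_def by auto
  then have dist: "distinct [e,f,g,h]" using ne ef gh by auto
  have "matching {e,f,g,h}" unfolding matching_def using ef gh disj by blast
  moreover have "card {e,f,g,h} = 4" using dist by simp
  ultimately have "piece U {e,f,g,h}" unfolding piece_def
    by (intro exI[of _ "{e,f,g,h}"] exI[of _ "{}"]) auto
  then show ?thesis using \<open>card {e,f,g,h} = 4\<close> ef gh by (intro exI[of _ "{e,f,g,h}"]) auto
qed

section \<open>Peeling phases\<close>

fun peels :: "'a set set \<Rightarrow> 'a set set list \<Rightarrow> 'a set set \<Rightarrow> bool" where
  "peels F [] L \<longleftrightarrow> L = F"
| "peels F (R # Rs) L \<longleftrightarrow> R \<subseteq> F \<and> peels (F - R) Rs L"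

lemma peels_append:
  "peels F (Rs @ Ss) L \<longleftrightarrow> (\<exists>F'. peels F Rs F' \<and> peels F' Ss L)"
  by (induction Rs arbitrary: F) auto

lemma peels_rest: "peels F Rs L \<Longrightarrow> L = F - \<Union>(set Rs)"
  by (induction Rs arbitrary: F) auto

lemma peels_subset: "peels F Rs L \<Longrightarrow> R \<in> set Rs \<Longrightarrow> R \<subseteq> F"
  by (induction Rs arbitrary: F) auto

lemma peels_disjoint:
  "peels F Rs L \<Longrightarrow> i < j \<Longrightarrow> j < length Rs \<Longrightarrow> Rs ! i \<inter> Rs ! j = {}"
proof (induction Rs arbitrary: F i j)
  case (Cons R Rs)
  show ?case
  proof (cases i)
    case 0
    have "Rs ! (j - 1) \<subseteq> F - R"
      using Cons.prems peels_subset[of "F - R" Rs L "Rs ! (j - 1)"] by simp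
    then show ?thesis using 0 Cons.prems by (auto simp: nth_Cons')
  next
    case (Suc i')
    obtain j' where "j = Suc j'" using Cons.prems(2) by (cases j) auto
    then show ?thesis using Suc Cons.IH[of "F - R" i' j'] Cons.prems by simp
  qed
qed simp

definition pair_matching :: "'a set set \<Rightarrow> bool" where
  "pair_matching R \<longleftrightarrow> matching R \<and> card R = 2"

lemma matching_dg_le:
  assumes "matching R" "finite R"
  shows "dg R v \<le> 1"
proof -
  have "\<forall>e\<in>{e \<in> R. v \<in> e}. \<forall>f\<in>{e \<in> R. v \<in> e}. e = f"
    using assms(1) unfolding matching_def by blast
  then show ?thesis unfolding dg_def using assms(2) by (simp add: card_le_Suc0_iff_eq)
qed

lemma pair_matching_dg_le: "pair_matching R \<Longrightarrow> dg R v \<le> 1"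
  unfolding pair_matching_def by (intro matching_dg_le) (auto intro: card_ge_0_finite)

lemma pair_matching_covering:
  assumes b: "bipart P Q F" and star: "\<And>v. dg F v < card F"
    and X: "finite X" "card X \<le> 2" "\<And>v. v \<in> X \<Longrightarrow> 3 \<le> dg F v"
  shows "\<exists>R\<subseteq>F. pair_matching R \<and> (\<forall>v\<in>X. dg R v = 1)"
proof -
  obtain e f where ef: "e \<in> F" "f \<in> F" "e \<inter> f = {}" "X \<subseteq> e \<union> f"
    using disjoint_pair_covering[OF b star X] by blast
  have "e \<noteq> {}" using bipart_edge_finite[OF b ef(1)] by auto
  then have pm: "pair_matching {e,f}" unfolding pair_matching_def
    using matching_pair[OF ef(3)] piece_pair(2)[OF ef(3)] by simp
  have "dg {e,f} v = 1" if "v \<in> X" for v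
  proof -
    have "\<exists>g\<in>{e,f}. v \<in> g" using that ef(4) by blast
    then have "0 < dg {e,f} v" by (subst dg_pos_iff) simp_all
    then show ?thesis using pair_matching_dg_le[OF pm, of v] by linarith
  qed
  then show ?thesis using ef pm by (intro exI[of _ "{e,f}"]) simp
qed

text \<open>The bounds are exactly those that survive the removal of a pair hitting all of \<open>X\<close>: such a pair costs the
  graph two edges and every vertex of \<open>X\<close> one.\<close>

lemma peel_pairs_through:
  assumes "bipart P Q F" "\<And>v. dg F v + 2 * k < card F + 2"
    and "finite X" "card X \<le> 2" "\<And>v. v \<in> X \<Longrightarrow> k + 2 \<le> dg F v"
  shows "\<exists>Rs L. peels F Rs L \<and> length Rs = k \<and>
           (\<forall>R\<in>set Rs. pair_matching R \<and> (\<forall>v\<in>X. dg R v = 1)) \<and>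
           card L + 2 * k = card F \<and> (\<forall>v\<in>X. dg L v + k = dg F v)"
  using assms
proof (induction k arbitrary: F)
  case 0
  show ?case by (intro exI[of _ "[]"] exI[of _ F]) simp
next
  case (Suc k)
  note b = Suc.prems(1)
  have fin: "finite F" using b by (rule bipart_finite)
  have big: "dg F v + 2 * k < card F" for v using Suc.prems(2)[of v] by simp
  have star: "dg F v < card F" for v using big[of v] by simp
  have deg3: "3 \<le> dg F v" if "v \<in> X" for v using Suc.prems(5)[OF that] by simp
  obtain R where R: "R \<subseteq> F" "pair_matching R" "\<forall>v\<in>X. dg R v = 1"
    using pair_matching_covering[OF b star Suc.prems(3,4) deg3] by blast
  have finR: "finite R" using R(1) fin by (rule finite_subset)
  have cF: "card (F - R) + 2 = card F"
    using card_Diff_subset[OF finR R(1)] card_mono[OF fin R(1)] R(2)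
    unfolding pair_matching_def by simp
  have dF: "dg (F - R) v + dg R v = dg F v" for v
    using dg_Diff[OF fin R(1), of v] dg_mono[OF fin R(1), of v] by simp
  have "\<exists>Rs L. peels (F - R) Rs L \<and> length Rs = k \<and>
           (\<forall>R\<in>set Rs. pair_matching R \<and> (\<forall>v\<in>X. dg R v = 1)) \<and>
           card L + 2 * k = card (F - R) \<and> (\<forall>v\<in>X. dg L v + k = dg (F - R) v)"
  proof (rule Suc.IH)
    show "bipart P Q (F - R)" using bipart_subset[OF b] by blast
    show "dg (F - R) v + 2 * k < card (F - R) + 2" for v
      using big[of v] dF[of v] cF by linarith
    show "k + 2 \<le> dg (F - R) v" if "v \<in> X" for v
      using Suc.prems(5)[OF that] dF[of v] R(3) that by simp
  qed fact+
  then obtain Rs L where RL: "peels (F - R) Rs L" "length Rs = k"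
    "\<forall>R\<in>set Rs. pair_matching R \<and> (\<forall>v\<in>X. dg R v = 1)"
    "card L + 2 * k = card (F - R)" "\<forall>v\<in>X. dg L v + k = dg (F - R) v" by blast
  have "dg L v + Suc k = dg F v" if "v \<in> X" for v
    using RL(5) dF[of v] R(3) that by simp
  then show ?case using RL R cF
    by (intro exI[of _ "R # Rs"] exI[of _ L]) simp
qed

text \<open>With \<open>s\<close> pairs still to be removed in all (the \<open>k\<close> pairs removed here and \<open>s'\<close> later ones), the
  degree of \<open>v\<close> may be at most \<open>s + c v\<close>. This bound drops by one with each pair, so a pair only has to hit the vertices
  of degree at least \<open>s + \<theta>\<close>, where \<open>\<theta>\<close> is a common lower bound of the allowances \<open>c v\<close>. Three such vertices would
  need more than \<open>2 * s + x\<close> edges, so at most two have to be hit. The number \<open>x\<close> of surplus edges is invariant.\<close>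

lemma peel_pairs:
  assumes "bipart P Q F" "card F = 2 * (s' + k) + x"
    and "\<And>v. dg F v \<le> s' + k + c v" "\<And>v. \<theta> \<le> c v" "\<And>v. c v \<le> \<Theta>"
    and "\<Theta> < x + s' + 1" "x + 2 < s' + 1 + 3 * \<theta>" "3 \<le> s' + 1 + \<theta>"
  shows "\<exists>Rs L. peels F Rs L \<and> length Rs = k \<and> (\<forall>R\<in>set Rs. pair_matching R) \<and>
           card L = 2 * s' + x \<and> (\<forall>v. dg L v \<le> s' + c v)"
  using assms(1-3)
proof (induction k arbitrary: F)
  case 0
  then show ?case by (intro exI[of _ "[]"] exI[of _ F]) simp
next
  case (Suc k)
  note b = Suc.prems(1)
  have fin: "finite F" using b by (rule bipart_finite)
  let ?s = "s' + Suc k"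
  let ?X = "{v. ?s + \<theta> \<le> dg F v}"
  have cF0: "card F = 2 * s' + 2 * k + 2 + x" using Suc.prems(2) by simp
  have star: "dg F v < card F" for v
    using cF0 Suc.prems(3)[of v] assms(5)[of v] assms(6) by simp
  have finX: "finite ?X" by (rule finite_heavy[OF b]) simp
  have cX: "card ?X \<le> 2"
  proof (rule ccontr)
    assume "\<not> ?thesis"
    then have "3 \<le> card ?X" by simp
    then obtain u v w where uvw: "u \<in> ?X" "v \<in> ?X" "w \<in> ?X" "u \<noteq> v" "u \<noteq> w" "v \<noteq> w"
      by (rule three_of_card)
    then have "3 * (?s + \<theta>) \<le> dg F u + dg F v + dg F w" by simp
    then show False using dg_sum3[OF b uvw(4-6)] Suc.prems(2) assms(7) by simp
  qed
  have deg3: "3 \<le> dg F v" if "v \<in> ?X" for v using that assms(8) by simp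
  obtain R where R: "R \<subseteq> F" "pair_matching R" "\<forall>v\<in>?X. dg R v = 1"
    using pair_matching_covering[OF b star finX cX deg3] by blast
  have finR: "finite R" using R(1) fin by (rule finite_subset)
  have cF: "card (F - R) + 2 = card F"
    using card_Diff_subset[OF finR R(1)] card_mono[OF fin R(1)] R(2)
    unfolding pair_matching_def by simp
  have dF: "dg (F - R) v + dg R v = dg F v" for v
    using dg_Diff[OF fin R(1), of v] dg_mono[OF fin R(1), of v] by simp
  have "dg (F - R) v \<le> s' + k + c v" for v
  proof (cases "v \<in> ?X")
    case True
    then show ?thesis using R(3) dF[of v] Suc.prems(3)[of v] by auto
  next
    case False
    then show ?thesis using dF[of v] assms(4)[of v] by simp
  qed
  then obtain Rs L where RL: "peels (F - R) Rs L" "length Rs = k"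
    "\<forall>R\<in>set Rs. pair_matching R" "card L = 2 * s' + x" "\<forall>v. dg L v \<le> s' + c v"
    using Suc.IH[of "F - R"] bipart_subset[OF b, of "F - R"] cF Suc.prems(2) by auto
  then show ?case using R by (intro exI[of _ "R # Rs"] exI[of _ L]) simp
qed

text \<open>The same invariant as for pairs, except that each step removes four edges. By counting there are at most
  three vertices of degree at least \<open>s + \<theta>\<close>, and a piece with a star hits all of them. One vertex \<open>y\<close> may exceed the bound by as
  much as the number of steps: it is taken as the centre of the star whenever it has to be hit, so its degree
  drops by two and the excess by one. If no vertex has to be hit, a star at any vertex
  of degree more than \<open>\<delta> + 5\<close> will do, since such a vertex lies in \<open>U\<close>, and if there is none, four disjoint edges exist.\<close>

lemma peel_four_edge_pieces:
  assumes "bipart P Q F" "card F = 2 * (s' + k) + 2 * k + x"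
    and "\<And>v. v \<noteq> y \<Longrightarrow> dg F v \<le> s' + k + c v" "dg F y \<le> s' + k + k + \<theta>" "c y = \<theta>"
    and "\<And>v. \<theta> \<le> c v" "\<And>v. c v \<le> \<Theta>" "k > 0 \<Longrightarrow> 2 * \<Theta> \<le> x"
    and "x + 6 < 2 * s' + 4 * \<theta>"
    and "\<And>v. v \<notin> U \<Longrightarrow> dg F v \<le> \<delta>" "\<delta> < s' + \<theta>" "6 \<le> s' + \<theta>" "5 * \<delta> + 30 < 2 * s' + x"
  shows "\<exists>Rs L. peels F Rs L \<and> length Rs = k \<and> (\<forall>R\<in>set Rs. piece U R \<and> card R = 4) \<and>
           card L = 2 * s' + x \<and> (\<forall>v. dg L v \<le> s' + c v)"
  using assms(1-4,8,10)
proof (induction k arbitrary: F)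
  case 0
  have "dg F v \<le> s' + c v" for v using 0(3)[of v] 0(4) assms(5) by (cases "v = y") auto
  then show ?case using 0 by (intro exI[of _ "[]"] exI[of _ F]) simp
next
  case (Suc k)
  note b = Suc.prems(1)
  have fin: "finite F" using b by (rule bipart_finite)
  let ?s = "s' + Suc k"
  let ?X = "{v. ?s + \<theta> \<le> dg F v}"
  have x2: "2 * \<Theta> \<le> x" using Suc.prems(5) by simp
  have th: "\<theta> \<le> \<Theta>" using assms(6,7) le_trans by blast
  have sum2: "dg F u + dg F v < card F" if "u \<noteq> v" for u v
  proof -
    have *: "dg F u \<le> ?s + \<Theta>" if "u \<noteq> y" for u
      using Suc.prems(3)[OF that] assms(7)[of u] by linarith
    have y: "dg F y \<le> ?s + Suc k + \<theta>" using Suc.prems(4) by simp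
    show ?thesis
    proof (cases "u = y \<or> v = y")
      case True
      then show ?thesis using *[of u] *[of v] y that x2 th Suc.prems(2) by auto
    next
      case False
      then show ?thesis using *[of u] *[of v] x2 Suc.prems(2) by auto
    qed
  qed
  have finX: "finite ?X" by (rule finite_heavy[OF b]) simp
  have cX: "card ?X \<le> 3"
  proof (rule ccontr)
    assume "\<not> ?thesis"
    then have "4 \<le> card ?X" by simp
    then obtain u v w z where uvw: "u \<in> ?X" "v \<in> ?X" "w \<in> ?X" "z \<in> ?X" "distinct [u, v, w, z]"
      by (rule four_of_card)
    then have "4 * (?s + \<theta>) \<le> dg F u + dg F v + dg F w + dg F z" by simp
    moreover have "card (edges_meeting F {u,v,w,z}) \<le> card F" by (rule card_mono[OF fin edges_meeting_subset])
    ultimately show False using dg_sum4[OF b uvw(5)] Suc.prems(2) assms(9) by simp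
  qed
  have "\<exists>R\<subseteq>F. piece U R \<and> card R = 4 \<and> (\<forall>v\<in>?X. 1 \<le> dg R v) \<and> (y \<in> ?X \<longrightarrow> dg R y = 2)"
  proof (cases "?X = {}")
    case False
    \<comment> \<open>The centre is \<open>y\<close> if \<open>y\<close> must be hit, since it may have to lose two edges.\<close>
    then obtain z where z: "z \<in> ?X" "y \<in> ?X \<Longrightarrow> z = y" by blast
    have c2: "card (?X - {z}) \<le> 2" using cX z(1) finX by simp
    have "z \<in> U"
    proof (rule ccontr)
      assume "z \<notin> U"
      then show False using Suc.prems(6)[of z] z(1) assms(11) by simp
    qed
    moreover have "6 \<le> dg F z" using z(1) assms(12) by simp
    moreover have "dg F u + dg F z < card F" if "u \<noteq> z" for u using sum2[OF that] .
    moreover have "4 \<le> dg F v" if "v \<in> ?X" for v using that assms(12) by simp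
    ultimately have "\<exists>R\<subseteq>F. piece U R \<and> card R = 4 \<and> (\<forall>v\<in>?X. 1 \<le> dg R v) \<and> dg R z = 2"
      by (intro star_piece_covering[OF b _ _ _ finX c2])
    then show ?thesis using z(2) by blast
  next
    case True
    show ?thesis
    proof (cases "\<exists>z. \<delta> + 6 \<le> dg F z")
      case True
      then obtain z where z: "\<delta> + 6 \<le> dg F z" by blast
      then have "z \<in> U" using Suc.prems(6)[of z] by fastforce
      moreover have "6 \<le> dg F z" using z by simp
      moreover have "dg F u + dg F z < card F" if "u \<noteq> z" for u using sum2[OF that] .
      ultimately have "\<exists>R\<subseteq>F. piece U R \<and> card R = 4 \<and> (\<forall>v\<in>{}. 1 \<le> dg R v) \<and> dg R z = 2"
        by (intro star_piece_covering[OF b]) auto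
      then show ?thesis using \<open>?X = {}\<close> by blast
    next
      case False
      have "dg F v \<le> \<delta> + 5" for v
      proof -
        have "\<not> \<delta> + 6 \<le> dg F v" using False by blast
        then show ?thesis by simp
      qed
      moreover have "5 * (\<delta> + 5) < card F" using Suc.prems(2) assms(13) by simp
      ultimately have "\<exists>R\<subseteq>F. piece U R \<and> card R = 4" by (rule four_matching_exists[OF b])
      then show ?thesis using \<open>?X = {}\<close> by blast
    qed
  qed
  then obtain R where R: "R \<subseteq> F" "piece U R" "card R = 4" "\<forall>v\<in>?X. 1 \<le> dg R v"
    "y \<in> ?X \<Longrightarrow> dg R y = 2" by blast
  have finR: "finite R" using R(1) fin by (rule finite_subset)
  have cF: "card (F - R) + 4 = card F"
    using card_Diff_subset[OF finR R(1)] card_mono[OF fin R(1)] R(3) by simp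
  have dF: "dg (F - R) v + dg R v = dg F v" for v
    using dg_Diff[OF fin R(1), of v] dg_mono[OF fin R(1), of v] by simp
  have "\<exists>Rs L. peels (F - R) Rs L \<and> length Rs = k \<and> (\<forall>R\<in>set Rs. piece U R \<and> card R = 4) \<and>
           card L = 2 * s' + x \<and> (\<forall>v. dg L v \<le> s' + c v)"
  proof (rule Suc.IH)
    show "bipart P Q (F - R)" using bipart_subset[OF b] by blast
    show "card (F - R) = 2 * (s' + k) + 2 * k + x" using cF Suc.prems(2) by simp
    show "dg (F - R) v \<le> s' + k + c v" if "v \<noteq> y" for v
    proof (cases "v \<in> ?X")
      case True
      then have "1 \<le> dg R v" using R(4) by blast
      then show ?thesis using dF[of v] Suc.prems(3)[OF that] by linarith
    next
      case False
      then show ?thesis using dF[of v] assms(6)[of v] by simp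
    qed
    show "dg (F - R) y \<le> s' + k + k + \<theta>"
    proof (cases "y \<in> ?X")
      case True
      then show ?thesis using dF[of y] Suc.prems(4) R(5)[OF True] by linarith
    next
      case False
      then show ?thesis using dF[of y] by simp
    qed
    show "2 * \<Theta> \<le> x" by (rule x2)
    show "dg (F - R) v \<le> \<delta>" if "v \<notin> U" for v
      using Suc.prems(6)[OF that] dF[of v] by linarith
  qed
  then obtain Rs L where RL: "peels (F - R) Rs L" "length Rs = k"
    "\<forall>R\<in>set Rs. piece U R \<and> card R = 4" "card L = 2 * s' + x" "\<forall>v. dg L v \<le> s' + c v" by blast
  then show ?case using R by (intro exI[of _ "R # Rs"] exI[of _ L]) simp
qed

section \<open>Decomposing one cell and the leftovers\<close>

lemma no_three_edges_at:
  assumes "finite F" "dg F v \<le> 2" "a \<in> F" "b \<in> F" "c \<in> F" "v \<in> a" "v \<in> b" "v \<in> c"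
  shows "a = b \<or> a = c \<or> b = c"
proof (rule ccontr)
  assume "\<not> ?thesis"
  then have "card {a,b,c} = 3" by simp
  moreover have "card {a,b,c} \<le> dg F v" unfolding dg_def
    by (rule card_mono) (use assms in auto)
  ultimately show False using assms(2) by simp
qed

text \<open>The greedy step hits vertices of degree at least three, but when two pairs are left, the vertices that both
  pairs must hit have degree two. Each of the three ways to pair up the four edges is therefore considered. If none
  works, then either some edge meets the other three, which forces a degree of three, or three edges pairwise meet,
  which forces a star of three edges or a triangle.\<close>

lemma four_edges_split:
  assumes b: "bipart P Q F" and c4: "card F = 4" and d2: "\<And>v. dg F v \<le> 2"
  shows "\<exists>Rs. peels F Rs {} \<and> length Rs = 2 \<and> (\<forall>R\<in>set Rs. pair_matching R)"
proof -
  have fin: "finite F" using b by (rule bipart_finite)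
  obtain a b' c d where F: "F = {a,b',c,d}" and dist: "distinct [a,b',c,d]"
  proof -
    obtain a b' c d where *: "a \<in> F" "b' \<in> F" "c \<in> F" "d \<in> F" "distinct [a,b',c,d]"
      by (rule four_of_card[of F]) (use c4 in simp)
    then have "{a,b',c,d} = F" by (intro card_subset_eq[OF fin]) (use c4 in auto)
    then show ?thesis using that[of a b' c d] * by simp
  qed
  have star: "\<not> (e1 \<inter> e2 \<noteq> {} \<and> e1 \<inter> e3 \<noteq> {} \<and> e1 \<inter> e4 \<noteq> {})"
    if "F = {e1,e2,e3,e4}" for e1 e2 e3 e4
  proof
    assume m: "e1 \<inter> e2 \<noteq> {} \<and> e1 \<inter> e3 \<noteq> {} \<and> e1 \<inter> e4 \<noteq> {}"
    have e1: "e1 \<in> F" using that by simp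
    obtain x y where xy: "e1 = {x,y}" by (rule bipart_edgeE[OF b e1])
    let ?X = "{e \<in> F. x \<in> e}" let ?Y = "{e \<in> F. y \<in> e}"
    have "?X \<union> ?Y = F" using that m xy by blast
    moreover have "card ?X + card ?Y = card (?X \<union> ?Y) + card (?X \<inter> ?Y)"
      using fin by (intro card_Un_Int) simp_all
    moreover have "card {e1} \<le> card (?X \<inter> ?Y)"
      by (rule card_mono) (use fin e1 xy in auto)
    ultimately show False using d2[of x] d2[of y] c4 unfolding dg_def by simp
  qed
  have tri: "\<not> (e1 \<inter> e2 \<noteq> {} \<and> e1 \<inter> e3 \<noteq> {} \<and> e2 \<inter> e3 \<noteq> {})"
    if "e1 \<in> F" "e2 \<in> F" "e3 \<in> F" "distinct [e1,e2,e3]" for e1 e2 e3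
  proof
    assume m: "e1 \<inter> e2 \<noteq> {} \<and> e1 \<inter> e3 \<noteq> {} \<and> e2 \<inter> e3 \<noteq> {}"
    obtain p where p: "p \<in> e1" "p \<in> e2" using m by blast
    obtain p' where p': "p' \<in> e1" "p' \<in> e3" using m by blast
    obtain r where r: "r \<in> e2" "r \<in> e3" using m by blast
    have pp: "p \<noteq> p'" using no_three_edges_at[OF fin d2 that(1-3), of p] p p' that(4) by auto
    then have "\<not> (p \<in> P \<longleftrightarrow> p' \<in> P)" using bipart_same_class[OF b that(1) p(1) p'(1)] by blast
    then consider "r \<in> P \<longleftrightarrow> p \<in> P" | "r \<in> P \<longleftrightarrow> p' \<in> P" by blast
    then have "e1 = e3 \<or> e1 = e2"
    proof cases
      case 1
      then have "r = p" using bipart_same_class[OF b that(2) r(1) p(2)] by blast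
      then have "e3 = {p,p'}" using bipart_edge_eq[OF b that(3) _ p'(2) pp] r by blast
      then show ?thesis using bipart_edge_eq[OF b that(1) p(1) p'(1) pp] by simp
    next
      case 2
      then have "r = p'" using bipart_same_class[OF b that(3) r(2) p'(2)] by blast
      then have "e2 = {p,p'}" using bipart_edge_eq[OF b that(2) p(2) _ pp] r by blast
      then show ?thesis using bipart_edge_eq[OF b that(1) p(1) p'(1) pp] by simp
    qed
    then show False using that(4) by auto
  qed
  have split: ?thesis if "F = {e1,e2} \<union> {e3,e4}" "distinct [e1,e2,e3,e4]"
    "e1 \<inter> e2 = {}" "e3 \<inter> e4 = {}" for e1 e2 e3 e4
  proof -
    have "F - {e1,e2} = {e3,e4}" using that(1,2) by auto
    then have "peels F [{e1,e2},{e3,e4}] {}" using that(1) by simp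
    moreover have "pair_matching {e1,e2}" "pair_matching {e3,e4}"
      unfolding pair_matching_def using matching_pair that(2-4) by auto
    ultimately show ?thesis by (intro exI[of _ "[{e1,e2},{e3,e4}]"]) simp
  qed
  have perms: "F = {b',a,c,d}" "F = {c,a,b',d}" "F = {d,a,b',c}" using F by auto
  have mem: "a \<in> F" "b' \<in> F" "c \<in> F" "d \<in> F" using F by auto
  have sta: "\<not> (a \<inter> b' \<noteq> {} \<and> a \<inter> c \<noteq> {} \<and> a \<inter> d \<noteq> {})" by (rule star[OF F])
  have stb: "\<not> (b' \<inter> a \<noteq> {} \<and> b' \<inter> c \<noteq> {} \<and> b' \<inter> d \<noteq> {})" by (rule star[OF perms(1)])
  have stc: "\<not> (c \<inter> a \<noteq> {} \<and> c \<inter> b' \<noteq> {} \<and> c \<inter> d \<noteq> {})" by (rule star[OF perms(2)])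
  have std: "\<not> (d \<inter> a \<noteq> {} \<and> d \<inter> b' \<noteq> {} \<and> d \<inter> c \<noteq> {})" by (rule star[OF perms(3)])
  have t1: "\<not> (a \<inter> b' \<noteq> {} \<and> a \<inter> c \<noteq> {} \<and> b' \<inter> c \<noteq> {})" by (rule tri) (use mem dist in auto)
  have t2: "\<not> (a \<inter> b' \<noteq> {} \<and> a \<inter> d \<noteq> {} \<and> b' \<inter> d \<noteq> {})" by (rule tri) (use mem dist in auto)
  have t3: "\<not> (a \<inter> c \<noteq> {} \<and> a \<inter> d \<noteq> {} \<and> c \<inter> d \<noteq> {})" by (rule tri) (use mem dist in auto)
  have t4: "\<not> (b' \<inter> c \<noteq> {} \<and> b' \<inter> d \<noteq> {} \<and> c \<inter> d \<noteq> {})" by (rule tri) (use mem dist in auto)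
  have "(a \<inter> b' = {} \<and> c \<inter> d = {}) \<or> (a \<inter> c = {} \<and> b' \<inter> d = {}) \<or> (a \<inter> d = {} \<and> b' \<inter> c = {})"
    using sta stb stc std t1 t2 t3 t4
    by (simp only: Int_commute[of b' a] Int_commute[of c a] Int_commute[of d a]
        Int_commute[of c b'] Int_commute[of d b'] Int_commute[of d c]) argo
  then consider "a \<inter> b' = {}" "c \<inter> d = {}" | "a \<inter> c = {}" "b' \<inter> d = {}"
    | "a \<inter> d = {}" "b' \<inter> c = {}" by blast
  then show ?thesis
  proof cases
    case 1
    show ?thesis
    proof (rule split[OF _ _ 1])
      show "F = {a, b'} \<union> {c, d}" using F by auto
    qed (use dist in auto)
  next
    case 2
    show ?thesis
    proof (rule split[OF _ _ 2])
      show "F = {a, c} \<union> {b', d}" using F by auto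
    qed (use dist in auto)
  next
    case 3
    show ?thesis
    proof (rule split[OF _ _ 3])
      show "F = {a, d} \<union> {b', c}" using F by auto
    qed (use dist in auto)
  qed
qed

lemma pair_matching_piece: "pair_matching R \<Longrightarrow> piece U R"
  unfolding pair_matching_def piece_def by (intro exI[of _ R] exI[of _ "{}"]) simp

text \<open>Here there is no slack: the degree bound \<open>r\<close> is the number of pieces. Four-edge pieces come first, while
  degrees and edge numbers are still large, then pairs, and the last two pairs are split by hand.\<close>

lemma leftover_decomposition:
  assumes b: "bipart P Q F" and cF: "card F = 2 * r + 2 * q"
    and dF: "\<And>v. dg F v \<le> r" and U: "\<And>v. v \<notin> U \<Longrightarrow> dg F v \<le> \<delta>"
    and big: "5 * \<delta> + 2 * q + 30 < 2 * r"
  shows "\<exists>Rs. peels F Rs {} \<and> length Rs = r \<and> (\<forall>R\<in>set Rs. piece U R)"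
proof -
  let ?s = "r - q"
  have r: "r = ?s + q" "?s = 2 + (?s - 2)" using big by simp_all
  \<comment> \<open>All degrees are at most \<open>r\<close>, so any vertex can play the part of the exceptional one.\<close>
  obtain y :: 'a where True by simp
  have "\<exists>Rs L. peels F Rs L \<and> length Rs = q \<and> (\<forall>R\<in>set Rs. piece U R \<and> card R = 4) \<and>
           card L = 2 * ?s + 0 \<and> (\<forall>v. dg L v \<le> ?s + (\<lambda>_. 0) v)"
  proof (rule peel_four_edge_pieces[OF b, where \<theta>=0 and \<Theta>=0 and y=y and \<delta>=\<delta>])
    show "card F = 2 * (?s + q) + 2 * q + 0" using cF r(1) by simp
    show "dg F v \<le> ?s + q + 0" if "v \<noteq> y" for v using dF[of v] r(1) by simp
    show "dg F y \<le> ?s + q + q + 0" using dF[of y] r(1) by simp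
  qed (use big U in auto)
  then obtain Rs1 L1 where 1: "peels F Rs1 L1" "length Rs1 = q" "\<forall>R\<in>set Rs1. piece U R"
    "card L1 = 2 * ?s" "\<forall>v. dg L1 v \<le> ?s" by auto
  have b1: "bipart P Q L1" using bipart_subset[OF b] peels_rest[OF 1(1)] by blast
  have "\<exists>Rs L. peels L1 Rs L \<and> length Rs = ?s - 2 \<and> (\<forall>R\<in>set Rs. pair_matching R) \<and>
           card L = 2 * 2 + 0 \<and> (\<forall>v. dg L v \<le> 2 + (\<lambda>_. 0) v)"
  proof (rule peel_pairs[OF b1, where \<theta>=0 and \<Theta>=0])
    show "card L1 = 2 * (2 + (?s - 2)) + 0" using 1(4) r(2) by simp
    show "dg L1 v \<le> 2 + (?s - 2) + 0" for v using 1(5) r(2) by simp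
  qed simp_all
  then obtain Rs2 L2 where 2: "peels L1 Rs2 L2" "length Rs2 = ?s - 2" "\<forall>R\<in>set Rs2. pair_matching R"
    "card L2 = 4" "\<forall>v. dg L2 v \<le> 2" by auto
  have b2: "bipart P Q L2" using bipart_subset[OF b1] peels_rest[OF 2(1)] by blast
  obtain Rs3 where 3: "peels L2 Rs3 {}" "length Rs3 = 2" "\<forall>R\<in>set Rs3. pair_matching R"
    using four_edges_split[OF b2 2(4)] 2(5) by blast
  have "peels F (Rs1 @ Rs2 @ Rs3) {}" unfolding peels_append using 1(1) 2(1) 3(1) by blast
  moreover have "length (Rs1 @ Rs2 @ Rs3) = r" using 1(2) 2(2) 3(2) big by simp
  moreover have "\<forall>R\<in>set (Rs1 @ Rs2 @ Rs3). piece U R"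
    using 1(3) 2(3) 3(3) by (auto intro: pair_matching_piece)
  ultimately show ?thesis by blast
qed

text \<open>One cell has slack: \<open>x\<close> edges may remain, of degree about \<open>\<theta>\<close> at each vertex. After \<open>T\<close> pairs through \<open>X\<close>,
  the vertices of \<open>X\<close> may still have degree above \<open>s + \<theta>\<close>. They get the larger allowance \<open>c v\<close>,
  which keeps the excess \<open>dg F v - (T + s)\<close> as leftover instead of trying to remove it.\<close>

lemma cell_decomposition:
  assumes b: "bipart P Q F" and cF: "card F = 2 * (T + s) + 2 * q + x" and qs: "q \<le> s"
    and X: "finite X" "card X \<le> 2" "y \<notin> X"
    and dX: "\<And>v. v \<in> X \<Longrightarrow> T + 2 \<le> dg F v \<and> dg F v \<le> T + s + \<Theta>"
    and small: "\<And>v. v \<notin> X \<Longrightarrow> v \<noteq> y \<Longrightarrow> dg F v \<le> s" and dy: "dg F y \<le> s + q + \<theta>"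
    and star: "\<And>v. dg F v + 2 * T < card F + 2"
    and U: "\<And>v. v \<notin> U \<Longrightarrow> dg F v \<le> \<delta>"
    and par: "0 < q \<Longrightarrow> 2 * \<Theta> \<le> x" "\<theta> \<le> \<Theta>" "\<Theta> < x" "x + 6 < 3 * \<theta>" "6 \<le> \<theta>" "\<delta> < \<theta>"
      "5 * \<delta> + 30 < x"
  shows "\<exists>Rs L. peels F Rs L \<and> length Rs = T + s \<and> (\<forall>R\<in>set Rs. piece U R) \<and>
    (\<forall>k<T. pair_matching (Rs ! k) \<and> (\<forall>v\<in>X. dg (Rs ! k) v = 1)) \<and>
    card L = x \<and> (\<forall>v. dg L v \<le> (if v \<in> X then max \<theta> (dg F v - (T + s)) else \<theta>))"
proof -
  define c where "c v = (if v \<in> X then max \<theta> (dg F v - (T + s)) else \<theta>)" for v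
  have c: "\<theta> \<le> c v" "c v \<le> \<Theta>" for v
    using dX[of v] par(2) unfolding c_def by auto
  have fin: "finite F" using b by (rule bipart_finite)
  obtain Rs1 L1 where 1: "peels F Rs1 L1" "length Rs1 = T"
    "\<forall>R\<in>set Rs1. pair_matching R \<and> (\<forall>v\<in>X. dg R v = 1)"
    "card L1 + 2 * T = card F" "\<forall>v\<in>X. dg L1 v + T = dg F v"
    using peel_pairs_through[OF b star X(1,2)] dX by (metis add.commute)
  have sub1: "L1 \<subseteq> F" using peels_rest[OF 1(1)] by blast
  have b1: "bipart P Q L1" by (rule bipart_subset[OF b sub1])
  have d1: "dg L1 v \<le> dg F v" for v by (rule dg_mono[OF fin sub1])
  let ?s = "s - q"
  have s: "?s + q = s" using qs by simp
  have "\<exists>Rs L. peels L1 Rs L \<and> length Rs = q \<and> (\<forall>R\<in>set Rs. piece U R \<and> card R = 4) \<and>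
           card L = 2 * ?s + x \<and> (\<forall>v. dg L v \<le> ?s + c v)"
  proof (rule peel_four_edge_pieces[OF b1, where \<theta>=\<theta> and \<Theta>=\<Theta> and y=y and \<delta>=\<delta>])
    show "card L1 = 2 * (?s + q) + 2 * q + x" using cF 1(4) s by simp
    show "dg L1 v \<le> ?s + q + c v" if "v \<noteq> y" for v
    proof (cases "v \<in> X")
      case True
      then have "dg L1 v + T = dg F v" using 1(5) by blast
      moreover have "dg F v - (T + s) \<le> c v" unfolding c_def using True by simp
      ultimately show ?thesis using s by linarith
    next
      case False
      then show ?thesis using small[OF False that] d1[of v] s by linarith
    qed
    show "dg L1 y \<le> ?s + q + q + \<theta>" using dy d1[of y] s by linarith
    show "c y = \<theta>" unfolding c_def using X(3) by simp
    show "dg L1 v \<le> \<delta>" if "v \<notin> U" for v using U[OF that] d1[of v] by linarith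
  qed (use par c in auto)
  then obtain Rs2 L2 where 2: "peels L1 Rs2 L2" "length Rs2 = q" "\<forall>R\<in>set Rs2. piece U R"
    "card L2 = 2 * ?s + x" "\<forall>v. dg L2 v \<le> ?s + c v" by blast
  have b2: "bipart P Q L2" using bipart_subset[OF b1] peels_rest[OF 2(1)] by blast
  have "\<exists>Rs L. peels L2 Rs L \<and> length Rs = ?s \<and> (\<forall>R\<in>set Rs. pair_matching R) \<and>
           card L = 2 * 0 + x \<and> (\<forall>v. dg L v \<le> 0 + c v)"
  proof (rule peel_pairs[OF b2, where \<theta>=\<theta> and \<Theta>=\<Theta>])
    show "card L2 = 2 * (0 + ?s) + x" using 2(4) by simp
    show "dg L2 v \<le> 0 + ?s + c v" for v using 2(5) by simp
  qed (use par c in auto)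
  then obtain Rs3 L3 where 3: "peels L2 Rs3 L3" "length Rs3 = ?s" "\<forall>R\<in>set Rs3. pair_matching R"
    "card L3 = x" "\<forall>v. dg L3 v \<le> c v" by auto
  let ?Rs = "Rs1 @ Rs2 @ Rs3"
  have "peels F ?Rs L3" unfolding peels_append using 1(1) 2(1) 3(1) by blast
  moreover have "length ?Rs = T + s" using 1(2) 2(2) 3(2) s by simp
  moreover have "\<forall>R\<in>set ?Rs. piece U R"
    using 1(3) 2(3) 3(3) by (auto intro: pair_matching_piece)
  moreover have "pair_matching (?Rs ! k) \<and> (\<forall>v\<in>X. dg (?Rs ! k) v = 1)" if "k < T" for k
    using 1(2,3) that by (simp add: nth_append)
  ultimately show ?thesis using 3(4,5) unfolding c_def by blast
qed

section \<open>Hall's theorem\<close>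

text \<open>The classical induction on the number of sets: split along a tight subfamily if there is one, and otherwise
  choose an element for one set, which costs the others at most one element.\<close>

lemma hall:
  assumes "finite I" "\<And>i. i \<in> I \<Longrightarrow> finite (S i)"
    and "\<And>J. J \<subseteq> I \<Longrightarrow> card J \<le> card (\<Union>i\<in>J. S i)"
  shows "\<exists>f. inj_on f I \<and> (\<forall>i\<in>I. f i \<in> S i)"
  using assms
proof (induction "card I" arbitrary: I S rule: less_induct)
  case less
  note fin = less.prems(1) and finS = less.prems(2) and H = less.prems(3)
  show ?case
  proof (cases "I = {}")
    case True
    then show ?thesis by simp
  next
    case False
    show ?thesis
    proof (cases "\<exists>J. J \<noteq> {} \<and> J \<subset> I \<and> card (\<Union>i\<in>J. S i) = card J")
      case True
      then obtain J where J: "J \<noteq> {}" "J \<subset> I" "card (\<Union>i\<in>J. S i) = card J" by blast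
      have finJ: "finite J" using J(2) fin by (meson finite_subset psubset_imp_subset)
      let ?N = "\<Union>i\<in>J. S i"
      have finN: "finite ?N" using finJ finS J(2) by blast
      have "\<exists>f. inj_on f J \<and> (\<forall>i\<in>J. f i \<in> S i)"
        by (rule less.hyps) (use J(2) fin finJ finS H psubset_card_mono[OF fin J(2)] in auto)
      then obtain f where f: "inj_on f J" "\<forall>i\<in>J. f i \<in> S i" by blast
      have "\<exists>g. inj_on g (I - J) \<and> (\<forall>i\<in>I - J. g i \<in> S i - ?N)"
      proof (rule less.hyps)
        show "card (I - J) < card I" using J(1,2) fin by (intro psubset_card_mono) auto
        fix J' assume J': "J' \<subseteq> I - J"
        have finJ': "finite J'" using J' fin by (meson finite_Diff finite_subset)
        have fU: "finite (\<Union>i\<in>J'. S i - ?N)" using finJ' finS J' by blast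
        have "card J + card J' = card (J \<union> J')"
          using J' finJ finJ' by (subst card_Un_disjoint) auto
        also have "\<dots> \<le> card (\<Union>i\<in>J \<union> J'. S i)" by (rule H) (use J' J(2) in auto)
        also have "(\<Union>i\<in>J \<union> J'. S i) = ?N \<union> (\<Union>i\<in>J'. S i - ?N)" by auto
        also have "card \<dots> \<le> card ?N + card (\<Union>i\<in>J'. S i - ?N)" by (rule card_Un_le)
        finally show "card J' \<le> card (\<Union>i\<in>J'. S i - ?N)" using J(3) by simp
      qed (use fin finS in auto)
      then obtain g where g: "inj_on g (I - J)" "\<forall>i\<in>I - J. g i \<in> S i - ?N" by blast
      let ?h = "\<lambda>i. if i \<in> J then f i else g i"
      have "inj_on ?h I"
      proof (rule inj_onI)
        fix i j assume ij: "i \<in> I" "j \<in> I" "?h i = ?h j"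
        have mix: "f a \<noteq> g b" if "a \<in> J" "b \<in> I - J" for a b
          using f(2) g(2) that by (metis Diff_iff UN_I)
        show "i = j"
        proof (cases "i \<in> J"; cases "j \<in> J")
          assume "i \<in> J" "j \<in> J"
          then show ?thesis using ij f(1) by (simp add: inj_on_def)
        next
          assume "i \<in> J" "j \<notin> J"
          then show ?thesis using ij mix[of i j] by simp
        next
          assume "i \<notin> J" "j \<in> J"
          then show ?thesis using ij mix[of j i] by simp
        next
          assume "i \<notin> J" "j \<notin> J"
          then show ?thesis using ij g(1) by (simp add: inj_on_def)
        qed
      qed
      moreover have "\<forall>i\<in>I. ?h i \<in> S i" using f(2) g(2) by auto
      ultimately show ?thesis by blast
    next
      case noTight: False
      obtain i where i: "i \<in> I" using \<open>I \<noteq> {}\<close> by blast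
      have "card {i} \<le> card (\<Union>j\<in>{i}. S j)" by (rule H) (use i in simp)
      then have "S i \<noteq> {}" by auto
      then obtain x where x: "x \<in> S i" by blast
      have "\<exists>g. inj_on g (I - {i}) \<and> (\<forall>j\<in>I - {i}. g j \<in> S j - {x})"
      proof (rule less.hyps)
        show "card (I - {i}) < card I" using i fin by (intro psubset_card_mono) auto
        fix J' assume J': "J' \<subseteq> I - {i}"
        have finJ': "finite J'" using J' fin by (meson finite_Diff finite_subset)
        have eq: "(\<Union>j\<in>J'. S j - {x}) = (\<Union>j\<in>J'. S j) - {x}" by auto
        show "card J' \<le> card (\<Union>j\<in>J'. S j - {x})"
        proof (cases "J' = {}")
          case False
          have "card J' \<le> card (\<Union>j\<in>J'. S j)" by (rule H) (use J' in auto)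
          moreover have "J' \<subset> I" using J' i by blast
          then have "card (\<Union>j\<in>J'. S j) \<noteq> card J'" using noTight False by blast
          ultimately have "card J' < card (\<Union>j\<in>J'. S j)" by simp
          moreover have "card (\<Union>j\<in>J'. S j) - 1 \<le> card ((\<Union>j\<in>J'. S j) - {x})"
            using card_Diff1_le diff_card_le_card_Diff[of "{x}" "\<Union>j\<in>J'. S j"] by simp
          ultimately show ?thesis unfolding eq by linarith
        qed simp
      qed (use fin finS in auto)
      then obtain g where g: "inj_on g (I - {i})" "\<forall>j\<in>I - {i}. g j \<in> S j - {x}" by blast
      let ?h = "g(i := x)"
      have "inj_on ?h (insert i (I - {i}))"
        unfolding inj_on_insert using g by (auto simp: inj_on_def)
      moreover have "insert i (I - {i}) = I" using i by blast
      moreover have "\<forall>j\<in>I. ?h j \<in> S j" using g(2) x by auto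
      ultimately show ?thesis by metis
    qed
  qed
qed

section \<open>Distributing the edges at the exceptional vertices\<close>

text \<open>All edges at one exceptional vertex go to clusters, and \<open>E\<close> is the set of their other ends. A colour \<open>c\<close> stands for
  a piece: it demands \<open>r c\<close> of these ends, from the cluster \<open>A (\<tau> c)\<close> or from anywhere if \<open>\<tau> c = 0\<close>, and forbids \<open>X c\<close>.
  The demands add up to \<open>card E\<close>, so a system of distinct representatives of the slots \<open>(c, k)\<close> with \<open>k < r c\<close> uses up all of \<open>E\<close>.
  Hall's condition holds because more than \<open>t\<close> slots of one type together see their whole host set, and a single slot
  already sees all of it except \<open>t'\<close> elements.\<close>

lemma vertex_assignment:
  fixes E :: "'a set" and C :: "'c set" and r :: "'c \<Rightarrow> nat" and X :: "'c \<Rightarrow> 'a set"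
    and \<tau> :: "'c \<Rightarrow> nat" and A :: "nat \<Rightarrow> 'a set"
  assumes finE: "finite E" and finC: "finite C" and EA: "E \<subseteq> (\<Union>i\<in>{1..K}. A i)"
    and disj: "\<And>i j. i \<in> {1..K} \<Longrightarrow> j \<in> {1..K} \<Longrightarrow> i \<noteq> j \<Longrightarrow> A i \<inter> A j = {}"
    and \<tau>: "\<And>c. c \<in> C \<Longrightarrow> \<tau> c \<le> K" and r2: "\<And>c. c \<in> C \<Longrightarrow> r c \<le> 2"
    and tot: "(\<Sum>c\<in>C. r c) = card E"
    and loc: "\<And>i. i \<in> {1..K} \<Longrightarrow> (\<Sum>c\<in>{c\<in>C. \<tau> c = i}. r c) \<le> card (E \<inter> A i)"
    and big: "\<And>i. i \<in> {1..K} \<Longrightarrow> t + t' \<le> card (E \<inter> A i)"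
    and glob: "t + t' \<le> (\<Sum>c\<in>{c\<in>C. \<tau> c = 0}. r c)"
    and X: "\<And>c. c \<in> C \<Longrightarrow> card (E \<inter> X c) \<le> t'"
    and Xa: "\<And>a. a \<in> E \<Longrightarrow> 2 * card {c \<in> C. a \<in> X c} \<le> t"
  shows "\<exists>\<chi>. (\<forall>a\<in>E. \<chi> a \<in> C \<and> a \<notin> X (\<chi> a) \<and> (\<tau> (\<chi> a) \<noteq> 0 \<longrightarrow> a \<in> A (\<tau> (\<chi> a)))) \<and>
             (\<forall>c\<in>C. card {a \<in> E. \<chi> a = c} = r c)"
proof -
  define I where "I = (SIGMA c:C. {..<r c})"
  \<comment> \<open>\<open>host i\<close> is the set from which colours of type \<open>i\<close> may choose.\<close>
  define host where "host i = (if i = 0 then E else E \<inter> A i)" for i :: nat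
  define S where "S s = host (\<tau> (fst s)) - X (fst s)" for s :: "'c \<times> nat"
  have finI: "finite I" unfolding I_def using finC by auto
  have hostE: "host i \<subseteq> E" for i unfolding host_def by auto
  have finhost: "finite (host i)" for i using finite_subset[OF hostE finE] .
  have finS: "finite (S s)" for s unfolding S_def using finhost by blast
  have part: "card {s \<in> I. \<tau> (fst s) = i} = (\<Sum>c\<in>{c\<in>C. \<tau> c = i}. r c)" for i
  proof -
    have "{s \<in> I. \<tau> (fst s) = i} = (SIGMA c:{c\<in>C. \<tau> c = i}. {..<r c})" unfolding I_def by auto
    then show ?thesis using finC by (simp add: card_SigmaI)
  qed
  have cardI: "card I = card E" unfolding I_def using finC tot by (simp add: card_SigmaI)
  have many: "host i \<subseteq> (\<Union>s\<in>J. S s)"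
    if J: "J \<subseteq> I" "\<And>s. s \<in> J \<Longrightarrow> \<tau> (fst s) = i" "t < card J" for J i
  proof
    fix a assume a: "a \<in> host i"
    then have aE: "a \<in> E" using hostE by blast
    let ?B = "{s \<in> I. a \<in> X (fst s)}"
    have "?B = (SIGMA c:{c\<in>C. a \<in> X c}. {..<r c})" unfolding I_def by auto
    then have "card ?B = (\<Sum>c\<in>{c\<in>C. a \<in> X c}. r c)" using finC by (simp add: card_SigmaI)
    also have "\<dots> \<le> card {c\<in>C. a \<in> X c} * 2"
      using sum_bounded_above[of "{c\<in>C. a \<in> X c}" r 2] r2 by simp
    also have "\<dots> \<le> t" using Xa[OF aE] by simp
    finally have "card ?B < card J" using J(3) by simp
    then have "\<not> J \<subseteq> ?B" using card_mono[of ?B J] finI by auto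
    then obtain s where s: "s \<in> J" "a \<notin> X (fst s)" using J(1) by blast
    then have "a \<in> S s" unfolding S_def using a J(2)[OF s(1)] by simp
    then show "a \<in> (\<Union>s\<in>J. S s)" using s(1) by blast
  qed
  have one: "card (host (\<tau> (fst s))) \<le> card (S s) + t'" if "s \<in> I" for s
  proof -
    have "fst s \<in> C" using that unfolding I_def by auto
    then have "card (E \<inter> X (fst s)) \<le> t'" by (rule X)
    moreover have "card (host (\<tau> (fst s)) \<inter> X (fst s)) \<le> card (E \<inter> X (fst s))"
      by (rule card_mono) (use hostE finE in auto)
    moreover have "card (S s) = card (host (\<tau> (fst s))) - card (host (\<tau> (fst s)) \<inter> X (fst s))"
      unfolding S_def using finhost by (intro card_Diff_subset_Int) blast
    ultimately show ?thesis by linarith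
  qed
  have "card J \<le> card (\<Union>s\<in>J. S s)" if J: "J \<subseteq> I" for J
  proof -
    define Ji where "Ji i = {s \<in> J. \<tau> (fst s) = i}" for i
    have finJ: "finite J" using J finI by (rule finite_subset)
    have finN: "finite (\<Union>s\<in>J. S s)" using finJ finS by blast
    show ?thesis
    proof (cases "Ji 0 = {}")
      case False
      show ?thesis
      proof (cases "t < card (Ji 0)")
        case True
        have "host 0 \<subseteq> (\<Union>s\<in>Ji 0. S s)" by (rule many[OF _ _ True]) (use J Ji_def in auto)
        also have "\<dots> \<subseteq> (\<Union>s\<in>J. S s)" unfolding Ji_def by blast
        finally have "card E \<le> card (\<Union>s\<in>J. S s)"
          using finN unfolding host_def by (simp add: card_mono)
        then show ?thesis using card_mono[OF finI J] cardI by linarith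
      next
        case few: False
        obtain s where s: "s \<in> Ji 0" using False by blast
        let ?I0 = "{s \<in> I. \<tau> (fst s) = 0}"
        have "J \<subseteq> Ji 0 \<union> (I - ?I0)" using J unfolding Ji_def by blast
        then have "card J \<le> card (Ji 0 \<union> (I - ?I0))"
          using finI finJ unfolding Ji_def by (intro card_mono) auto
        also have "\<dots> \<le> card (Ji 0) + card (I - ?I0)" by (rule card_Un_le)
        also have "card (I - ?I0) = card I - card ?I0" using finI by (intro card_Diff_subset) auto
        finally have "card J \<le> t + (card E - card ?I0)" using few cardI by simp
        moreover have "t + t' \<le> card ?I0" using part[of 0] glob by simp
        moreover have "card ?I0 \<le> card E" using card_mono[OF finI, of ?I0] cardI by auto
        moreover have "card E \<le> card (S s) + t'"
          using one[of s] s J unfolding Ji_def host_def by auto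
        moreover have "card (S s) \<le> card (\<Union>s\<in>J. S s)"
          using s finN unfolding Ji_def by (intro card_mono) auto
        ultimately show ?thesis by linarith
      qed
    next
      case True
      define N where "N i = (\<Union>s\<in>Ji i. S s)" for i
      have Jun: "J = (\<Union>i\<in>{1..K}. Ji i)"
      proof
        show "J \<subseteq> (\<Union>i\<in>{1..K}. Ji i)"
        proof
          fix s assume s: "s \<in> J"
          have "\<tau> (fst s) \<noteq> 0" 
          proof
            assume "\<tau> (fst s) = 0"
            then have "s \<in> Ji 0" using s unfolding Ji_def by simp
            then show False using True by simp
          qed
          moreover have "fst s \<in> C" using s J unfolding I_def by auto
          then have "\<tau> (fst s) \<le> K" by (rule \<tau>)
          ultimately have "\<tau> (fst s) \<in> {1..K}" by simp
          moreover have "s \<in> Ji (\<tau> (fst s))" using s unfolding Ji_def by simp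
          ultimately show "s \<in> (\<Union>i\<in>{1..K}. Ji i)" by blast
        qed
      qed (auto simp: Ji_def)
      have NA: "N i \<subseteq> A i" if "i \<in> {1..K}" for i
        unfolding N_def Ji_def S_def host_def using that by auto
      have "card (Ji i) \<le> card (N i)" if i: "i \<in> {1..K}" for i
      proof -
        have finNi: "finite (N i)" unfolding N_def Ji_def using finJ finS by auto
        consider "Ji i = {}" | "t < card (Ji i)" | "Ji i \<noteq> {}" "card (Ji i) \<le> t" using not_less by blast
        then show ?thesis
        proof cases
          case 1
          then show ?thesis by simp
        next
          case 2
          have "host i \<subseteq> N i" unfolding N_def by (rule many[OF _ _ 2]) (use J Ji_def in auto)
          then have "card (E \<inter> A i) \<le> card (N i)"
            using card_mono[OF finNi] i unfolding host_def by auto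
          moreover have "card (Ji i) \<le> card {s \<in> I. \<tau> (fst s) = i}"
            using J finI unfolding Ji_def by (intro card_mono) auto
          ultimately show ?thesis using part[of i] loc[OF i] by linarith
        next
          case 3
          then obtain s where s: "s \<in> Ji i" by blast
          have "card (host i) \<le> card (S s) + t'" using one[of s] s J unfolding Ji_def by auto
          moreover have "card (host i) = card (E \<inter> A i)" using i unfolding host_def by auto
          moreover have "card (S s) \<le> card (N i)"
            using s unfolding N_def by (intro card_mono) (use finNi N_def in auto)
          ultimately show ?thesis using 3(2) big[OF i] by linarith
        qed
      qed
      then have "(\<Sum>i\<in>{1..K}. card (Ji i)) \<le> (\<Sum>i\<in>{1..K}. card (N i))" by (rule sum_mono)
      moreover have "card J \<le> (\<Sum>i\<in>{1..K}. card (Ji i))"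
        using card_UN_le[of "{1..K}" Ji] arg_cong[OF Jun, of card] by simp
      moreover have "(\<Sum>i\<in>{1..K}. card (N i)) = card (\<Union>i\<in>{1..K}. N i)"
      proof (rule card_UN_disjoint[symmetric])
        show "\<forall>i\<in>{1..K}. finite (N i)" unfolding N_def Ji_def using finJ finS by auto
        show "\<forall>i\<in>{1..K}. \<forall>j\<in>{1..K}. i \<noteq> j \<longrightarrow> N i \<inter> N j = {}" using NA disj by blast
      qed simp
      moreover have "card (\<Union>i\<in>{1..K}. N i) \<le> card (\<Union>s\<in>J. S s)"
        by (rule card_mono[OF finN]) (auto simp: N_def Ji_def)
      ultimately show ?thesis by linarith
    qed
  qed
  then have "\<exists>f. inj_on f I \<and> (\<forall>s\<in>I. f s \<in> S s)" by (rule hall[OF finI finS])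
  then obtain f where f: "inj_on f I" "\<forall>s\<in>I. f s \<in> S s" by blast
  have "f ` I \<subseteq> E" using f(2) hostE unfolding S_def by blast
  then have im: "f ` I = E" using card_image[OF f(1)] cardI by (intro card_subset_eq[OF finE]) auto
  define \<chi> where "\<chi> a = fst (the_inv_into I f a)" for a
  have \<chi>f: "\<chi> (f s) = fst s" if "s \<in> I" for s
    unfolding \<chi>_def using that by (simp add: the_inv_into_f_f[OF f(1)])
  have "\<chi> a \<in> C \<and> a \<notin> X (\<chi> a) \<and> (\<tau> (\<chi> a) \<noteq> 0 \<longrightarrow> a \<in> A (\<tau> (\<chi> a)))" if aE: "a \<in> E" for a
  proof -
    obtain s where s: "s \<in> I" "a = f s" using aE im by blast
    then have "a \<in> S s" using f(2) by blast
    then show ?thesis using s \<chi>f[OF s(1)] unfolding S_def host_def I_def by auto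
  qed
  moreover have "card {a \<in> E. \<chi> a = c} = r c" if "c \<in> C" for c
  proof -
    have "{a \<in> E. \<chi> a = c} = f ` ({c} \<times> {..<r c})"
    proof
      show "{a \<in> E. \<chi> a = c} \<subseteq> f ` ({c} \<times> {..<r c})"
      proof
        fix a assume a: "a \<in> {a \<in> E. \<chi> a = c}"
        then obtain s where s: "s \<in> I" "a = f s" using im by blast
        then have "s \<in> {c} \<times> {..<r c}" using \<chi>f[OF s(1)] a unfolding I_def by auto
        then show "a \<in> f ` ({c} \<times> {..<r c})" using s(2) by blast
      qed
      show "f ` ({c} \<times> {..<r c}) \<subseteq> {a \<in> E. \<chi> a = c}"
        using im \<chi>f that unfolding I_def by auto
    qed
    moreover have "inj_on f ({c} \<times> {..<r c})"
      by (rule inj_on_subset[OF f(1)]) (use that in \<open>auto simp: I_def\<close>)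
    ultimately show ?thesis by (simp add: card_image)
  qed
  ultimately show ?thesis by blast
qed

text \<open>The exceptional vertices are treated one at a time. For the next vertex, a colour also forbids the
  neighbours that it gave to earlier vertices. This adds at most \<open>2 * card V\<close> elements to a forbidden set and
  forbids an element for at most \<open>card V\<close> further colours.\<close>

lemma star_assignment:
  fixes V :: "'a set" and E :: "'a \<Rightarrow> 'a set" and C :: "'c set" and r :: "'a \<Rightarrow> 'c \<Rightarrow> nat"
    and X :: "'c \<Rightarrow> 'a set" and \<tau> :: "'c \<Rightarrow> nat" and A :: "nat \<Rightarrow> 'a set"
  assumes finV: "finite V" and finE: "\<And>v. v \<in> V \<Longrightarrow> finite (E v)" and finC: "finite C"
    and EA: "\<And>v. v \<in> V \<Longrightarrow> E v \<subseteq> (\<Union>i\<in>{1..K}. A i)"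
    and disj: "\<And>i j. i \<in> {1..K} \<Longrightarrow> j \<in> {1..K} \<Longrightarrow> i \<noteq> j \<Longrightarrow> A i \<inter> A j = {}"
    and \<tau>: "\<And>c. c \<in> C \<Longrightarrow> \<tau> c \<le> K" and r2: "\<And>v c. v \<in> V \<Longrightarrow> c \<in> C \<Longrightarrow> r v c \<le> 2"
    and tot: "\<And>v. v \<in> V \<Longrightarrow> (\<Sum>c\<in>C. r v c) = card (E v)"
    and loc: "\<And>v i. v \<in> V \<Longrightarrow> i \<in> {1..K} \<Longrightarrow> (\<Sum>c\<in>{c\<in>C. \<tau> c = i}. r v c) \<le> card (E v \<inter> A i)"
    and big: "\<And>v i. v \<in> V \<Longrightarrow> i \<in> {1..K} \<Longrightarrow> t + t' \<le> card (E v \<inter> A i)"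
    and glob: "\<And>v. v \<in> V \<Longrightarrow> t + t' \<le> (\<Sum>c\<in>{c\<in>C. \<tau> c = 0}. r v c)"
    and X: "\<And>c. c \<in> C \<Longrightarrow> finite (X c) \<and> card (X c) + 2 * card V \<le> t'"
    and Xa: "\<And>a. a \<in> (\<Union>i\<in>{1..K}. A i) \<Longrightarrow> 2 * (card {c \<in> C. a \<in> X c} + card V) \<le> t"
  shows "\<exists>\<chi>. (\<forall>v\<in>V. \<forall>a\<in>E v. \<chi> v a \<in> C \<and> a \<notin> X (\<chi> v a) \<and>
                 (\<tau> (\<chi> v a) \<noteq> 0 \<longrightarrow> a \<in> A (\<tau> (\<chi> v a)))) \<and>
             (\<forall>v\<in>V. \<forall>c\<in>C. card {a \<in> E v. \<chi> v a = c} = r v c) \<and>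
             (\<forall>v\<in>V. \<forall>w\<in>V. v \<noteq> w \<longrightarrow> (\<forall>a\<in>E v \<inter> E w. \<chi> v a \<noteq> \<chi> w a))"
proof -
  define good where "good W \<chi> \<longleftrightarrow> (\<forall>v\<in>W. \<forall>a\<in>E v. \<chi> v a \<in> C \<and> a \<notin> X (\<chi> v a) \<and>
                 (\<tau> (\<chi> v a) \<noteq> 0 \<longrightarrow> a \<in> A (\<tau> (\<chi> v a)))) \<and>
             (\<forall>v\<in>W. \<forall>c\<in>C. card {a \<in> E v. \<chi> v a = c} = r v c) \<and>
             (\<forall>v\<in>W. \<forall>w\<in>W. v \<noteq> w \<longrightarrow> (\<forall>a\<in>E v \<inter> E w. \<chi> v a \<noteq> \<chi> w a))" for W \<chi>
  have "W \<subseteq> V \<Longrightarrow> \<exists>\<chi>. good W \<chi>" if "finite W" for W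
    using that
  proof (induction W rule: finite_induct)
    case empty
    show ?case unfolding good_def by simp
  next
    case (insert v W)
    then obtain \<chi> where \<chi>: "good W \<chi>" by blast
    have vV: "v \<in> V" and WV: "W \<subseteq> V" using insert.prems by auto
    have cW: "card W \<le> card V" using card_mono[OF finV WV] .
    \<comment> \<open>A neighbour already used by an earlier vertex in colour \<open>c\<close> is forbidden in this colour.\<close>
    define X' where "X' c = X c \<union> (\<Union>w\<in>W. {a \<in> E w. \<chi> w a = c})" for c
    have "\<exists>\<xi>. (\<forall>a\<in>E v. \<xi> a \<in> C \<and> a \<notin> X' (\<xi> a) \<and> (\<tau> (\<xi> a) \<noteq> 0 \<longrightarrow> a \<in> A (\<tau> (\<xi> a)))) \<and>
             (\<forall>c\<in>C. card {a \<in> E v. \<xi> a = c} = r v c)"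
    proof (rule vertex_assignment[OF finE[OF vV] finC EA[OF vV] disj \<tau> r2[OF vV] tot[OF vV]
          loc[OF vV] big[OF vV] glob[OF vV]])
      fix c assume c: "c \<in> C"
      have "card (E v \<inter> X' c) \<le> card (X' c)"
        by (rule card_mono) (use X[OF c] insert.hyps(1) finE WV in \<open>auto simp: X'_def\<close>)
      also have "\<dots> \<le> card (X c) + card (\<Union>w\<in>W. {a \<in> E w. \<chi> w a = c})"
        unfolding X'_def by (rule card_Un_le)
      also have "card (\<Union>w\<in>W. {a \<in> E w. \<chi> w a = c}) \<le> (\<Sum>w\<in>W. card {a \<in> E w. \<chi> w a = c})"
        by (rule card_UN_le[OF insert.hyps(1)])
      also have "\<dots> \<le> card W * 2"
      proof -
        have "card {a \<in> E w. \<chi> w a = c} \<le> 2" if w: "w \<in> W" for w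
        proof -
          have "card {a \<in> E w. \<chi> w a = c} = r w c" using \<chi> c w unfolding good_def by blast
          then show ?thesis using r2[of w c] c w WV by auto
        qed
        then show ?thesis using sum_bounded_above[of W "\<lambda>w. card {a \<in> E w. \<chi> w a = c}" 2] by simp
      qed
      finally show "card (E v \<inter> X' c) \<le> t'" using X[OF c] cW by linarith
    next
      fix a assume a: "a \<in> E v"
      have "{c \<in> C. a \<in> X' c} \<subseteq> {c \<in> C. a \<in> X c} \<union> (\<lambda>w. \<chi> w a) ` W"
        unfolding X'_def by auto
      then have "card {c \<in> C. a \<in> X' c} \<le> card ({c \<in> C. a \<in> X c} \<union> (\<lambda>w. \<chi> w a) ` W)"
        using finC insert.hyps(1) by (intro card_mono) auto
      also have "\<dots> \<le> card {c \<in> C. a \<in> X c} + card ((\<lambda>w. \<chi> w a) ` W)" by (rule card_Un_le)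
      also have "card ((\<lambda>w. \<chi> w a) ` W) \<le> card W" by (rule card_image_le[OF insert.hyps(1)])
      finally show "2 * card {c \<in> C. a \<in> X' c} \<le> t"
        using Xa[of a] a EA[OF vV] cW by (meson add_left_mono le_trans mult_le_mono2 subsetD)
    qed
    then obtain \<xi> where \<xi>: "\<forall>a\<in>E v. \<xi> a \<in> C \<and> a \<notin> X' (\<xi> a) \<and> (\<tau> (\<xi> a) \<noteq> 0 \<longrightarrow> a \<in> A (\<tau> (\<xi> a)))"
      "\<forall>c\<in>C. card {a \<in> E v. \<xi> a = c} = r v c" by blast
    let ?\<chi> = "\<chi>(v := \<xi>)"
    have up: "?\<chi> w = \<chi> w" if "w \<in> W" for w using that insert.hyps(2) by auto
    have new: "\<xi> a \<noteq> \<chi> w a" if "w \<in> W" "a \<in> E v \<inter> E w" for w a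
    proof
      assume "\<xi> a = \<chi> w a"
      then have "a \<in> X' (\<xi> a)" using that unfolding X'_def by auto
      then show False using \<xi>(1) that by blast
    qed
    have "good (insert v W) ?\<chi>"
      unfolding good_def
    proof (intro conjI ballI impI)
      fix w a assume wa: "w \<in> insert v W" "a \<in> E w"
      then have "?\<chi> w a \<in> C \<and> a \<notin> X (?\<chi> w a) \<and> (\<tau> (?\<chi> w a) \<noteq> 0 \<longrightarrow> a \<in> A (\<tau> (?\<chi> w a)))"
      proof (cases "w = v")
        case True
        then show ?thesis using \<xi>(1) wa unfolding X'_def by auto
      next
        case False
        then show ?thesis using \<chi> wa unfolding good_def by auto
      qed
      then show "?\<chi> w a \<in> C" "a \<notin> X (?\<chi> w a)" "\<tau> (?\<chi> w a) \<noteq> 0 \<Longrightarrow> a \<in> A (\<tau> (?\<chi> w a))" by auto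
    next
      fix w c assume wc: "w \<in> insert v W" "c \<in> C"
      then show "card {a \<in> E w. ?\<chi> w a = c} = r w c"
        using \<xi>(2) \<chi> up unfolding good_def by (cases "w = v") auto
    next
      fix w u a assume w: "w \<in> insert v W" "u \<in> insert v W" "w \<noteq> u" "a \<in> E w \<inter> E u"
      consider "w = v" "u \<in> W" | "u = v" "w \<in> W" | "w \<in> W" "u \<in> W" using w by blast
      then show "?\<chi> w a \<noteq> ?\<chi> u a"
      proof cases
        case 1
        then show ?thesis using new[of u a] w up by auto
      next
        case 2
        then show ?thesis using new[of w a] w up by (metis Int_commute fun_upd_same)
      next
        case 3
        then show ?thesis using \<chi> w up unfolding good_def by metis
      qed
    qed
    then show ?case by blast
  qed
  then obtain \<chi> where "good V \<chi>" using finV by blast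
  then show ?thesis unfolding good_def by blast
qed

section \<open>Path systems from pieces\<close>

lemma deg_eq_dg:
  assumes "simple_graph G"
  shows "deg G v = dg (edges G) v"
proof -
  have "bij_betw (\<lambda>u. {u, v}) {u \<in> verts G. {u, v} \<in> edges G} {e \<in> edges G. v \<in> e}"
    unfolding bij_betw_def
  proof
    show "inj_on (\<lambda>u. {u, v}) {u \<in> verts G. {u, v} \<in> edges G}"
      by (auto simp: inj_on_def doubleton_eq_iff)
    show "(\<lambda>u. {u, v}) ` {u \<in> verts G. {u, v} \<in> edges G} = {e \<in> edges G. v \<in> e}"
    proof
      show "{e \<in> edges G. v \<in> e} \<subseteq> (\<lambda>u. {u, v}) ` {u \<in> verts G. {u, v} \<in> edges G}"
      proof
        fix e assume e: "e \<in> {e \<in> edges G. v \<in> e}"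
        then obtain a b where ab: "a \<in> verts G" "b \<in> verts G" "e = {a, b}"
          using assms unfolding simple_graph_def by blast
        have "e = {(if v = a then b else a), v}" using e ab(3) by auto
        then show "e \<in> (\<lambda>u. {u, v}) ` {u \<in> verts G. {u, v} \<in> edges G}"
          using e ab by (intro image_eqI[of _ _ "if v = a then b else a"]) auto
      qed
    qed auto
  qed
  then show ?thesis unfolding deg_def deg_in_def dg_def by (rule bij_betw_same_card)
qed

lemma edges_path_Nil [simp]: "edges (path_of [x]) = {}"
  unfolding path_of_def by simp

lemma edges_path_Cons [simp]:
  "edges (path_of (x # y # zs)) = insert {x, y} (edges (path_of (y # zs)))"
proof -
  have "{{(x # y # zs) ! i, (x # y # zs) ! Suc i} | i. Suc i < length (x # y # zs)} =
        insert {x, y} {{(y # zs) ! i, (y # zs) ! Suc i} | i. Suc i < length (y # zs)}"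
  proof (intro equalityI subsetI)
    fix e assume "e \<in> {{(x # y # zs) ! i, (x # y # zs) ! Suc i} | i. Suc i < length (x # y # zs)}"
    then obtain i where i: "e = {(x # y # zs) ! i, (x # y # zs) ! Suc i}" "Suc i < length (x # y # zs)"
      by blast
    show "e \<in> insert {x, y} {{(y # zs) ! i, (y # zs) ! Suc i} | i. Suc i < length (y # zs)}"
    proof (cases i)
      case 0
      then show ?thesis using i by simp
    next
      case (Suc j)
      then have "e = {(y # zs) ! j, (y # zs) ! Suc j}" "Suc j < length (y # zs)" using i by auto
      then show ?thesis by blast
    qed
  next
    fix e assume "e \<in> insert {x, y} {{(y # zs) ! i, (y # zs) ! Suc i} | i. Suc i < length (y # zs)}"
    then consider "e = {x, y}" | i where "e = {(y # zs) ! i, (y # zs) ! Suc i}" "Suc i < length (y # zs)"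
      by blast
    then show "e \<in> {{(x # y # zs) ! i, (x # y # zs) ! Suc i} | i. Suc i < length (x # y # zs)}"
    proof cases
      case 1
      then show ?thesis by (auto intro!: exI[of _ 0])
    next
      case (2 i)
      then show ?thesis by (auto intro!: exI[of _ "Suc i"])
    qed
  qed
  then show ?thesis unfolding path_of_def graph.sel .
qed

lemma edges_path_append:
  "edges (path_of (xs @ [y, b])) = edges (path_of (xs @ [y])) \<union> {{y, b}}"
proof (induction xs)
  case (Cons x xs)
  then show ?case by (cases xs) auto
qed simp

lemma verts_path [simp]: "verts (path_of xs) = set xs"
  unfolding path_of_def by simp

lemma edges_path_subset: "e \<in> edges (path_of xs) \<Longrightarrow> e \<subseteq> set xs"
  unfolding path_of_def by auto

lemma simple_graph_path:
  assumes "distinct xs"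
  shows "simple_graph (path_of xs)"
  unfolding simple_graph_def
proof (intro conjI ballI)
  fix e assume "e \<in> edges (path_of xs)"
  then obtain i where i: "e = {xs ! i, xs ! Suc i}" "Suc i < length xs"
    unfolding path_of_def by auto
  then have "xs ! i \<noteq> xs ! Suc i" using assms by (simp add: nth_eq_iff_index_eq)
  then show "\<exists>u v. u \<in> verts (path_of xs) \<and> v \<in> verts (path_of xs) \<and> u \<noteq> v \<and> e = {u, v}"
    using i by (intro exI[of _ "xs ! i"] exI[of _ "xs ! Suc i"]) simp
qed simp

text \<open>A path in a path from one end to the other is the whole path: each step must go on to the next vertex,
  since going back would repeat a vertex.\<close>

lemma path_determined_by_ends:
  assumes xs: "distinct xs" "xs \<noteq> []" and ps: "distinct ps" "ps \<noteq> []"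
    and ends: "hd xs = hd ps" "last xs = last ps"
    and sub: "edges (path_of xs) \<subseteq> edges (path_of ps)"
  shows "xs = ps"
proof -
  have *: "k < length xs \<Longrightarrow> k < length ps \<and> xs ! k = ps ! k" for k
  proof (induction k rule: less_induct)
    case (less k)
    show ?case
    proof (cases k)
      case 0
      then show ?thesis using ends(1) xs(2) ps(2) by (simp add: hd_conv_nth)
    next
      case (Suc j)
      have j: "j < length ps" "xs ! j = ps ! j" using less Suc by auto
      have "{xs ! j, xs ! Suc j} \<in> edges (path_of xs)"
        unfolding path_of_def using less.prems Suc by auto
      then have "{xs ! j, xs ! Suc j} \<in> edges (path_of ps)" using sub by blast
      then obtain i where i: "{xs ! j, xs ! Suc j} = {ps ! i, ps ! Suc i}" "Suc i < length ps"
        unfolding path_of_def by auto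
      have "i = j \<or> Suc i = j"
      proof -
        have "ps ! j = ps ! i \<or> ps ! j = ps ! Suc i" using i(1) j(2) by auto
        then show ?thesis using ps(1) i(2) j(1) by (auto simp: nth_eq_iff_index_eq)
      qed
      then show ?thesis
      proof
        assume ij: "i = j"
        have "xs ! Suc j \<noteq> xs ! j" using xs(1) less.prems Suc by (simp add: nth_eq_iff_index_eq)
        then have "xs ! Suc j = ps ! Suc j" using i(1) j(2) ij by (auto simp: doubleton_eq_iff)
        then show ?thesis using i(2) ij Suc by simp
      next
        assume ij: "Suc i = j"
        have "xs ! i = ps ! i" using less.IH[of i] less.prems Suc ij by auto
        moreover have "xs ! Suc j \<noteq> xs ! j" "xs ! Suc j \<noteq> xs ! i"
          using xs(1) less.prems Suc ij by (auto simp: nth_eq_iff_index_eq)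
        ultimately have False using i(1) j(2) ij by (auto simp: doubleton_eq_iff)
        then show ?thesis ..
      qed
    qed
  qed
  have pos: "0 < length xs" "0 < length ps" using xs(2) ps(2) by simp_all
  then have l: "length xs - 1 < length xs" "length ps - 1 < length ps" by linarith+
  have "ps ! (length xs - 1) = last xs"
    using *[OF l(1)] by (simp only: last_conv_nth[OF xs(2)])
  also have "\<dots> = ps ! (length ps - 1)" using ends(2) by (simp only: last_conv_nth[OF ps(2)])
  finally have "length xs - 1 = length ps - 1"
    using nth_eq_iff_index_eq[OF ps(1) conjunct1[OF *[OF l(1)]] l(2)] by blast
  then have len: "length xs = length ps" using pos by linarith
  show ?thesis
  proof (rule nth_equalityI[OF len])
    show "xs ! i = ps ! i" if "i < length xs" for i using *[OF that] by (rule conjunct2)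
  qed
qed

lemma piece_shape:
  assumes "piece U R"
  obtains M S where "R = M \<union> S" "matching M" "card M \<in> {2, 4}" "finite M"
    "S = {} \<or> star_edges M U S"
proof -
  obtain M S where MS: "R = M \<union> S" "matching M" "card M \<in> {2, 4}" "S = {} \<or> star_edges M U S"
    using assms unfolding piece_def by blast
  moreover have "finite M" using MS(3) by (auto intro: card_ge_0_finite)
  ultimately show thesis using that by blast
qed

lemma piece_finite:
  assumes "piece U R"
  shows "finite R"
proof -
  obtain M S where MS: "R = M \<union> S" "finite M" "S = {} \<or> star_edges M U S"
    using assms by (rule piece_shape)
  have "finite S" using MS(3)
  proof
    assume "star_edges M U S"
    then obtain g1 g2 where "S = {g1, g2}" unfolding star_edges_def by blast
    then show ?thesis by simp
  qed simp
  then show ?thesis using MS(1,2) by simp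
qed

lemma piece_dg:
  assumes "piece U R"
  shows "dg R v \<le> 2" "v \<notin> U \<Longrightarrow> dg R v \<le> 1"
proof -
  obtain M S where MS: "R = M \<union> S" "matching M" "finite M" "S = {} \<or> star_edges M U S"
    using assms by (rule piece_shape)
  have M1: "dg M v \<le> 1" by (rule matching_dg_le[OF MS(2,3)])
  have "dg R v \<le> 2 \<and> (v \<notin> U \<longrightarrow> dg R v \<le> 1)"
  proof (cases "S = {}")
    case True
    then show ?thesis using M1 MS(1) by simp
  next
    case False
    then obtain z g1 g2 where g: "z \<in> U" "S = {g1,g2}" "g1 \<noteq> g2" "g1 \<inter> g2 = {z}"
      "\<forall>e\<in>M. e \<inter> (g1 \<union> g2) = {}" using MS(4) unfolding star_edges_def by blast
    show ?thesis
    proof (cases "v \<in> g1 \<union> g2")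
      case True
      then have eq: "{e \<in> R. v \<in> e} = {e \<in> {g1,g2}. v \<in> e}" using g MS(1) by blast
      have "card {e \<in> {g1,g2}. v \<in> e} \<le> card {g1,g2}" by (rule card_mono) auto
      moreover have "card {e \<in> {g1,g2}. v \<in> e} \<le> 1" if "v \<notin> U"
      proof -
        have "v \<notin> g1 \<inter> g2" using that g(1,4) by auto
        then have "{e \<in> {g1,g2}. v \<in> e} \<subseteq> {g1} \<or> {e \<in> {g1,g2}. v \<in> e} \<subseteq> {g2}" by auto
        then show ?thesis
          using card_mono[of "{g1}" "{e \<in> {g1,g2}. v \<in> e}"] card_mono[of "{g2}" "{e \<in> {g1,g2}. v \<in> e}"]
          by (elim disjE) simp_all
      qed
      ultimately show ?thesis unfolding dg_def eq using g(3) by simp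
    next
      case False
      then have "{e \<in> R. v \<in> e} = {e \<in> M. v \<in> e}" using g MS(1) by auto
      then show ?thesis using M1 unfolding dg_def by simp
    qed
  qed
  then show "dg R v \<le> 2" "v \<notin> U \<Longrightarrow> dg R v \<le> 1" by auto
qed

definition pendant_edges :: "'a set \<Rightarrow> ('a \<Rightarrow> 'a set) \<Rightarrow> 'a set set" where
  "pendant_edges V0 N = {{v, a} | v a. v \<in> V0 \<and> a \<in> N v}"

definition completed :: "'a set \<Rightarrow> 'a set set \<Rightarrow> ('a \<Rightarrow> 'a set) \<Rightarrow> 'a graph" where
  "completed V0 R N = Graph (V0 \<union> \<Union>R \<union> (\<Union>v\<in>V0. N v)) (R \<union> pendant_edges V0 N)"

lemma pendant_edges_Un:
  "pendant_edges (S \<union> S') N = pendant_edges S N \<union> pendant_edges S' N"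
  unfolding pendant_edges_def by blast

text \<open>A piece \<open>R\<close> together with sets \<open>N v\<close> of pendant neighbours that bring every exceptional vertex to degree
  two. The last two assumptions make all pendant neighbours distinct and new.\<close>

locale completion =
  fixes A A0 B B0 :: "'a set" and R :: "'a set set" and N :: "'a \<Rightarrow> 'a set"
  assumes disj: "A \<inter> A0 = {}" "A \<inter> B = {}" "A \<inter> B0 = {}" "A0 \<inter> B = {}" "A0 \<inter> B0 = {}" "B \<inter> B0 = {}"
    and fin0: "finite A0" "finite B0"
    and bip: "bipart (A \<union> A0) (B \<union> B0) R"
    and pieceR: "piece (A0 \<union> B0) R"
    and NA: "v \<in> A0 \<Longrightarrow> N v \<subseteq> A" and NB: "v \<in> B0 \<Longrightarrow> N v \<subseteq> B"
    and finN: "v \<in> A0 \<union> B0 \<Longrightarrow> finite (N v)"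
    and cardN: "v \<in> A0 \<union> B0 \<Longrightarrow> card (N v) + dg R v = 2"
    and NN: "v \<in> A0 \<union> B0 \<Longrightarrow> w \<in> A0 \<union> B0 \<Longrightarrow> v \<noteq> w \<Longrightarrow> N v \<inter> N w = {}"
    and NR: "v \<in> A0 \<union> B0 \<Longrightarrow> N v \<inter> \<Union>R = {}"
begin

abbreviation "V0 \<equiv> A0 \<union> B0"
abbreviation "J \<equiv> completed V0 R N"

text \<open>The component of \<open>J\<close> that arises from a component \<open>C\<close> of the piece.\<close>

definition with_pendants :: "'a set \<Rightarrow> 'a set" where
  "with_pendants C = C \<union> (\<Union>v\<in>C \<inter> V0. N v)"

text \<open>The list by which a path is prolonged beyond an end \<open>v\<close> of piece degree one: by the unique pendant
  neighbour if \<open>v\<close> is exceptional, and not at all otherwise.\<close>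

definition pendant_end :: "'a \<Rightarrow> 'a list" where
  "pendant_end v = (if v \<in> V0 then [the_elem (N v)] else [])"

lemma N_V0: "v \<in> V0 \<Longrightarrow> N v \<inter> V0 = {}"
proof (cases "v \<in> A0")
  case True
  show ?thesis using NA[OF True] disj by blast
next
  case False
  assume "v \<in> V0"
  then have "v \<in> B0" using False by blast
  then show ?thesis using NB[of v] disj by blast
qed

lemma pendant_end:
  assumes "dg R v = 1"
  shows "v \<in> V0 \<Longrightarrow> \<exists>a. N v = {a} \<and> pendant_end v = [a]" "v \<notin> V0 \<Longrightarrow> pendant_end v = []"
proof -
  assume v: "v \<in> V0"
  then have "card (N v) = 1" using cardN[OF v] assms by simp
  then obtain a where "N v = {a}" by (meson card_1_singletonE)
  then show "\<exists>a. N v = {a} \<and> pendant_end v = [a]" unfolding pendant_end_def using v by simp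
qed (simp add: pendant_end_def)

lemma path_pendant_end:
  assumes "dg R v = 1"
  shows "edges (path_of (pendant_end v @ v # zs)) = pendant_edges ({v} \<inter> V0) N \<union> edges (path_of (v # zs))"
    and "edges (path_of (zs @ v # pendant_end v)) = edges (path_of (zs @ [v])) \<union> pendant_edges ({v} \<inter> V0) N"
proof -
  consider "v \<notin> V0" "pendant_end v = []" | a where "v \<in> V0" "N v = {a}" "pendant_end v = [a]"
    using pendant_end[OF assms] by blast
  then have "edges (path_of (pendant_end v @ v # zs)) = pendant_edges ({v} \<inter> V0) N \<union> edges (path_of (v # zs)) \<and>
    edges (path_of (zs @ v # pendant_end v)) = edges (path_of (zs @ [v])) \<union> pendant_edges ({v} \<inter> V0) N"
  proof cases
    case 1
    then have "pendant_edges ({v} \<inter> V0) N = {}" unfolding pendant_edges_def by simp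
    then show ?thesis using 1 by simp
  next
    case (2 a)
    then have "{v} \<inter> V0 = {v}" by blast
    then have "pendant_edges ({v} \<inter> V0) N = {{v, a}}" unfolding pendant_edges_def using 2(2) by simp
    moreover have "{a, v} = {v, a}" by blast
    ultimately show ?thesis using 2(3) by (simp add: edges_path_append)
  qed
  then show "edges (path_of (pendant_end v @ v # zs)) = pendant_edges ({v} \<inter> V0) N \<union> edges (path_of (v # zs))"
    "edges (path_of (zs @ v # pendant_end v)) = edges (path_of (zs @ [v])) \<union> pendant_edges ({v} \<inter> V0) N" by simp_all
qed

text \<open>A matching edge joins \<open>A \<union> A0\<close> to \<open>B \<union> B0\<close>. An end in \<open>A0\<close> is prolonged into \<open>A\<close> and an end in \<open>B0\<close> into \<open>B\<close>,
  so the path runs from \<open>A\<close> to \<open>B\<close>.\<close>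

lemma edge_list:
  assumes e: "e \<in> R" and lone: "\<And>f. f \<in> R \<Longrightarrow> f \<inter> e \<noteq> {} \<Longrightarrow> f = e"
  shows "\<exists>l. distinct l \<and> l \<noteq> [] \<and> set l = with_pendants e \<and>
     edges (path_of l) = {f \<in> R. f \<subseteq> e} \<union> pendant_edges (e \<inter> V0) N \<and>
     hd l \<in> A \<and> last l \<in> B \<and> set l \<inter> A = {hd l} \<and> set l \<inter> B = {last l}"
proof -
  obtain x y where xy: "e = {x,y}" "x \<in> A \<union> A0" "y \<in> B \<union> B0" "x \<noteq> y"
    by (rule bipart_edgeE[OF bip e]) blast
  have one: "dg R v = 1" if "v \<in> e" for v
  proof -
    have "{f \<in> R. v \<in> f} = {e}" using lone e that by blast
    then show ?thesis unfolding dg_def by simp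
  qed
  have within: "{f \<in> R. f \<subseteq> e} = {e}"
  proof -
    have "f = e" if "f \<in> R" "f \<subseteq> e" for f
    proof (rule lone[OF that(1)])
      have "f \<noteq> {}" using bipart_edge_finite[OF bip that(1)] by auto
      then show "f \<inter> e \<noteq> {}" using that(2) by blast
    qed
    then show ?thesis using e by blast
  qed
  have dx: "dg R x = 1" "dg R y = 1" using one xy by auto
  have x: "(x \<in> A \<and> x \<notin> V0 \<and> pendant_end x = []) \<or> (x \<in> A0 \<and> (\<exists>a\<in>A. N x = {a} \<and> pendant_end x = [a]))"
  proof (cases "x \<in> A0")
    case True
    then show ?thesis using pendant_end(1)[OF dx(1)] NA[of x] by auto
  next
    case False
    then have "x \<in> A" "x \<notin> V0" using xy(2) disj by blast+
    then show ?thesis using pendant_end(2)[OF dx(1)] by blast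
  qed
  have y: "(y \<in> B \<and> y \<notin> V0 \<and> pendant_end y = []) \<or> (y \<in> B0 \<and> (\<exists>b\<in>B. N y = {b} \<and> pendant_end y = [b]))"
  proof (cases "y \<in> B0")
    case True
    then show ?thesis using pendant_end(1)[OF dx(2)] NB[of y] by auto
  next
    case False
    then have "y \<in> B" "y \<notin> V0" using xy(3) disj by blast+
    then show ?thesis using pendant_end(2)[OF dx(2)] by blast
  qed
  let ?l = "pendant_end x @ [x,y] @ pendant_end y"
  show ?thesis
  proof (intro exI[of _ ?l] conjI)
    from x y show "distinct ?l" using xy(4) disj by (elim disjE conjE bexE) auto
    show "?l \<noteq> []" by simp
    from x y show "set ?l = with_pendants e" unfolding with_pendants_def xy(1) using disj by (elim disjE conjE bexE) auto
    have "e \<inter> V0 = ({x} \<inter> V0) \<union> ({y} \<inter> V0)" using xy(1) by blast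
    then have "pendant_edges (e \<inter> V0) N = pendant_edges ({x} \<inter> V0) N \<union> pendant_edges ({y} \<inter> V0) N"
      using pendant_edges_Un by metis
    moreover have "edges (path_of ?l) =
        pendant_edges ({x} \<inter> V0) N \<union> ({{x,y}} \<union> pendant_edges ({y} \<inter> V0) N)"
      using path_pendant_end(1)[OF dx(1), of "[y] @ pendant_end y"] path_pendant_end(2)[OF dx(2), of "[]"] by simp
    moreover have "{f \<in> R. f \<subseteq> e} = {{x,y}}" using within xy(1) by simp
    ultimately show "edges (path_of ?l) = {f \<in> R. f \<subseteq> e} \<union> pendant_edges (e \<inter> V0) N"
      by (simp only: Un_ac)
    from x y show "hd ?l \<in> A" by (elim disjE conjE bexE) auto
    from x y show "last ?l \<in> B" by (elim disjE conjE bexE) auto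
    from x y show "set ?l \<inter> A = {hd ?l}" using disj by (elim disjE conjE bexE) auto
    from x y show "set ?l \<inter> B = {last ?l}" using disj by (elim disjE conjE bexE) auto
  qed
qed

text \<open>Both edges of a star cross, so its two ends lie on the same side, and so does everything appended to them.\<close>

lemma star_list:
  assumes g: "z \<in> V0" "g1 \<in> R" "g2 \<in> R" "g1 \<noteq> g2" "g1 \<inter> g2 = {z}"
    and lone: "\<And>f. f \<in> R \<Longrightarrow> f \<inter> (g1 \<union> g2) \<noteq> {} \<Longrightarrow> f = g1 \<or> f = g2"
  shows "\<exists>l. distinct l \<and> l \<noteq> [] \<and> set l = with_pendants (g1 \<union> g2) \<and>
     edges (path_of l) = {f \<in> R. f \<subseteq> g1 \<union> g2} \<union> pendant_edges ((g1 \<union> g2) \<inter> V0) N \<and>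
     (set l \<inter> A = {} \<or> set l \<inter> B = {})"
proof -
  have zg: "z \<in> g1" "z \<in> g2" using g(5) by auto
  have dz: "dg R z = 2"
  proof -
    have "f = g1 \<or> f = g2" if "f \<in> R" "z \<in> f" for f
      using lone[OF that(1)] that(2) zg by auto
    then have "{f \<in> R. z \<in> f} \<subseteq> {g1,g2}" by blast
    moreover have "{g1,g2} \<subseteq> {f \<in> R. z \<in> f}" using g(2,3) zg by simp
    ultimately have "{f \<in> R. z \<in> f} = {g1,g2}" by (rule subset_antisym)
    then show ?thesis unfolding dg_def using g(4) by simp
  qed
  have Nz: "N z = {}" using cardN[OF g(1)] finN[OF g(1)] dz by simp
  have within: "{f \<in> R. f \<subseteq> g1 \<union> g2} = {g1,g2}"
  proof -
    have "f = g1 \<or> f = g2" if "f \<in> R" "f \<subseteq> g1 \<union> g2" for f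
    proof (rule lone[OF that(1)])
      have "f \<noteq> {}" using bipart_edge_finite[OF bip that(1)] by auto
      then show "f \<inter> (g1 \<union> g2) \<noteq> {}" using that(2) by blast
    qed
    then show ?thesis using g by blast
  qed
  have other: "\<exists>p. g = {z,p} \<and> p \<noteq> z \<and>
      (z \<in> A0 \<longrightarrow> p \<in> B \<union> B0) \<and> (z \<in> B0 \<longrightarrow> p \<in> A \<union> A0)" if gR: "g \<in> R" "z \<in> g" for g
  proof -
    obtain x y where xy: "g = {x,y}" "x \<in> A \<union> A0" "y \<in> B \<union> B0" "x \<noteq> y"
      by (rule bipart_edgeE[OF bip gR(1)]) blast
    consider "z = x" | "z = y" using gR xy by blast
    then show ?thesis
    proof cases
      case 1
      then show ?thesis using xy disj by (intro exI[of _ y]) auto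
    next
      case 2
      then show ?thesis using xy disj by (intro exI[of _ x]) auto
    qed
  qed
  obtain p where p: "g1 = {z,p}" "p \<noteq> z" "z \<in> A0 \<Longrightarrow> p \<in> B \<union> B0" "z \<in> B0 \<Longrightarrow> p \<in> A \<union> A0"
    using other[OF g(2) zg(1)] by blast
  obtain q where q: "g2 = {z,q}" "q \<noteq> z" "z \<in> A0 \<Longrightarrow> q \<in> B \<union> B0" "z \<in> B0 \<Longrightarrow> q \<in> A \<union> A0"
    using other[OF g(3) zg(2)] by blast
  have pq: "p \<noteq> q" using g(4) p(1) q(1) by auto
  have dp: "dg R p = 1"
  proof -
    have p12: "p \<in> g1" "p \<notin> g2" using p(1,2) q(1) pq by auto
    have "f = g1" if "f \<in> R" "p \<in> f" for f
      using lone[OF that(1)] that(2) p12 by auto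
    then have "{f \<in> R. p \<in> f} \<subseteq> {g1}" by blast
    moreover have "{g1} \<subseteq> {f \<in> R. p \<in> f}" using g(2) p12(1) by simp
    ultimately have "{f \<in> R. p \<in> f} = {g1}" by (rule subset_antisym)
    then show ?thesis unfolding dg_def by simp
  qed
  have dq: "dg R q = 1"
  proof -
    have q12: "q \<in> g2" "q \<notin> g1" using p(1) q(1,2) pq by auto
    have "f = g2" if "f \<in> R" "q \<in> f" for f
      using lone[OF that(1)] that(2) q12 by auto
    then have "{f \<in> R. q \<in> f} \<subseteq> {g2}" by blast
    moreover have "{g2} \<subseteq> {f \<in> R. q \<in> f}" using g(3) q12(1) by simp
    ultimately have "{f \<in> R. q \<in> f} = {g2}" by (rule subset_antisym)
    then show ?thesis unfolding dg_def by simp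
  qed
  have un: "g1 \<union> g2 = {z,p,q}" using p(1) q(1) by auto
  have P: "(p \<notin> V0 \<and> pendant_end p = []) \<or> (p \<in> V0 \<and> (\<exists>a. N p = {a} \<and> pendant_end p = [a]))"
    using pendant_end[OF dp] by blast
  have Q: "(q \<notin> V0 \<and> pendant_end q = []) \<or> (q \<in> V0 \<and> (\<exists>a. N q = {a} \<and> pendant_end q = [a]))"
    using pendant_end[OF dq] by blast
  have dist: "N v \<inter> {z,p,q} = {}" if "v \<in> V0" for v
    using NR[OF that] g(2,3) un by blast
  have Npq: "N p \<inter> N q = {}" if "p \<in> V0" "q \<in> V0" by (rule NN[OF that pq])
  let ?l = "pendant_end p @ [p,z,q] @ pendant_end q"
  have setl: "set ?l = {z,p,q} \<union> (\<Union>v\<in>{p,q} \<inter> V0. N v)"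
    using P Q by (elim disjE conjE exE) auto
  show ?thesis
  proof (intro exI[of _ ?l] conjI)
    from P Q show "distinct ?l" using dist[of p] dist[of q] Npq p(2) q(2) pq
      by (elim disjE conjE exE) auto
    show "?l \<noteq> []" by simp
    show "set ?l = with_pendants (g1 \<union> g2)" unfolding setl with_pendants_def un using g(1) Nz by auto
    have "(g1 \<union> g2) \<inter> V0 = ({z} \<inter> V0) \<union> (({p} \<inter> V0) \<union> ({q} \<inter> V0))" unfolding un by blast
    moreover have "pendant_edges ({z} \<inter> V0) N = {}" unfolding pendant_edges_def using Nz by simp
    ultimately have "pendant_edges ((g1 \<union> g2) \<inter> V0) N =
        pendant_edges ({p} \<inter> V0) N \<union> pendant_edges ({q} \<inter> V0) N"
      by (simp only: pendant_edges_Un Un_empty_left)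
    moreover have "edges (path_of ?l) =
        pendant_edges ({p} \<inter> V0) N \<union> ({{p,z},{z,q}} \<union> pendant_edges ({q} \<inter> V0) N)"
      using path_pendant_end(1)[OF dp, of "[z,q] @ pendant_end q"] path_pendant_end(2)[OF dq, of "[]"] by simp
    moreover have "{{p,z},{z,q}} = {g1,g2}" unfolding p(1) q(1) by (simp add: insert_commute[of p z])
    ultimately show "edges (path_of ?l) = {f \<in> R. f \<subseteq> g1 \<union> g2} \<union> pendant_edges ((g1 \<union> g2) \<inter> V0) N"
      unfolding within by (simp only: Un_ac)
    show "set ?l \<inter> A = {} \<or> set ?l \<inter> B = {}"
    proof (cases "z \<in> A0")
      case True
      then have pq: "p \<in> B \<union> B0" "q \<in> B \<union> B0" using p(3) q(3) by blast+
      have "N v \<subseteq> B" if "v \<in> {p,q} \<inter> V0" for v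
      proof -
        have "v \<in> B0" using that pq disj by auto
        then show ?thesis by (rule NB)
      qed
      then have "(\<Union>v\<in>{p,q} \<inter> V0. N v) \<inter> A = {}" using disj(2) by (auto simp: disjoint_iff)
      moreover have "{z,p,q} \<inter> A = {}" using True pq disj by auto
      ultimately have "set ?l \<inter> A = {}" unfolding setl by (simp add: Int_Un_distrib2)
      then show ?thesis by blast
    next
      case False
      then have zB: "z \<in> B0" using g(1) by blast
      then have pq: "p \<in> A \<union> A0" "q \<in> A \<union> A0" using p(4) q(4) by blast+
      have "N v \<subseteq> A" if "v \<in> {p,q} \<inter> V0" for v
      proof -
        have "v \<in> A0" using that pq disj by auto
        then show ?thesis by (rule NA)
      qed
      then have "(\<Union>v\<in>{p,q} \<inter> V0. N v) \<inter> B = {}" using disj(2) by (auto simp: disjoint_iff)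
      moreover have "{z,p,q} \<inter> B = {}" using zB pq disj by auto
      ultimately have "set ?l \<inter> B = {}" unfolding setl by (simp add: Int_Un_distrib2)
      then show ?thesis by blast
    qed
  qed
qed

text \<open>An exceptional vertex off the piece is the midpoint of a path between its two pendant neighbours, which lie
  on its own side.\<close>

lemma single_list:
  assumes v: "v \<in> V0" "v \<notin> \<Union>R"
  shows "\<exists>l. distinct l \<and> l \<noteq> [] \<and> set l = with_pendants {v} \<and>
     edges (path_of l) = {f \<in> R. f \<subseteq> {v}} \<union> pendant_edges ({v} \<inter> V0) N \<and>
     (set l \<inter> A = {} \<or> set l \<inter> B = {})"
proof -
  have "{f \<in> R. v \<in> f} = {}" using v(2) by blast
  then have "dg R v = 0" unfolding dg_def by (simp only: card.empty)
  then have "card (N v) = 2" using cardN[OF v(1)] by simp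
  then obtain a b where ab: "N v = {a,b}" "a \<noteq> b" unfolding card_2_iff by blast
  have nv: "v \<noteq> a" "v \<noteq> b" using N_V0[OF v(1)] v(1) ab by auto
  have within: "{f \<in> R. f \<subseteq> {v}} = {}"
  proof -
    have "\<not> f \<subseteq> {v}" if "f \<in> R" for f
    proof
      assume "f \<subseteq> {v}"
      then have "card f \<le> 1" using card_mono[of "{v}" f] by simp
      then show False using bipart_edge_finite[OF bip that] by simp
    qed
    then show ?thesis by blast
  qed
  show ?thesis
  proof (intro exI[of _ "[a,v,b]"] conjI)
    show "edges (path_of [a,v,b]) = {f \<in> R. f \<subseteq> {v}} \<union> pendant_edges ({v} \<inter> V0) N"
      unfolding within pendant_edges_def using ab v(1) by (auto simp: insert_commute)
    show "set [a,v,b] \<inter> A = {} \<or> set [a,v,b] \<inter> B = {}"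
      using NA[of v] NB[of v] v(1) ab(1) disj by (cases "v \<in> A0") auto
  qed (use ab nv v in \<open>auto simp: with_pendants_def\<close>)
qed

text \<open>The components are indexed by what they contain of the piece: a matching edge, the star, or a single exceptional vertex.\<close>

lemma components:
  obtains M \<C> l where "M \<subseteq> \<C>" "card M \<in> {2, 4}" "\<And>C D. C \<in> \<C> \<Longrightarrow> D \<in> \<C> \<Longrightarrow> C \<noteq> D \<Longrightarrow> C \<inter> D = {}"
    "\<Union>\<C> = V0 \<union> \<Union>R" "\<And>e. e \<in> R \<Longrightarrow> \<exists>C\<in>\<C>. e \<subseteq> C"
    "\<And>C. C \<in> \<C> \<Longrightarrow> distinct (l C) \<and> l C \<noteq> [] \<and> set (l C) = with_pendants C \<and>
        edges (path_of (l C)) = {f \<in> R. f \<subseteq> C} \<union> pendant_edges (C \<inter> V0) N"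
    "\<And>C. C \<in> M \<Longrightarrow> hd (l C) \<in> A \<and> last (l C) \<in> B \<and>
        set (l C) \<inter> A = {hd (l C)} \<and> set (l C) \<inter> B = {last (l C)}"
    "\<And>C. C \<in> \<C> \<Longrightarrow> C \<notin> M \<Longrightarrow> set (l C) \<inter> A = {} \<or> set (l C) \<inter> B = {}"
proof -
  obtain M S where MS: "R = M \<union> S" "matching M" "card M \<in> {2, 4}" "finite M"
    "S = {} \<or> star_edges M V0 S" using pieceR by (rule piece_shape)
  have MS_disj: "e \<inter> f = {}" if "e \<in> M" "f \<in> S" for e f
    using MS(5) that unfolding star_edges_def by blast
  define \<S> where "\<S> = (if S = {} then {} else {\<Union>S})"
  define \<V> where "\<V> = (\<lambda>v. {v}) ` (V0 - \<Union>R)"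
  let ?\<C> = "M \<union> \<S> \<union> \<V>"
  have SU: "\<Union>\<S> = \<Union>S" unfolding \<S>_def by auto
  have ne: "e \<noteq> {}" if "e \<in> R" for e using bipart_edge_finite[OF bip that] by auto
  have MSd: "C \<inter> D = {}" if "C \<in> M" "D \<in> \<S>" for C D
    using MS_disj that unfolding \<S>_def by (auto split: if_splits)
  have MV: "C \<inter> D = {}" if "C \<in> M \<union> \<S>" "D \<in> \<V>" for C D
    using that MS(1) unfolding \<V>_def \<S>_def by (auto split: if_splits)
  have pd: "C \<inter> D = {}" if CD: "C \<in> ?\<C>" "D \<in> ?\<C>" "C \<noteq> D" for C D
  proof -
    have MM: "C \<inter> D = {}" if "C \<in> M" "D \<in> M" using MS(2) that CD(3) unfolding matching_def by blast
    have SS: False if "C \<in> \<S>" "D \<in> \<S>" using that CD(3) unfolding \<S>_def by (simp split: if_splits)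
    have VV: "C \<inter> D = {}" if "C \<in> \<V>" "D \<in> \<V>" using that CD(3) unfolding \<V>_def by auto
    show ?thesis using MM SS VV MSd[of C D] MSd[of D C] MV[of C D] MV[of D C] CD(1,2)
      by (auto simp: Int_commute[of D C])
  qed
  have un: "\<Union>?\<C> = V0 \<union> \<Union>R" using SU MS(1) unfolding \<V>_def by auto
  have inC: "\<exists>C\<in>?\<C>. e \<subseteq> C" if "e \<in> R" for e
  proof (cases "e \<in> M")
    case False
    then have "e \<in> S" using that MS(1) by blast
    then show ?thesis unfolding \<S>_def by (intro bexI[of _ "\<Union>S"]) auto
  qed blast
  define Q where "Q C l \<longleftrightarrow> (distinct l \<and> l \<noteq> [] \<and> set l = with_pendants C \<and>
        edges (path_of l) = {f \<in> R. f \<subseteq> C} \<union> pendant_edges (C \<inter> V0) N) \<and>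
        (C \<in> M \<longrightarrow> hd l \<in> A \<and> last l \<in> B \<and> set l \<inter> A = {hd l} \<and> set l \<inter> B = {last l}) \<and>
        (C \<notin> M \<longrightarrow> set l \<inter> A = {} \<or> set l \<inter> B = {})" for C l
  have "\<exists>l. Q C l" if C: "C \<in> ?\<C>" for C
  proof -
    consider "C \<in> M" | "C \<in> \<S>" "C \<notin> M" | "C \<in> \<V>" "C \<notin> M" using C by blast
    then show ?thesis
    proof cases
      case 1
      have CR: "C \<in> R" using 1 MS(1) by blast
      have lone: "f = C" if "f \<in> R" "f \<inter> C \<noteq> {}" for f
      proof (cases "f \<in> M")
        case True
        then show ?thesis using MS(2) 1 that(2) unfolding matching_def by blast
      next
        case False
        then show ?thesis using MS_disj[OF 1, of f] MS(1) that by blast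
      qed
      have "\<exists>l. distinct l \<and> l \<noteq> [] \<and> set l = with_pendants C \<and>
         edges (path_of l) = {f \<in> R. f \<subseteq> C} \<union> pendant_edges (C \<inter> V0) N \<and>
         hd l \<in> A \<and> last l \<in> B \<and> set l \<inter> A = {hd l} \<and> set l \<inter> B = {last l}"
        by (rule edge_list[OF CR lone])
      then show ?thesis unfolding Q_def using 1 by (elim exE) (rule exI, simp)
    next
      case 2
      then have "S \<noteq> {}" and CS: "C = \<Union>S" unfolding \<S>_def by (auto split: if_splits)
      then obtain z g1 g2 where g: "z \<in> V0" "S = {g1,g2}" "g1 \<noteq> g2" "g1 \<inter> g2 = {z}"
        "\<forall>e\<in>M. e \<inter> (g1 \<union> g2) = {}" using MS(5) unfolding star_edges_def by blast
      have C12: "C = g1 \<union> g2" using CS g(2) by simp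
      have gR: "g1 \<in> R" "g2 \<in> R" using g(2) MS(1) by auto
      have lone: "f = g1 \<or> f = g2" if "f \<in> R" "f \<inter> (g1 \<union> g2) \<noteq> {}" for f
        using that g(2,5) MS(1) by blast
      have "\<exists>l. distinct l \<and> l \<noteq> [] \<and> set l = with_pendants (g1 \<union> g2) \<and>
         edges (path_of l) = {f \<in> R. f \<subseteq> g1 \<union> g2} \<union> pendant_edges ((g1 \<union> g2) \<inter> V0) N \<and>
         (set l \<inter> A = {} \<or> set l \<inter> B = {})"
        by (rule star_list[OF g(1) gR g(3,4) lone])
      then show ?thesis unfolding C12[symmetric] Q_def using 2(2) by (elim exE) (rule exI, simp)
    next
      case 3
      then obtain v where v: "v \<in> V0" "v \<notin> \<Union>R" "C = {v}" unfolding \<V>_def by blast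
      from single_list[OF v(1,2)] show ?thesis
        unfolding v(3)[symmetric] Q_def using 3(2) by (elim exE) (rule exI, simp)
    qed
  qed
  then have "\<forall>C\<in>?\<C>. \<exists>l. Q C l" by blast
  then obtain l where l: "\<forall>C\<in>?\<C>. Q C (l C)" using bchoice by blast
  show thesis
  proof (rule that[of M ?\<C> l])
    show "M \<subseteq> ?\<C>" by blast
    show "card M \<in> {2,4}" by fact
    show "\<Union>?\<C> = V0 \<union> \<Union>R" by fact
    show "C \<inter> D = {}" if "C \<in> ?\<C>" "D \<in> ?\<C>" "C \<noteq> D" for C D by (rule pd[OF that])
    show "\<exists>C\<in>?\<C>. e \<subseteq> C" if "e \<in> R" for e by (rule inC[OF that])
    show "distinct (l C) \<and> l C \<noteq> [] \<and> set (l C) = with_pendants C \<and>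
        edges (path_of (l C)) = {f \<in> R. f \<subseteq> C} \<union> pendant_edges (C \<inter> V0) N" if "C \<in> ?\<C>" for C
      using bspec[OF l that] unfolding Q_def by (elim conjE) (intro conjI)
    show "hd (l C) \<in> A \<and> last (l C) \<in> B \<and>
        set (l C) \<inter> A = {hd (l C)} \<and> set (l C) \<inter> B = {last (l C)}" if CM: "C \<in> M" for C
      using bspec[OF l UnI1[OF UnI1[OF CM]]] CM unfolding Q_def by argo
    show "set (l C) \<inter> A = {} \<or> set (l C) \<inter> B = {}" if "C \<in> ?\<C>" "C \<notin> M" for C
      using bspec[OF l that(1)] that(2) unfolding Q_def by argo
  qed
qed

lemma simple_J: "simple_graph J"
  unfolding simple_graph_def completed_def graph.sel
proof (intro conjI ballI)
  have "finite (\<Union>R)" using piece_finite[OF pieceR] bipart_edge_finite[OF bip] by blast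
  then show "finite (V0 \<union> \<Union>R \<union> (\<Union>v\<in>V0. N v))" using fin0 finN by simp
  fix e assume "e \<in> R \<union> pendant_edges V0 N"
  then consider "e \<in> R" | v a where "v \<in> V0" "a \<in> N v" "e = {v,a}"
    unfolding pendant_edges_def by blast
  then show "\<exists>u v. u \<in> V0 \<union> \<Union>R \<union> (\<Union>v\<in>V0. N v) \<and> v \<in> V0 \<union> \<Union>R \<union> (\<Union>v\<in>V0. N v) \<and> u \<noteq> v \<and> e = {u, v}"
  proof cases
    case 1
    obtain x y where "e = {x,y}" "x \<noteq> y" by (rule bipart_edgeE[OF bip 1])
    then show ?thesis using 1 by (intro exI[of _ x] exI[of _ y]) auto
  next
    case (2 v a)
    have "a \<noteq> v" using 2 N_V0[OF 2(1)] by blast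
    then show ?thesis using 2 by (intro exI[of _ v] exI[of _ a]) auto
  qed
qed

lemma dg_pendant:
  shows "v \<in> V0 \<Longrightarrow> dg (pendant_edges V0 N) v = card (N v)"
    and "v \<notin> V0 \<Longrightarrow> dg (pendant_edges V0 N) v \<le> 1"
    and "v \<notin> V0 \<Longrightarrow> v \<notin> (\<Union>w\<in>V0. N w) \<Longrightarrow> dg (pendant_edges V0 N) v = 0"
proof -
  assume v: "v \<in> V0"
  have "{e \<in> pendant_edges V0 N. v \<in> e} = (\<lambda>a. {v,a}) ` N v"
    unfolding pendant_edges_def using v N_V0 by blast
  moreover have "inj_on (\<lambda>a. {v,a}) (N v)" by (auto simp: inj_on_def doubleton_eq_iff)
  ultimately show "dg (pendant_edges V0 N) v = card (N v)" unfolding dg_def by (simp add: card_image)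
next
  assume v: "v \<notin> V0"
  show "dg (pendant_edges V0 N) v \<le> 1"
  proof (cases "\<exists>w\<in>V0. v \<in> N w")
    case True
    then obtain w where w: "w \<in> V0" "v \<in> N w" by blast
    have "{e \<in> pendant_edges V0 N. v \<in> e} \<subseteq> {{w,v}}"
    proof
      fix e assume "e \<in> {e \<in> pendant_edges V0 N. v \<in> e}"
      then obtain u a where ua: "u \<in> V0" "a \<in> N u" "e = {u,a}" "v \<in> e"
        unfolding pendant_edges_def by blast
      then have va: "v = a" using v by blast
      then have "u = w" using NN[OF ua(1) w(1)] ua(2) w(2) by blast
      then show "e \<in> {{w,v}}" using ua va by simp
    qed
    then show ?thesis unfolding dg_def using card_mono[of "{{w,v}}"] by simp
  next
    case False
    then have "{e \<in> pendant_edges V0 N. v \<in> e} = {}" unfolding pendant_edges_def using v by auto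
    then show ?thesis unfolding dg_def by (simp only: card.empty)
  qed
next
  assume "v \<notin> V0" "v \<notin> (\<Union>w\<in>V0. N w)"
  then have "{e \<in> pendant_edges V0 N. v \<in> e} = {}" unfolding pendant_edges_def by auto
  then show "dg (pendant_edges V0 N) v = 0" unfolding dg_def by (simp only: card.empty)
qed

lemma finite_pendant: "finite (pendant_edges V0 N)"
proof -
  have "pendant_edges V0 N \<subseteq> (\<Union>v\<in>V0. (\<lambda>a. {v,a}) ` N v)" unfolding pendant_edges_def by blast
  then show ?thesis by (rule finite_subset) (use fin0 finN in auto)
qed

lemma R_pendant: "R \<inter> pendant_edges V0 N = {}"
proof -
  have "e \<notin> R" if ep: "e \<in> pendant_edges V0 N" for e
  proof
    assume eR: "e \<in> R"
    obtain v a where va: "v \<in> V0" "a \<in> N v" "e = {v,a}" using ep unfolding pendant_edges_def by blast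
    then have "a \<in> \<Union>R" using eR by blast
    then show False using NR[OF va(1)] va(2) by blast
  qed
  then show ?thesis by blast
qed

lemma deg_J: "deg J v = dg R v + dg (pendant_edges V0 N) v"
proof -
  have "edges J = R \<union> pendant_edges V0 N" unfolding completed_def by simp
  then show ?thesis unfolding deg_eq_dg[OF simple_J]
    using dg_Un_disjoint[OF piece_finite[OF pieceR] finite_pendant R_pendant] by simp
qed

text \<open>A path between \<open>A\<close> and \<open>B\<close> stays in one component and has the same ends as it, so it is the component.
  Thus the \<open>AB\<close>-paths are the components of the matching edges, two or four in number.\<close>

lemma completed_HES:
  assumes "4 \<le> sqrt \<epsilon>\<^sub>0 * real (card (A \<union> A0 \<union> B \<union> B0))"
  shows "hamilton_exceptional_system \<epsilon>\<^sub>0 A A0 B B0 J"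
proof -
  obtain M \<C> l where M: "M \<subseteq> \<C>" and cM: "card M \<in> {2, 4}"
    and pd: "\<And>C D. C \<in> \<C> \<Longrightarrow> D \<in> \<C> \<Longrightarrow> C \<noteq> D \<Longrightarrow> C \<inter> D = {}"
    and un: "\<Union>\<C> = V0 \<union> \<Union>R" and inC: "\<And>e. e \<in> R \<Longrightarrow> \<exists>C\<in>\<C>. e \<subseteq> C"
    and l: "\<And>C. C \<in> \<C> \<Longrightarrow> distinct (l C) \<and> l C \<noteq> [] \<and> set (l C) = with_pendants C \<and>
        edges (path_of (l C)) = {f \<in> R. f \<subseteq> C} \<union> pendant_edges (C \<inter> V0) N"
    and AB: "\<And>C. C \<in> M \<Longrightarrow> hd (l C) \<in> A \<and> last (l C) \<in> B \<and>
        set (l C) \<inter> A = {hd (l C)} \<and> set (l C) \<inter> B = {last (l C)}"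
    and noAB: "\<And>C. C \<in> \<C> \<Longrightarrow> C \<notin> M \<Longrightarrow> set (l C) \<inter> A = {} \<or> set (l C) \<inter> B = {}"
    by (rule components) blast
  have NC: "N v \<inter> C = {}" if "v \<in> V0" "C \<in> \<C>" for v C
    using N_V0[OF that(1)] NR[OF that(1)] un that(2) by blast
  have with_pendants_disj: "with_pendants C \<inter> with_pendants D = {}" if "C \<in> \<C>" "D \<in> \<C>" "C \<noteq> D" for C D
  proof -
    have 1: "C \<inter> D = {}" by (rule pd[OF that])
    have "N v \<inter> N w = {}" if "v \<in> C \<inter> V0" "w \<in> D \<inter> V0" for v w
      using NN[of v w] that 1 by blast
    then show ?thesis unfolding with_pendants_def using 1 NC[OF _ that(1)] NC[OF _ that(2)] by blast
  qed
  have verts_J: "verts J = (\<Union>C\<in>\<C>. with_pendants C)"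
  proof -
    have "(\<Union>C\<in>\<C>. with_pendants C) = \<Union>\<C> \<union> (\<Union>v\<in>\<Union>\<C> \<inter> V0. N v)" unfolding with_pendants_def by blast
    also have "\<Union>\<C> \<inter> V0 = V0" unfolding un by blast
    finally show ?thesis unfolding completed_def un by simp
  qed
  have edges_J: "edges J = (\<Union>C\<in>\<C>. edges (path_of (l C)))"
  proof -
    have "(\<Union>C\<in>\<C>. edges (path_of (l C))) = (\<Union>C\<in>\<C>. {f \<in> R. f \<subseteq> C} \<union> pendant_edges (C \<inter> V0) N)"
      using l by (intro SUP_cong) auto
    also have "\<dots> = (\<Union>C\<in>\<C>. {f \<in> R. f \<subseteq> C}) \<union> (\<Union>C\<in>\<C>. pendant_edges (C \<inter> V0) N)" by blast
    also have "(\<Union>C\<in>\<C>. {f \<in> R. f \<subseteq> C}) = R" using inC by blast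
    also have "(\<Union>C\<in>\<C>. pendant_edges (C \<inter> V0) N) = pendant_edges (\<Union>\<C> \<inter> V0) N"
      unfolding pendant_edges_def by blast
    also have "\<Union>\<C> \<inter> V0 = V0" unfolding un by blast
    finally show ?thesis unfolding completed_def by simp
  qed
  have comp_eq: "C = D" if "C \<in> \<C>" "D \<in> \<C>" "x \<in> with_pendants C" "x \<in> with_pendants D" for C D x
    using with_pendants_disj[OF that(1,2)] that(3,4) by blast
  have ps: "path_system J"
    unfolding path_system_def
  proof (intro conjI exI[of _ "(\<lambda>C. path_of (l C)) ` \<C>"] ballI impI)
    show "simple_graph J" by (rule simple_J)
    show "is_path P" if "P \<in> (\<lambda>C. path_of (l C)) ` \<C>" for P
      using that l unfolding is_path_def by blast
    show "verts P \<inter> verts Q = {}" if PQ: "P \<in> (\<lambda>C. path_of (l C)) ` \<C>"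
      "Q \<in> (\<lambda>C. path_of (l C)) ` \<C>" "P \<noteq> Q" for P Q
    proof -
      obtain C D where CD: "C \<in> \<C>" "D \<in> \<C>" "P = path_of (l C)" "Q = path_of (l D)" using PQ by blast
      then have "C \<noteq> D" using PQ(3) by blast
      then show ?thesis using with_pendants_disj[OF CD(1,2)] l CD by simp
    qed
    show "verts J = (\<Union>P\<in>(\<lambda>C. path_of (l C)) ` \<C>. verts P)" using verts_J l by simp
    show "edges J = (\<Union>P\<in>(\<lambda>C. path_of (l C)) ` \<C>. edges P)" using edges_J by simp
  qed
  have AV: "v \<notin> V0" if "v \<in> A \<union> B" for v using that disj by blast
  have cover: "exceptional_cover A A0 B B0 J"
    unfolding exceptional_cover_def
  proof (intro conjI ballI)
    show "path_system J" by (rule ps)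
    show "V0 \<subseteq> verts J" unfolding completed_def by auto
    have "e \<subseteq> A \<union> A0 \<union> B \<union> B0" if "e \<in> R" for e
      by (rule bipart_edgeE[OF bip that]) auto
    then have "\<Union>R \<subseteq> A \<union> A0 \<union> B \<union> B0" by blast
    moreover have "(\<Union>v\<in>V0. N v) \<subseteq> A \<union> B" using NA NB by fastforce
    ultimately show "verts J \<subseteq> A \<union> A0 \<union> B \<union> B0" unfolding completed_def by auto
    show "deg J v = 2" if "v \<in> V0" for v
      using cardN[OF that] dg_pendant(1)[OF that] unfolding deg_J by simp
    show "deg J v \<le> 1" if "v \<in> verts J - V0" for v
    proof -
      have v: "v \<notin> V0" using that by blast
      show ?thesis
      proof (cases "v \<in> (\<Union>w\<in>V0. N w)")
        case True
        then obtain w where "w \<in> V0" "v \<in> N w" by blast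
        then have "v \<notin> \<Union>R" using NR[of w] by blast
        then have "{f \<in> R. v \<in> f} = {}" by blast
        then have "dg R v = 0" unfolding dg_def by (simp only: card.empty)
        then show ?thesis using dg_pendant(2)[OF v] unfolding deg_J by simp
      next
        case False
        then show ?thesis using dg_pendant(3)[OF v False] piece_dg(2)[OF pieceR v] unfolding deg_J by simp
      qed
    qed
    have noin: "\<not> e \<subseteq> X" if "e \<in> edges J" "X = A \<or> X = B" for e X
    proof -
      have "e \<in> R \<or> e \<in> pendant_edges V0 N" using that(1) unfolding completed_def by simp
      then consider "e \<in> R" | v a where "v \<in> V0" "e = {v,a}"
        unfolding pendant_edges_def by blast
      then show ?thesis
      proof cases
        case 1
        obtain x y where "e = {x,y}" "x \<in> A \<union> A0" "y \<in> B \<union> B0"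
          by (rule bipart_edgeE[OF bip 1])
        then show ?thesis using that(2) disj by auto
      next
        case (2 v a)
        then show ?thesis using AV[of v] that(2) by auto
      qed
    qed
    have "{e \<in> edges J. e \<subseteq> A} = {}" "{e \<in> edges J. e \<subseteq> B} = {}" using noin by blast+
    then show "e_within J A = 0" "e_within J B = 0" unfolding e_within_def by (simp_all only: card.empty)
  qed
  have paths: "paths_between J A B = (\<lambda>C. path_of (l C)) ` M"
  proof
    show "(\<lambda>C. path_of (l C)) ` M \<subseteq> paths_between J A B"
    proof
      fix P assume "P \<in> (\<lambda>C. path_of (l C)) ` M"
      then obtain C where C: "C \<in> M" "P = path_of (l C)" by blast
      have CC: "C \<in> \<C>" using C M by blast
      have "subgraph P J" unfolding subgraph_def C(2)
        using l[OF CC] CC verts_J edges_J by (auto simp: simple_graph_path)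
      then show "P \<in> paths_between J A B" unfolding paths_between_def
        using l[OF CC] AB[OF C(1)] C(2) by blast
    qed
    show "paths_between J A B \<subseteq> (\<lambda>C. path_of (l C)) ` M"
    proof
      fix P assume "P \<in> paths_between J A B"
      then obtain xs where xs: "P = path_of xs" "xs \<noteq> []" "distinct xs" "hd xs \<in> A" "last xs \<in> B"
        "subgraph (path_of xs) J" unfolding paths_between_def by blast
      have vxs: "set xs \<subseteq> verts J" and exs: "edges (path_of xs) \<subseteq> edges J"
        using xs(6) unfolding subgraph_def by auto
      obtain C where C: "C \<in> \<C>" "hd xs \<in> with_pendants C" using vxs xs(2) verts_J hd_in_set[OF xs(2)] by blast
      have same: "e \<subseteq> with_pendants C \<and> e \<in> edges (path_of (l C))" if ex: "e \<in> edges J" "x \<in> e" "x \<in> with_pendants C" for e x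
      proof -
        have "e \<in> (\<Union>C\<in>\<C>. edges (path_of (l C)))" using ex(1) edges_J by simp
        then obtain D where D: "D \<in> \<C>" "e \<in> edges (path_of (l D))" by blast
        have eD: "e \<subseteq> with_pendants D" using edges_path_subset[OF D(2)] l[OF D(1)] by simp
        then have "D = C" using comp_eq[OF D(1) C(1), of x] ex by blast
        then show ?thesis using D(2) eD by simp
      qed
      have step: "{xs ! k, xs ! Suc k} \<in> edges J" if "Suc k < length xs" for k
        using exs that unfolding path_of_def by auto
      have inside: "k < length xs \<Longrightarrow> xs ! k \<in> with_pendants C" for k
      proof (induction k)
        case 0
        then show ?case using C(2) xs(2) by (simp add: hd_conv_nth)
      next
        case (Suc k)
        then show ?case using same[OF step[of k], of "xs ! k"] by simp
      qed
      have setxs: "set xs \<subseteq> with_pendants C" using inside by (auto simp: in_set_conv_nth)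
      have edgexs: "edges (path_of xs) \<subseteq> edges (path_of (l C))"
      proof
        fix e assume e: "e \<in> edges (path_of xs)"
        then obtain k where k: "e = {xs ! k, xs ! Suc k}" "Suc k < length xs"
          unfolding path_of_def by auto
        show "e \<in> edges (path_of (l C))"
          using same[OF step[OF k(2)], of "xs ! k"] inside[of k] k by simp
      qed
      have lC: "set (l C) = with_pendants C" "distinct (l C)" "l C \<noteq> []" using l[OF C(1)] by auto
      have h: "hd xs \<in> set (l C) \<inter> A" using C(2) lC(1) xs(4) by blast
      have la: "last xs \<in> set (l C) \<inter> B" using setxs lC(1) xs(5) last_in_set[OF xs(2)] by blast
      have CM: "C \<in> M" using noAB[OF C(1)] h la by blast
      have "hd xs = hd (l C)" "last xs = last (l C)" using AB[OF CM] h la by auto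
      then have "xs = l C"
        using path_determined_by_ends[OF xs(3,2) lC(2,3) _ _ edgexs] by blast
      then show "P \<in> (\<lambda>C. path_of (l C)) ` M" using xs(1) CM by blast
    qed
  qed
  have "inj_on (\<lambda>C. path_of (l C)) M"
  proof (rule inj_onI)
    fix C D assume CD: "C \<in> M" "D \<in> M" "path_of (l C) = path_of (l D)"
    have C: "C \<in> \<C>" "D \<in> \<C>" using CD M by auto
    have s: "set (l C) = set (l D)" using arg_cong[OF CD(3), of verts] by simp
    have lC: "l C \<noteq> []" "set (l C) = with_pendants C" "set (l D) = with_pendants D" using l[OF C(1)] l[OF C(2)] by blast+
    have h: "hd (l C) \<in> set (l C)" using lC(1) by (rule hd_in_set)
    show "C = D"
    proof (rule comp_eq[OF C])
      show "hd (l C) \<in> with_pendants C" using h unfolding lC(2) .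
      show "hd (l C) \<in> with_pendants D" using h unfolding s lC(3) .
    qed
  qed
  then have "card (paths_between J A B) = card M" unfolding paths by (rule card_image)
  then show ?thesis unfolding hamilton_exceptional_system_def using cover cM assms by auto
qed

end

section \<open>Equitable splitting\<close>

text \<open>Deal out the elements in rounds, one to each class; only the last round is incomplete.\<close>

lemma equitable_split:
  assumes "finite S" "finite Z" "Z \<noteq> {}"
  shows "\<exists>g. (\<forall>e\<in>S. g e \<in> Z) \<and>
    (\<forall>z\<in>Z. \<bar>real (card {e \<in> S. g e = z}) - real (card S) / real (card Z)\<bar> \<le> 1)"
  using assms(1)
proof (induction "card S" arbitrary: S rule: less_induct)
  case less
  have Zpos: "0 < card Z" using assms(2,3) by (simp add: card_gt_0_iff)
  show ?case
  proof (cases "card S < card Z")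
    case True
    obtain g where g: "inj_on g S" "g ` S \<subseteq> Z"
      using card_le_inj[OF less.prems assms(2)] True by auto
    have "\<bar>real (card {e \<in> S. g e = z}) - real (card S) / real (card Z)\<bar> \<le> 1" if "z \<in> Z" for z
    proof -
      have "\<forall>e\<in>{e \<in> S. g e = z}. \<forall>f\<in>{e \<in> S. g e = z}. e = f"
        using g(1) by (auto dest: inj_onD)
      then have "card {e \<in> S. g e = z} \<le> 1" using less.prems by (simp add: card_le_Suc0_iff_eq)
      then have "real (card {e \<in> S. g e = z}) \<le> 1" by linarith
      moreover have "0 \<le> real (card S) / real (card Z)" "real (card S) / real (card Z) \<le> 1"
        using True Zpos by (auto simp: divide_le_eq)
      ultimately show ?thesis by linarith
    qed
    then show ?thesis using g(2) by (intro exI[of _ g] conjI ballI) auto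
  next
    case False
    then obtain T where T: "T \<subseteq> S" "card T = card Z" "finite T"
      using obtain_subset_with_card_n[of "card Z" S] by auto
    obtain h where h: "bij_betw h T Z" using finite_same_card_bij[OF T(3) assms(2) T(2)] by blast
    have cST: "card (S - T) = card S - card Z" using T by (simp add: card_Diff_subset)
    have "card (S - T) < card S" using cST Zpos False by simp
    then obtain g where g: "\<forall>e\<in>S - T. g e \<in> Z"
      "\<forall>z\<in>Z. \<bar>real (card {e \<in> S - T. g e = z}) - real (card (S - T)) / real (card Z)\<bar> \<le> 1"
      using less.hyps[of "S - T"] less.prems by auto
    let ?g = "\<lambda>e. if e \<in> T then h e else g e"
    have hZ: "h e \<in> Z" if "e \<in> T" for e using h that by (auto simp: bij_betw_def)
    have "\<bar>real (card {e \<in> S. ?g e = z}) - real (card S) / real (card Z)\<bar> \<le> 1" if z: "z \<in> Z" for z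
    proof -
      obtain t where t: "t \<in> T" "h t = z" using h z by (auto simp: bij_betw_def)
      have "{e \<in> S. ?g e = z} = insert t {e \<in> S - T. g e = z}"
      proof (intro equalityI subsetI)
        fix e assume e: "e \<in> {e \<in> S. ?g e = z}"
        show "e \<in> insert t {e \<in> S - T. g e = z}"
        proof (cases "e \<in> T")
          case True
          then have "h e = h t" using e t by simp
          then have "e = t" using h True t(1) by (auto simp: bij_betw_def dest: inj_onD)
          then show ?thesis by simp
        next
          case False
          then show ?thesis using e by simp
        qed
      next
        fix e assume "e \<in> insert t {e \<in> S - T. g e = z}"
        then show "e \<in> {e \<in> S. ?g e = z}" using t T(1) by auto
      qed
      then have "card {e \<in> S. ?g e = z} = Suc (card {e \<in> S - T. g e = z})"
        using t(1) less.prems by simp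
      moreover have "real (card (S - T)) / real (card Z) = real (card S) / real (card Z) - 1"
        using cST False Zpos by (simp add: of_nat_diff diff_divide_distrib)
      ultimately show ?thesis using bspec[OF g(2) z] by simp
    qed
    moreover have "\<forall>e\<in>S. ?g e \<in> Z" using g(1) hZ by auto
    ultimately show ?thesis by (intro exI[of _ ?g] conjI ballI) simp_all
  qed
qed

lemma keyed_split:
  assumes "finite S" "finite Z" "Z \<noteq> {}"
  shows "\<exists>g. (\<forall>e\<in>S. g e \<in> Z) \<and>
    (\<forall>k. \<forall>z\<in>Z. \<bar>real (card {e \<in> S. key e = k \<and> g e = z}) -
        real (card {e \<in> S. key e = k}) / real (card Z)\<bar> \<le> 1)"
proof -
  define Q where "Q k g \<longleftrightarrow> (\<forall>e\<in>{e \<in> S. key e = k}. g e \<in> Z) \<and>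
    (\<forall>z\<in>Z. \<bar>real (card {e \<in> {e \<in> S. key e = k}. g e = z}) -
       real (card {e \<in> S. key e = k}) / real (card Z)\<bar> \<le> 1)" for k g
  have "\<forall>k. \<exists>g. Q k g"
    unfolding Q_def by (intro allI equitable_split) (use assms in simp_all)
  from choice[OF this] obtain h where "\<forall>k. Q k (h k)" by blast
  then have h: "\<And>k e. e \<in> {e \<in> S. key e = k} \<Longrightarrow> h k e \<in> Z"
    "\<And>k z. z \<in> Z \<Longrightarrow> \<bar>real (card {e \<in> {e \<in> S. key e = k}. h k e = z}) -
       real (card {e \<in> S. key e = k}) / real (card Z)\<bar> \<le> 1" unfolding Q_def by blast+
  let ?g = "\<lambda>e. h (key e) e"
  have "\<bar>real (card {e \<in> S. key e = k \<and> ?g e = z}) -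
        real (card {e \<in> S. key e = k}) / real (card Z)\<bar> \<le> 1" if "z \<in> Z" for k z
  proof -
    have "{e \<in> S. key e = k \<and> ?g e = z} = {e \<in> {e \<in> S. key e = k}. h k e = z}" by auto
    then show ?thesis using h(2)[OF that, of k] by simp
  qed
  then show ?thesis using h(1) by (intro exI[of _ ?g]) auto
qed

lemma card_fibres:
  assumes "finite S" "finite T" "\<And>s. s \<in> S \<Longrightarrow> f s \<in> T"
  shows "card S = (\<Sum>t\<in>T. card {s \<in> S. f s = t})"
  using sum.group[OF assms(1,2), of f "\<lambda>_. 1::nat"] assms(3) by (simp add: image_subset_iff)

text \<open>The deviations of the fibres add up, each being at most one.\<close>

lemma fibre_sum_close:
  fixes P :: "'e \<Rightarrow> bool"
  assumes "finite H" "finite T" "\<And>e. e \<in> H \<Longrightarrow> Q e \<Longrightarrow> p e \<in> T"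
    and close: "\<And>t. t \<in> T \<Longrightarrow> \<bar>real (card {e \<in> H. Q e \<and> p e = t \<and> P e}) - real (card {e \<in> H. Q e \<and> p e = t}) / k\<bar> \<le> 1"
  shows "\<bar>real (card {e \<in> H. Q e \<and> P e}) - real (card {e \<in> H. Q e}) / k\<bar> \<le> real (card T)"
proof -
  have 1: "card {e \<in> H. Q e \<and> P e} = (\<Sum>t\<in>T. card {e \<in> H. Q e \<and> p e = t \<and> P e})"
  proof -
    have "card {e \<in> H. Q e \<and> P e} = (\<Sum>t\<in>T. card {e \<in> {e \<in> H. Q e \<and> P e}. p e = t})"
      by (rule card_fibres) (use assms in auto)
    also have "\<dots> = (\<Sum>t\<in>T. card {e \<in> H. Q e \<and> p e = t \<and> P e})"
      by (intro sum.cong refl arg_cong[where f=card]) auto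
    finally show ?thesis .
  qed
  have 2: "card {e \<in> H. Q e} = (\<Sum>t\<in>T. card {e \<in> H. Q e \<and> p e = t})"
  proof -
    have "card {e \<in> H. Q e} = (\<Sum>t\<in>T. card {e \<in> {e \<in> H. Q e}. p e = t})"
      by (rule card_fibres) (use assms in auto)
    also have "\<dots> = (\<Sum>t\<in>T. card {e \<in> H. Q e \<and> p e = t})"
      by (intro sum.cong refl arg_cong[where f=card]) auto
    finally show ?thesis .
  qed
  have "real (card {e \<in> H. Q e \<and> P e}) - real (card {e \<in> H. Q e}) / k =
     (\<Sum>t\<in>T. real (card {e \<in> H. Q e \<and> p e = t \<and> P e}) - real (card {e \<in> H. Q e \<and> p e = t}) / k)"
    unfolding 1 2 by (simp add: sum_subtractf sum_divide_distrib)
  also have "\<bar>\<dots>\<bar> \<le> (\<Sum>t\<in>T. \<bar>real (card {e \<in> H. Q e \<and> p e = t \<and> P e}) - real (card {e \<in> H. Q e \<and> p e = t}) / k\<bar>)"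
    by (rule sum_abs)
  also have "\<dots> \<le> (\<Sum>t\<in>T. 1)" by (rule sum_mono) (rule close)
  finally show ?thesis by simp
qed

text \<open>Here \<open>pa e\<close> and \<open>pb e\<close> are the ends of \<open>e\<close> on the two sides and \<open>ia e\<close>, \<open>ib e\<close> the indices of their
  clusters, with \<open>0\<close> for exceptional ends. An index that is \<open>0\<close> leaves a coordinate of the cell free. It is
  chosen equitably, separately for each exceptional end and each cluster of the other end, so that the
  degrees of exceptional vertices are split equally too. Edges between two exceptional vertices are few at
  each vertex, so for them only the total number is balanced.\<close>

lemma cell_split:
  fixes H :: "'e set" and ia ib :: "'e \<Rightarrow> nat" and pa pb :: "'e \<Rightarrow> 'v" and \<rho> v :: real
  assumes finH: "finite H" and K: "0 < K"
    and ia: "\<And>e. e \<in> H \<Longrightarrow> ia e \<le> K" and ib: "\<And>e. e \<in> H \<Longrightarrow> ib e \<le> K"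
    and fin0: "finite A0" "finite B0" and v: "real (card A0) \<le> v" "real (card B0) \<le> v"
    and pa: "\<And>e. e \<in> H \<Longrightarrow> ia e = 0 \<longleftrightarrow> pa e \<in> A0" and pb: "\<And>e. e \<in> H \<Longrightarrow> ib e = 0 \<longleftrightarrow> pb e \<in> B0"
    and eAB: "\<And>i j. i \<in> {1..K} \<Longrightarrow> j \<in> {1..K} \<Longrightarrow>
       \<bar>real (card {e \<in> H. ia e = i \<and> ib e = j}) - real (card {e \<in> H. ia e \<noteq> 0 \<and> ib e \<noteq> 0}) / (real K)\<^sup>2\<bar> \<le> \<rho>"
    and e0B: "\<And>j. j \<in> {1..K} \<Longrightarrow>
       \<bar>real (card {e \<in> H. ia e = 0 \<and> ib e = j}) - real (card {e \<in> H. ia e = 0 \<and> ib e \<noteq> 0}) / real K\<bar> \<le> \<rho> * real K"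
    and eA0: "\<And>i. i \<in> {1..K} \<Longrightarrow>
       \<bar>real (card {e \<in> H. ib e = 0 \<and> ia e = i}) - real (card {e \<in> H. ib e = 0 \<and> ia e \<noteq> 0}) / real K\<bar> \<le> \<rho> * real K"
    and dA: "\<And>x j. x \<in> A0 \<Longrightarrow> j \<in> {1..K} \<Longrightarrow>
       \<bar>real (card {e \<in> H. pa e = x \<and> ib e = j}) - real (card {e \<in> H. pa e = x \<and> ib e \<noteq> 0}) / real K\<bar> \<le> \<rho> * real K"
    and dB: "\<And>y i. y \<in> B0 \<Longrightarrow> i \<in> {1..K} \<Longrightarrow>
       \<bar>real (card {e \<in> H. pb e = y \<and> ia e = i}) - real (card {e \<in> H. pb e = y \<and> ia e \<noteq> 0}) / real K\<bar> \<le> \<rho> * real K"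
    and d0A: "\<And>x. x \<in> A0 \<Longrightarrow> real (card {e \<in> H. pa e = x \<and> ib e = 0}) \<le> v"
    and d0B: "\<And>y. y \<in> B0 \<Longrightarrow> real (card {e \<in> H. pb e = y \<and> ia e = 0}) \<le> v"
  shows "\<exists>cellf. (\<forall>e\<in>H. cellf e \<in> {1..K} \<times> {1..K} \<and> ia e \<in> {0, fst (cellf e)} \<and> ib e \<in> {0, snd (cellf e)}) \<and>
    (\<forall>z\<in>{1..K} \<times> {1..K}. \<bar>real (card {e \<in> H. cellf e = z}) - real (card H) / (real K)\<^sup>2\<bar> \<le> 3 * \<rho> + 2 * v + 1) \<and>
    (\<forall>z\<in>{1..K} \<times> {1..K}. \<forall>x\<in>A0. \<bar>real (card {e \<in> H. cellf e = z \<and> pa e = x}) - real (card {e \<in> H. pa e = x}) / (real K)\<^sup>2\<bar> \<le> \<rho> + v + 1) \<and>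
    (\<forall>z\<in>{1..K} \<times> {1..K}. \<forall>y\<in>B0. \<bar>real (card {e \<in> H. cellf e = z \<and> pb e = y}) - real (card {e \<in> H. pb e = y}) / (real K)\<^sup>2\<bar> \<le> \<rho> + v + 1)"
proof -
  let ?Z = "{1..K}"
  have Z: "finite ?Z" "?Z \<noteq> {}" "card ?Z = K" using K by auto
  have ZZ: "finite (?Z \<times> ?Z)" "?Z \<times> ?Z \<noteq> {}" "real (card (?Z \<times> ?Z)) = (real K)\<^sup>2"
    using K by (auto simp: card_cartesian_product power2_eq_square)
  have K2: "0 < (real K)\<^sup>2" "1 \<le> (real K)\<^sup>2" "1 \<le> real K" using K by auto
  have vpos: "0 \<le> v" using v(1) by linarith
  obtain g1 where "(\<forall>e\<in>H. g1 e \<in> ?Z) \<and> (\<forall>k. \<forall>z\<in>?Z. \<bar>real (card {e \<in> H. (pa e, ib e) = k \<and> g1 e = z}) -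
        real (card {e \<in> H. (pa e, ib e) = k}) / real K\<bar> \<le> 1)"
    using keyed_split[OF finH Z(1,2), of "\<lambda>e. (pa e, ib e)", unfolded Z(3)] by (elim exE) (rule that)
  then have g1: "\<And>e. e \<in> H \<Longrightarrow> g1 e \<in> ?Z"
    "\<And>k z. z \<in> ?Z \<Longrightarrow> \<bar>real (card {e \<in> H. (pa e, ib e) = k \<and> g1 e = z}) -
        real (card {e \<in> H. (pa e, ib e) = k}) / real K\<bar> \<le> 1" by blast+
  obtain g2 where "(\<forall>e\<in>H. g2 e \<in> ?Z) \<and> (\<forall>k. \<forall>z\<in>?Z. \<bar>real (card {e \<in> H. (pb e, ia e) = k \<and> g2 e = z}) -
        real (card {e \<in> H. (pb e, ia e) = k}) / real K\<bar> \<le> 1)"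
    using keyed_split[OF finH Z(1,2), of "\<lambda>e. (pb e, ia e)", unfolded Z(3)] by (elim exE) (rule that)
  then have g2: "\<And>e. e \<in> H \<Longrightarrow> g2 e \<in> ?Z"
    "\<And>k z. z \<in> ?Z \<Longrightarrow> \<bar>real (card {e \<in> H. (pb e, ia e) = k \<and> g2 e = z}) -
        real (card {e \<in> H. (pb e, ia e) = k}) / real K\<bar> \<le> 1" by blast+
  obtain g3 where "(\<forall>e\<in>H. g3 e \<in> ?Z \<times> ?Z) \<and> (\<forall>k. \<forall>z\<in>?Z \<times> ?Z. \<bar>real (card {e \<in> H. (ia e = 0 \<and> ib e = 0) = k \<and> g3 e = z}) -
        real (card {e \<in> H. (ia e = 0 \<and> ib e = 0) = k}) / (real K)\<^sup>2\<bar> \<le> 1)"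
    using keyed_split[OF finH ZZ(1,2), of "\<lambda>e. ia e = 0 \<and> ib e = 0", unfolded ZZ(3)] by (elim exE) (rule that)
  then have g3: "\<And>e. e \<in> H \<Longrightarrow> g3 e \<in> ?Z \<times> ?Z"
    "\<And>k z. z \<in> ?Z \<times> ?Z \<Longrightarrow> \<bar>real (card {e \<in> H. (ia e = 0 \<and> ib e = 0) = k \<and> g3 e = z}) -
        real (card {e \<in> H. (ia e = 0 \<and> ib e = 0) = k}) / (real K)\<^sup>2\<bar> \<le> 1" by blast+
  \<comment> \<open>Coordinates prescribed by a cluster are kept; \<open>g1\<close>, \<open>g2\<close> and \<open>g3\<close> supply the free ones.\<close>
  define cellf where "cellf e = (if ia e \<noteq> 0 \<and> ib e \<noteq> 0 then (ia e, ib e)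
      else if ib e \<noteq> 0 then (g1 e, ib e) else if ia e \<noteq> 0 then (ia e, g2 e) else g3 e)" for e
  have 1: "cellf e \<in> ?Z \<times> ?Z \<and> ia e \<in> {0, fst (cellf e)} \<and> ib e \<in> {0, snd (cellf e)}" if "e \<in> H" for e
    using ia[OF that] ib[OF that] g1(1)[OF that] g2(1)[OF that] g3(1)[OF that] unfolding cellf_def by auto
  have 2: "\<bar>real (card {e \<in> H. cellf e = (i,j)}) - real (card H) / (real K)\<^sup>2\<bar> \<le> 3 * \<rho> + 2 * v + 1"
    if i: "i \<in> ?Z" and j: "j \<in> ?Z" for i j
  proof -
    have ij0: "i \<noteq> 0" "j \<noteq> 0" using i j by auto
    define S1 where "S1 = {e \<in> H. ia e = i \<and> ib e = j}"
    define S2 where "S2 = {e \<in> H. (ia e = 0 \<and> ib e = j) \<and> g1 e = i}"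
    define S3 where "S3 = {e \<in> H. (ib e = 0 \<and> ia e = i) \<and> g2 e = j}"
    define S4 where "S4 = {e \<in> H. (ia e = 0 \<and> ib e = 0) = True \<and> g3 e = (i,j)}"
    have "{e \<in> H. cellf e = (i,j)} = S1 \<union> (S2 \<union> (S3 \<union> S4))"
      unfolding S1_def S2_def S3_def S4_def cellf_def using ij0 by (auto split: if_splits)
    moreover have "card (S1 \<union> (S2 \<union> (S3 \<union> S4))) = card S1 + (card S2 + (card S3 + card S4))"
    proof -
      have f: "finite S1" "finite S2" "finite S3" "finite S4"
        unfolding S1_def S2_def S3_def S4_def using finH by auto
      have d: "S1 \<inter> (S2 \<union> (S3 \<union> S4)) = {}" "S2 \<inter> (S3 \<union> S4) = {}" "S3 \<inter> S4 = {}"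
        unfolding S1_def S2_def S3_def S4_def using ij0 by auto
      show ?thesis using f d by (simp add: card_Un_disjoint)
    qed
    ultimately have cc: "real (card {e \<in> H. cellf e = (i,j)}) =
        real (card S1) + real (card S2) + real (card S3) + real (card S4)" by simp
    have b1: "\<bar>real (card S1) - real (card {e \<in> H. ia e \<noteq> 0 \<and> ib e \<noteq> 0}) / (real K)\<^sup>2\<bar> \<le> \<rho>"
      unfolding S1_def by (rule eAB[OF i j])
    have close: "\<bar>s - u / (real K)\<^sup>2\<bar> \<le> \<rho> + v"
      if "\<bar>s - t / real K\<bar> \<le> v" "\<bar>t - u / real K\<bar> \<le> \<rho> * real K" for s t u :: real
    proof -
      have "\<bar>t - u / real K\<bar> / real K \<le> \<rho>" using that(2) K by (simp add: divide_le_eq)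
      moreover have "\<bar>t - u / real K\<bar> / real K = \<bar>t / real K - u / (real K)\<^sup>2\<bar>"
      proof -
        have "t / real K - u / (real K)\<^sup>2 = (t - u / real K) / real K"
          by (simp add: diff_divide_distrib power2_eq_square)
        then show ?thesis by (simp add: abs_divide)
      qed
      ultimately show ?thesis using that(1) by linarith
    qed
    have s2: "\<bar>real (card S2) - real (card {e \<in> H. ia e = 0 \<and> ib e = j}) / real K\<bar> \<le> real (card A0)"
      unfolding S2_def
    proof (rule fibre_sum_close[OF finH fin0(1), where p=pa])
      show "pa e \<in> A0" if "e \<in> H" "ia e = 0 \<and> ib e = j" for e using pa that by blast
      fix x assume x: "x \<in> A0"
      have "{e \<in> H. (ia e = 0 \<and> ib e = j) \<and> pa e = x \<and> g1 e = i} = {e \<in> H. (pa e, ib e) = (x,j) \<and> g1 e = i}"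
        "{e \<in> H. (ia e = 0 \<and> ib e = j) \<and> pa e = x} = {e \<in> H. (pa e, ib e) = (x,j)}"
        using pa x by auto
      then show "\<bar>real (card {e \<in> H. (ia e = 0 \<and> ib e = j) \<and> pa e = x \<and> g1 e = i}) -
          real (card {e \<in> H. (ia e = 0 \<and> ib e = j) \<and> pa e = x}) / real K\<bar> \<le> 1"
        using g1(2)[OF i, of "(x,j)"] by simp
    qed
    have b2: "\<bar>real (card S2) - real (card {e \<in> H. ia e = 0 \<and> ib e \<noteq> 0}) / (real K)\<^sup>2\<bar> \<le> \<rho> + v"
      by (rule close[OF _ e0B[OF j]]) (use s2 v in linarith)
    have s3: "\<bar>real (card S3) - real (card {e \<in> H. ib e = 0 \<and> ia e = i}) / real K\<bar> \<le> real (card B0)"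
      unfolding S3_def
    proof (rule fibre_sum_close[OF finH fin0(2), where p=pb])
      show "pb e \<in> B0" if "e \<in> H" "ib e = 0 \<and> ia e = i" for e using pb that by blast
      fix x assume x: "x \<in> B0"
      have "{e \<in> H. (ib e = 0 \<and> ia e = i) \<and> pb e = x \<and> g2 e = j} = {e \<in> H. (pb e, ia e) = (x,i) \<and> g2 e = j}"
        "{e \<in> H. (ib e = 0 \<and> ia e = i) \<and> pb e = x} = {e \<in> H. (pb e, ia e) = (x,i)}"
        using pb x by auto
      then show "\<bar>real (card {e \<in> H. (ib e = 0 \<and> ia e = i) \<and> pb e = x \<and> g2 e = j}) -
          real (card {e \<in> H. (ib e = 0 \<and> ia e = i) \<and> pb e = x}) / real K\<bar> \<le> 1"
        using g2(2)[OF j, of "(x,i)"] by simp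
    qed
    have b3: "\<bar>real (card S3) - real (card {e \<in> H. ib e = 0 \<and> ia e \<noteq> 0}) / (real K)\<^sup>2\<bar> \<le> \<rho> + v"
      by (rule close[OF _ eA0[OF i]]) (use s3 v in linarith)
    have "(i,j) \<in> ?Z \<times> ?Z" using i j by simp
    from g3(2)[OF this, of True]
    have b4: "\<bar>real (card S4) - real (card {e \<in> H. (ia e = 0 \<and> ib e = 0) = True}) / (real K)\<^sup>2\<bar> \<le> 1"
      unfolding S4_def .
    let ?a = "real (card {e \<in> H. ia e \<noteq> 0 \<and> ib e \<noteq> 0})" let ?b = "real (card {e \<in> H. ia e = 0 \<and> ib e \<noteq> 0})"
    let ?c = "real (card {e \<in> H. ib e = 0 \<and> ia e \<noteq> 0})" let ?d = "real (card {e \<in> H. (ia e = 0 \<and> ib e = 0) = True})"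
    have "H = {e \<in> H. ia e \<noteq> 0 \<and> ib e \<noteq> 0} \<union> ({e \<in> H. ia e = 0 \<and> ib e \<noteq> 0} \<union>
       ({e \<in> H. ib e = 0 \<and> ia e \<noteq> 0} \<union> {e \<in> H. (ia e = 0 \<and> ib e = 0) = True}))" (is "H = ?P \<union> (?Q \<union> (?R \<union> ?S))")
      by auto
    then have "card H = card (?P \<union> (?Q \<union> (?R \<union> ?S)))" by (rule arg_cong)
    also have "\<dots> = card ?P + card (?Q \<union> (?R \<union> ?S))" by (rule card_Un_disjoint) (use finH in auto)
    also have "card (?Q \<union> (?R \<union> ?S)) = card ?Q + card (?R \<union> ?S)" by (rule card_Un_disjoint) (use finH in auto)
    also have "card (?R \<union> ?S) = card ?R + card ?S" by (rule card_Un_disjoint) (use finH in auto)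
    finally have "real (card H) / (real K)\<^sup>2 = ?a / (real K)\<^sup>2 + ?b / (real K)\<^sup>2 + ?c / (real K)\<^sup>2 + ?d / (real K)\<^sup>2"
      by (simp add: add_divide_distrib)
    then show ?thesis using b1 b2 b3 b4 unfolding cc by linarith
  qed
  have degree: "\<bar>s1 + s2 - (t1 + t2) / (real K)\<^sup>2\<bar> \<le> \<rho> + v + 1"
    if "\<bar>s1 - u / real K\<bar> \<le> 1" "\<bar>u - t1 / real K\<bar> \<le> \<rho> * real K" "0 \<le> s2" "s2 \<le> t2" "t2 \<le> v"
    for s1 s2 t1 t2 u :: real
  proof -
    have "\<bar>u - t1 / real K\<bar> / real K \<le> \<rho>" using that(2) K by (simp add: divide_le_eq)
    moreover have "\<bar>u - t1 / real K\<bar> / real K = \<bar>u / real K - t1 / (real K)\<^sup>2\<bar>"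
      proof -
        have "u / real K - t1 / (real K)\<^sup>2 = (u - t1 / real K) / real K"
          by (simp add: diff_divide_distrib power2_eq_square)
        then show ?thesis by (simp add: abs_divide)
      qed
    moreover have "0 \<le> t2 / (real K)\<^sup>2" using that by simp
    moreover have "t2 / (real K)\<^sup>2 \<le> t2"
    proof -
      have "t2 * 1 \<le> t2 * (real K)\<^sup>2" by (rule mult_left_mono) (use that K2 in auto)
      then show ?thesis using K2(1) by (simp add: divide_le_eq)
    qed
    moreover have "(t1 + t2) / (real K)\<^sup>2 = t1 / (real K)\<^sup>2 + t2 / (real K)\<^sup>2" by (rule add_divide_distrib)
    ultimately show ?thesis using that by linarith
  qed
  have split_card: "real (card {e \<in> H. P e}) = real (card {e \<in> H. P e \<and> Q e}) + real (card {e \<in> H. P e \<and> \<not> Q e})" for P Q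
  proof -
    have "card {e \<in> H. P e} = card ({e \<in> H. P e \<and> Q e} \<union> {e \<in> H. P e \<and> \<not> Q e})"
      by (rule arg_cong[where f=card]) auto
    also have "\<dots> = card {e \<in> H. P e \<and> Q e} + card {e \<in> H. P e \<and> \<not> Q e}"
      by (rule card_Un_disjoint) (use finH in auto)
    finally show ?thesis by simp
  qed
  have 3: "\<bar>real (card {e \<in> H. cellf e = (i,j) \<and> pa e = x}) - real (card {e \<in> H. pa e = x}) / (real K)\<^sup>2\<bar> \<le> \<rho> + v + 1"
    if i: "i \<in> ?Z" and j: "j \<in> ?Z" and x: "x \<in> A0" for i j x
  proof -
    have j0: "j \<noteq> 0" using j by auto
    have e1: "{e \<in> H. (cellf e = (i,j) \<and> pa e = x) \<and> ib e \<noteq> 0} = {e \<in> H. (pa e, ib e) = (x,j) \<and> g1 e = i}"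
    proof -
      have "ia e = 0" if "e \<in> H" "pa e = x" for e using pa[OF that(1)] that(2) x by blast
      then show ?thesis unfolding cellf_def using j0 by auto
    qed
    have le: "card {e \<in> H. (cellf e = (i,j) \<and> pa e = x) \<and> \<not> ib e \<noteq> 0} \<le> card {e \<in> H. pa e = x \<and> \<not> ib e \<noteq> 0}"
      by (rule card_mono) (use finH in auto)
    have eq: "{e \<in> H. (pa e, ib e) = (x,j)} = {e \<in> H. pa e = x \<and> ib e = j}" by auto
    show ?thesis
      unfolding split_card[of "\<lambda>e. cellf e = (i,j) \<and> pa e = x" "\<lambda>e. ib e \<noteq> 0"] split_card[of "\<lambda>e. pa e = x" "\<lambda>e. ib e \<noteq> 0"] e1
      by (rule degree[OF g1(2)[OF i, of "(x,j)", unfolded eq] dA[OF x j]]) (use le d0A[OF x] in auto)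
  qed
  have 4: "\<bar>real (card {e \<in> H. cellf e = (i,j) \<and> pb e = x}) - real (card {e \<in> H. pb e = x}) / (real K)\<^sup>2\<bar> \<le> \<rho> + v + 1"
    if i: "i \<in> ?Z" and j: "j \<in> ?Z" and x: "x \<in> B0" for i j x
  proof -
    have i0: "i \<noteq> 0" using i by auto
    have e1: "{e \<in> H. (cellf e = (i,j) \<and> pb e = x) \<and> ia e \<noteq> 0} = {e \<in> H. (pb e, ia e) = (x,i) \<and> g2 e = j}"
    proof -
      have "ib e = 0" if "e \<in> H" "pb e = x" for e using pb[OF that(1)] that(2) x by blast
      then show ?thesis unfolding cellf_def using i0 by auto
    qed
    have le: "card {e \<in> H. (cellf e = (i,j) \<and> pb e = x) \<and> \<not> ia e \<noteq> 0} \<le> card {e \<in> H. pb e = x \<and> \<not> ia e \<noteq> 0}"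
      by (rule card_mono) (use finH in auto)
    have eq: "{e \<in> H. (pb e, ia e) = (x,i)} = {e \<in> H. pb e = x \<and> ia e = i}" by auto
    show ?thesis
      unfolding split_card[of "\<lambda>e. cellf e = (i,j) \<and> pb e = x" "\<lambda>e. ia e \<noteq> 0"] split_card[of "\<lambda>e. pb e = x" "\<lambda>e. ia e \<noteq> 0"] e1
      by (rule degree[OF g2(2)[OF j, of "(x,i)", unfolded eq] dB[OF x i]]) (use le d0B[OF x] in auto)
  qed
  show ?thesis
  proof (intro exI[of _ cellf] conjI ballI)
    fix e assume "e \<in> H"
    then show "cellf e \<in> ?Z \<times> ?Z" "ia e \<in> {0, fst (cellf e)}" "ib e \<in> {0, snd (cellf e)}" using 1 by blast+
  next
    fix z assume z: "z \<in> ?Z \<times> ?Z"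
    obtain i j where ij: "z = (i,j)" "i \<in> ?Z" "j \<in> ?Z" using z by blast
    show "\<bar>real (card {e \<in> H. cellf e = z}) - real (card H) / (real K)\<^sup>2\<bar> \<le> 3 * \<rho> + 2 * v + 1"
      unfolding ij(1) by (rule 2[OF ij(2,3)])
    show "\<bar>real (card {e \<in> H. cellf e = z \<and> pa e = x}) - real (card {e \<in> H. pa e = x}) / (real K)\<^sup>2\<bar> \<le> \<rho> + v + 1" if "x \<in> A0" for x
      unfolding ij(1) by (rule 3[OF ij(2,3) that])
    show "\<bar>real (card {e \<in> H. cellf e = z \<and> pb e = x}) - real (card {e \<in> H. pb e = x}) / (real K)\<^sup>2\<bar> \<le> \<rho> + v + 1" if "x \<in> B0" for x
      unfolding ij(1) by (rule 4[OF ij(2,3) that])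
  qed
qed

section \<open>Critical bipartite graphs\<close>

lemma dg_star_other:
  assumes "bipart P Q E" "R \<subseteq> {e \<in> E. t \<in> e}" "x \<noteq> t"
  shows "dg R x \<le> 1"
proof -
  have "{e \<in> R. x \<in> e} \<subseteq> {{t, x}}"
    using bipart_edge_eq[OF assms(1), of _ t x] assms(2,3) by blast
  then show ?thesis unfolding dg_def using card_mono[of "{{t,x}}"] by simp
qed

lemma dg_UN_le:
  assumes "finite X" "\<And>t. t \<in> X \<Longrightarrow> finite (R t)"
  shows "dg (\<Union>t\<in>X. R t) x \<le> (\<Sum>t\<in>X. dg (R t) x)"
proof -
  have "{e \<in> (\<Union>t\<in>X. R t). x \<in> e} = (\<Union>t\<in>X. {e \<in> R t. x \<in> e})" by auto
  then show ?thesis unfolding dg_def using card_UN_le[OF assms(1), of "\<lambda>t. {e \<in> R t. x \<in> e}"] by simp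
qed

text \<open>The stars share few edges: at a vertex \<open>x\<close>, each star centred elsewhere contributes at most one edge.\<close>

lemma trimmed_stars:
  assumes b: "bipart P Q E" and X: "finite X" "\<And>t. t \<in> X \<Longrightarrow> k \<le> dg E t"
  shows "\<exists>R. (\<forall>t\<in>X. R t \<subseteq> {e \<in> E. t \<in> e}) \<and> (\<forall>t\<in>X. card (R t) = k) \<and>
    (\<forall>x. dg (\<Union>t\<in>X. R t) x + (if x \<in> X then 1 else 0) \<le> (if x \<in> X then k else 0) + card X)"
proof -
  have fin: "finite E" using b by (rule bipart_finite)
  have "\<exists>R. R \<subseteq> {e \<in> E. t \<in> e} \<and> card R = k" if "t \<in> X" for t
    using X(2)[OF that] unfolding dg_def by (meson obtain_subset_with_card_n)
  then have "\<forall>t\<in>X. \<exists>R. R \<subseteq> {e \<in> E. t \<in> e} \<and> card R = k" by blast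
  from bchoice[OF this] obtain R where R: "\<And>t. t \<in> X \<Longrightarrow> R t \<subseteq> {e \<in> E. t \<in> e}" "\<And>t. t \<in> X \<Longrightarrow> card (R t) = k"
    by blast
  have finR: "finite (R t)" if "t \<in> X" for t using finite_subset[OF R(1)[OF that]] fin by simp
  have "dg (\<Union>t\<in>X. R t) x + (if x \<in> X then 1 else 0) \<le> (if x \<in> X then k else 0) + card X" for x
  proof -
    have *: "dg (\<Union>t\<in>X. R t) x \<le> (\<Sum>t\<in>X. dg (R t) x)" by (rule dg_UN_le[OF X(1) finR])
    have o: "(\<Sum>t\<in>Y. dg (R t) x) \<le> card Y" if "Y \<subseteq> X" "x \<notin> Y" for Y
    proof -
      have "(\<Sum>t\<in>Y. dg (R t) x) \<le> (\<Sum>t\<in>Y. 1)"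
      proof (rule sum_mono)
        fix t assume t: "t \<in> Y"
        show "dg (R t) x \<le> 1"
          by (rule dg_star_other[OF b R(1)]) (use t that in auto)
      qed
      then show ?thesis by simp
    qed
    show ?thesis
    proof (cases "x \<in> X")
      case True
      have "(\<Sum>t\<in>X. dg (R t) x) = dg (R x) x + (\<Sum>t\<in>X - {x}. dg (R t) x)"
        using True X(1) by (simp add: sum.remove)
      moreover have "dg (R x) x \<le> k" using dg_le_card[OF finR[OF True], of x] R(2)[OF True] by simp
      moreover have "(\<Sum>t\<in>X - {x}. dg (R t) x) \<le> card (X - {x})" by (rule o) auto
      moreover have "card (X - {x}) + 1 = card X" using True X(1) by (metis Suc_eq_plus1 card_Suc_Diff1)
      ultimately show ?thesis using * True by simp
    next
      case False
      then show ?thesis using * o[of X] by simp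
    qed
  qed
  then show ?thesis using R by (intro exI[of _ R] conjI ballI allI) simp_all
qed

text \<open>Stars with slightly fewer than \<open>11 D/40\<close> edges at four heavy vertices would form a subgraph of
  admissible maximum degree with about \<open>44 D/40\<close> edges, which is more than criticality allows.\<close>

lemma critical_few_heavy:
  fixes D :: real
  assumes b: "bipart P Q E" and D: "400 \<le> D"
    and crit: "\<And>H. H \<subseteq> E \<Longrightarrow> (\<And>v. real (dg H v) \<le> 11 * D / 40) \<Longrightarrow> real (card H) \<le> 41 * D / 40"
  shows "card {v. 11 * D / 40 \<le> real (dg E v)} \<le> 3"
proof (rule ccontr)
  assume "\<not> ?thesis"
  then have "4 \<le> card {v. 11 * D / 40 \<le> real (dg E v)}" by simp
  then obtain u v w z where uv: "11 * D / 40 \<le> real (dg E u)" "11 * D / 40 \<le> real (dg E v)"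
    "11 * D / 40 \<le> real (dg E w)" "11 * D / 40 \<le> real (dg E z)" and dist: "distinct [u,v,w,z]"
    by (rule four_of_card) blast
  let ?X = "{u,v,w,z}"
  \<comment> \<open>At most four stars are united, so a vertex can gain degree up to \<open>4\<close> beyond its own star.\<close>
  define k where "k = nat \<lfloor>11 * D / 40\<rfloor> - 4"
  have k: "real k + 4 \<le> 11 * D / 40" "11 * D / 40 \<le> real k + 5"
    using D unfolding k_def by linarith+
  have cX: "card ?X = 4" using dist by simp
  have h: "k \<le> dg E t" if "t \<in> ?X" for t using that uv k by auto
  have finX: "finite ?X" by simp
  have "\<exists>R. (\<forall>t\<in>?X. R t \<subseteq> {e \<in> E. t \<in> e}) \<and> (\<forall>t\<in>?X. card (R t) = k) \<and>
    (\<forall>x. dg (\<Union>t\<in>?X. R t) x + (if x \<in> ?X then 1 else 0) \<le> (if x \<in> ?X then k else 0) + card ?X)"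
    by (rule trimmed_stars[OF b finX h])
  then obtain R where R': "\<forall>t\<in>?X. R t \<subseteq> {e \<in> E. t \<in> e}" "\<forall>t\<in>?X. card (R t) = k"
    "\<forall>x. dg (\<Union>t\<in>?X. R t) x + (if x \<in> ?X then 1 else 0) \<le> (if x \<in> ?X then k else 0) + card ?X"
    by (elim exE conjE) (rule that)
  note R = bspec[OF R'(1)] bspec[OF R'(2)] spec[OF R'(3)]
  let ?H = "\<Union>t\<in>?X. R t"
  have HE: "?H \<subseteq> E" using R(1) by blast
  have fin: "finite E" using b by (rule bipart_finite)
  have finH: "finite ?H" using finite_subset[OF HE fin] .
  have "real (dg ?H x) \<le> 11 * D / 40" for x
  proof -
    have "dg ?H x \<le> k + 4" using R(3)[of x] cX by (auto split: if_splits)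
    then show ?thesis using k by linarith
  qed
  then have up: "real (card ?H) \<le> 41 * D / 40" by (rule crit[OF HE])
  have low: "k \<le> dg ?H t" if t: "t \<in> ?X" for t
  proof -
    have "R t \<subseteq> {e \<in> ?H. t \<in> e}" using R(1)[OF t] t by blast
    then have "card (R t) \<le> card {e \<in> ?H. t \<in> e}" using finH by (intro card_mono) simp_all
    then show ?thesis using R(2)[OF t] unfolding dg_def by simp
  qed
  have "dg ?H u + dg ?H v + dg ?H w + dg ?H z \<le> card (edges_meeting ?H ?X) + 6"
    by (rule dg_sum4[OF bipart_subset[OF b HE] dist])
  moreover have "card (edges_meeting ?H ?X) \<le> card ?H" by (rule card_mono[OF finH edges_meeting_subset])
  ultimately have "4 * k \<le> card ?H + 6" using low[of u] low[of v] low[of w] low[of z] by simp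
  then have "4 * real k \<le> real (card ?H) + 6" by linarith
  then show False using up k D by linarith
qed

text \<open>Trimming the stars at the at most three heavy vertices to \<open>11 D/40\<close> edges leaves an admissible subgraph. It has
  at most \<open>41 D/40\<close> edges, and at most about \<open>D/2 - 11 D/40 = 9 D/40\<close> edges are lost at each of the three.\<close>

lemma critical_card_bound:
  fixes D :: real
  assumes b: "bipart P Q E" and D: "400 \<le> D" and max: "\<And>v. real (dg E v) \<le> D / 2"
    and crit: "\<And>H. H \<subseteq> E \<Longrightarrow> (\<And>v. real (dg H v) \<le> 11 * D / 40) \<Longrightarrow> real (card H) \<le> 41 * D / 40"
  shows "real (card E) \<le> 68 * D / 40 + 15"
proof -
  let ?W = "{v. 11 * D / 40 \<le> real (dg E v)}"
  have fin: "finite E" using b by (rule bipart_finite)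
  have cW: "card ?W \<le> 3" by (rule critical_few_heavy[OF b D crit])
  \<comment> \<open>At most four stars are united, so a vertex can gain degree up to \<open>4\<close> beyond its own star.\<close>
  define k where "k = nat \<lfloor>11 * D / 40\<rfloor> - 4"
  have k: "real k + 4 \<le> 11 * D / 40" "11 * D / 40 \<le> real k + 5" "0 < k"
    using D unfolding k_def by linarith+
  have "?W \<subseteq> {v. k \<le> dg E v}" using k by auto
  then have finW: "finite ?W" using finite_heavy[OF b k(3)] finite_subset by blast
  have h: "k \<le> dg E t" if "t \<in> ?W" for t using that k by auto
  have "\<exists>R. (\<forall>t\<in>?W. R t \<subseteq> {e \<in> E. t \<in> e}) \<and> (\<forall>t\<in>?W. card (R t) = k) \<and>
    (\<forall>x. dg (\<Union>t\<in>?W. R t) x + (if x \<in> ?W then 1 else 0) \<le> (if x \<in> ?W then k else 0) + card ?W)"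
    by (rule trimmed_stars[OF b finW h])
  then obtain R where R': "\<forall>t\<in>?W. R t \<subseteq> {e \<in> E. t \<in> e}" "\<forall>t\<in>?W. card (R t) = k"
    "\<forall>x. dg (\<Union>t\<in>?W. R t) x + (if x \<in> ?W then 1 else 0) \<le> (if x \<in> ?W then k else 0) + card ?W"
    by (elim exE conjE) (rule that)
  note R = bspec[OF R'(1)] bspec[OF R'(2)] spec[OF R'(3)]
  define S where "S = (\<Union>t\<in>?W. R t)"
  define O' where "O' = {e \<in> E. e \<inter> ?W = {}}"
  let ?H = "S \<union> O'"
  have HE: "?H \<subseteq> E" using R(1) unfolding S_def O'_def by blast
  have finH: "finite S" "finite O'" using finite_subset[OF HE fin] by auto
  have "real (dg ?H x) \<le> 11 * D / 40" for x
  proof (cases "x \<in> ?W")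
    case True
    then have "{e \<in> ?H. x \<in> e} = {e \<in> S. x \<in> e}" unfolding O'_def by blast
    then have "dg ?H x = dg S x" unfolding dg_def by simp
    moreover have "dg S x \<le> k + 3" using R(3)[of x] cW True unfolding S_def by simp
    ultimately show ?thesis using k by linarith
  next
    case False
    have "dg ?H x \<le> dg E x" by (rule dg_mono[OF fin HE])
    then show ?thesis using False by simp
  qed
  then have up: "real (card ?H) \<le> 41 * D / 40" by (rule crit[OF HE])
  have "E - ?H \<subseteq> (\<Union>t\<in>?W. {e \<in> E. t \<in> e} - R t)" unfolding S_def O'_def by blast
  then have "card (E - ?H) \<le> card (\<Union>t\<in>?W. {e \<in> E. t \<in> e} - R t)"
    using fin finW by (intro card_mono) auto
  also have "\<dots> \<le> (\<Sum>t\<in>?W. card ({e \<in> E. t \<in> e} - R t))" by (rule card_UN_le[OF finW])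
  finally have "real (card (E - ?H)) \<le> real (\<Sum>t\<in>?W. card ({e \<in> E. t \<in> e} - R t))"
    by (rule of_nat_mono)
  also have "\<dots> = (\<Sum>t\<in>?W. real (card ({e \<in> E. t \<in> e} - R t)))" by (rule of_nat_sum)
  also have "\<dots> \<le> (\<Sum>t\<in>?W. D / 2 - real k)"
  proof (rule sum_mono)
    fix t assume t: "t \<in> ?W"
    have "finite (R t)" using finite_subset[OF R(1)[OF t]] fin by simp
    then have "card ({e \<in> E. t \<in> e} - R t) = dg E t - k"
      using card_Diff_subset[OF \<open>finite (R t)\<close> R(1)[OF t]] R(2)[OF t] unfolding dg_def by simp
    then show "real (card ({e \<in> E. t \<in> e} - R t)) \<le> D / 2 - real k"
      using max[of t] h[OF t] by (simp add: of_nat_diff)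
  qed
  also have "\<dots> = real (card ?W) * (D / 2 - real k)" by simp
  also have "\<dots> \<le> 3 * (D / 2 - real k)" using cW k D by (intro mult_right_mono) auto
  finally have "real (card (E - ?H)) \<le> 3 * (D / 2 - real k)" .
  moreover have "card E = card ?H + card (E - ?H)"
    using card_Diff_subset[of ?H E] HE finH card_mono[OF fin HE] by simp
  then have "real (card E) = real (card ?H) + real (card (E - ?H))" by linarith
  moreover have "a + c \<le> 68 * D / 40 + 15"
    if "c \<le> 3 * (D / 2 - real k)" "a \<le> 41 * D / 40" for a c :: real
    using that k(2) by (simp add: field_simps)
  ultimately show ?thesis using up by metis
qed

section \<open>Decomposing the cross graph\<close>

lemma peels_dg:
  "peels F Rs L \<Longrightarrow> finite F \<Longrightarrow> dg F v = (\<Sum>k<length Rs. dg (Rs ! k) v) + dg L v"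
proof (induction Rs arbitrary: F)
  case (Cons R Rs)
  have R: "R \<subseteq> F" "peels (F - R) Rs L" using Cons.prems by auto
  have "dg F v = dg R v + dg (F - R) v"
    using dg_Diff[OF Cons.prems(2) R(1), of v] dg_mono[OF Cons.prems(2) R(1), of v] by simp
  also have "dg (F - R) v = (\<Sum>k<length Rs. dg (Rs ! k) v) + dg L v"
    by (rule Cons.IH[OF R(2)]) (use Cons.prems in simp)
  finally show ?case by (simp add: sum.lessThan_Suc_shift del: sum.lessThan_Suc)
qed simp

lemma peels_nth_disjoint:
  assumes "peels F Rs L" "i < length Rs" "j < length Rs" "i \<noteq> j"
  shows "Rs ! i \<inter> Rs ! j = {}"
proof (cases "i < j")
  case True
  then show ?thesis using peels_disjoint[OF assms(1)] assms(3) by blast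
next
  case False
  then have "j < i" using assms(4) by simp
  then have "Rs ! j \<inter> Rs ! i = {}" using peels_disjoint[OF assms(1)] assms(2) by blast
  then show ?thesis by (simp add: Int_commute)
qed

lemma peels_Union:
  assumes "peels F Rs L"
  shows "(\<Union>k<length Rs. Rs ! k) \<union> L = F"
proof -
  have "(!) Rs ` {..<length Rs} = set Rs" using nth_image[of "length Rs" Rs] by (simp add: lessThan_atLeast0)
  then have 1: "(\<Union>k<length Rs. Rs ! k) = \<Union>(set Rs)" by simp
  have 2: "\<Union>(set Rs) \<subseteq> F"
  proof (rule Union_least)
    fix R assume "R \<in> set Rs"
    then show "R \<subseteq> F" by (rule peels_subset[OF assms])
  qed
  show ?thesis unfolding peels_rest[OF assms] 1 using 2 by (simp add: Un_absorb1)
qed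

text \<open>The set \<open>F z k\<close> is the \<open>k\<close>-th piece of the cell \<open>z\<close>, and \<open>F (0, 0) k\<close> the \<open>k\<close>-th piece cut from the leftovers,
  \<open>(0, 0)\<close> being no cell. The difficulty is to keep the total leftover degree of every vertex at most \<open>K\<^sup>2 * T\<close>, as there
  are only so many pieces to come. For the vertices outside \<open>X\<close> it suffices that the leftover degree in a
  cell is at most \<open>\<theta> < T\<close>. A vertex of \<open>X\<close> may keep more in a cell, namely its excess over \<open>M - T\<close> if that exceeds \<open>\<theta>\<close>.
  The excess varies little between cells. So it is either at most \<open>T\<close> in all cells, or at least \<open>\<theta>\<close> in all of
  them. In the latter case the vertex has lost \<open>M - T\<close> edges in each cell, out of at most \<open>K\<^sup>2 * M\<close> in all.\<close>

lemma cross_decomposition: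
  fixes H :: "'a set set" and K M T \<eta> q p :: nat and cellf :: "'a set \<Rightarrow> nat \<times> nat"
  assumes b: "bipart P Q H" and K: "0 < K" and cH: "card H = 2 * K\<^sup>2 * M + 2 * q"
    and cellf: "\<And>e. e \<in> H \<Longrightarrow> cellf e \<in> {1..K} \<times> {1..K}"
    and ccell: "\<And>z. z \<in> {1..K} \<times> {1..K} \<Longrightarrow>
       \<bar>real (card {e \<in> H. cellf e = z}) - real (card H) / (real K)\<^sup>2\<bar> \<le> real \<eta>"
    and dcell: "\<And>z v. z \<in> {1..K} \<times> {1..K} \<Longrightarrow> v \<in> U \<Longrightarrow>
       \<bar>real (dg {e \<in> H. cellf e = z} v) - real (dg H v) / (real K)\<^sup>2\<bar> \<le> real \<eta>"
    and U: "\<And>v. v \<notin> U \<Longrightarrow> dg H v \<le> \<eta>"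
    and X: "finite X" "card X \<le> 2" "y \<notin> X" "X \<subseteq> U"
    and dX: "\<And>v. v \<in> X \<Longrightarrow> dg H v \<le> K\<^sup>2 * M" "\<And>v. v \<in> X \<Longrightarrow> K\<^sup>2 * (T + 2 + \<eta>) \<le> dg H v"
    and small: "\<And>v. v \<notin> X \<Longrightarrow> v \<noteq> y \<Longrightarrow> dg H v + K\<^sup>2 * (2 * T + \<eta>) \<le> K\<^sup>2 * M"
    and dy: "dg H y \<le> K\<^sup>2 * M + K\<^sup>2 * p"
      "dg H y + K\<^sup>2 * (2 * T + \<eta>) \<le> K\<^sup>2 * M \<or> K\<^sup>2 * (p + 2 * T + 6 * \<eta> + 2) \<le> q"
    and par: "10 \<le> \<eta>" "100 * \<eta> \<le> T" "4 * T + p \<le> M" "q + K\<^sup>2 * (2 * T) \<le> K\<^sup>2 * M"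
  shows "\<exists>F :: nat \<times> nat \<Rightarrow> nat \<Rightarrow> 'a set set.
    (\<forall>z\<in>{1..K} \<times> {1..K}. \<forall>k<M - T. piece U (F z k) \<and> F z k \<subseteq> {e \<in> H. cellf e = z}) \<and>
    (\<forall>z\<in>{1..K} \<times> {1..K}. \<forall>k<T. pair_matching (F z k) \<and> (\<forall>v\<in>X. dg (F z k) v = 1)) \<and>
    (\<forall>z\<in>{1..K} \<times> {1..K}. \<forall>k<M - T. \<forall>l<M - T. k \<noteq> l \<longrightarrow> F z k \<inter> F z l = {}) \<and>
    (\<forall>k<K\<^sup>2 * T. piece U (F (0,0) k) \<and> F (0,0) k \<subseteq> H) \<and>
    (\<forall>k<K\<^sup>2 * T. \<forall>l<K\<^sup>2 * T. k \<noteq> l \<longrightarrow> F (0,0) k \<inter> F (0,0) l = {}) \<and>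
    (\<forall>z\<in>{1..K} \<times> {1..K}. \<forall>k<M - T. \<forall>l<K\<^sup>2 * T. F z k \<inter> F (0,0) l = {}) \<and>
    (\<Union>z\<in>{1..K} \<times> {1..K}. \<Union>k<M - T. F z k) \<union> (\<Union>k<K\<^sup>2 * T. F (0,0) k) = H \<and>
    (\<forall>z\<in>{1..K} \<times> {1..K}. \<forall>v. dg {e \<in> H. cellf e = z} v \<le> (\<Sum>k<M - T. dg (F z k) v) + T + \<eta>) \<and>
    (\<forall>v. (\<Sum>k<K\<^sup>2 * T. dg (F (0,0) k) v) \<le> K\<^sup>2 * T)"
proof -
  let ?Z = "{1..K} \<times> {1..K}"
  define Hc where "Hc z = {e \<in> H. cellf e = z}" for z
  have finH: "finite H" using b by (rule bipart_finite)
  have HcH: "Hc z \<subseteq> H" for z unfolding Hc_def by blast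
  have bc: "bipart P Q (Hc z)" for z by (rule bipart_subset[OF b HcH])
  have finc: "finite (Hc z)" for z by (rule bipart_finite[OF bc])
  have K2: "0 < K\<^sup>2" using K by simp
  have rK: "(real K)\<^sup>2 = real (K\<^sup>2)" by simp
  have cardZ: "card ?Z = K\<^sup>2" by (simp add: card_cartesian_product power2_eq_square)
  have Hun: "H = (\<Union>z\<in>?Z. Hc z)" using cellf unfolding Hc_def by auto
  have Hdisj: "Hc z \<inter> Hc z' = {}" if "z \<noteq> z'" for z z' using that unfolding Hc_def by auto
  have sumdeg: "(\<Sum>z\<in>?Z. dg (Hc z) v) = dg H v" for v
    using dg_UN_disjoint[of ?Z Hc v] finc Hdisj Hun by simp
  have sumcard: "(\<Sum>z\<in>?Z. card (Hc z)) = card H"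
    using card_UN_disjoint[of ?Z Hc] finc Hdisj arg_cong[OF Hun, of card] by simp
  have up: "real (dg H v) \<le> real (K\<^sup>2 * a) \<Longrightarrow> dg (Hc z) v \<le> a + \<eta>" if "z \<in> ?Z" "v \<in> U" for z v a
  proof -
    assume "real (dg H v) \<le> real (K\<^sup>2 * a)"
    then have "real (dg H v) / real (K\<^sup>2) \<le> real a" using K2 by (simp add: divide_le_eq mult.commute)
    then show ?thesis using dcell[OF that] unfolding Hc_def[symmetric] rK by linarith
  qed
  have low: "K\<^sup>2 * a \<le> dg H v \<Longrightarrow> a \<le> dg (Hc z) v + \<eta>" if "z \<in> ?Z" "v \<in> U" for z v a
  proof -
    assume "K\<^sup>2 * a \<le> dg H v"
    then have "real (K\<^sup>2 * a) \<le> real (dg H v)" by (rule of_nat_mono)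
    then have "real a \<le> real (dg H v) / real (K\<^sup>2)" using K2 by (simp add: le_divide_eq mult.commute)
    then show ?thesis using dcell[OF that] unfolding Hc_def[symmetric] rK by linarith
  qed
  have upU: "dg (Hc z) v \<le> a" if "z \<in> ?Z" "dg H v + K\<^sup>2 * b' \<le> K\<^sup>2 * M" "a + b' = M + \<eta>" "\<eta> \<le> a" for z v a b'
  proof (cases "v \<in> U")
    case True
    have "b' \<le> M"
    proof -
      have "K\<^sup>2 * b' \<le> K\<^sup>2 * M" using that(2) by linarith
      then show ?thesis using K2 by simp
    qed
    then have "K\<^sup>2 * (M - b') = K\<^sup>2 * M - K\<^sup>2 * b'" by (simp add: diff_mult_distrib2)
    then have "dg H v \<le> K\<^sup>2 * (M - b')" using that(2) by linarith
    then have "real (dg H v) \<le> real (K\<^sup>2 * (M - b'))" by (rule of_nat_mono)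
    then have "dg (Hc z) v \<le> (M - b') + \<eta>" by (rule up[OF that(1) True])
    then show ?thesis using that(3) \<open>b' \<le> M\<close> by linarith
  next
    case False
    have "dg (Hc z) v \<le> dg H v" by (rule dg_mono[OF finH HcH])
    then show ?thesis using U[OF False] that(4) by linarith
  qed
  \<comment> \<open>Each cell removes slightly fewer four-edge pieces than its share, so that its surplus \<open>x z\<close> is large enough.\<close>
  define qc where "qc = q div K\<^sup>2 - 4 * \<eta>"
  define s where "s = M - 2 * T"
  \<comment> \<open>An eighth of \<open>T\<close> is far more than the deviation \<open>2 * \<eta>\<close> between cells, while \<open>3 * \<theta>\<close> still exceeds \<open>2 * T\<close>.\<close>
  define \<theta> where "\<theta> = T - T div 8"
  have TM: "T + s = M - T" "s + 2 * T = M" using par(3) unfolding s_def by linarith+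
  have \<theta>: "8 * \<theta> \<ge> 7 * T" "\<theta> + T div 8 = T" unfolding \<theta>_def by linarith+
  have qdiv: "q div K\<^sup>2 * K\<^sup>2 \<le> q" "q < (q div K\<^sup>2 + 1) * K\<^sup>2"
  proof -
    show "q div K\<^sup>2 * K\<^sup>2 \<le> q" by simp
    show "q < (q div K\<^sup>2 + 1) * K\<^sup>2"
      using dividend_less_div_times[OF K2, of q] by (simp only: distrib_right mult_1 add.commute)
  qed
  have qs: "qc \<le> s"
  proof -
    have "q div K\<^sup>2 * K\<^sup>2 + 2 * T * K\<^sup>2 \<le> M * K\<^sup>2" 
    proof -
      have "q + 2 * T * K\<^sup>2 \<le> M * K\<^sup>2" using par(4) by (simp add: algebra_simps)
      then show ?thesis using qdiv(1) by linarith
    qed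
    then have "(q div K\<^sup>2 + 2 * T) * K\<^sup>2 \<le> M * K\<^sup>2" by (simp add: distrib_right)
    then have "q div K\<^sup>2 + 2 * T \<le> M" using K2 by simp
    then show ?thesis unfolding qc_def s_def by linarith
  qed
  have rq: "real (q div K\<^sup>2) \<le> real q / real (K\<^sup>2)" "real q / real (K\<^sup>2) < real (q div K\<^sup>2) + 1"
  proof -
    have "real (q div K\<^sup>2) * real (K\<^sup>2) \<le> real q" using of_nat_mono[OF qdiv(1), where 'a=real] by simp
    then show "real (q div K\<^sup>2) \<le> real q / real (K\<^sup>2)" using K2 by (simp add: le_divide_eq)
    have "real q < real ((q div K\<^sup>2 + 1) * K\<^sup>2)" using qdiv(2) by (rule of_nat_less_iff[THEN iffD2])
    also have "\<dots> = (real (q div K\<^sup>2) + 1) * real (K\<^sup>2)" by (simp add: algebra_simps)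
    finally show "real q / real (K\<^sup>2) < real (q div K\<^sup>2) + 1" using K2 by (simp add: divide_less_eq)
  qed
  have cHK: "real (card H) / real (K\<^sup>2) = 2 * real M + 2 * (real q / real (K\<^sup>2))"
    unfolding cH using K2 by (simp add: add_divide_distrib)
  have cc: "2 * M + 2 * (q div K\<^sup>2) \<le> card (Hc z) + \<eta>" "card (Hc z) \<le> 2 * M + 2 * (q div K\<^sup>2) + 2 + \<eta>"
    if "z \<in> ?Z" for z
    using ccell[OF that] rq unfolding Hc_def[symmetric] rK cHK by linarith+
  define x where "x z = card (Hc z) - (2 * (T + s) + 2 * qc)" for z
  have xz: "card (Hc z) = 2 * (T + s) + 2 * qc + x z" "2 * T \<le> x z + \<eta>" "x z \<le> 2 * T + 2 + 9 * \<eta>"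
    "0 < qc \<Longrightarrow> 2 * T + 7 * \<eta> \<le> x z" if "z \<in> ?Z" for z
  proof -
    obtain d where d: "q div K\<^sup>2 = d" by simp
    have qd: "qc = d - 4 * \<eta>" unfolding qc_def d ..
    have c: "2 * M + 2 * d \<le> card (Hc z) + \<eta>" "card (Hc z) \<le> 2 * M + 2 * d + 2 + \<eta>"
      using cc[OF that] unfolding d by simp_all
    have M2: "M = T + s + T" using TM(2) unfolding s_def by linarith
    have qd1: "qc \<le> d" "d \<le> qc + 4 * \<eta>" unfolding qd by linarith+
    have T1: "\<eta> \<le> T" using par(2) by linarith
    have "2 * (T + s) + 2 * qc \<le> card (Hc z)" using c(1) M2 qd1(1) T1 unfolding distrib_left by linarith
    then show e: "card (Hc z) = 2 * (T + s) + 2 * qc + x z" unfolding x_def by linarith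
    show "2 * T \<le> x z + \<eta>" using e c(1) M2 qd1(1) unfolding distrib_left by linarith
    show "x z \<le> 2 * T + 2 + 9 * \<eta>" using e c(2) M2 qd1(2) unfolding distrib_left by linarith
    show "2 * T + 7 * \<eta> \<le> x z" if "0 < qc"
    proof -
      have "d = qc + 4 * \<eta>" using that unfolding qd by linarith
      then show ?thesis using e c(1) M2 unfolding distrib_left by linarith
    qed
  qed
  \<comment> \<open>Only \<open>y\<close> can have more than \<open>K\<^sup>2 * M\<close> edges, and it has at most \<open>K\<^sup>2 * p\<close> more.\<close>
  have dM: "dg (Hc z) v \<le> M + p + \<eta>" if z: "z \<in> ?Z" for z v
  proof -
    have le: "dg H v \<le> K\<^sup>2 * (M + p)"
    proof -
      consider "v \<in> X" | "v = y" | "v \<notin> X" "v \<noteq> y" by blast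
      then show ?thesis
      proof cases
        case 1
        then show ?thesis using dX(1)[OF 1] by (simp add: distrib_left)
      next
        case 2
        then show ?thesis using dy(1) by (simp add: distrib_left)
      next
        case 3
        then show ?thesis using small[OF 3] by (simp add: distrib_left)
      qed
    qed
    show ?thesis
    proof (cases "v \<in> U")
      case True
      then show ?thesis using up[OF z True, of "M + p"] of_nat_mono[OF le, where 'a=real] by simp
    next
      case False
      then show ?thesis using U[OF False] dg_mono[OF finH HcH, of z v] by linarith
    qed
  qed
  have cell: "\<exists>Rs L. peels (Hc z) Rs L \<and> length Rs = T + s \<and> (\<forall>R\<in>set Rs. piece U R) \<and>
    (\<forall>k<T. pair_matching (Rs ! k) \<and> (\<forall>v\<in>X. dg (Rs ! k) v = 1)) \<and>
    card L = x z \<and> (\<forall>v. dg L v \<le> (if v \<in> X then max \<theta> (dg (Hc z) v - (T + s)) else \<theta>))"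
    if z: "z \<in> ?Z" for z
  proof (rule cell_decomposition[OF bc, where y=y and \<Theta>="T + \<eta>" and \<delta>=\<eta> and q=qc])
    show "card (Hc z) = 2 * (T + s) + 2 * qc + x z" by (rule xz(1)[OF z])
    show "T + 2 \<le> dg (Hc z) v \<and> dg (Hc z) v \<le> T + s + (T + \<eta>)" if v: "v \<in> X" for v
    proof -
      have vU: "v \<in> U" using v X(4) by blast
      have "T + 2 + \<eta> \<le> dg (Hc z) v + \<eta>" by (rule low[OF z vU dX(2)[OF v]])
      moreover have "dg (Hc z) v \<le> M + \<eta>" using up[OF z vU, of M] of_nat_mono[OF dX(1)[OF v], where 'a=real] by blast
      ultimately show ?thesis using TM by linarith
    qed
    show "dg (Hc z) v \<le> s" if "v \<notin> X" "v \<noteq> y" for v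
      by (rule upU[OF z small[OF that]]) (use TM par in linarith)+
    show "dg (Hc z) y \<le> s + qc + \<theta>"
    proof (cases "dg H y + K\<^sup>2 * (2 * T + \<eta>) \<le> K\<^sup>2 * M")
      case True
      have "dg (Hc z) y \<le> s" by (rule upU[OF z True]) (use TM par in linarith)+
      then show ?thesis by linarith
    next
      case False
      then have "K\<^sup>2 * (p + 2 * T + 6 * \<eta> + 2) \<le> q" using dy(2) by blast
      then have "p + 2 * T + 6 * \<eta> + 2 \<le> q div K\<^sup>2"
        using div_le_mono[of "K\<^sup>2 * (p + 2 * T + 6 * \<eta> + 2)" q "K\<^sup>2"] K2 by simp
      then have "p + 2 * T + 2 * \<eta> + 2 \<le> qc" unfolding qc_def by linarith
      then show ?thesis using dM[OF z, of y] TM by linarith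
    qed
    show "dg (Hc z) v + 2 * T < card (Hc z) + 2" for v
      using dM[OF z, of v] cc(1)[OF z] par by linarith
    show "dg (Hc z) v \<le> \<eta>" if "v \<notin> U" for v
      using U[OF that] dg_mono[OF finH HcH, of z v] by linarith
    show "0 < qc \<Longrightarrow> 2 * (T + \<eta>) \<le> x z" using xz(4)[OF z] unfolding distrib_left by linarith
    show "\<theta> \<le> T + \<eta>" using \<theta> by linarith
    show "T + \<eta> < x z" using xz(2)[OF z] par by linarith
    show "x z + 6 < 3 * \<theta>" using xz(3)[OF z] \<theta>(1) par by linarith
    show "6 \<le> \<theta>" "\<eta> < \<theta>" using \<theta>(1) par by linarith+
    show "5 * \<eta> + 30 < x z" using xz(2)[OF z] par by linarith
  qed (fact qs X(1-3))+
  define CR where "CR z Rs L \<longleftrightarrow> peels (Hc z) Rs L \<and> length Rs = T + s \<and> (\<forall>R\<in>set Rs. piece U R) \<and>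
    (\<forall>k<T. pair_matching (Rs ! k) \<and> (\<forall>v\<in>X. dg (Rs ! k) v = 1)) \<and>
    card L = x z \<and> (\<forall>v. dg L v \<le> (if v \<in> X then max \<theta> (dg (Hc z) v - (T + s)) else \<theta>))" for z Rs L
  have "\<forall>z\<in>?Z. \<exists>Rs. \<exists>L. CR z Rs L" unfolding CR_def using cell by blast
  from bchoice[OF this] obtain Rs where "\<forall>z\<in>?Z. \<exists>L. CR z (Rs z) L" by blast
  from bchoice[OF this] obtain L where RL: "\<And>z. z \<in> ?Z \<Longrightarrow> CR z (Rs z) (L z)" by blast
  have peel: "peels (Hc z) (Rs z) (L z)" and len: "length (Rs z) = M - T"
    and pcs: "\<forall>R\<in>set (Rs z). piece U R"
    and spec: "\<forall>k<T. pair_matching (Rs z ! k) \<and> (\<forall>v\<in>X. dg (Rs z ! k) v = 1)"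
    and cL: "card (L z) = x z"
    and dL: "dg (L z) v \<le> (if v \<in> X then max \<theta> (dg (Hc z) v - (M - T)) else \<theta>)"
    if "z \<in> ?Z" for z v using RL[OF that] unfolding CR_def TM(1) by blast+
  have LH: "L z \<subseteq> Hc z" if "z \<in> ?Z" for z using peels_rest[OF peel[OF that]] by blast
  define LL where "LL = (\<Union>z\<in>?Z. L z)"
  have finL: "finite (L z)" if "z \<in> ?Z" for z using finite_subset[OF LH[OF that] finc] .
  have Ldisj: "L z \<inter> L z' = {}" if "z \<in> ?Z" "z' \<in> ?Z" "z \<noteq> z'" for z z'
    using LH[OF that(1)] LH[OF that(2)] Hdisj[OF that(3)] by blast
  have LLH: "LL \<subseteq> H" unfolding LL_def using LH HcH by blast
  have bL: "bipart P Q LL" by (rule bipart_subset[OF b LLH])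
  have cLL: "card LL = (\<Sum>z\<in>?Z. x z)"
    using card_UN_disjoint[of ?Z L] finL Ldisj cL unfolding LL_def by simp
  have dLL: "dg LL v = (\<Sum>z\<in>?Z. dg (L z) v)" for v
    unfolding LL_def by (rule dg_UN_disjoint) (use finL Ldisj in auto)
  \<comment> \<open>The four-edge pieces that the cells did not remove.\<close>
  define qL where "qL = q - K\<^sup>2 * qc"
  have qcq: "K\<^sup>2 * qc \<le> q"
  proof -
    have "qc * K\<^sup>2 \<le> q div K\<^sup>2 * K\<^sup>2" unfolding qc_def by (rule mult_right_mono) simp_all
    then have "qc * K\<^sup>2 \<le> q" using qdiv(1) by (rule le_trans)
    then show ?thesis by (simp only: mult.commute)
  qed
  have "card LL = 2 * (K\<^sup>2 * T) + 2 * qL"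
  proof -
    have "card H = (\<Sum>z\<in>?Z. 2 * (T + s) + 2 * qc + x z)"
      unfolding sumcard[symmetric] by (rule sum.cong[OF refl xz(1)])
    also have "\<dots> = K\<^sup>2 * (2 * (T + s) + 2 * qc) + card LL"
      unfolding cLL sum.distrib sum_constant cardZ by (simp add: distrib_left)
    finally have "K\<^sup>2 * (2 * (T + s) + 2 * qc) + card LL = 2 * K\<^sup>2 * M + 2 * q" using cH by simp
    moreover have "2 * K\<^sup>2 * M = K\<^sup>2 * (2 * (T + s)) + 2 * (K\<^sup>2 * T)"
    proof -
      have "M = T + s + T" using TM by linarith
      then show ?thesis by (simp add: algebra_simps)
    qed
    moreover have "K\<^sup>2 * (2 * (T + s) + 2 * qc) = K\<^sup>2 * (2 * (T + s)) + 2 * (K\<^sup>2 * qc)" by (simp add: algebra_simps)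
    ultimately show ?thesis using qcq unfolding qL_def by linarith
  qed
  moreover have r: "dg LL v \<le> K\<^sup>2 * T" for v
  proof (cases "v \<in> X \<and> (\<forall>z\<in>?Z. \<theta> \<le> dg (Hc z) v - (M - T))")
    case True
    have "(\<Sum>z\<in>?Z. dg (L z) v) + (\<Sum>z\<in>?Z. M - T) = (\<Sum>z\<in>?Z. dg (L z) v + (M - T))" by (simp add: sum.distrib)
    also have "\<dots> \<le> (\<Sum>z\<in>?Z. dg (Hc z) v)"
    proof (rule sum_mono)
      fix z assume z: "z \<in> ?Z"
      have "\<theta> \<le> dg (Hc z) v - (M - T)" using True z by blast
      moreover have "0 < \<theta>" using \<theta>(1) par by linarith
      moreover have "dg (L z) v \<le> max \<theta> (dg (Hc z) v - (M - T))" using dL[OF z, of v] True by simp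
      ultimately show "dg (L z) v + (M - T) \<le> dg (Hc z) v" by linarith
    qed
    also have "\<dots> \<le> K\<^sup>2 * M" using sumdeg dX(1) True by simp
    finally have "dg LL v + K\<^sup>2 * (M - T) \<le> K\<^sup>2 * M" unfolding dLL sum_constant cardZ by simp
    moreover have "K\<^sup>2 * M = K\<^sup>2 * (M - T) + K\<^sup>2 * T"
      using TM by (metis distrib_left add.commute add.assoc mult_2)
    ultimately show ?thesis by linarith
  next
    case F: False
    have "dg (L z) v \<le> T" if z: "z \<in> ?Z" for z
    proof (cases "v \<in> X")
      case True
      then obtain z0 where z0: "z0 \<in> ?Z" "\<not> \<theta> \<le> dg (Hc z0) v - (M - T)" using F by blast
      have vU: "v \<in> U" using True X(4) by blast
      have "dg (Hc z) v \<le> dg (Hc z0) v + 2 * \<eta>"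
        using dcell[OF z vU] dcell[OF z0(1) vU] unfolding Hc_def[symmetric] by linarith
      moreover have "T div 8 \<ge> 2 * \<eta>" using par by linarith
      ultimately have "dg (Hc z) v - (M - T) \<le> T" using z0(2) \<theta>(2) par by linarith
      then show ?thesis using dL[OF z, of v] True \<theta>(2) by simp
    next
      case False
      then show ?thesis using dL[OF z, of v] \<theta>(2) by simp
    qed
    then have "(\<Sum>z\<in>?Z. dg (L z) v) \<le> (\<Sum>z\<in>?Z. T)" by (rule sum_mono)
    then show ?thesis unfolding dLL sum_constant cardZ by simp
  qed
  moreover have "dg LL v \<le> \<eta>" if "v \<notin> U" for v
    using U[OF that] dg_mono[OF finH LLH, of v] by linarith
  moreover have "5 * \<eta> + 2 * qL + 30 < 2 * (K\<^sup>2 * T)"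
  proof -
    have "q \<le> (q div K\<^sup>2 + 1) * K\<^sup>2" using qdiv(2) by simp
    also have "\<dots> \<le> (qc + 4 * \<eta> + 1) * K\<^sup>2"
    proof (rule mult_right_mono)
      show "q div K\<^sup>2 + 1 \<le> qc + 4 * \<eta> + 1" unfolding qc_def by linarith
    qed simp
    also have "\<dots> = K\<^sup>2 * qc + K\<^sup>2 * (4 * \<eta> + 1)" by (simp add: algebra_simps)
    finally have "qL \<le> K\<^sup>2 * (4 * \<eta> + 1)" unfolding qL_def by linarith
    moreover have "5 * \<eta> + 30 + 2 * (4 * \<eta> + 1) < 2 * T" using par unfolding distrib_left by linarith
    then have "K\<^sup>2 * (5 * \<eta> + 30 + 2 * (4 * \<eta> + 1)) < K\<^sup>2 * (2 * T)" using K2 by simp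
    then have "K\<^sup>2 * (5 * \<eta> + 30) + 2 * (K\<^sup>2 * (4 * \<eta> + 1)) < 2 * (K\<^sup>2 * T)" by (simp add: algebra_simps)
    moreover have "1 * (5 * \<eta> + 30) \<le> K\<^sup>2 * (5 * \<eta> + 30)" by (rule mult_right_mono) (use K2 in auto)
    then have "5 * \<eta> + 30 \<le> K\<^sup>2 * (5 * \<eta> + 30)" unfolding mult_1 .
    ultimately show ?thesis by linarith
  qed
  ultimately obtain RsL where RsL: "peels LL RsL {}" "length RsL = K\<^sup>2 * T" "\<forall>R\<in>set RsL. piece U R"
    using leftover_decomposition[OF bL, of "K\<^sup>2 * T" qL U \<eta>] by blast
  define F where "F z = (if z = (0,0) then (!) RsL else (!) (Rs z))" for z :: "nat \<times> nat"
  have F0: "F (0,0) k = RsL ! k" for k unfolding F_def by simp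
  have Fz: "F z k = Rs z ! k" if "z \<in> ?Z" for z k using that unfolding F_def by auto
  have Fsub: "F z k \<subseteq> Hc z - L z" if "z \<in> ?Z" "k < M - T" for z k
    using peels_subset[OF peel[OF that(1)], of "Rs z ! k"] peels_rest[OF peel[OF that(1)]] len[OF that(1)] that
    unfolding Fz[OF that(1)] by (auto simp: nth_mem)
  have F0sub: "F (0,0) k \<subseteq> LL" if "k < K\<^sup>2 * T" for k
    using peels_subset[OF RsL(1), of "RsL ! k"] RsL(2) that unfolding F0 by simp
  show ?thesis
    unfolding Hc_def[symmetric]
  proof (rule exI[of _ F], intro conjI ballI allI impI)
    fix z k assume z: "z \<in> ?Z" and k: "k < M - T"
    show "piece U (F z k)" using pcs[OF z] len[OF z] k unfolding Fz[OF z] by simp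
    show "F z k \<subseteq> Hc z" using Fsub[OF z k] by blast
    show "F z k \<inter> F z l = {}" if "l < M - T" "k \<noteq> l" for l
      unfolding Fz[OF z] by (rule peels_nth_disjoint[OF peel[OF z]]) (use k that len[OF z] in auto)
    show "F z k \<inter> F (0,0) l = {}" if "l < K\<^sup>2 * T" for l
    proof -
      have "e \<notin> LL" if e: "e \<in> F z k" for e
      proof
        assume "e \<in> LL"
        then obtain z' where z': "z' \<in> ?Z" "e \<in> L z'" unfolding LL_def by blast
        have "e \<in> Hc z" "e \<notin> L z" using Fsub[OF z k] e by auto
        then show False using z' LH[OF z'(1)] Hdisj[of z z'] by blast
      qed
      then show ?thesis using F0sub[OF that] by blast
    qed
  next
    fix z k assume z: "z \<in> ?Z" and k: "k < T"
    show "pair_matching (F z k)" using spec[OF z] k unfolding Fz[OF z] by blast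
    show "dg (F z k) v = 1" if "v \<in> X" for v using spec[OF z] k that unfolding Fz[OF z] by blast
  next
    fix k assume k: "k < K\<^sup>2 * T"
    show "piece U (F (0,0) k)" using RsL(2,3) k unfolding F0 by simp
    show "F (0,0) k \<subseteq> H" using F0sub[OF k] LLH by blast
    show "F (0,0) k \<inter> F (0,0) l = {}" if "l < K\<^sup>2 * T" "k \<noteq> l" for l
      unfolding F0 by (rule peels_nth_disjoint[OF RsL(1)]) (use k that RsL(2) in auto)
  next
    have 1: "(\<Union>k<M - T. F z k) \<union> L z = Hc z" if "z \<in> ?Z" for z
      using peels_Union[OF peel[OF that]] len[OF that] Fz[OF that] by simp
    have 2: "(\<Union>k<K\<^sup>2 * T. F (0,0) k) = LL" using peels_Union[OF RsL(1)] RsL(2) F0 by simp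
    have "(\<Union>z\<in>?Z. \<Union>k<M - T. F z k) \<union> LL = (\<Union>z\<in>?Z. (\<Union>k<M - T. F z k) \<union> L z)" unfolding LL_def by blast
    also have "\<dots> = (\<Union>z\<in>?Z. Hc z)" by (rule SUP_cong[OF refl 1])
    finally show "(\<Union>z\<in>?Z. \<Union>k<M - T. F z k) \<union> (\<Union>k<K\<^sup>2 * T. F (0,0) k) = H" unfolding 2 Hun[symmetric] .
  next
    fix z v assume z: "z \<in> ?Z"
    have "dg (Hc z) v = (\<Sum>k<M - T. dg (F z k) v) + dg (L z) v"
      using peels_dg[OF peel[OF z] finc, of v] len[OF z] Fz[OF z] by simp
    moreover have "dg (L z) v \<le> T + \<eta>"
    proof (cases "v \<in> X")
      case True
      have vU: "v \<in> U" using True X(4) by blast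
      have "dg (Hc z) v \<le> M + \<eta>"
        using up[OF z vU, of M] of_nat_mono[OF dX(1)[OF True], where 'a=real] by blast
      then show ?thesis using dL[OF z, of v] True \<theta>(2) par(3) by simp
    next
      case False
      then show ?thesis using dL[OF z, of v] \<theta>(2) by simp
    qed
    ultimately show "dg (Hc z) v \<le> (\<Sum>k<M - T. dg (F z k) v) + T + \<eta>" by linarith
  next
    fix v
    have "dg LL v = (\<Sum>k<K\<^sup>2 * T. dg (F (0,0) k) v)"
      using peels_dg[OF RsL(1) bipart_finite[OF bL], of v] RsL(2) F0 by (simp add: dg_def)
    then show "(\<Sum>k<K\<^sup>2 * T. dg (F (0,0) k) v) \<le> K\<^sup>2 * T" using r[of v] by simp
  qed
qed

section \<open>Assigning pendant edges on one side\<close>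

text \<open>At most six edges, each with two ends.\<close>

lemma piece_card_Union:
  assumes "bipart P Q R" "piece U R"
  shows "finite (\<Union>R)" "card (\<Union>R) \<le> 12"
proof -
  obtain M S where MS: "R = M \<union> S" "card M \<in> {2, 4}" "finite M" "S = {} \<or> star_edges M U S"
    using assms(2) by (rule piece_shape)
  have "card S \<le> 2" using MS(4)
  proof
    assume "star_edges M U S"
    then obtain g1 g2 where "S = {g1, g2}" unfolding star_edges_def by blast
    then show ?thesis by (simp add: card_insert_if)
  qed simp
  moreover have "card M \<le> 4" using MS(2) by auto
  moreover have "card R \<le> card M + card S" unfolding MS(1) by (rule card_Un_le)
  ultimately have cR: "card R \<le> 6" by linarith
  have fR: "finite R" using assms(2) by (rule piece_finite)
  show "finite (\<Union>R)" using fR bipart_edge_finite(1)[OF assms(1)] by blast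
  have "card (\<Union>R) \<le> (\<Sum>e\<in>R. card e)" using card_Union_le_sum_card[of R] bipart_edge_finite(1)[OF assms(1)] by blast
  also have "\<dots> = (\<Sum>e\<in>R. 2)" by (rule sum.cong[OF refl]) (rule bipart_edge_finite(2)[OF assms(1)])
  finally show "card (\<Union>R) \<le> 12" using cR by simp
qed

text \<open>The hypotheses of the assignment lemma are verified for the demands \<open>2 - dg (F c) v\<close>. Pieces of type \<open>i\<close> number only
  \<open>K * (M - T)\<close>, so their demand stays below the number of edges at \<open>v\<close> into \<open>A i\<close> by a margin coming from \<open>T\<close>, which
  beats the errors \<open>\<eta>\<close>. Pieces of type \<open>0\<close> take \<open>K\<^sup>2 * T\<close> of the remaining edges at least.\<close>

lemma side_assignment:
  fixes E :: "'a \<Rightarrow> 'a set" and C :: "'c set" and F :: "'c \<Rightarrow> 'a set set" and \<tau> :: "'c \<Rightarrow> nat"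
    and K M T \<eta> p :: nat
  assumes K: "0 < K" and V: "finite V" "card V \<le> \<eta>" and finC: "finite C"
    and b: "bipart P Q H" and piec: "\<And>c. c \<in> C \<Longrightarrow> piece U (F c)"
    and Fdisj: "\<And>c d. c \<in> C \<Longrightarrow> d \<in> C \<Longrightarrow> c \<noteq> d \<Longrightarrow> F c \<inter> F d = {}" and FH: "(\<Union>c\<in>C. F c) = H"
    and finE: "\<And>v. v \<in> V \<Longrightarrow> finite (E v)" and EA: "\<And>v. v \<in> V \<Longrightarrow> E v \<subseteq> (\<Union>i\<in>{1..K}. A i)"
    and disj: "\<And>i j. i \<in> {1..K} \<Longrightarrow> j \<in> {1..K} \<Longrightarrow> i \<noteq> j \<Longrightarrow> A i \<inter> A j = {}"
    and \<tau>: "\<And>c. c \<in> C \<Longrightarrow> \<tau> c \<le> K" and cC: "card C = K\<^sup>2 * M"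
    and cnt: "\<And>i. i \<in> {1..K} \<Longrightarrow> card {c \<in> C. \<tau> c = i} = K * (M - T)"
    and cnt0: "card {c \<in> C. \<tau> c = 0} = K\<^sup>2 * T"
    and deg: "\<And>v. v \<in> V \<Longrightarrow> card (E v) + dg H v = 2 * (K\<^sup>2 * M)"
    and degi: "\<And>v i. v \<in> V \<Longrightarrow> i \<in> {1..K} \<Longrightarrow> 2 * (K\<^sup>2 * M) \<le> K * card (E v \<inter> A i) + dg H v + K\<^sup>2 * \<eta>"
    and dmax: "\<And>v. v \<in> V \<Longrightarrow> dg H v \<le> K\<^sup>2 * M + K\<^sup>2 * p"
    and cells: "\<And>v i. v \<in> V \<Longrightarrow> i \<in> {1..K} \<Longrightarrow>
       dg H v \<le> K * (\<Sum>c\<in>{c\<in>C. \<tau> c = i}. dg (F c) v) + K\<^sup>2 * (T + 2 * \<eta>)"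
    and left: "\<And>v. v \<in> V \<Longrightarrow> (\<Sum>c\<in>{c\<in>C. \<tau> c = 0}. dg (F c) v) \<le> K\<^sup>2 * T"
    and small: "\<And>a. a \<in> (\<Union>i\<in>{1..K}. A i) \<Longrightarrow> dg H a \<le> \<eta>"
    and par: "10 \<le> \<eta>" "100 * \<eta> \<le> T" "4 * T + p \<le> M"
  shows "\<exists>\<chi>. (\<forall>v\<in>V. \<forall>a\<in>E v. \<chi> v a \<in> C \<and> a \<notin> \<Union>(F (\<chi> v a)) \<and>
                 (\<tau> (\<chi> v a) \<noteq> 0 \<longrightarrow> a \<in> A (\<tau> (\<chi> v a)))) \<and>
             (\<forall>v\<in>V. \<forall>c\<in>C. card {a \<in> E v. \<chi> v a = c} = 2 - dg (F c) v) \<and>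
             (\<forall>v\<in>V. \<forall>w\<in>V. v \<noteq> w \<longrightarrow> (\<forall>a\<in>E v \<inter> E w. \<chi> v a \<noteq> \<chi> w a))"
proof -
  have FcH: "F c \<subseteq> H" if "c \<in> C" for c using FH that by blast
  have bF: "bipart P Q (F c)" if "c \<in> C" for c by (rule bipart_subset[OF b FcH[OF that]])
  have finF: "finite (F c)" if "c \<in> C" for c by (rule bipart_finite[OF bF[OF that]])
  have d2: "dg (F c) v \<le> 2" if "c \<in> C" for c v by (rule piece_dg(1)[OF piec[OF that]])
  have sumdg: "(\<Sum>c\<in>C. dg (F c) v) = dg H v" for v
  proof -
    have "dg (\<Union>c\<in>C. F c) v = (\<Sum>c\<in>C. dg (F c) v)"
      by (rule dg_UN_disjoint[OF finC finF Fdisj])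
    then show ?thesis unfolding FH by (rule sym)
  qed
  have sumr: "(\<Sum>c\<in>C'. 2 - dg (F c) v) + (\<Sum>c\<in>C'. dg (F c) v) = 2 * card C'" if "C' \<subseteq> C" for C' v
  proof -
    have "(\<Sum>c\<in>C'. 2 - dg (F c) v) + (\<Sum>c\<in>C'. dg (F c) v) = (\<Sum>c\<in>C'. (2 - dg (F c) v) + dg (F c) v)"
      by (rule sum.distrib[symmetric])
    also have "\<dots> = (\<Sum>c\<in>C'. 2)"
    proof (rule sum.cong[OF refl])
      fix c assume "c \<in> C'"
      then have "dg (F c) v \<le> 2" using d2 that by blast
      then show "2 - dg (F c) v + dg (F c) v = 2" by simp
    qed
    finally show ?thesis by simp
  qed
  have K2: "0 < K\<^sup>2" using K by simp
  show ?thesis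
  \<comment> \<open>A piece has at most twelve vertices, and a vertex of a cluster lies in at most \<open>\<eta>\<close> pieces.\<close>
  proof (rule star_assignment[where t="4 * \<eta>" and t'="12 + 2 * \<eta>" and r="\<lambda>v c. 2 - dg (F c) v", OF V(1) finE finC EA disj \<tau>])
    show "(\<Sum>c\<in>C. 2 - dg (F c) v) = card (E v)" if v: "v \<in> V" for v
      using sumr[OF subset_refl, of v] sumdg[of v] deg[OF v] unfolding cC by linarith
    show "(\<Sum>c\<in>{c\<in>C. \<tau> c = i}. 2 - dg (F c) v) \<le> card (E v \<inter> A i)" if v: "v \<in> V" and i: "i \<in> {1..K}" for v i
    proof -
      let ?r = "\<Sum>c\<in>{c\<in>C. \<tau> c = i}. 2 - dg (F c) v" let ?d = "\<Sum>c\<in>{c\<in>C. \<tau> c = i}. dg (F c) v"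
      have "{c\<in>C. \<tau> c = i} \<subseteq> C" by blast
      from sumr[OF this, of v] have 0: "?r + ?d = 2 * (K * (M - T))" unfolding cnt[OF i] .
      have "K * ?r + K * ?d = K * (?r + ?d)" by (simp only: distrib_left)
      also have "\<dots> = K * (2 * (K * (M - T)))" by (simp only: 0)
      also have "\<dots> = 2 * (K\<^sup>2 * (M - T))" by (simp add: power2_eq_square)
      finally have 1: "K * ?r + K * ?d = 2 * (K\<^sup>2 * (M - T))" .
      have "M - T + T = M" using par(3) by linarith
      then have "K\<^sup>2 * (M - T) + K\<^sup>2 * T = K\<^sup>2 * M" by (simp only: distrib_left[symmetric])
      moreover have "K\<^sup>2 * (T + 2 * \<eta>) = K\<^sup>2 * T + 2 * (K\<^sup>2 * \<eta>)" by (simp add: distrib_left)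
      moreover have "3 * \<eta> \<le> T" using par by linarith
      then have "K\<^sup>2 * (3 * \<eta>) \<le> K\<^sup>2 * T" by simp
      then have "3 * (K\<^sup>2 * \<eta>) \<le> K\<^sup>2 * T" by simp
      ultimately have "K * ?r \<le> K * card (E v \<inter> A i)"
        using 1 cells[OF v i] degi[OF v i] by linarith
      then show ?thesis using K by simp
    qed
    show "4 * \<eta> + (12 + 2 * \<eta>) \<le> card (E v \<inter> A i)" if v: "v \<in> V" and i: "i \<in> {1..K}" for v i
    proof -
      let ?c = "card (E v \<inter> A i)"
      have "K\<^sup>2 * M \<le> K * ?c + K\<^sup>2 * p + K\<^sup>2 * \<eta>" using degi[OF v i] dmax[OF v] by linarith
      also have "\<dots> \<le> K\<^sup>2 * ?c + K\<^sup>2 * p + K\<^sup>2 * \<eta>"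
      proof -
        have "1 * (K * ?c) \<le> K * (K * ?c)" by (rule mult_right_mono) (use K in auto)
        moreover have "K * (K * ?c) = K\<^sup>2 * ?c" by (simp only: power2_eq_square mult.assoc)
        ultimately show ?thesis by simp
      qed
      also have "\<dots> = K\<^sup>2 * (?c + p + \<eta>)" by (simp add: distrib_left)
      finally have "M \<le> ?c + p + \<eta>" using K2 by simp
      then show ?thesis using par by linarith
    qed
    show "4 * \<eta> + (12 + 2 * \<eta>) \<le> (\<Sum>c\<in>{c\<in>C. \<tau> c = 0}. 2 - dg (F c) v)" if v: "v \<in> V" for v
    proof -
      have "K\<^sup>2 * T \<le> (\<Sum>c\<in>{c\<in>C. \<tau> c = 0}. 2 - dg (F c) v)"
      proof -
        have "{c\<in>C. \<tau> c = 0} \<subseteq> C" by blast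
        from sumr[OF this, of v] show ?thesis using left[OF v] unfolding cnt0 by linarith
      qed
      moreover have "1 * T \<le> K\<^sup>2 * T" by (rule mult_right_mono) (use K2 in auto)
      ultimately show ?thesis using par by linarith
    qed
    show "finite (\<Union>(F c)) \<and> card (\<Union>(F c)) + 2 * card V \<le> 12 + 2 * \<eta>" if c: "c \<in> C" for c
      using piece_card_Union[OF bF[OF c] piec[OF c]] V(2) by simp
    show "2 * (card {c \<in> C. a \<in> \<Union>(F c)} + card V) \<le> 4 * \<eta>" if a: "a \<in> (\<Union>i\<in>{1..K}. A i)" for a
    proof -
      have "card {c \<in> C. a \<in> \<Union>(F c)} = (\<Sum>c\<in>{c \<in> C. a \<in> \<Union>(F c)}. 1)" by simp
      also have "\<dots> \<le> (\<Sum>c\<in>{c \<in> C. a \<in> \<Union>(F c)}. dg (F c) a)"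
      proof (rule sum_mono)
        fix c assume c: "c \<in> {c \<in> C. a \<in> \<Union>(F c)}"
        then have cC: "c \<in> C" and "\<exists>e\<in>F c. a \<in> e" by blast+
        then have "0 < dg (F c) a" using dg_pos_iff[OF finF[OF cC]] by simp
        then show "1 \<le> dg (F c) a" by simp
      qed
      also have "\<dots> \<le> (\<Sum>c\<in>C. dg (F c) a)" by (rule sum_mono2) (use finC in auto)
      also have "\<dots> \<le> \<eta>" using sumdg[of a] small[OF a] by simp
      finally show ?thesis using V(2) by simp
    qed
  qed simp_all
qed

section \<open>Crossing edges of a graph\<close>

lemma e_between_eq_card: "e_between G X Y = card (edges (bip G X Y))"
  unfolding e_between_def bip_def by simp

lemma e_between_commute: "e_between G X Y = e_between G Y X"
  unfolding e_between_def by (rule arg_cong[where f=card]) (auto simp: insert_commute)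

lemma e_between_single: "e_between G {x} Y = deg_in G x Y"
proof -
  have "{e \<in> edges G. \<exists>x\<in>{x}. \<exists>y\<in>Y. e = {x, y}} = (\<lambda>u. {u, x}) ` {u \<in> Y. {u, x} \<in> edges G}"
    by (auto simp: insert_commute)
  moreover have "inj_on (\<lambda>u. {u, x}) {u \<in> Y. {u, x} \<in> edges G}" by (auto simp: inj_on_def doubleton_eq_iff)
  ultimately show ?thesis unfolding e_between_def deg_in_def by (simp add: card_image)
qed

lemma simple_graph_finite_edges: "simple_graph G \<Longrightarrow> finite (edges G)"
proof -
  assume G: "simple_graph G"
  have "edges G \<subseteq> Pow (verts G)"
  proof
    fix e assume "e \<in> edges G"
    then obtain u v where "u \<in> verts G" "v \<in> verts G" "e = {u,v}" using G unfolding simple_graph_def by blast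
    then show "e \<in> Pow (verts G)" by simp
  qed
  moreover have "finite (verts G)" using G unfolding simple_graph_def by blast
  ultimately show ?thesis by (meson finite_Pow_iff finite_subset)
qed

lemma simple_graph_edgeE:
  assumes "simple_graph G" "e \<in> edges G"
  obtains u v where "u \<in> verts G" "v \<in> verts G" "u \<noteq> v" "e = {u, v}"
  using assms unfolding simple_graph_def by blast

lemma simple_graph_bip:
  assumes "simple_graph G"
  shows "simple_graph (bip G X Y)"
  unfolding simple_graph_def
proof (intro conjI ballI)
  show "finite (verts (bip G X Y))" using assms unfolding simple_graph_def bip_def by simp
  fix e assume "e \<in> edges (bip G X Y)"
  then obtain x y where e: "e \<in> edges G" "x \<in> X" "y \<in> Y" "e = {x, y}" unfolding bip_def by auto
  obtain u v where uv: "u \<in> verts G" "v \<in> verts G" "u \<noteq> v" "e = {u, v}"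
    by (rule simple_graph_edgeE[OF assms e(1)])
  have "x \<in> verts G" "y \<in> verts G" "x \<noteq> y" using uv e(4) by auto
  then show "\<exists>u v. u \<in> verts (bip G X Y) \<and> v \<in> verts (bip G X Y) \<and> u \<noteq> v \<and> e = {u, v}"
    using e by (intro exI[of _ x] exI[of _ y]) (simp add: bip_def)
qed

lemma bipart_bip:
  assumes "simple_graph G" "X \<inter> Y = {}"
  shows "bipart X Y (edges (bip G X Y))"
  unfolding bipart_def
proof (intro conjI ballI)
  show "finite (edges (bip G X Y))" by (rule simple_graph_finite_edges[OF simple_graph_bip[OF assms(1)]])
  show "\<exists>x\<in>X. \<exists>y\<in>Y. e = {x, y}" if "e \<in> edges (bip G X Y)" for e
    using that unfolding bip_def by simp
qed fact

lemma edges_bip: "edges (bip G X Y) = {e \<in> edges G. \<exists>x\<in>X. \<exists>y\<in>Y. e = {x, y}}"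
  unfolding bip_def by simp

lemma edges_bip_commute: "edges (bip G X Y) = edges (bip G Y X)"
  unfolding edges_bip by (auto simp: insert_commute)

lemma dg_bip:
  assumes "X \<inter> Y = {}" "v \<in> X"
  shows "dg (edges (bip G X Y)) v = deg_in G v Y"
proof -
  have "{e \<in> edges (bip G X Y). v \<in> e} = {e \<in> edges G. \<exists>x\<in>{v}. \<exists>y\<in>Y. e = {x, y}}"
    unfolding edges_bip using assms by auto
  then show ?thesis unfolding dg_def e_between_single[symmetric] e_between_def by simp
qed

lemma deg_in_Un:
  assumes "finite X" "finite Y" "X \<inter> Y = {}"
  shows "deg_in G v (X \<union> Y) = deg_in G v X + deg_in G v Y"
proof -
  have "{u \<in> X \<union> Y. {u, v} \<in> edges G} = {u \<in> X. {u, v} \<in> edges G} \<union> {u \<in> Y. {u, v} \<in> edges G}" by auto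
  moreover have "card ({u \<in> X. {u, v} \<in> edges G} \<union> {u \<in> Y. {u, v} \<in> edges G}) =
      card {u \<in> X. {u, v} \<in> edges G} + card {u \<in> Y. {u, v} \<in> edges G}"
    by (rule card_Un_disjoint) (use assms in auto)
  ultimately show ?thesis unfolding deg_in_def by simp
qed

text \<open>An edge at \<open>v\<close> that stays on its own side goes to a cluster.\<close>

lemma side_degree:
  assumes "simple_graph G" "verts G = A0 \<union> cA \<union> B'" "A0 \<inter> cA = {}" "(A0 \<union> cA) \<inter> B' = {}"
    and "\<And>e. e \<in> edges G \<Longrightarrow> \<not> e \<subseteq> A0" "v \<in> A0"
  shows "deg G v = deg_in G v cA + dg (edges (bip G (A0 \<union> cA) B')) v"
proof -
  have fin: "finite A0" "finite cA" "finite B'" using assms(1,2) unfolding simple_graph_def by auto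
  have "{u \<in> A0. {u, v} \<in> edges G} = {}" using assms(5)[of "{_, v}"] assms(6) by auto
  then have "deg_in G v A0 = 0" unfolding deg_in_def by (simp only: card.empty)
  moreover have "deg G v = deg_in G v A0 + deg_in G v cA + deg_in G v B'"
    unfolding deg_def assms(2) using deg_in_Un[of "A0 \<union> cA" B' G v] deg_in_Un[of A0 cA G v] fin assms(3,4) by simp
  moreover have "dg (edges (bip G (A0 \<union> cA) B')) v = deg_in G v B'"
    by (rule dg_bip) (use assms in auto)
  ultimately show ?thesis by simp
qed

text \<open>The names of the pieces: \<open>M - T\<close> for each cell, and \<open>K\<^sup>2 * T\<close> unrestricted ones under the label \<open>(0, 0)\<close>.\<close>

definition colours :: "nat \<Rightarrow> nat \<Rightarrow> nat \<Rightarrow> ((nat \<times> nat) \<times> nat) set" where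
  "colours K M T = ({1..K} \<times> {1..K}) \<times> {..<M - T} \<union> {(0,0)} \<times> {..<K\<^sup>2 * T}"

lemma finite_colours: "finite (colours K M T)"
  unfolding colours_def by simp

lemma card_colours: "T \<le> M \<Longrightarrow> card (colours K M T) = K\<^sup>2 * M"
proof -
  assume TM: "T \<le> M"
  have "card (colours K M T) = card (({1..K} \<times> {1..K}) \<times> {..<M - T}) + card ({(0::nat,0::nat)} \<times> {..<K\<^sup>2 * T})"
    unfolding colours_def by (rule card_Un_disjoint) auto
  also have "\<dots> = K\<^sup>2 * (M - T) + K\<^sup>2 * T" by (simp add: card_cartesian_product power2_eq_square)
  also have "\<dots> = K\<^sup>2 * (M - T + T)" by (simp only: distrib_left)
  finally show ?thesis using TM by simp
qed

text \<open>The projection \<open>\<sigma>\<close> picks the coordinate of the cell that concerns the side in question; a row or a column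
  consists of \<open>K\<close> cells, whose degree errors are added up.\<close>

lemma side_assignment_from_cells:
  fixes F :: "nat \<times> nat \<Rightarrow> nat \<Rightarrow> 'a set set" and \<sigma> :: "nat \<times> nat \<Rightarrow> nat" and cellf :: "'a set \<Rightarrow> nat \<times> nat"
    and K M T \<eta> p :: nat
  assumes K: "0 < K" and V: "finite V" "card V \<le> \<eta>" and b: "bipart P Q H"
    and piec: "\<And>c. c \<in> colours K M T \<Longrightarrow> piece U (F (fst c) (snd c))"
    and Fdisj: "\<And>c d. c \<in> colours K M T \<Longrightarrow> d \<in> colours K M T \<Longrightarrow> c \<noteq> d \<Longrightarrow>
       F (fst c) (snd c) \<inter> F (fst d) (snd d) = {}"
    and FH: "(\<Union>c\<in>colours K M T. F (fst c) (snd c)) = H"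
    and finE: "\<And>v. v \<in> V \<Longrightarrow> finite (E v)" and EA: "\<And>v. v \<in> V \<Longrightarrow> E v \<subseteq> (\<Union>i\<in>{1..K}. A i)"
    and disj: "\<And>i j. i \<in> {1..K} \<Longrightarrow> j \<in> {1..K} \<Longrightarrow> i \<noteq> j \<Longrightarrow> A i \<inter> A j = {}"
    and \<sigma>: "\<And>z. z \<in> {1..K} \<times> {1..K} \<Longrightarrow> \<sigma> z \<in> {1..K}" "\<sigma> (0,0) = 0"
      "\<And>i. i \<in> {1..K} \<Longrightarrow> card {z \<in> {1..K} \<times> {1..K}. \<sigma> z = i} = K"
    and deg: "\<And>v. v \<in> V \<Longrightarrow> card (E v) + dg H v = 2 * (K\<^sup>2 * M)"
    and degi: "\<And>v i. v \<in> V \<Longrightarrow> i \<in> {1..K} \<Longrightarrow> card (E v) \<le> K * card (E v \<inter> A i) + K\<^sup>2 * \<eta>"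
    and dmax: "\<And>v. v \<in> V \<Longrightarrow> dg H v \<le> K\<^sup>2 * M + K\<^sup>2 * p"
    and dcell: "\<And>z v. z \<in> {1..K} \<times> {1..K} \<Longrightarrow> v \<in> V \<Longrightarrow>
       \<bar>real (dg {e \<in> H. cellf e = z} v) - real (dg H v) / (real K)\<^sup>2\<bar> \<le> real \<eta>"
    and dF: "\<And>z v. z \<in> {1..K} \<times> {1..K} \<Longrightarrow>
       dg {e \<in> H. cellf e = z} v \<le> (\<Sum>k<M - T. dg (F z k) v) + T + \<eta>"
    and left: "\<And>v. (\<Sum>k<K\<^sup>2 * T. dg (F (0,0) k) v) \<le> K\<^sup>2 * T"
    and small: "\<And>a. a \<in> (\<Union>i\<in>{1..K}. A i) \<Longrightarrow> dg H a \<le> \<eta>"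
    and par: "10 \<le> \<eta>" "100 * \<eta> \<le> T" "4 * T + p \<le> M"
  shows "\<exists>\<chi>. (\<forall>v\<in>V. \<forall>a\<in>E v. \<chi> v a \<in> colours K M T \<and> a \<notin> \<Union>(F (fst (\<chi> v a)) (snd (\<chi> v a))) \<and>
                 (\<sigma> (fst (\<chi> v a)) \<noteq> 0 \<longrightarrow> a \<in> A (\<sigma> (fst (\<chi> v a))))) \<and>
             (\<forall>v\<in>V. \<forall>c\<in>colours K M T. card {a \<in> E v. \<chi> v a = c} = 2 - dg (F (fst c) (snd c)) v) \<and>
             (\<forall>v\<in>V. \<forall>w\<in>V. v \<noteq> w \<longrightarrow> (\<forall>a\<in>E v \<inter> E w. \<chi> v a \<noteq> \<chi> w a))"
proof -
  let ?C = "colours K M T" let ?Z = "{1..K} \<times> {1..K}"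
  have K2: "0 < K\<^sup>2" using K by simp
  have slice: "{c \<in> ?C. \<sigma> (fst c) = i} = {z \<in> ?Z. \<sigma> z = i} \<times> {..<M - T}" if "i \<in> {1..K}" for i
    using \<sigma>(1,2) that unfolding colours_def by auto
  have nz: "\<sigma> z \<noteq> 0" if "z \<in> ?Z" for z using \<sigma>(1)[OF that] by auto
  have slice0: "{c \<in> ?C. \<sigma> (fst c) = 0} = {(0,0)} \<times> {..<K\<^sup>2 * T}"
  proof (intro equalityI subsetI)
    fix c assume c: "c \<in> {c \<in> ?C. \<sigma> (fst c) = 0}"
    then have "c \<notin> ?Z \<times> {..<M - T}" using nz[of "fst c"] by (metis (mono_tags) mem_Collect_eq mem_Times_iff)
    then show "c \<in> {(0,0)} \<times> {..<K\<^sup>2 * T}" using c unfolding colours_def by blast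
  next
    fix c assume "c \<in> {(0::nat,0::nat)} \<times> {..<K\<^sup>2 * T}"
    then show "c \<in> {c \<in> ?C. \<sigma> (fst c) = 0}" using \<sigma>(2) unfolding colours_def by (simp add: mem_Times_iff)
  qed
  show ?thesis
  proof (rule side_assignment[where F="\<lambda>c. F (fst c) (snd c)" and \<tau>="\<lambda>c. \<sigma> (fst c)" and C="?C",
        OF K V finite_colours b piec Fdisj FH finE EA disj])
    show "\<sigma> (fst c) \<le> K" if "c \<in> ?C" for c
    proof -
      have "fst c \<in> ?Z \<or> fst c = (0,0)" using that unfolding colours_def by auto
      then show ?thesis using \<sigma>(1)[of "fst c"] \<sigma>(2) by auto
    qed
    show "card ?C = K\<^sup>2 * M" by (rule card_colours) (use par in linarith)
    show "card {c \<in> ?C. \<sigma> (fst c) = i} = K * (M - T)" if "i \<in> {1..K}" for i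
      unfolding slice[OF that] card_cartesian_product \<sigma>(3)[OF that] by simp
    show "card {c \<in> ?C. \<sigma> (fst c) = 0} = K\<^sup>2 * T" unfolding slice0 by (simp add: card_cartesian_product)
    show "card (E v) + dg H v = 2 * (K\<^sup>2 * M)" if "v \<in> V" for v by (rule deg[OF that])
    show "2 * (K\<^sup>2 * M) \<le> K * card (E v \<inter> A i) + dg H v + K\<^sup>2 * \<eta>" if "v \<in> V" "i \<in> {1..K}" for v i
      using deg[OF that(1)] degi[OF that] by linarith
    show "dg H v \<le> K\<^sup>2 * M + K\<^sup>2 * p" if "v \<in> V" for v by (rule dmax[OF that])
    show "dg H v \<le> K * (\<Sum>c\<in>{c \<in> ?C. \<sigma> (fst c) = i}. dg (F (fst c) (snd c)) v) + K\<^sup>2 * (T + 2 * \<eta>)"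
      if v: "v \<in> V" and i: "i \<in> {1..K}" for v i
    proof -
      let ?S = "{z \<in> ?Z. \<sigma> z = i}" let ?f = "\<lambda>z. \<Sum>k<M - T. dg (F z k) v"
      have "(\<Sum>c\<in>{c \<in> ?C. \<sigma> (fst c) = i}. dg (F (fst c) (snd c)) v) = (\<Sum>z\<in>?S. ?f z)"
        unfolding slice[OF i] sum.cartesian_product by (simp add: case_prod_beta)
      moreover have "K * dg H v \<le> K\<^sup>2 * (\<Sum>z\<in>?S. ?f z) + K * (K\<^sup>2 * (T + 2 * \<eta>))"
      proof -
        have "dg H v \<le> K\<^sup>2 * ?f z + K\<^sup>2 * (T + 2 * \<eta>)" if z: "z \<in> ?S" for z
        proof -
          have zZ: "z \<in> ?Z" using z by blast
          have "real (dg H v) / real (K\<^sup>2) \<le> real (?f z + T + 2 * \<eta>)"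
            using dcell[OF zZ v] of_nat_mono[OF dF[OF zZ, of v], where 'a=real] by simp
          then have "real (dg H v) \<le> real (?f z + T + 2 * \<eta>) * real (K\<^sup>2)"
            using K2 by (simp add: divide_le_eq)
          then have "real (dg H v) \<le> real ((?f z + T + 2 * \<eta>) * K\<^sup>2)" by (simp only: of_nat_mult)
          then have "dg H v \<le> (?f z + T + 2 * \<eta>) * K\<^sup>2" by (rule of_nat_le_iff[THEN iffD1])
          then show ?thesis by (simp add: algebra_simps)
        qed
        then have "(\<Sum>z\<in>?S. dg H v) \<le> (\<Sum>z\<in>?S. K\<^sup>2 * ?f z + K\<^sup>2 * (T + 2 * \<eta>))" by (rule sum_mono)
        then show ?thesis unfolding sum_constant \<sigma>(3)[OF i] sum.distrib sum_distrib_left[symmetric] by simp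
      qed
      then have "K * dg H v \<le> K * (K * (\<Sum>z\<in>?S. ?f z) + K\<^sup>2 * (T + 2 * \<eta>))"
        by (simp only: distrib_left power2_eq_square mult.assoc)
      then have "dg H v \<le> K * (\<Sum>z\<in>?S. ?f z) + K\<^sup>2 * (T + 2 * \<eta>)" using K by simp
      ultimately show ?thesis by simp
    qed
    show "(\<Sum>c\<in>{c \<in> ?C. \<sigma> (fst c) = 0}. dg (F (fst c) (snd c)) v) \<le> K\<^sup>2 * T" if "v \<in> V" for v
    proof -
      have "(\<Sum>c\<in>{(0,0)} \<times> {..<K\<^sup>2 * T}. dg (F (fst c) (snd c)) v) = (\<Sum>z\<in>{(0,0)}. \<Sum>k<K\<^sup>2 * T. dg (F z k) v)"
        unfolding sum.cartesian_product by (simp add: case_prod_beta)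
      then show ?thesis unfolding slice0 using left[of v] by simp
    qed
    show "dg H a \<le> \<eta>" if "a \<in> (\<Union>i\<in>{1..K}. A i)" for a by (rule small[OF that])
  qed (fact par | assumption)+
qed

section \<open>Assembling the systems\<close>

text \<open>What the construction uses of the graph. Here \<open>\<eta>\<close> bounds the error of every equitable splitting and the crossing degree of
  nonexceptional vertices. The set \<open>X\<close> holds the heavy ones among \<open>w\<^sub>1, w\<^sub>2\<close>, and \<open>y\<close> is a possible third heavy vertex; if
  its crossing degree is large, then so is the number \<open>q\<close> of four-edge pieces.\<close>

locale hes_setup =
  fixes G :: "'a graph" and A B :: "nat \<Rightarrow> 'a set" and K M T \<eta> p q \<nu> :: nat and \<rho> \<epsilon>\<^sub>0 :: real
    and X :: "'a set" and y :: 'a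
  assumes K: "0 < K" and simple: "simple_graph G" and vG: "verts G = side K A \<union> side K B"
    and dA: "i \<le> K \<Longrightarrow> j \<le> K \<Longrightarrow> i \<noteq> j \<Longrightarrow> A i \<inter> A j = {}"
    and dB: "i \<le> K \<Longrightarrow> j \<le> K \<Longrightarrow> i \<noteq> j \<Longrightarrow> B i \<inter> B j = {}"
    and dAB: "i \<le> K \<Longrightarrow> j \<le> K \<Longrightarrow> A i \<inter> B j = {}"
    and noin: "e \<in> edges G \<Longrightarrow> \<not> e \<subseteq> clusters K A" "e \<in> edges G \<Longrightarrow> \<not> e \<subseteq> clusters K B"
      "e \<in> edges G \<Longrightarrow> \<not> e \<subseteq> A 0" "e \<in> edges G \<Longrightarrow> \<not> e \<subseteq> B 0"
    and deg0: "v \<in> A 0 \<union> B 0 \<Longrightarrow> deg G v = 2 * (K\<^sup>2 * M)"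
    and cV0: "card (A 0 \<union> B 0) \<le> \<nu>" and \<rho>: "0 \<le> \<rho>" "3 * \<rho> + 2 * real \<nu> + 1 \<le> real \<eta>"
    and eAB: "i \<in> {1..K} \<Longrightarrow> j \<in> {1..K} \<Longrightarrow>
       \<bar>real (e_between G (A i) (B j)) - real (e_between G (clusters K A) (clusters K B)) / (real K)\<^sup>2\<bar> \<le> \<rho>"
    and e0B: "j \<in> {1..K} \<Longrightarrow>
       \<bar>real (e_between G (A 0) (B j)) - real (e_between G (A 0) (clusters K B)) / real K\<bar> \<le> \<rho> * real K"
    and eA0: "i \<in> {1..K} \<Longrightarrow>
       \<bar>real (e_between G (B 0) (A i)) - real (e_between G (B 0) (clusters K A)) / real K\<bar> \<le> \<rho> * real K"
    and dinA: "v \<in> A 0 \<union> B 0 \<Longrightarrow> i \<in> {1..K} \<Longrightarrow>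
       \<bar>real (deg_in G v (A i)) - real (deg_in G v (clusters K A)) / real K\<bar> \<le> \<rho> * real K"
    and dinB: "v \<in> A 0 \<union> B 0 \<Longrightarrow> i \<in> {1..K} \<Longrightarrow>
       \<bar>real (deg_in G v (B i)) - real (deg_in G v (clusters K B)) / real K\<bar> \<le> \<rho> * real K"
    and cH: "card (edges (bip G (side K A) (side K B))) = 2 * K\<^sup>2 * M + 2 * q"
    and U: "v \<notin> A 0 \<union> B 0 \<Longrightarrow> dg (edges (bip G (side K A) (side K B))) v \<le> \<eta>"
    and X: "finite X" "card X \<le> 2" "y \<notin> X" "X \<subseteq> A 0 \<union> B 0"
    and dX: "v \<in> X \<Longrightarrow> dg (edges (bip G (side K A) (side K B))) v \<le> K\<^sup>2 * M"
      "v \<in> X \<Longrightarrow> K\<^sup>2 * (T + 2 + \<eta>) \<le> dg (edges (bip G (side K A) (side K B))) v"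
    and small: "v \<notin> X \<Longrightarrow> v \<noteq> y \<Longrightarrow> dg (edges (bip G (side K A) (side K B))) v + K\<^sup>2 * (2 * T + \<eta>) \<le> K\<^sup>2 * M"
    and dmax: "dg (edges (bip G (side K A) (side K B))) v \<le> K\<^sup>2 * M + K\<^sup>2 * p"
    and dy: "dg (edges (bip G (side K A) (side K B))) y + K\<^sup>2 * (2 * T + \<eta>) \<le> K\<^sup>2 * M \<or>
       K\<^sup>2 * (p + 2 * T + 6 * \<eta> + 2) \<le> q"
    and par: "10 \<le> \<eta>" "100 * \<eta> \<le> T" "4 * T + p \<le> M" "q + K\<^sup>2 * (2 * T) \<le> K\<^sup>2 * M"
    and eps: "4 \<le> sqrt \<epsilon>\<^sub>0 * real (card (verts G))"
begin

abbreviation "cA \<equiv> clusters K A"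
abbreviation "cB \<equiv> clusters K B"
abbreviation "A' \<equiv> side K A"
abbreviation "B' \<equiv> side K B"
abbreviation "V\<^sub>0 \<equiv> A 0 \<union> B 0"
abbreviation "H \<equiv> edges (bip G A' B')"
abbreviation "Z \<equiv> {1..K} \<times> {1..K}"

lemma clusterE:
  assumes "x \<in> side K S"
  obtains i where "i \<le> K" "x \<in> S i"
  using assms unfolding side_def clusters_def by (elim UnE UN_E) auto

lemma cluster_in_side: "i \<le> K \<Longrightarrow> S i \<subseteq> side K S"
  unfolding side_def clusters_def by (cases "i = 0") auto

lemma sides_disjoint: "A' \<inter> B' = {}"
proof -
  have "x \<notin> B'" if "x \<in> A'" for x
  proof
    assume "x \<in> B'"
    then obtain j where "j \<le> K" "x \<in> B j" by (rule clusterE)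
    moreover obtain i where "i \<le> K" "x \<in> A i" using \<open>x \<in> A'\<close> by (rule clusterE)
    ultimately show False using dAB by blast
  qed
  then show ?thesis by blast
qed

lemma zero_disjoint: "A 0 \<inter> cA = {}" "B 0 \<inter> cB = {}"
proof -
  have "A 0 \<inter> A i = {}" "B 0 \<inter> B i = {}" if "i \<in> {1..K}" for i
    using dA[of 0 i] dB[of 0 i] that by auto
  then show "A 0 \<inter> cA = {}" "B 0 \<inter> cB = {}" unfolding clusters_def by blast+
qed

lemma finite_verts: "finite A'" "finite B'"
  using simple vG unfolding simple_graph_def by auto

lemma bipH: "bipart A' B' H"
  by (rule bipart_bip[OF simple sides_disjoint])

text \<open>This translates the regularity conditions of the scheme, stated by edge counts between clusters, into the
  hypotheses of the cell lemma, where edges are classified by the clusters of their ends.\<close>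

lemma cells_exist:
  obtains cellf where "\<And>e. e \<in> H \<Longrightarrow> cellf e \<in> Z"
    "\<And>e. e \<in> H \<Longrightarrow> e \<subseteq> V\<^sub>0 \<union> A (fst (cellf e)) \<union> B (snd (cellf e))"
    "\<And>z. z \<in> Z \<Longrightarrow> \<bar>real (card {e \<in> H. cellf e = z}) - real (card H) / (real K)\<^sup>2\<bar> \<le> real \<eta>"
    "\<And>z v. z \<in> Z \<Longrightarrow> v \<in> V\<^sub>0 \<Longrightarrow>
       \<bar>real (dg {e \<in> H. cellf e = z} v) - real (dg H v) / (real K)\<^sup>2\<bar> \<le> real \<eta>"
proof -
  define pa where "pa e = (THE x. x \<in> e \<and> x \<in> A')" for e :: "'a set"
  define pb where "pb e = (THE x. x \<in> e \<and> x \<in> B')" for e :: "'a set"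
  define ia where "ia e = (THE i. i \<le> K \<and> pa e \<in> A i)" for e
  define ib where "ib e = (THE i. i \<le> K \<and> pb e \<in> B i)" for e
  have pe: "pa e \<in> A' \<and> pb e \<in> B' \<and> pa e \<in> e \<and> pb e \<in> e \<and> e \<subseteq> {pa e, pb e}" if eH: "e \<in> H" for e
  proof -
    obtain x y where xy: "e = {x,y}" "x \<in> A'" "y \<in> B'" "x \<notin> B'" "y \<notin> A'"
      by (rule bipart_edgeE[OF bipH eH])
    have "pa e = x" unfolding pa_def by (rule the_equality) (use xy in auto)
    moreover have "pb e = y" unfolding pb_def by (rule the_equality) (use xy in auto)
    ultimately show ?thesis using xy by simp
  qed
  have ia: "ia e = i \<longleftrightarrow> pa e \<in> A i" if e: "e \<in> H" and i: "i \<le> K" for e i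
  proof -
    obtain k where k: "k \<le> K" "pa e \<in> A k" using pe[OF e] by (blast elim: clusterE)
    have uniq: "j = k" if "j \<le> K" "pa e \<in> A j" for j using dA[of j k] that k by blast
    have ek: "ia e = k" unfolding ia_def
    proof (rule the_equality)
      show "k \<le> K \<and> pa e \<in> A k" using k by simp
      show "j = k" if "j \<le> K \<and> pa e \<in> A j" for j using uniq[of j] that by simp
    qed
    show ?thesis
    proof
      assume "ia e = i"
      then show "pa e \<in> A i" using k(2) unfolding ek by simp
    next
      assume "pa e \<in> A i"
      then show "ia e = i" using uniq[OF i] unfolding ek by simp
    qed
  qed
  have ib: "ib e = i \<longleftrightarrow> pb e \<in> B i" if e: "e \<in> H" and i: "i \<le> K" for e i
  proof -
    obtain k where k: "k \<le> K" "pb e \<in> B k" using pe[OF e] by (blast elim: clusterE)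
    have uniq: "j = k" if "j \<le> K" "pb e \<in> B j" for j using dB[of j k] that k by blast
    have ek: "ib e = k" unfolding ib_def
    proof (rule the_equality)
      show "k \<le> K \<and> pb e \<in> B k" using k by simp
      show "j = k" if "j \<le> K \<and> pb e \<in> B j" for j using uniq[of j] that by simp
    qed
    show ?thesis
    proof
      assume "ib e = i"
      then show "pb e \<in> B i" using k(2) unfolding ek by simp
    next
      assume "pb e \<in> B i"
      then show "ib e = i" using uniq[OF i] unfolding ek by simp
    qed
  qed
  have iaK: "ia e \<le> K" if e: "e \<in> H" for e
  proof -
    obtain k where "k \<le> K" "pa e \<in> A k" using pe[OF e] by (blast elim: clusterE)
    then show ?thesis using ia[OF e] by blast
  qed
  have ibK: "ib e \<le> K" if e: "e \<in> H" for e
  proof -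
    obtain k where "k \<le> K" "pb e \<in> B k" using pe[OF e] by (blast elim: clusterE)
    then show ?thesis using ib[OF e] by blast
  qed
  have ia0: "ia e \<noteq> 0 \<longleftrightarrow> pa e \<in> cA" if e: "e \<in> H" for e
  proof -
    have "pa e \<in> A 0 \<or> pa e \<in> cA" using pe[OF e] unfolding side_def by blast
    moreover have "\<not> (pa e \<in> A 0 \<and> pa e \<in> cA)" using zero_disjoint(1) by blast
    moreover have "ia e = 0 \<longleftrightarrow> pa e \<in> A 0" by (rule ia[OF e le0])
    ultimately show ?thesis by argo
  qed
  have ib0: "ib e \<noteq> 0 \<longleftrightarrow> pb e \<in> cB" if e: "e \<in> H" for e
  proof -
    have "pb e \<in> B 0 \<or> pb e \<in> cB" using pe[OF e] unfolding side_def by blast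
    moreover have "\<not> (pb e \<in> B 0 \<and> pb e \<in> cB)" using zero_disjoint(2) by blast
    moreover have "ib e = 0 \<longleftrightarrow> pb e \<in> B 0" by (rule ib[OF e le0])
    ultimately show ?thesis by argo
  qed
  have cnt: "card {e \<in> H. pa e \<in> S \<and> pb e \<in> S'} = e_between G S S'" if S: "S \<subseteq> A'" "S' \<subseteq> B'" for S S'
  proof -
    have "{e \<in> H. pa e \<in> S \<and> pb e \<in> S'} = {e \<in> edges G. \<exists>x\<in>S. \<exists>y\<in>S'. e = {x, y}}"
    proof (intro equalityI subsetI)
      fix e assume e: "e \<in> {e \<in> H. pa e \<in> S \<and> pb e \<in> S'}"
      then have "e \<in> edges G" unfolding edges_bip by simp
      moreover have "e = {pa e, pb e}" using pe[of e] e by blast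
      ultimately show "e \<in> {e \<in> edges G. \<exists>x\<in>S. \<exists>y\<in>S'. e = {x, y}}" using e by blast
    next
      fix e assume "e \<in> {e \<in> edges G. \<exists>x\<in>S. \<exists>y\<in>S'. e = {x, y}}"
      then obtain x y where xy: "e \<in> edges G" "x \<in> S" "y \<in> S'" "e = {x, y}" by blast
      then have eH: "e \<in> H" unfolding edges_bip using S by blast
      have d: "x \<in> A'" "y \<in> B'" "x \<notin> B'" "y \<notin> A'" using xy S sides_disjoint by auto
      have "pa e \<in> {x, y}" "pb e \<in> {x, y}" using pe[OF eH] unfolding xy(4)[symmetric] by blast+
      then have "pa e = x" "pb e = y" using pe[OF eH] d by auto
      then show "e \<in> {e \<in> H. pa e \<in> S \<and> pb e \<in> S'}" using eH xy by simp
    qed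
    then show ?thesis unfolding e_between_def by simp
  qed
  have sub: "A i \<subseteq> A'" "B i \<subseteq> B'" if "i \<le> K" for i
    by (rule cluster_in_side[OF that])+
  have subc: "cA \<subseteq> A'" "cB \<subseteq> B'" unfolding side_def by auto
  have cong: "card {e \<in> H. P e} = card {e \<in> H. R e}" if "\<And>e. e \<in> H \<Longrightarrow> P e = R e" for P R
    by (intro arg_cong[where f=card] Collect_cong conj_cong refl that)
  have fin0: "finite (A 0)" "finite (B 0)"
    by (rule finite_subset[OF sub(1) finite_verts(1)], simp) (rule finite_subset[OF sub(2) finite_verts(2)], simp)
  have nA: "card (A 0) \<le> \<nu>" "card (B 0) \<le> \<nu>"
  proof -
    have "finite (A 0 \<union> B 0)" using fin0 by simp
    then show "card (A 0) \<le> \<nu>" "card (B 0) \<le> \<nu>"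
      using cV0 card_mono[of "A 0 \<union> B 0" "A 0"] card_mono[of "A 0 \<union> B 0" "B 0"] by auto
  qed
  have c1: "card {e \<in> H. ia e = i \<and> ib e = j} = e_between G (A i) (B j)" if "i \<le> K" "j \<le> K" for i j
  proof -
    have "card {e \<in> H. ia e = i \<and> ib e = j} = card {e \<in> H. pa e \<in> A i \<and> pb e \<in> B j}"
      by (rule cong) (use ia ib that in simp)
    then show ?thesis using cnt[OF sub(1)[OF that(1)] sub(2)[OF that(2)]] by simp
  qed
  have c2: "card {e \<in> H. ia e \<noteq> 0 \<and> ib e \<noteq> 0} = e_between G cA cB"
  proof -
    have "card {e \<in> H. ia e \<noteq> 0 \<and> ib e \<noteq> 0} = card {e \<in> H. pa e \<in> cA \<and> pb e \<in> cB}"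
      by (rule cong) (use ia0 ib0 in simp)
    then show ?thesis using cnt[OF subc] by simp
  qed
  have c3: "card {e \<in> H. ia e = 0 \<and> ib e \<noteq> 0} = e_between G (A 0) cB"
  proof -
    have "card {e \<in> H. ia e = 0 \<and> ib e \<noteq> 0} = card {e \<in> H. pa e \<in> A 0 \<and> pb e \<in> cB}"
      by (rule cong) (use ia ib0 in simp)
    then show ?thesis using cnt[OF sub(1)[of 0] subc(2)] by simp
  qed
  have c4: "card {e \<in> H. ib e = 0 \<and> ia e \<noteq> 0} = e_between G (B 0) cA"
  proof -
    have "card {e \<in> H. ib e = 0 \<and> ia e \<noteq> 0} = card {e \<in> H. pa e \<in> cA \<and> pb e \<in> B 0}"
      by (rule cong) (use ia0 ib in auto)
    then show ?thesis using cnt[OF subc(1) sub(2)[of 0]] by (simp add: e_between_commute)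
  qed
  have c5: "card {e \<in> H. ib e = 0 \<and> ia e = i} = e_between G (B 0) (A i)" if "i \<le> K" for i
  proof -
    have "card {e \<in> H. ib e = 0 \<and> ia e = i} = card {e \<in> H. pa e \<in> A i \<and> pb e \<in> B 0}"
      by (rule cong) (use ia ib that in auto)
    then show ?thesis using cnt[OF sub(1)[OF that] sub(2)[of 0]] by (simp add: e_between_commute)
  qed
  have x1: "card {e \<in> H. pa e = x \<and> pb e \<in> S} = deg_in G x S" if "x \<in> A'" "S \<subseteq> B'" for x S
    using cnt[of "{x}" S] that by (simp add: e_between_single)
  have x2: "card {e \<in> H. pb e = x \<and> pa e \<in> S} = deg_in G x S" if "x \<in> B'" "S \<subseteq> A'" for x S
  proof -
    have "card {e \<in> H. pb e = x \<and> pa e \<in> S} = card {e \<in> H. pa e \<in> S \<and> pb e \<in> {x}}" by (rule cong) auto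
    also have "\<dots> = e_between G S {x}" by (rule cnt) (use that in auto)
    finally show ?thesis by (simp add: e_between_commute[of G S] e_between_single)
  qed
  have y1: "card {e \<in> H. pa e = x \<and> ib e = j} = deg_in G x (B j)" if "x \<in> A'" "j \<le> K" for x j
    using x1[OF that(1) sub(2)[OF that(2)]] cong[of "\<lambda>e. pa e = x \<and> ib e = j" "\<lambda>e. pa e = x \<and> pb e \<in> B j"] ib that(2) by simp
  have y2: "card {e \<in> H. pa e = x \<and> ib e \<noteq> 0} = deg_in G x cB" if "x \<in> A'" for x
    using x1[OF that subc(2)] cong[of "\<lambda>e. pa e = x \<and> ib e \<noteq> 0" "\<lambda>e. pa e = x \<and> pb e \<in> cB"] ib0 by simp
  have y3: "card {e \<in> H. pb e = x \<and> ia e = j} = deg_in G x (A j)" if "x \<in> B'" "j \<le> K" for x j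
    using x2[OF that(1) sub(1)[OF that(2)]] cong[of "\<lambda>e. pb e = x \<and> ia e = j" "\<lambda>e. pb e = x \<and> pa e \<in> A j"] ia that(2) by simp
  have y4: "card {e \<in> H. pb e = x \<and> ia e \<noteq> 0} = deg_in G x cA" if "x \<in> B'" for x
    using x2[OF that subc(1)] cong[of "\<lambda>e. pb e = x \<and> ia e \<noteq> 0" "\<lambda>e. pb e = x \<and> pa e \<in> cA"] ia0 by simp
  have A0: "x \<in> A'" if "x \<in> A 0" for x using sub(1)[of 0] that by blast
  have B0: "x \<in> B'" if "x \<in> B 0" for x using sub(2)[of 0] that by blast
  have "\<exists>cellf. (\<forall>e\<in>H. cellf e \<in> {1..K} \<times> {1..K} \<and> ia e \<in> {0, fst (cellf e)} \<and> ib e \<in> {0, snd (cellf e)}) \<and>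
    (\<forall>z\<in>{1..K} \<times> {1..K}. \<bar>real (card {e \<in> H. cellf e = z}) - real (card H) / (real K)\<^sup>2\<bar> \<le> 3 * \<rho> + 2 * real \<nu> + 1) \<and>
    (\<forall>z\<in>{1..K} \<times> {1..K}. \<forall>x\<in>A 0. \<bar>real (card {e \<in> H. cellf e = z \<and> pa e = x}) - real (card {e \<in> H. pa e = x}) / (real K)\<^sup>2\<bar> \<le> \<rho> + real \<nu> + 1) \<and>
    (\<forall>z\<in>{1..K} \<times> {1..K}. \<forall>y\<in>B 0. \<bar>real (card {e \<in> H. cellf e = z \<and> pb e = y}) - real (card {e \<in> H. pb e = y}) / (real K)\<^sup>2\<bar> \<le> \<rho> + real \<nu> + 1)"
  proof (rule cell_split[OF bipart_finite[OF bipH] K iaK ibK fin0])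
    show "real (card (A 0)) \<le> real \<nu>" "real (card (B 0)) \<le> real \<nu>" using nA by simp_all
    show "(ia e = 0) = (pa e \<in> A 0)" if "e \<in> H" for e using ia[OF that, of 0] by simp
    show "(ib e = 0) = (pb e \<in> B 0)" if "e \<in> H" for e using ib[OF that, of 0] by simp
    show "\<bar>real (card {e \<in> H. ia e = i \<and> ib e = j}) - real (card {e \<in> H. ia e \<noteq> 0 \<and> ib e \<noteq> 0}) / (real K)\<^sup>2\<bar> \<le> \<rho>"
      if "i \<in> {1..K}" "j \<in> {1..K}" for i j
      using eAB[OF that] c1[of i j] that unfolding c2 by simp
    show "\<bar>real (card {e \<in> H. ia e = 0 \<and> ib e = j}) - real (card {e \<in> H. ia e = 0 \<and> ib e \<noteq> 0}) / real K\<bar> \<le> \<rho> * real K"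
      if "j \<in> {1..K}" for j using e0B[OF that] c1[of 0 j] that unfolding c3 by simp
    show "\<bar>real (card {e \<in> H. ib e = 0 \<and> ia e = i}) - real (card {e \<in> H. ib e = 0 \<and> ia e \<noteq> 0}) / real K\<bar> \<le> \<rho> * real K"
      if "i \<in> {1..K}" for i using eA0[OF that] c5[of i] that unfolding c4 by simp
    show "\<bar>real (card {e \<in> H. pa e = x \<and> ib e = j}) - real (card {e \<in> H. pa e = x \<and> ib e \<noteq> 0}) / real K\<bar> \<le> \<rho> * real K"
      if "x \<in> A 0" "j \<in> {1..K}" for x j
      using dinB[of x j] y1[OF A0[OF that(1)], of j] y2[OF A0[OF that(1)]] that by simp
    show "\<bar>real (card {e \<in> H. pb e = x \<and> ia e = j}) - real (card {e \<in> H. pb e = x \<and> ia e \<noteq> 0}) / real K\<bar> \<le> \<rho> * real K"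
      if "x \<in> B 0" "j \<in> {1..K}" for x j
      using dinA[of x j] y3[OF B0[OF that(1)], of j] y4[OF B0[OF that(1)]] that by simp
    have din: "deg_in G x S \<le> card S" if "finite S" for x S
      unfolding deg_in_def by (rule card_mono[OF that]) auto
    show "real (card {e \<in> H. pa e = x \<and> ib e = 0}) \<le> real \<nu>" if "x \<in> A 0" for x
      using y1[OF A0[OF that], of 0] din[OF fin0(2), of x] nA(2) by simp
    show "real (card {e \<in> H. pb e = x \<and> ia e = 0}) \<le> real \<nu>" if "x \<in> B 0" for x
      using y3[OF B0[OF that], of 0] din[OF fin0(1), of x] nA(1) by simp
  qed
  then obtain cellf where cf: "\<forall>e\<in>H. cellf e \<in> Z \<and> ia e \<in> {0, fst (cellf e)} \<and> ib e \<in> {0, snd (cellf e)}"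
    "\<forall>z\<in>Z. \<bar>real (card {e \<in> H. cellf e = z}) - real (card H) / (real K)\<^sup>2\<bar> \<le> 3 * \<rho> + 2 * real \<nu> + 1"
    "\<forall>z\<in>Z. \<forall>x\<in>A 0. \<bar>real (card {e \<in> H. cellf e = z \<and> pa e = x}) - real (card {e \<in> H. pa e = x}) / (real K)\<^sup>2\<bar> \<le> \<rho> + real \<nu> + 1"
    "\<forall>z\<in>Z. \<forall>y\<in>B 0. \<bar>real (card {e \<in> H. cellf e = z \<and> pb e = y}) - real (card {e \<in> H. pb e = y}) / (real K)\<^sup>2\<bar> \<le> \<rho> + real \<nu> + 1"
    by (elim exE conjE) (rule that)
  have dgA: "dg {e \<in> H. P e} x = card {e \<in> H. P e \<and> pa e = x}" if x: "x \<in> A'" for x P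
    unfolding dg_def
  proof (rule arg_cong[where f=card], intro equalityI subsetI)
    fix e assume e: "e \<in> {e \<in> {e \<in> H. P e}. x \<in> e}"
    then have "x = pa e \<or> x = pb e" "pb e \<in> B'" using pe[of e] by blast+
    then show "e \<in> {e \<in> H. P e \<and> pa e = x}" using e x sides_disjoint by auto
  next
    fix e assume e: "e \<in> {e \<in> H. P e \<and> pa e = x}"
    then have "x \<in> e" using pe[of e] by blast
    then show "e \<in> {e \<in> {e \<in> H. P e}. x \<in> e}" using e by simp
  qed
  have dgB: "dg {e \<in> H. P e} x = card {e \<in> H. P e \<and> pb e = x}" if x: "x \<in> B'" for x P
    unfolding dg_def
  proof (rule arg_cong[where f=card], intro equalityI subsetI)
    fix e assume e: "e \<in> {e \<in> {e \<in> H. P e}. x \<in> e}"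
    then have "x = pa e \<or> x = pb e" "pa e \<in> A'" using pe[of e] by blast+
    then show "e \<in> {e \<in> H. P e \<and> pb e = x}" using e x sides_disjoint by auto
  next
    fix e assume e: "e \<in> {e \<in> H. P e \<and> pb e = x}"
    then have "x \<in> e" using pe[of e] by blast
    then show "e \<in> {e \<in> {e \<in> H. P e}. x \<in> e}" using e by simp
  qed
  have \<eta>: "\<rho> + real \<nu> + 1 \<le> real \<eta>" using \<rho> by linarith
  show thesis
  proof (rule that[of cellf])
    show "cellf e \<in> Z" if "e \<in> H" for e using cf(1) that by blast
    show "e \<subseteq> V\<^sub>0 \<union> A (fst (cellf e)) \<union> B (snd (cellf e))" if e: "e \<in> H" for e
    proof -
      have "pa e \<in> A (ia e)" using ia[OF e iaK[OF e]] by blast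
      then have "pa e \<in> A 0 \<union> A (fst (cellf e))" using cf(1) e by fastforce
      moreover have "pb e \<in> B (ib e)" using ib[OF e ibK[OF e]] by blast
      then have "pb e \<in> B 0 \<union> B (snd (cellf e))" using cf(1) e by fastforce
      moreover have "e \<subseteq> {pa e, pb e}" using pe[OF e] by blast
      ultimately show ?thesis by blast
    qed
    show "\<bar>real (card {e \<in> H. cellf e = z}) - real (card H) / (real K)\<^sup>2\<bar> \<le> real \<eta>" if "z \<in> Z" for z
      using bspec[OF cf(2) that] \<rho>(2) by linarith
    show "\<bar>real (dg {e \<in> H. cellf e = z} v) - real (dg H v) / (real K)\<^sup>2\<bar> \<le> real \<eta>" if z: "z \<in> Z" and v: "v \<in> V\<^sub>0" for z v
    proof (cases "v \<in> A 0")
      case True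
      have "dg H v = card {e \<in> H. pa e = v}" using dgA[OF A0[OF True], of "\<lambda>_. True"] by simp
      then show ?thesis
        using bspec[OF bspec[OF cf(3) z] True] dgA[OF A0[OF True], of "\<lambda>e. cellf e = z"] \<eta> by simp
    next
      case False
      then have vB: "v \<in> B 0" using v by blast
      have "dg H v = card {e \<in> H. pb e = v}" using dgB[OF B0[OF vB], of "\<lambda>_. True"] by simp
      then show ?thesis
        using bspec[OF bspec[OF cf(4) z] vB] dgB[OF B0[OF vB], of "\<lambda>e. cellf e = z"] \<eta> by simp
    qed
  qed
qed

lemma crossing_not_within:
  assumes "e \<in> H"
  shows "\<not> e \<subseteq> A'" "\<not> e \<subseteq> B'"
  using assms sides_disjoint unfolding edges_bip by auto

text \<open>Colour the crossing edges by pieces, then the remaining edges at the exceptional vertices, first for \<open>A\<close> and then for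
  \<open>B\<close>, by the piece that receives them. The two sides do not interact, as pendant neighbours of
  \<open>A\<^sub>0\<close> lie in \<open>A\<close> and those of \<open>B\<^sub>0\<close> in \<open>B\<close>. Every edge has exactly one colour, and the colour classes are the systems.\<close>

lemma systems_exist:
  "\<exists>\<J> :: 'a graph set. finite \<J> \<and> card \<J> = K\<^sup>2 * M \<and>
     (\<forall>J\<in>\<J>. subgraph J G \<and> HES \<epsilon>\<^sub>0 K A B J) \<and>
     (\<forall>J\<in>\<J>. \<forall>J'\<in>\<J>. J \<noteq> J' \<longrightarrow> edges J \<inter> edges J' = {}) \<and>
     (\<Union>J\<in>\<J>. edges J) = edges G \<and>
     (\<forall>i\<in>{1..K}. \<forall>i'\<in>{1..K}. \<exists>\<S> \<subseteq> \<J>. card \<S> = M - T \<and>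
        (\<forall>J\<in>\<S>. local_HES \<epsilon>\<^sub>0 K A B i i' J) \<and>
        (\<exists>\<T> \<subseteq> \<S>. card \<T> = T \<and>
           (\<forall>J\<in>\<T>. e_between J A' B' = 2 \<and> (\<forall>w\<in>X. deg (bip J A' B') w = 1))))"
proof -
  obtain cellf where cf: "\<And>e. e \<in> H \<Longrightarrow> cellf e \<in> Z"
    "\<And>e. e \<in> H \<Longrightarrow> e \<subseteq> V\<^sub>0 \<union> A (fst (cellf e)) \<union> B (snd (cellf e))"
    "\<And>z. z \<in> Z \<Longrightarrow> \<bar>real (card {e \<in> H. cellf e = z}) - real (card H) / (real K)\<^sup>2\<bar> \<le> real \<eta>"
    "\<And>z v. z \<in> Z \<Longrightarrow> v \<in> V\<^sub>0 \<Longrightarrow>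
       \<bar>real (dg {e \<in> H. cellf e = z} v) - real (dg H v) / (real K)\<^sup>2\<bar> \<le> real \<eta>"
    by (rule cells_exist) blast
  have "\<exists>F :: nat \<times> nat \<Rightarrow> nat \<Rightarrow> 'a set set.
    (\<forall>z\<in>Z. \<forall>k<M - T. piece V\<^sub>0 (F z k) \<and> F z k \<subseteq> {e \<in> H. cellf e = z}) \<and>
    (\<forall>z\<in>Z. \<forall>k<T. pair_matching (F z k) \<and> (\<forall>v\<in>X. dg (F z k) v = 1)) \<and>
    (\<forall>z\<in>Z. \<forall>k<M - T. \<forall>l<M - T. k \<noteq> l \<longrightarrow> F z k \<inter> F z l = {}) \<and>
    (\<forall>k<K\<^sup>2 * T. piece V\<^sub>0 (F (0,0) k) \<and> F (0,0) k \<subseteq> H) \<and>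
    (\<forall>k<K\<^sup>2 * T. \<forall>l<K\<^sup>2 * T. k \<noteq> l \<longrightarrow> F (0,0) k \<inter> F (0,0) l = {}) \<and>
    (\<forall>z\<in>Z. \<forall>k<M - T. \<forall>l<K\<^sup>2 * T. F z k \<inter> F (0,0) l = {}) \<and>
    ((\<Union>z\<in>Z. \<Union>k<M - T. F z k) \<union> (\<Union>k<K\<^sup>2 * T. F (0,0) k) = H) \<and>
    (\<forall>z\<in>Z. \<forall>v. dg {e \<in> H. cellf e = z} v \<le> (\<Sum>k<M - T. dg (F z k) v) + T + \<eta>) \<and>
    (\<forall>v. (\<Sum>k<K\<^sup>2 * T. dg (F (0,0) k) v) \<le> K\<^sup>2 * T)"
    by (rule cross_decomposition[OF bipH K cH cf(1,3,4) U X dX small dmax dy par])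
  then obtain F where F1: "\<forall>z\<in>Z. \<forall>k<M - T. piece V\<^sub>0 (F z k) \<and> F z k \<subseteq> {e \<in> H. cellf e = z}"
    and F2: "\<forall>z\<in>Z. \<forall>k<T. pair_matching (F z k) \<and> (\<forall>v\<in>X. dg (F z k) v = 1)"
    and F3: "\<forall>z\<in>Z. \<forall>k<M - T. \<forall>l<M - T. k \<noteq> l \<longrightarrow> F z k \<inter> F z l = {}"
    and F4: "\<forall>k<K\<^sup>2 * T. piece V\<^sub>0 (F (0,0) k) \<and> F (0,0) k \<subseteq> H"
    and F5: "\<forall>k<K\<^sup>2 * T. \<forall>l<K\<^sup>2 * T. k \<noteq> l \<longrightarrow> F (0,0) k \<inter> F (0,0) l = {}"
    and F6: "\<forall>z\<in>Z. \<forall>k<M - T. \<forall>l<K\<^sup>2 * T. F z k \<inter> F (0,0) l = {}"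
    and F7: "(\<Union>z\<in>Z. \<Union>k<M - T. F z k) \<union> (\<Union>k<K\<^sup>2 * T. F (0,0) k) = H"
    and F8: "\<forall>z\<in>Z. \<forall>v. dg {e \<in> H. cellf e = z} v \<le> (\<Sum>k<M - T. dg (F z k) v) + T + \<eta>"
    and F9: "\<forall>v. (\<Sum>k<K\<^sup>2 * T. dg (F (0,0) k) v) \<le> K\<^sup>2 * T"
    by (elim exE conjE) (rule that)
  have F1a: "piece V\<^sub>0 (F z k)" and F1b: "F z k \<subseteq> {e \<in> H. cellf e = z}" if "z \<in> Z" "k < M - T" for z k
    using bspec[OF F1 that(1)] that(2) by simp_all
  have F3r: "F z k \<inter> F z l = {}" if "z \<in> Z" "k < M - T" "l < M - T" "k \<noteq> l" for z k l
    using bspec[OF F3 that(1)] that(2-4) by simp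
  have F4a: "piece V\<^sub>0 (F (0,0) k)" and F4b: "F (0,0) k \<subseteq> H" if "k < K\<^sup>2 * T" for k
    using spec[OF F4, of k] that by simp_all
  have F5r: "F (0,0) k \<inter> F (0,0) l = {}" if "k < K\<^sup>2 * T" "l < K\<^sup>2 * T" "k \<noteq> l" for k l
    using spec[OF F5, of k] that by simp
  have F6r: "F z k \<inter> F (0,0) l = {}" if "z \<in> Z" "k < M - T" "l < K\<^sup>2 * T" for z k l
    using bspec[OF F6 that(1)] that(2,3) by simp
  let ?C = "colours K M T"
  define FF where "FF c = F (fst c) (snd c)" for c
  have TM: "T \<le> M" "T \<le> M - T" using par(3) by linarith+
  have Cc: "(fst c \<in> Z \<and> snd c < M - T) \<or> (fst c = (0,0) \<and> snd c < K\<^sup>2 * T)" if "c \<in> ?C" for c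
    using that unfolding colours_def by auto
  have CZ: "(z, k) \<in> ?C" if "z \<in> Z" "k < M - T" for z k using that unfolding colours_def by blast
  have C0: "((0,0), k) \<in> ?C" if "k < K\<^sup>2 * T" for k using that unfolding colours_def by simp
  have piec: "piece V\<^sub>0 (FF c)" if "c \<in> ?C" for c
    using Cc[OF that]
  proof (elim disjE conjE)
    assume "fst c \<in> Z" "snd c < M - T"
    then show ?thesis unfolding FF_def by (rule F1a)
  next
    assume *: "fst c = (0,0)" "snd c < K\<^sup>2 * T"
    show ?thesis unfolding FF_def *(1) by (rule F4a[OF *(2)])
  qed
  have Fdisj: "FF c \<inter> FF d = {}" if cd: "c \<in> ?C" "d \<in> ?C" "c \<noteq> d" for c d
  proof -
    have LL: "F z k \<inter> F z' l = {}" if "z \<in> Z" "z' \<in> Z" "k < M - T" "l < M - T" "(z,k) \<noteq> (z',l)" for z z' k l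
    proof (cases "z = z'")
      case True
      then show ?thesis using F3r[of z k l] that by simp
    next
      case False
      then show ?thesis using F1b[OF that(1,3)] F1b[OF that(2,4)] by blast
    qed
    from Cc[OF cd(1)] Cc[OF cd(2)] show ?thesis
    proof (elim disjE conjE)
      assume "fst c \<in> Z" "snd c < M - T" "fst d \<in> Z" "snd d < M - T"
      then show ?thesis unfolding FF_def by (intro LL) (use cd(3) in \<open>auto simp: prod_eq_iff\<close>)
    next
      assume *: "fst c \<in> Z" "snd c < M - T" "fst d = (0,0)" "snd d < K\<^sup>2 * T"
      show ?thesis unfolding FF_def *(3) by (rule F6r[OF *(1,2,4)])
    next
      assume *: "fst c = (0,0)" "snd c < K\<^sup>2 * T" "fst d \<in> Z" "snd d < M - T"
      have "F (fst d) (snd d) \<inter> F (0,0) (snd c) = {}" by (rule F6r[OF *(3,4,2)])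
      then show ?thesis unfolding FF_def *(1) by (simp only: Int_commute)
    next
      assume *: "fst c = (0,0)" "snd c < K\<^sup>2 * T" "fst d = (0,0)" "snd d < K\<^sup>2 * T"
      have "snd c \<noteq> snd d" using cd(3) * by (auto simp: prod_eq_iff)
      then show ?thesis unfolding FF_def *(1,3) by (rule F5r[OF *(2,4)])
    qed
  qed
  have FcH: "FF c \<subseteq> H" if "c \<in> ?C" for c
    using Cc[OF that]
  proof (elim disjE conjE)
    assume "fst c \<in> Z" "snd c < M - T"
    from F1b[OF this] show ?thesis unfolding FF_def by blast
  next
    assume *: "fst c = (0,0)" "snd c < K\<^sup>2 * T"
    from F4b[OF *(2)] show ?thesis unfolding FF_def *(1) .
  qed
  have FH: "(\<Union>c\<in>?C. FF c) = H"
  proof (intro equalityI subsetI)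
    fix e assume "e \<in> H"
    then have "e \<in> (\<Union>z\<in>Z. \<Union>k<M - T. F z k) \<or> e \<in> (\<Union>k<K\<^sup>2 * T. F (0,0) k)"
      unfolding F7[symmetric] by (rule UnE) simp_all
    then show "e \<in> (\<Union>c\<in>?C. FF c)"
    proof
      assume "e \<in> (\<Union>z\<in>Z. \<Union>k<M - T. F z k)"
      then obtain z k where "z \<in> Z" "k < M - T" "e \<in> F z k" by blast
      then show ?thesis using CZ[of z k] unfolding FF_def by (intro UN_I[of "(z,k)"]) simp_all
    next
      assume "e \<in> (\<Union>k<K\<^sup>2 * T. F (0,0) k)"
      then obtain k where "k < K\<^sup>2 * T" "e \<in> F (0,0) k" by blast
      then show ?thesis using C0[of k] unfolding FF_def by (intro UN_I[of "((0,0),k)"]) simp_all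
    qed
  qed (use FcH in blast)
  define EA where "EA v = {a \<in> cA. {a, v} \<in> edges G}" for v
  define EB where "EB v = {a \<in> cB. {a, v} \<in> edges G}" for v
  have subc: "cA \<subseteq> A'" "cB \<subseteq> B'" "A 0 \<subseteq> A'" "B 0 \<subseteq> B'" unfolding side_def by auto
  have finc: "finite cA" "finite cB" "finite (A 0)" "finite (B 0)"
    by (rule finite_subset[OF subc(1) finite_verts(1)] finite_subset[OF subc(2) finite_verts(2)]
        finite_subset[OF subc(3) finite_verts(1)] finite_subset[OF subc(4) finite_verts(2)])+
  have V0\<eta>: "card (A 0) \<le> \<eta>" "card (B 0) \<le> \<eta>"
  proof -
    have "\<nu> \<le> \<eta>" using \<rho> by linarith
    then show "card (A 0) \<le> \<eta>" "card (B 0) \<le> \<eta>"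
      using cV0 card_mono[of "A 0 \<union> B 0" "A 0"] card_mono[of "A 0 \<union> B 0" "B 0"] finc by auto
  qed
  have \<rho>\<eta>: "\<rho> \<le> real \<eta>" using \<rho> by linarith
  have scale: "d \<le> K * d' + K\<^sup>2 * \<eta>" if "\<bar>real d' - real d / real K\<bar> \<le> \<rho> * real K" for d d'
  proof -
    have "\<rho> * real K \<le> real \<eta> * real K" using \<rho>\<eta> by (rule mult_right_mono) simp
    then have "real d / real K \<le> real d' + real \<eta> * real K" using that by linarith
    then have "real d \<le> (real d' + real \<eta> * real K) * real K" using K by (simp add: divide_le_eq)
    also have "\<dots> = real (K * d' + K\<^sup>2 * \<eta>)" by (simp add: algebra_simps power2_eq_square)
    finally show ?thesis by (rule of_nat_le_iff[THEN iffD1])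
  qed
  have sets: "cA = (\<Union>i\<in>{1..K}. A i)" "cB = (\<Union>i\<in>{1..K}. B i)" unfolding clusters_def by (rule refl)+
  have smallA: "dg H a \<le> \<eta>" if "a \<in> (\<Union>i\<in>{1..K}. A i)" for a
  proof (rule U)
    have "a \<in> cA" using that sets by simp
    then show "a \<notin> V\<^sub>0" using zero_disjoint sides_disjoint subc by blast
  qed
  have smallB: "dg H a \<le> \<eta>" if "a \<in> (\<Union>i\<in>{1..K}. B i)" for a
  proof (rule U)
    have "a \<in> cB" using that sets by simp
    then show "a \<notin> V\<^sub>0" using zero_disjoint sides_disjoint subc by blast
  qed
  have "\<exists>\<chi>. (\<forall>v\<in>A 0. \<forall>a\<in>EA v. \<chi> v a \<in> ?C \<and> a \<notin> \<Union>(F (fst (\<chi> v a)) (snd (\<chi> v a))) \<and>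
                 (fst (fst (\<chi> v a)) \<noteq> 0 \<longrightarrow> a \<in> A (fst (fst (\<chi> v a))))) \<and>
             (\<forall>v\<in>A 0. \<forall>c\<in>?C. card {a \<in> EA v. \<chi> v a = c} = 2 - dg (F (fst c) (snd c)) v) \<and>
             (\<forall>v\<in>A 0. \<forall>w\<in>A 0. v \<noteq> w \<longrightarrow> (\<forall>a\<in>EA v \<inter> EA w. \<chi> v a \<noteq> \<chi> w a))"
  proof (rule side_assignment_from_cells[OF K finc(3) V0\<eta>(1) bipH piec[unfolded FF_def] Fdisj[unfolded FF_def] FH[unfolded FF_def],
        where cellf=cellf])
    show "finite (EA v)" for v unfolding EA_def using finc by simp
    show "EA v \<subseteq> (\<Union>i\<in>{1..K}. A i)" for v unfolding EA_def sets[symmetric] by blast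
    show "A i \<inter> A j = {}" if "i \<in> {1..K}" "j \<in> {1..K}" "i \<noteq> j" for i j using dA[of i j] that by simp
    show "fst z \<in> {1..K}" if "z \<in> Z" for z :: "nat \<times> nat" using that by (rule mem_Times_iff[THEN iffD1, THEN conjunct1])
    show "fst (0::nat,0::nat) = 0" by simp
    show "card {z \<in> Z. fst z = i} = K" if "i \<in> {1..K}" for i
    proof -
      have "{z \<in> Z. fst z = i} = {i} \<times> {1..K}" using that by auto
      then show ?thesis by (simp add: card_cartesian_product)
    qed
    show "card (EA v) + dg H v = 2 * (K\<^sup>2 * M)" if v: "v \<in> A 0" for v
    proof -
      have "deg G v = deg_in G v cA + dg (edges (bip G (A 0 \<union> cA) B')) v"
        by (rule side_degree[OF simple _ zero_disjoint(1) _ noin(3) v])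
          (use vG sides_disjoint in \<open>simp_all add: side_def\<close>)
      moreover have "deg_in G v cA = card (EA v)" unfolding deg_in_def EA_def by simp
      ultimately show ?thesis using deg0[of v] v by (simp add: side_def[of K A])
    qed
    show "card (EA v) \<le> K * card (EA v \<inter> A i) + K\<^sup>2 * \<eta>" if v: "v \<in> A 0" and i: "i \<in> {1..K}" for v i
    proof -
      have "A i \<subseteq> cA" using i sets by blast
      then have "EA v \<inter> A i = {u \<in> A i. {u, v} \<in> edges G}" unfolding EA_def by blast
      then have "card (EA v \<inter> A i) = deg_in G v (A i)" unfolding deg_in_def by simp
      moreover have "card (EA v) = deg_in G v cA" unfolding deg_in_def EA_def by simp
      ultimately show ?thesis using scale[OF dinA[of v i]] v i by simp
    qed
    show "dg H v \<le> K\<^sup>2 * M + K\<^sup>2 * p" for v by (rule dmax)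
    show "\<bar>real (dg {e \<in> H. cellf e = z} v) - real (dg H v) / (real K)\<^sup>2\<bar> \<le> real \<eta>" if "z \<in> Z" "v \<in> A 0" for z v
      by (rule cf(4)) (use that in simp_all)
    show "dg {e \<in> H. cellf e = z} v \<le> (\<Sum>k<M - T. dg (F z k) v) + T + \<eta>" if "z \<in> Z" for z v using F8 that by blast
    show "(\<Sum>k<K\<^sup>2 * T. dg (F (0,0) k) v) \<le> K\<^sup>2 * T" for v using F9 by blast
    show "dg H a \<le> \<eta>" if "a \<in> (\<Union>i\<in>{1..K}. A i)" for a by (rule smallA[OF that])
  qed (fact par | assumption)+
  then obtain \<chi>A where \<chi>A': "\<forall>v\<in>A 0. \<forall>a\<in>EA v. \<chi>A v a \<in> ?C \<and> a \<notin> \<Union>(F (fst (\<chi>A v a)) (snd (\<chi>A v a))) \<and>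
                 (fst (fst (\<chi>A v a)) \<noteq> 0 \<longrightarrow> a \<in> A (fst (fst (\<chi>A v a))))"
    "\<forall>v\<in>A 0. \<forall>c\<in>?C. card {a \<in> EA v. \<chi>A v a = c} = 2 - dg (F (fst c) (snd c)) v"
    "\<forall>v\<in>A 0. \<forall>w\<in>A 0. v \<noteq> w \<longrightarrow> (\<forall>a\<in>EA v \<inter> EA w. \<chi>A v a \<noteq> \<chi>A w a)"
    by (elim exE conjE) (rule that)
  have \<chi>A1: "\<chi>A v a \<in> ?C \<and> a \<notin> \<Union>(FF (\<chi>A v a)) \<and>
      (fst (fst (\<chi>A v a)) \<noteq> 0 \<longrightarrow> a \<in> A (fst (fst (\<chi>A v a))))" if "v \<in> A 0" "a \<in> EA v" for v a
    using bspec[OF bspec[OF \<chi>A'(1) that(1)] that(2)] unfolding FF_def .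
  have \<chi>A2: "card {a \<in> EA v. \<chi>A v a = c} = 2 - dg (FF c) v" if "v \<in> A 0" "c \<in> ?C" for v c
    using bspec[OF bspec[OF \<chi>A'(2) that(1)] that(2)] unfolding FF_def .
  have \<chi>A3: "\<chi>A v a \<noteq> \<chi>A w a" if "v \<in> A 0" "w \<in> A 0" "v \<noteq> w" "a \<in> EA v" "a \<in> EA w" for v w a
    using bspec[OF bspec[OF \<chi>A'(3) that(1)] that(2)] that(3-5) by simp
  note \<chi>A = \<chi>A1 \<chi>A2 \<chi>A3
  have "\<exists>\<chi>. (\<forall>v\<in>B 0. \<forall>a\<in>EB v. \<chi> v a \<in> ?C \<and> a \<notin> \<Union>(F (fst (\<chi> v a)) (snd (\<chi> v a))) \<and>
                 (snd (fst (\<chi> v a)) \<noteq> 0 \<longrightarrow> a \<in> B (snd (fst (\<chi> v a))))) \<and>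
             (\<forall>v\<in>B 0. \<forall>c\<in>?C. card {a \<in> EB v. \<chi> v a = c} = 2 - dg (F (fst c) (snd c)) v) \<and>
             (\<forall>v\<in>B 0. \<forall>w\<in>B 0. v \<noteq> w \<longrightarrow> (\<forall>a\<in>EB v \<inter> EB w. \<chi> v a \<noteq> \<chi> w a))"
  proof (rule side_assignment_from_cells[OF K finc(4) V0\<eta>(2) bipH piec[unfolded FF_def] Fdisj[unfolded FF_def] FH[unfolded FF_def],
        where cellf=cellf])
    show "finite (EB v)" for v unfolding EB_def using finc by simp
    show "EB v \<subseteq> (\<Union>i\<in>{1..K}. B i)" for v unfolding EB_def sets[symmetric] by blast
    show "B i \<inter> B j = {}" if "i \<in> {1..K}" "j \<in> {1..K}" "i \<noteq> j" for i j using dB[of i j] that by simp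
    show "snd z \<in> {1..K}" if "z \<in> Z" for z :: "nat \<times> nat" using that by (rule mem_Times_iff[THEN iffD1, THEN conjunct2])
    show "snd (0::nat,0::nat) = 0" by simp
    show "card {z \<in> Z. snd z = i} = K" if "i \<in> {1..K}" for i
    proof -
      have "{z \<in> Z. snd z = i} = {1..K} \<times> {i}" using that by auto
      then show ?thesis by (simp add: card_cartesian_product)
    qed
    show "card (EB v) + dg H v = 2 * (K\<^sup>2 * M)" if v: "v \<in> B 0" for v
    proof -
      have "deg G v = deg_in G v cB + dg (edges (bip G (B 0 \<union> cB) A')) v"
        by (rule side_degree[OF simple _ zero_disjoint(2) _ noin(4) v])
          (use vG sides_disjoint in \<open>simp_all add: side_def Un_commute Int_commute\<close>)
      moreover have "edges (bip G (B 0 \<union> cB) A') = H" using edges_bip_commute[of G B' A'] by (simp add: side_def[of K B])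
      moreover have "deg_in G v cB = card (EB v)" unfolding deg_in_def EB_def by simp
      ultimately show ?thesis using deg0[of v] v by simp
    qed
    show "card (EB v) \<le> K * card (EB v \<inter> B i) + K\<^sup>2 * \<eta>" if v: "v \<in> B 0" and i: "i \<in> {1..K}" for v i
    proof -
      have "B i \<subseteq> cB" using i sets by blast
      then have "EB v \<inter> B i = {u \<in> B i. {u, v} \<in> edges G}" unfolding EB_def by blast
      then have "card (EB v \<inter> B i) = deg_in G v (B i)" unfolding deg_in_def by simp
      moreover have "card (EB v) = deg_in G v cB" unfolding deg_in_def EB_def by simp
      ultimately show ?thesis using scale[OF dinB[of v i]] v i by simp
    qed
    show "dg H v \<le> K\<^sup>2 * M + K\<^sup>2 * p" for v by (rule dmax)
    show "\<bar>real (dg {e \<in> H. cellf e = z} v) - real (dg H v) / (real K)\<^sup>2\<bar> \<le> real \<eta>" if "z \<in> Z" "v \<in> B 0" for z v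
      by (rule cf(4)) (use that in simp_all)
    show "dg {e \<in> H. cellf e = z} v \<le> (\<Sum>k<M - T. dg (F z k) v) + T + \<eta>" if "z \<in> Z" for z v using F8 that by blast
    show "(\<Sum>k<K\<^sup>2 * T. dg (F (0,0) k) v) \<le> K\<^sup>2 * T" for v using F9 by blast
    show "dg H a \<le> \<eta>" if "a \<in> (\<Union>i\<in>{1..K}. B i)" for a by (rule smallB[OF that])
  qed (fact par | assumption)+
  then obtain \<chi>B where \<chi>B': "\<forall>v\<in>B 0. \<forall>a\<in>EB v. \<chi>B v a \<in> ?C \<and> a \<notin> \<Union>(F (fst (\<chi>B v a)) (snd (\<chi>B v a))) \<and>
                 (snd (fst (\<chi>B v a)) \<noteq> 0 \<longrightarrow> a \<in> B (snd (fst (\<chi>B v a))))"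
    "\<forall>v\<in>B 0. \<forall>c\<in>?C. card {a \<in> EB v. \<chi>B v a = c} = 2 - dg (F (fst c) (snd c)) v"
    "\<forall>v\<in>B 0. \<forall>w\<in>B 0. v \<noteq> w \<longrightarrow> (\<forall>a\<in>EB v \<inter> EB w. \<chi>B v a \<noteq> \<chi>B w a)"
    by (elim exE conjE) (rule that)
  have \<chi>B1: "\<chi>B v a \<in> ?C \<and> a \<notin> \<Union>(FF (\<chi>B v a)) \<and>
      (snd (fst (\<chi>B v a)) \<noteq> 0 \<longrightarrow> a \<in> B (snd (fst (\<chi>B v a))))" if "v \<in> B 0" "a \<in> EB v" for v a
    using bspec[OF bspec[OF \<chi>B'(1) that(1)] that(2)] unfolding FF_def .
  have \<chi>B2: "card {a \<in> EB v. \<chi>B v a = c} = 2 - dg (FF c) v" if "v \<in> B 0" "c \<in> ?C" for v c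
    using bspec[OF bspec[OF \<chi>B'(2) that(1)] that(2)] unfolding FF_def .
  have \<chi>B3: "\<chi>B v a \<noteq> \<chi>B w a" if "v \<in> B 0" "w \<in> B 0" "v \<noteq> w" "a \<in> EB v" "a \<in> EB w" for v w a
    using bspec[OF bspec[OF \<chi>B'(3) that(1)] that(2)] that(3-5) by simp
  note \<chi>B = \<chi>B1 \<chi>B2 \<chi>B3
  \<comment> \<open>The pendant neighbours of \<open>v\<close> in colour \<open>c\<close>.\<close>
  define N where "N c v = (if v \<in> A 0 then {a \<in> EA v. \<chi>A v a = c} else {a \<in> EB v. \<chi>B v a = c})" for c v
  have AB0: "v \<notin> A 0" if "v \<in> B 0" for v using that sides_disjoint subc by blast
  have NA: "N c v = {a \<in> EA v. \<chi>A v a = c}" if "v \<in> A 0" for c v unfolding N_def using that by simp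
  have NB: "N c v = {a \<in> EB v. \<chi>B v a = c}" if "v \<in> B 0" for c v unfolding N_def using AB0[OF that] by simp
  have NcA: "N c v \<subseteq> cA" if "v \<in> A 0" for c v unfolding NA[OF that] EA_def by blast
  have NcB: "N c v \<subseteq> cB" if "v \<in> B 0" for c v unfolding NB[OF that] EB_def by blast
  have NE: "{v, a} \<in> edges G" if "v \<in> V\<^sub>0" "a \<in> N c v" for v a c
  proof -
    have "{a, v} \<in> edges G"
    proof (cases "v \<in> A 0")
      case True
      then show ?thesis using that(2) unfolding NA[OF True] EA_def by blast
    next
      case False
      then have "v \<in> B 0" using that(1) by blast
      then show ?thesis using that(2) unfolding NB[OF \<open>v \<in> B 0\<close>] EB_def by blast
    qed
    then show ?thesis by (simp add: insert_commute)
  qed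
  have comp: "completion cA (A 0) cB (B 0) (FF c) (N c)" if c: "c \<in> ?C" for c
  proof
    show "cA \<inter> A 0 = {}" using zero_disjoint by auto
    show "cB \<inter> B 0 = {}" using zero_disjoint by auto
    show "cA \<inter> cB = {}" "cA \<inter> B 0 = {}" "A 0 \<inter> cB = {}" "A 0 \<inter> B 0 = {}" using sides_disjoint subc by blast+
    show "finite (A 0)" "finite (B 0)" by (rule finc)+
    have "side K A = cA \<union> A 0" "side K B = cB \<union> B 0" unfolding side_def by auto
    then show "bipart (cA \<union> A 0) (cB \<union> B 0) (FF c)" using bipart_subset[OF bipH FcH[OF c]] by simp
    show "piece V\<^sub>0 (FF c)" by (rule piec[OF c])
    show "N c v \<subseteq> cA" if "v \<in> A 0" for v by (rule NcA[OF that])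
    show "N c v \<subseteq> cB" if "v \<in> B 0" for v by (rule NcB[OF that])
    have cases0: "v \<in> A 0 \<or> v \<in> B 0" if "v \<in> V\<^sub>0" for v using that by blast
    have d2: "dg (FF c) v \<le> 2" for v by (rule piece_dg(1)[OF piec[OF c]])
    show "finite (N c v)" if "v \<in> V\<^sub>0" for v
      using cases0[OF that] finite_subset[OF NcA finc(1)] finite_subset[OF NcB finc(2)] by blast
    show "card (N c v) + dg (FF c) v = 2" if "v \<in> V\<^sub>0" for v
      using cases0[OF that]
    proof
      assume v: "v \<in> A 0"
      show ?thesis using \<chi>A(2)[OF v c] d2[of v] unfolding NA[OF v] by simp
    next
      assume v: "v \<in> B 0"
      show ?thesis using \<chi>B(2)[OF v c] d2[of v] unfolding NB[OF v] by simp
    qed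
    show "N c v \<inter> N c w = {}" if v: "v \<in> V\<^sub>0" and w: "w \<in> V\<^sub>0" and vw: "v \<noteq> w" for v w
    proof -
      have AA: "N c v \<inter> N c w = {}" if vw0: "v \<in> A 0" "w \<in> A 0"
      proof -
        have False if a: "a \<in> N c v" "a \<in> N c w" for a
        proof -
          have "a \<in> EA v" "\<chi>A v a = c" using a(1) unfolding NA[OF vw0(1)] by simp_all
          moreover have "a \<in> EA w" "\<chi>A w a = c" using a(2) unfolding NA[OF vw0(2)] by simp_all
          ultimately show False using \<chi>A3[OF vw0 vw, of a] by simp
        qed
        then show ?thesis by blast
      qed
      have BB: "N c v \<inter> N c w = {}" if vw0: "v \<in> B 0" "w \<in> B 0"
      proof -
        have False if a: "a \<in> N c v" "a \<in> N c w" for a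
        proof -
          have "a \<in> EB v" "\<chi>B v a = c" using a(1) unfolding NB[OF vw0(1)] by simp_all
          moreover have "a \<in> EB w" "\<chi>B w a = c" using a(2) unfolding NB[OF vw0(2)] by simp_all
          ultimately show False using \<chi>B3[OF vw0 vw, of a] by simp
        qed
        then show ?thesis by blast
      qed
      have ABd: "cA \<inter> cB = {}" using sides_disjoint subc by blast
      have AB: "N c v \<inter> N c w = {}" if "v \<in> A 0" "w \<in> B 0" using NcA[OF that(1), of c] NcB[OF that(2), of c] ABd by blast
      have BA: "N c v \<inter> N c w = {}" if "v \<in> B 0" "w \<in> A 0" using NcB[OF that(1), of c] NcA[OF that(2), of c] ABd by blast
      show ?thesis using cases0[OF v] cases0[OF w] AA BB AB BA by blast
    qed
    show "N c v \<inter> \<Union>(FF c) = {}" if "v \<in> V\<^sub>0" for v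
      using cases0[OF that]
    proof
      assume v: "v \<in> A 0"
      have "a \<notin> \<Union>(FF c)" if "a \<in> N c v" for a
      proof -
        have "a \<in> EA v" "\<chi>A v a = c" using that unfolding NA[OF v] by simp_all
        then show ?thesis using \<chi>A1[OF v, of a] by simp
      qed
      then show ?thesis by blast
    next
      assume v: "v \<in> B 0"
      have "a \<notin> \<Union>(FF c)" if "a \<in> N c v" for a
      proof -
        have "a \<in> EB v" "\<chi>B v a = c" using that unfolding NB[OF v] by simp_all
        then show ?thesis using \<chi>B1[OF v, of a] by simp
      qed
      then show ?thesis by blast
    qed
  qed
  define J where "J c = completed V\<^sub>0 (FF c) (N c)" for c
  define St where "St c = pendant_edges V\<^sub>0 (N c)" for c
  have eJ: "edges (J c) = FF c \<union> St c" for c unfolding J_def St_def completed_def by simp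
  have vJ: "verts (J c) = V\<^sub>0 \<union> \<Union>(FF c) \<union> (\<Union>v\<in>V\<^sub>0. N c v)" for c unfolding J_def completed_def by simp
  have StE: "\<exists>v a. v \<in> V\<^sub>0 \<and> a \<in> N c v \<and> e = {v, a}" if "e \<in> St c" for e c
    using that unfolding St_def pendant_edges_def by blast
  have St_not_H: "e \<notin> H" if eS: "e \<in> St c" for e c
  proof
    assume eH: "e \<in> H"
    obtain v a where va: "v \<in> V\<^sub>0" "a \<in> N c v" "e = {v, a}" using StE[OF eS] by blast
    show False
    proof (cases "v \<in> A 0")
      case True
      then have "e \<subseteq> A'" using NcA[OF True, of c] va subc by blast
      then show False using crossing_not_within(1)[OF eH] by blast
    next
      case False
      then have vB: "v \<in> B 0" using va(1) by blast
      then have "e \<subseteq> B'" using NcB[OF vB, of c] va subc by blast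
      then show False using crossing_not_within(2)[OF eH] by blast
    qed
  qed
  have N0: "a \<notin> V\<^sub>0" if "v \<in> V\<^sub>0" "a \<in> N c v" for v a c
    using that NcA[of v c] NcB[of v c] zero_disjoint sides_disjoint subc by blast
  have StSt: "c = d" if e: "e \<in> St c" "e \<in> St d" for c d e
  proof -
    obtain v a where va: "v \<in> V\<^sub>0" "a \<in> N c v" "e = {v, a}" using StE[OF e(1)] by blast
    obtain w b where wb: "w \<in> V\<^sub>0" "b \<in> N d w" "e = {w, b}" using StE[OF e(2)] by blast
    have "v = w" "a = b" using va wb N0[OF va(1,2)] N0[OF wb(1,2)] by (auto simp: doubleton_eq_iff)
    then have ad: "a \<in> N c v" "a \<in> N d v" using va wb by auto
    show ?thesis
    proof (cases "v \<in> A 0")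
      case True
      then show ?thesis using ad unfolding NA[OF True] by simp
    next
      case False
      then have vB: "v \<in> B 0" using va(1) by blast
      then show ?thesis using ad unfolding NB[OF vB] by simp
    qed
  qed
  have Jdisj: "edges (J c) \<inter> edges (J d) = {}" if cd: "c \<in> ?C" "d \<in> ?C" "c \<noteq> d" for c d
  proof -
    have "e \<notin> edges (J d)" if "e \<in> edges (J c)" for e
    proof
      assume ed: "e \<in> edges (J d)"
      from that ed consider "e \<in> FF c" "e \<in> FF d" | "e \<in> FF c" "e \<in> St d" | "e \<in> St c" "e \<in> FF d" | "e \<in> St c" "e \<in> St d"
        unfolding eJ by blast
      then show False
      proof cases
        case 1
        then show ?thesis using Fdisj[OF cd] by blast
      next
        case 2
        then show ?thesis using St_not_H[OF 2(2)] FcH[OF cd(1)] by blast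
      next
        case 3
        then show ?thesis using St_not_H[OF 3(1)] FcH[OF cd(2)] by blast
      next
        case 4
        then show ?thesis using StSt[OF 4] cd(3) by blast
      qed
    qed
    then show ?thesis by blast
  qed
  have FFne: "FF c \<noteq> {}" if "c \<in> ?C" for c
  proof
    assume "FF c = {}"
    then have "piece V\<^sub>0 {}" using piec[OF that] by simp
    moreover have "\<not> piece V\<^sub>0 {}" unfolding piece_def by auto
    ultimately show False by blast
  qed
  have inj: "inj_on J ?C"
  proof (rule inj_onI, rule ccontr)
    fix c d assume cd: "c \<in> ?C" "d \<in> ?C" "J c = J d" "c \<noteq> d"
    have "edges (J d) = {}" using Jdisj[OF cd(1,2,4)] unfolding cd(3) by (simp only: Int_absorb)
    then have "FF d = {}" unfolding eJ by (simp only: Un_empty)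
    then show False using FFne[OF cd(2)] by simp
  qed
  have subG: "subgraph (J c) G" if c: "c \<in> ?C" for c
  proof -
    interpret completion cA "A 0" cB "B 0" "FF c" "N c" by (rule comp[OF c])
    have "simple_graph (J c)" using simple_J unfolding J_def .
    moreover have FG: "FF c \<subseteq> edges G" using FcH[OF c] unfolding edges_bip by blast
    moreover have "St c \<subseteq> edges G"
    proof
      fix e assume "e \<in> St c"
      from StE[OF this] obtain v a where va: "v \<in> V\<^sub>0" "a \<in> N c v" "e = {v, a}" by blast
      show "e \<in> edges G" unfolding va(3) by (rule NE[OF va(1,2)])
    qed
    moreover have "verts (J c) \<subseteq> verts G"
    proof -
      have "e \<subseteq> verts G" if "e \<in> edges G" for e by (rule simple_graph_edgeE[OF simple that]) simp
      then have "\<Union>(FF c) \<subseteq> verts G" using FG by blast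
      moreover have "(\<Union>v\<in>V\<^sub>0. N c v) \<subseteq> cA \<union> cB"
      proof (rule UN_least)
        fix v assume "v \<in> V\<^sub>0"
        then consider "v \<in> A 0" | "v \<in> B 0" by blast
        then show "N c v \<subseteq> cA \<union> cB" using NcA[of v c] NcB[of v c] by cases blast+
      qed
      ultimately show ?thesis unfolding vJ vG side_def by blast
    qed
    ultimately show ?thesis unfolding subgraph_def eJ by blast
  qed
  have vAB: "cA \<union> A 0 \<union> cB \<union> B 0 = verts G" unfolding vG side_def by auto
  have HESJ: "HES \<epsilon>\<^sub>0 K A B (J c)" if c: "c \<in> ?C" for c
  proof -
    interpret completion cA "A 0" cB "B 0" "FF c" "N c" by (rule comp[OF c])
    show ?thesis using completed_HES[of \<epsilon>\<^sub>0] eps unfolding vAB J_def by blast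
  qed
  have bipJ: "edges (bip (J c) A' B') = FF c" if c: "c \<in> ?C" for c
  proof -
    have "e \<in> FF c" if "e \<in> edges (bip (J c) A' B')" for e
    proof -
      have e: "e \<in> edges (J c)" "\<exists>x\<in>A'. \<exists>y\<in>B'. e = {x, y}" using that unfolding edges_bip by blast+
      have "e \<in> edges G" using e(1) subG[OF c] unfolding subgraph_def by blast
      then have "e \<in> H" using e(2) unfolding edges_bip by blast
      then show ?thesis using e(1) St_not_H[of e c] unfolding eJ by blast
    qed
    moreover have "e \<in> edges (bip (J c) A' B')" if "e \<in> FF c" for e
    proof -
      have "e \<in> H" using FcH[OF c] that by blast
      then have "\<exists>x\<in>A'. \<exists>y\<in>B'. e = {x, y}" unfolding edges_bip by blast
      then show ?thesis using that eJ[of c] unfolding edges_bip by blast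
    qed
    ultimately show ?thesis by blast
  qed
  have cover: "edges G \<subseteq> (\<Union>c\<in>?C. edges (J c))"
  proof
    fix e assume e: "e \<in> edges G"
    show "e \<in> (\<Union>c\<in>?C. edges (J c))"
    proof (cases "e \<in> H")
      case True
      then show ?thesis using FH unfolding eJ by blast
    next
      case False
      obtain u w where uw: "u \<in> verts G" "w \<in> verts G" "e = {u, w}" by (rule simple_graph_edgeE[OF simple e])
      have nc: "\<not> (x \<in> A' \<and> y \<in> B')" if "e = {x, y}" for x y using False e that unfolding edges_bip by blast
      have "(u \<in> A' \<and> w \<in> A') \<or> (u \<in> B' \<and> w \<in> B')"
        using uw(1,2) nc[OF uw(3)] nc[of w u] uw(3) unfolding vG by (auto simp: insert_commute)
      moreover have "\<exists>v a. v \<in> A 0 \<and> a \<in> cA \<and> e = {v, a}" if "u \<in> A'" "w \<in> A'"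
      proof -
        have n: "\<not> (u \<in> cA \<and> w \<in> cA)" "\<not> (u \<in> A 0 \<and> w \<in> A 0)" using noin(1,3)[OF e] uw(3) by auto
        have "e = {w, u}" using uw(3) by auto
        then show ?thesis using n that uw(3) unfolding side_def by blast
      qed
      moreover have "\<exists>v a. v \<in> B 0 \<and> a \<in> cB \<and> e = {v, a}" if "u \<in> B'" "w \<in> B'"
      proof -
        have n: "\<not> (u \<in> cB \<and> w \<in> cB)" "\<not> (u \<in> B 0 \<and> w \<in> B 0)" using noin(2,4)[OF e] uw(3) by auto
        have "e = {w, u}" using uw(3) by auto
        then show ?thesis using n that uw(3) unfolding side_def by blast
      qed
      ultimately consider v a where "v \<in> A 0" "a \<in> cA" "e = {v, a}" | v a where "v \<in> B 0" "a \<in> cB" "e = {v, a}" by blast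
      then show ?thesis
      proof cases
        case (1 v a)
        have aE: "a \<in> EA v" unfolding EA_def using 1 e by (simp add: insert_commute)
        have "a \<in> N (\<chi>A v a) v" unfolding NA[OF 1(1)] using aE by simp
        then have "e \<in> St (\<chi>A v a)" unfolding St_def pendant_edges_def using 1 by blast
        then show ?thesis using \<chi>A(1)[OF 1(1) aE] unfolding eJ by blast
      next
        case (2 v a)
        have aE: "a \<in> EB v" unfolding EB_def using 2 e by (simp add: insert_commute)
        have "a \<in> N (\<chi>B v a) v" unfolding NB[OF 2(1)] using aE by simp
        then have "e \<in> St (\<chi>B v a)" unfolding St_def pendant_edges_def using 2 by blast
        then show ?thesis using \<chi>B(1)[OF 2(1) aE] unfolding eJ by blast
      qed
    qed
  qed
  have loc: "local_HES \<epsilon>\<^sub>0 K A B i j (J ((i,j),k))" if ij: "i \<in> {1..K}" "j \<in> {1..K}" and k: "k < M - T" for i j k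
  proof -
    have z: "(i,j) \<in> Z" using ij by simp
    have c: "((i,j),k) \<in> ?C" by (rule CZ[OF z k])
    have "\<Union>(FF ((i,j),k)) \<subseteq> V\<^sub>0 \<union> A i \<union> B j"
    proof (rule Union_least)
      fix e assume "e \<in> FF ((i,j),k)"
      then have "e \<in> F (i,j) k" unfolding FF_def by simp
      then have "e \<in> H" "cellf e = (i,j)" using F1b[OF z k] by auto
      then show "e \<subseteq> V\<^sub>0 \<union> A i \<union> B j" using cf(2)[of e] by simp
    qed
    moreover have "N ((i,j),k) v \<subseteq> A i \<union> B j" if v: "v \<in> V\<^sub>0" for v
    proof
      fix a assume a: "a \<in> N ((i,j),k) v"
      show "a \<in> A i \<union> B j"
      proof (cases "v \<in> A 0")
        case True
        then have "a \<in> EA v" "\<chi>A v a = ((i,j),k)" using a unfolding NA[OF True] by auto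
        then show ?thesis using \<chi>A(1)[OF True, of a] ij by simp
      next
        case False
        then have vB: "v \<in> B 0" using v by blast
        then have "a \<in> EB v" "\<chi>B v a = ((i,j),k)" using a unfolding NB[OF vB] by auto
        then show ?thesis using \<chi>B(1)[OF vB, of a] ij by simp
      qed
    qed
    ultimately have "verts (J ((i,j),k)) \<subseteq> V\<^sub>0 \<union> A i \<union> B j" unfolding vJ by blast
    then show ?thesis unfolding local_HES_def using HESJ[OF c] by blast
  qed
  have special: "e_between (J ((i,j),k)) A' B' = 2 \<and> (\<forall>w\<in>X. deg (bip (J ((i,j),k)) A' B') w = 1)"
    if ij: "i \<in> {1..K}" "j \<in> {1..K}" and k: "k < T" for i j k
  proof -
    have z: "(i,j) \<in> Z" using ij by simp
    have c: "((i,j),k) \<in> ?C" by (rule CZ[OF z]) (use k TM in linarith)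
    have s: "simple_graph (J ((i,j),k))" using subG[OF c] unfolding subgraph_def by blast
    have F: "pair_matching (F (i,j) k) \<and> (\<forall>v\<in>X. dg (F (i,j) k) v = 1)" using F2 z k by blast
    have "e_between (J ((i,j),k)) A' B' = 2" unfolding e_between_eq_card bipJ[OF c]
      using F unfolding FF_def pair_matching_def by simp
    moreover have "deg (bip (J ((i,j),k)) A' B') w = 1" if "w \<in> X" for w
      unfolding deg_eq_dg[OF simple_graph_bip[OF s]] bipJ[OF c] using F that unfolding FF_def by simp
    ultimately show ?thesis by blast
  qed
  have injk: "inj_on (\<lambda>k. J ((i,j),k)) {..<M - T}" if "i \<in> {1..K}" "j \<in> {1..K}" for i j
  proof (rule inj_onI)
    fix k l assume kl: "k \<in> {..<M - T}" "l \<in> {..<M - T}" "J ((i,j),k) = J ((i,j),l)"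
    have "((i,j),k) = ((i,j),l)" by (rule inj_onD[OF inj kl(3)]) (use kl that in \<open>auto intro!: CZ\<close>)
    then show "k = l" by simp
  qed
  show ?thesis
  proof (rule exI[of _ "J ` ?C"], intro conjI ballI impI)
    show "finite (J ` ?C)" using finite_colours by (rule finite_imageI)
    show "card (J ` ?C) = K\<^sup>2 * M" using card_image[OF inj] card_colours[OF TM(1)] by simp
    show "subgraph Q G" if "Q \<in> J ` ?C" for Q using that subG by blast
    show "HES \<epsilon>\<^sub>0 K A B Q" if "Q \<in> J ` ?C" for Q using that HESJ by blast
    show "edges Q \<inter> edges Q' = {}" if Q: "Q \<in> J ` ?C" "Q' \<in> J ` ?C" "Q \<noteq> Q'" for Q Q'
    proof -
      obtain c d where cd: "c \<in> ?C" "d \<in> ?C" "Q = J c" "Q' = J d" using Q by blast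
      then have "c \<noteq> d" using Q(3) by blast
      then show ?thesis unfolding cd(3,4) by (rule Jdisj[OF cd(1,2)])
    qed
    have "edges (J c) \<subseteq> edges G" if "c \<in> ?C" for c using subG[OF that] unfolding subgraph_def by blast
    then have "(\<Union>c\<in>?C. edges (J c)) \<subseteq> edges G" by (rule UN_least)
    then have "(\<Union>c\<in>?C. edges (J c)) = edges G" using cover by (rule subset_antisym)
    then show "(\<Union>Q\<in>J ` ?C. edges Q) = edges G" by (simp only: image_image)
  next
    fix i j assume ij: "i \<in> {1..K}" "j \<in> {1..K}"
    let ?S = "(\<lambda>k. J ((i,j),k)) ` {..<M - T}" let ?T = "(\<lambda>k. J ((i,j),k)) ` {..<T}"
    have z: "(i,j) \<in> Z" using ij by simp
    show "\<exists>\<S> \<subseteq> J ` ?C. card \<S> = M - T \<and> (\<forall>J\<in>\<S>. local_HES \<epsilon>\<^sub>0 K A B i j J) \<and>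
        (\<exists>\<T> \<subseteq> \<S>. card \<T> = T \<and> (\<forall>J\<in>\<T>. e_between J A' B' = 2 \<and> (\<forall>w\<in>X. deg (bip J A' B') w = 1)))"
    proof (rule exI[of _ ?S], intro conjI)
      show "?S \<subseteq> J ` ?C"
      proof (rule image_subsetI)
        fix k assume "k \<in> {..<M - T}"
        then show "J ((i,j),k) \<in> J ` ?C" by (intro imageI CZ[OF z]) simp
      qed
      show "card ?S = M - T" using card_image[OF injk[OF ij]] by simp
      show "\<forall>J\<in>?S. local_HES \<epsilon>\<^sub>0 K A B i j J" using loc[OF ij] by blast
      have sub: "{..<T} \<subseteq> {..<M - T}" using TM(2) by auto
      show "\<exists>\<T> \<subseteq> ?S. card \<T> = T \<and> (\<forall>J\<in>\<T>. e_between J A' B' = 2 \<and> (\<forall>w\<in>X. deg (bip J A' B') w = 1))"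
      proof (rule exI[of _ ?T], intro conjI)
        show "?T \<subseteq> ?S" using sub by (rule image_mono)
        show "card ?T = T" using card_image[OF inj_on_subset[OF injk[OF ij] sub]] by simp
        show "\<forall>J\<in>?T. e_between J A' B' = 2 \<and> (\<forall>w\<in>X. deg (bip J A' B') w = 1)"
        proof
          fix Q assume "Q \<in> ?T"
          then obtain k where k: "k < T" "Q = J ((i,j),k)" by blast
          show "e_between Q A' B' = 2 \<and> (\<forall>w\<in>X. deg (bip Q A' B') w = 1)"
            unfolding k(2) by (rule special[OF ij k(1)])
        qed
      qed
    qed
  qed
qed

end

section \<open>Criticality and the scheme conditions\<close>

text \<open>Criticality in terms of edge sets: a set of crossing edges is a subgraph once all vertices are added.\<close>

lemma critical_dg:
  assumes simple: "simple_graph G" and disj: "X \<inter> Y = {}" and crit: "critical G X Y D"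
    and sub: "H \<subseteq> edges (bip G X Y)" and dg: "\<And>v. real (dg H v) \<le> 11 * real D / 40"
  shows "real (card H) \<le> 41 * real D / 40"
proof -
  let ?B = "bip G X Y"
  let ?H = "Graph (verts ?B) H"
  have sB: "simple_graph ?B" by (rule simple_graph_bip[OF simple])
  then have sH: "simple_graph ?H" using sub unfolding simple_graph_def by auto
  have "subgraph ?H ?B" unfolding subgraph_def using sH sub by simp
  moreover have "real (max_deg ?H) \<le> 11 * real D / 40"
  proof -
    have "finite (verts ?H)" using sH unfolding simple_graph_def by blast
    then have "max_deg ?H \<in> insert 0 (deg ?H ` verts ?H)" unfolding max_deg_def by (intro Max_in) simp_all
    then consider "max_deg ?H = 0" | v where "max_deg ?H = deg ?H v" by (elim insertE imageE) auto
    then show ?thesis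
    proof cases
      case 1
      then show ?thesis by simp
    next
      case (2 v)
      then show ?thesis using dg[of v] unfolding deg_eq_dg[OF sH] by simp
    qed
  qed
  ultimately have "real (e_graph ?H) \<le> 41 * real D / 40" using crit unfolding critical_def by blast
  then show ?thesis unfolding e_graph_def by simp
qed

lemma dg_outside_verts:
  assumes "simple_graph G" "v \<notin> verts G"
  shows "dg (edges G) v = 0"
proof -
  have "v \<notin> e" if "e \<in> edges G" for e
    by (rule simple_graph_edgeE[OF assms(1) that]) (use assms(2) in auto)
  then have "{e \<in> edges G. v \<in> e} = {}" by blast
  then show ?thesis unfolding dg_def by (simp only: card.empty)
qed

lemma dg_le_max_deg:
  assumes "simple_graph G"
  shows "dg (edges G) v \<le> max_deg G"
proof (cases "v \<in> verts G")
  case True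
  have "finite (verts G)" using assms unfolding simple_graph_def by blast
  then have "deg G v \<le> max_deg G" unfolding max_deg_def using True by (intro Max_ge) simp_all
  then show ?thesis unfolding deg_eq_dg[OF assms] .
next
  case False
  then show ?thesis using dg_outside_verts[OF assms] by simp
qed

text \<open>The number of crossing edges is at most \<open>2 n\<close>, so the maxima in the conditions on a scheme are at most \<open>2 n\<close>, and
  all errors are multiples of the single quantity \<open>\<rho>\<close>.\<close>

lemma scheme_bounds:
  fixes \<epsilon> nn :: real
  assumes sch: "exceptional_scheme K m \<epsilon>\<^sub>0 \<epsilon> G A B" and K: "0 < K" and eps: "0 < \<epsilon>"
    and simple: "simple_graph G"
    and e2: "real (card (edges (bip G (side K A) (side K B)))) \<le> 2 * real (card (verts G))"
  defines "\<rho> \<equiv> 2 * \<epsilon> * real (card (verts G)) / (real K)\<^sup>2"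
  shows "i \<in> {1..K} \<Longrightarrow> j \<in> {1..K} \<Longrightarrow>
       \<bar>real (e_between G (A i) (B j)) - real (e_between G (clusters K A) (clusters K B)) / (real K)\<^sup>2\<bar> \<le> \<rho>"
    and "i \<in> {1..K} \<Longrightarrow>
       \<bar>real (e_between G (A 0) (B i)) - real (e_between G (A 0) (clusters K B)) / real K\<bar> \<le> \<rho> * real K"
    and "i \<in> {1..K} \<Longrightarrow>
       \<bar>real (e_between G (B 0) (A i)) - real (e_between G (B 0) (clusters K A)) / real K\<bar> \<le> \<rho> * real K"
    and "v \<in> verts G \<Longrightarrow> i \<in> {1..K} \<Longrightarrow>
       \<bar>real (deg_in G v (A i)) - real (deg_in G v (clusters K A)) / real K\<bar> \<le> \<rho> * real K"
    and "v \<in> verts G \<Longrightarrow> i \<in> {1..K} \<Longrightarrow>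
       \<bar>real (deg_in G v (B i)) - real (deg_in G v (clusters K B)) / real K\<bar> \<le> \<rho> * real K"
proof -
  let ?n = "real (card (verts G))"
  let ?cA = "clusters K A" let ?cB = "clusters K B"
  have S: "\<forall>v\<in>verts G. \<forall>i\<in>{1..K}.
          pm (real (deg_in G v (A i))) (real (deg_in G v ?cA) / real K) (\<epsilon> * ?n / real K) \<and>
          pm (real (deg_in G v (B i))) (real (deg_in G v ?cB) / real K) (\<epsilon> * ?n / real K)"
    and S2: "\<forall>i\<in>{1..K}. \<forall>i'\<in>{1..K}.
          pm (real (e_between G (B 0) (A i))) (real (e_between G (B 0) ?cA) / real K) (\<epsilon> * max (real (e_between G (B 0) ?cA)) ?n / real K) \<and>
          pm (real (e_between G (A 0) (B i))) (real (e_between G (A 0) ?cB) / real K) (\<epsilon> * max (real (e_between G (A 0) ?cB)) ?n / real K) \<and>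
          pm (real (e_between G (A i) (B i'))) (real (e_between G ?cA ?cB) / (real K)\<^sup>2) (\<epsilon> * max (real (e_between G ?cA ?cB)) ?n / (real K)\<^sup>2)"
    using sch unfolding exceptional_scheme_def Let_def by simp_all
  have \<rho>K: "\<rho> * real K = 2 * \<epsilon> * ?n / real K" unfolding \<rho>_def using K by (simp add: power2_eq_square)
  have pmD: "\<bar>a - b\<bar> \<le> c" if "pm a b c'" "c' \<le> c" for a b c c' using that unfolding pm_def by linarith
  have fin: "finite (edges (bip G (side K A) (side K B)))"
    by (rule simple_graph_finite_edges[OF simple_graph_bip[OF simple]])
  have le: "real (e_between G X Y) \<le> 2 * ?n" if "X \<subseteq> side K A" "Y \<subseteq> side K B" for X Y
  proof -
    have "edges (bip G X Y) \<subseteq> edges (bip G (side K A) (side K B))"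
      unfolding edges_bip using that by blast
    then have "e_between G X Y \<le> card (edges (bip G (side K A) (side K B)))"
      unfolding e_between_eq_card by (rule card_mono[OF fin])
    then show ?thesis using e2 by linarith
  qed
  have subs: "A 0 \<subseteq> side K A" "?cA \<subseteq> side K A" "B 0 \<subseteq> side K B" "?cB \<subseteq> side K B" unfolding side_def by auto
  have mx: "\<epsilon> * max (real (e_between G X Y)) ?n / d \<le> 2 * \<epsilon> * ?n / d"
    if "real (e_between G X Y) \<le> 2 * ?n" "0 < d" for X Y d
  proof -
    have "max (real (e_between G X Y)) ?n \<le> 2 * ?n" using that(1) by simp
    then have "\<epsilon> * max (real (e_between G X Y)) ?n \<le> \<epsilon> * (2 * ?n)" using eps by (intro mult_left_mono) simp_all
    also have "\<dots> = 2 * \<epsilon> * ?n" by simp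
    finally show ?thesis using that(2) by (intro divide_right_mono) simp_all
  qed
  have dk: "\<epsilon> * ?n / real K \<le> 2 * \<epsilon> * ?n / real K" using eps K by (intro divide_right_mono) simp_all
  have Kp: "0 < real K" "0 < (real K)\<^sup>2" using K by simp_all
  show "\<bar>real (e_between G (A i) (B j)) - real (e_between G ?cA ?cB) / (real K)\<^sup>2\<bar> \<le> \<rho>"
    if ij: "i \<in> {1..K}" "j \<in> {1..K}"
  proof (rule pmD)
    show "pm (real (e_between G (A i) (B j))) (real (e_between G ?cA ?cB) / (real K)\<^sup>2) (\<epsilon> * max (real (e_between G ?cA ?cB)) ?n / (real K)\<^sup>2)"
      using bspec[OF bspec[OF S2 ij(1)] ij(2)] by (elim conjE)
    show "\<epsilon> * max (real (e_between G ?cA ?cB)) ?n / (real K)\<^sup>2 \<le> \<rho>"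
      unfolding \<rho>_def by (rule mx[OF le[OF subs(2,4)] Kp(2)])
  qed
  show "\<bar>real (e_between G (A 0) (B i)) - real (e_between G (A 0) ?cB) / real K\<bar> \<le> \<rho> * real K"
    if i: "i \<in> {1..K}"
  proof (rule pmD)
    show "pm (real (e_between G (A 0) (B i))) (real (e_between G (A 0) ?cB) / real K) (\<epsilon> * max (real (e_between G (A 0) ?cB)) ?n / real K)"
      using bspec[OF bspec[OF S2 i] i] by (elim conjE)
    show "\<epsilon> * max (real (e_between G (A 0) ?cB)) ?n / real K \<le> \<rho> * real K"
      unfolding \<rho>K by (rule mx[OF le[OF subs(1,4)] Kp(1)])
  qed
  show "\<bar>real (e_between G (B 0) (A i)) - real (e_between G (B 0) ?cA) / real K\<bar> \<le> \<rho> * real K"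
    if i: "i \<in> {1..K}"
  proof (rule pmD)
    show "pm (real (e_between G (B 0) (A i))) (real (e_between G (B 0) ?cA) / real K) (\<epsilon> * max (real (e_between G (B 0) ?cA)) ?n / real K)"
      using bspec[OF bspec[OF S2 i] i] by (elim conjE)
    have "real (e_between G (B 0) ?cA) \<le> 2 * ?n"
      using le[OF subs(2,3)] by (simp only: e_between_commute[of G "B 0" ?cA])
    then show "\<epsilon> * max (real (e_between G (B 0) ?cA)) ?n / real K \<le> \<rho> * real K"
      unfolding \<rho>K by (rule mx[OF _ Kp(1)])
  qed
  show "\<bar>real (deg_in G v (A i)) - real (deg_in G v ?cA) / real K\<bar> \<le> \<rho> * real K"
    if v: "v \<in> verts G" and i: "i \<in> {1..K}"
  proof (rule pmD)
    show "pm (real (deg_in G v (A i))) (real (deg_in G v ?cA) / real K) (\<epsilon> * ?n / real K)"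
      using bspec[OF bspec[OF S v] i] by (elim conjE)
  qed (use dk \<rho>K in simp)
  show "\<bar>real (deg_in G v (B i)) - real (deg_in G v ?cB) / real K\<bar> \<le> \<rho> * real K"
    if v: "v \<in> verts G" and i: "i \<in> {1..K}"
  proof (rule pmD)
    show "pm (real (deg_in G v (B i))) (real (deg_in G v ?cB) / real K) (\<epsilon> * ?n / real K)"
      using bspec[OF bspec[OF S v] i] by (elim conjE)
  qed (use dk \<rho>K in simp)
qed

section \<open>Numerical conditions\<close>

text \<open>Since \<open>\<epsilon>\<close> is at most \<open>1 / K\<close>, a factor \<open>K\<^sup>2\<close> is absorbed by \<open>\<epsilon>\<^sup>2\<close>; this is why a fourth power relates \<open>\<epsilon>\<^sub>0\<close> to \<open>\<epsilon>\<close>.\<close>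

lemma hierarchy_bounds:
  fixes \<epsilon>\<^sub>0 \<epsilon> lam :: real and n K :: nat
  assumes "0 < n" "0 < K" "0 < \<epsilon>\<^sub>0" "0 < \<epsilon>" "1 / real n \<le> \<epsilon>\<^sub>0\<^sup>2 / 1000" "\<epsilon>\<^sub>0 \<le> \<epsilon>^4"
    "\<epsilon> \<le> lam / 10000" "\<epsilon> \<le> 1 / real K" "lam \<le> 1 / 100"
  shows "1000 * (real K)\<^sup>2 \<le> \<epsilon> * real n" "100 * (real K)\<^sup>2 * (\<epsilon>\<^sub>0 * real n) \<le> \<epsilon> * real n"
    "4 \<le> sqrt \<epsilon>\<^sub>0 * real n" "10000 * (\<epsilon> * real n) \<le> lam * real n" "lam * real n \<le> real n / 100"
    "1000 * (real K)\<^sup>2 \<le> real n"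
proof -
  have n: "0 < real n" and K: "0 < real K" using assms by simp_all
  have e: "\<epsilon> \<le> 1 / 1000000" using assms(7,9) by simp
  have e4: "\<epsilon>^4 \<le> \<epsilon>" using e assms(4) power_decreasing[of 1 4 \<epsilon>] by simp
  have e0: "\<epsilon>\<^sub>0 \<le> 1 / 1000000" using assms(6) e4 e by linarith
  have K1: "\<epsilon> * real K \<le> 1" using assms(8) K by (simp add: le_divide_eq)
  have K2: "\<epsilon>\<^sup>2 * (real K)\<^sup>2 \<le> 1"
  proof -
    have "(\<epsilon> * real K)\<^sup>2 \<le> 1\<^sup>2" using K1 assms(4) K by (intro power_mono) simp_all
    then show ?thesis by (simp add: power_mult_distrib)
  qed
  have n0: "1000 \<le> \<epsilon>\<^sub>0\<^sup>2 * real n" using assms(5) n by (simp add: divide_le_eq field_simps)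
  have e0e: "\<epsilon>\<^sub>0\<^sup>2 \<le> \<epsilon>^3"
  proof -
    have "\<epsilon>\<^sub>0\<^sup>2 \<le> \<epsilon>\<^sub>0 * 1" unfolding power2_eq_square using assms(3) e0 by (intro mult_left_mono) simp_all
    also have "\<dots> \<le> \<epsilon>^4" using assms(6) by simp
    also have "\<dots> \<le> \<epsilon>^3" using power_decreasing[of 3 4 \<epsilon>] e assms(4) by simp
    finally show ?thesis .
  qed
  have "1000 \<le> \<epsilon>^3 * real n" using n0 mult_right_mono[OF e0e, of "real n"] n by linarith
  then have e3: "1000 * (real K)\<^sup>2 \<le> \<epsilon>^3 * real n * (real K)\<^sup>2" by (rule mult_right_mono) simp
  also have "\<epsilon>^3 * real n * (real K)\<^sup>2 = \<epsilon> * real n * (\<epsilon>\<^sup>2 * (real K)\<^sup>2)" by (simp add: power2_eq_square power3_eq_cube)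
  also have "\<dots> \<le> \<epsilon> * real n * 1" using K2 assms(4) n by (intro mult_left_mono) simp_all
  finally show 1: "1000 * (real K)\<^sup>2 \<le> \<epsilon> * real n" by simp
  have "\<epsilon> * real n \<le> 1 * real n" using e n by (intro mult_right_mono) simp_all
  then show "1000 * (real K)\<^sup>2 \<le> real n" using 1 by linarith
  have "100 * (real K)\<^sup>2 * (\<epsilon>\<^sub>0 * real n) \<le> 100 * (real K)\<^sup>2 * (\<epsilon>^4 * real n)"
    using assms(6) n by (intro mult_left_mono mult_right_mono) simp_all
  also have "\<dots> = (100 * \<epsilon>) * (\<epsilon> * real n) * (\<epsilon>\<^sup>2 * (real K)\<^sup>2)" by (simp add: power2_eq_square power4_eq_xxxx)
  also have "\<dots> \<le> (100 * \<epsilon>) * (\<epsilon> * real n) * 1" using K2 assms(4) n by (intro mult_left_mono) simp_all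
  also have "\<dots> \<le> 1 * (\<epsilon> * real n) * 1" using e assms(4) n by (intro mult_right_mono) simp_all
  finally show "100 * (real K)\<^sup>2 * (\<epsilon>\<^sub>0 * real n) \<le> \<epsilon> * real n" by simp
  have "\<epsilon>\<^sub>0\<^sup>2 \<le> \<epsilon>\<^sub>0 * 1" unfolding power2_eq_square using assms(3) e0 by (intro mult_left_mono) simp_all
  then have "1000 \<le> \<epsilon>\<^sub>0 * real n" using n0 mult_right_mono[of "\<epsilon>\<^sub>0\<^sup>2" "\<epsilon>\<^sub>0" "real n"] n by linarith
  moreover have "\<epsilon>\<^sub>0 \<le> sqrt \<epsilon>\<^sub>0"
  proof (rule real_le_rsqrt)
    show "\<epsilon>\<^sub>0\<^sup>2 \<le> \<epsilon>\<^sub>0" using \<open>\<epsilon>\<^sub>0\<^sup>2 \<le> \<epsilon>\<^sub>0 * 1\<close> by simp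
  qed
  then have "\<epsilon>\<^sub>0 * real n \<le> sqrt \<epsilon>\<^sub>0 * real n" using n by (intro mult_right_mono) simp_all
  ultimately show "4 \<le> sqrt \<epsilon>\<^sub>0 * real n" by linarith
  have "10000 * \<epsilon> * real n \<le> lam * real n" using assms(7) n by (intro mult_right_mono) simp_all
  then show "10000 * (\<epsilon> * real n) \<le> lam * real n" by simp
  have "lam * real n \<le> 1 / 100 * real n" using assms(9) n by (intro mult_right_mono) simp_all
  then show "lam * real n \<le> real n / 100" by simp
qed

lemma hierarchy_funs:
  "hierarchy_fun (\<lambda>x. x / 10000)" "hierarchy_fun (\<lambda>x. x)"
  "hierarchy_fun (\<lambda>x. x^4)" "hierarchy_fun (\<lambda>x. x\<^sup>2 / 1000)"
proof -
  have p: "x ^ k \<in> {0<..1}" if "x \<in> {0<..1}" for x :: real and k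
    using that by (simp add: power_le_one)
  show "hierarchy_fun (\<lambda>x. x / 10000)" "hierarchy_fun (\<lambda>x. x)"
    unfolding hierarchy_fun_def by (auto intro!: mono_onI)
  show "hierarchy_fun (\<lambda>x. x^4)"
    unfolding hierarchy_fun_def using p[of _ 4] by (auto intro!: mono_onI power_mono)
  show "hierarchy_fun (\<lambda>x. x\<^sup>2 / 1000)"
    unfolding hierarchy_fun_def using p[of _ 2] by (force intro!: mono_onI divide_right_mono power_mono)
qed

text \<open>All numerical conditions of the construction, multiplied by \<open>k = K\<^sup>2\<close>, which makes them linear. The letters stand
  for \<open>F = \<phi> n\<close>, \<open>e = \<epsilon> n\<close>, \<open>L = \<lambda> n = k T\<close>, \<open>N = k M\<close>, \<open>k\<eta> = k \<eta>\<close> and \<open>kp = k p\<close>. In the main terms \<open>D\<close> is at least about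
  \<open>n/2\<close>, and the conditions reduce to inequalities such as \<open>11/40 < 1/2\<close> (a light vertex is below \<open>N\<close>) and
  \<open>(68/40 - 1)/2 < 1/2\<close> (so that \<open>q < N\<close>). The one with \<open>3 * x\<close> says that three vertices of degree about \<open>N\<close> force \<open>q\<close>
  to be about \<open>N/2\<close>.\<close>

lemma parameter_inequalities:
  fixes n D k L F e N k\<eta> kp :: real
  assumes "1 \<le> k" "1000 * k \<le> e" "10000 * e \<le> L" "L \<le> n / 100" "0 \<le> F" "F \<le> n / 100"
    "n / 2 - 1 \<le> D" "D \<le> n" "2 * N = D - F"
    "12 * e \<le> k\<eta>" "k\<eta> \<le> 13 * e" "F \<le> 2 * kp" "2 * kp \<le> F + 2 * k"
  shows "10 * k \<le> k\<eta>" "100 * k\<eta> \<le> L" "4 * L + kp \<le> N" "D / 2 \<le> N + kp"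
    "x \<le> 11 * D / 40 \<Longrightarrow> x + 2 * L + k\<eta> \<le> N"
    "11 * D / 40 \<le> x \<Longrightarrow> L + 2 * k + k\<eta> \<le> x - F"
    "h \<le> 68 * D / 40 + 15 \<Longrightarrow> (h - 2 * N) / 2 + 2 * L \<le> N"
    "N < x + 2 * L + k\<eta> \<Longrightarrow> 3 * x \<le> h + F + 2 \<Longrightarrow> kp + 2 * L + 6 * k\<eta> + 2 * k \<le> (h - 2 * N) / 2"
    "400 \<le> D" "68 * D / 40 + 15 \<le> 2 * n" "e + F < 11 * D / 40"
  using assms by (simp_all add: field_simps)

section \<open>The pruned graph\<close>

text \<open>\<open>Gd\<close> differs from \<open>G\<close> on the crossing edges by at most \<open>F = \<phi> n\<close> edges.\<close>

locale pruned_graph =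
  fixes G G\<^sub>0 Gd :: "'a graph" and A B :: "nat \<Rightarrow> 'a set" and K :: nat and D :: nat and F :: real
  assumes simple: "simple_graph G" and regular: "regular D G"
    and V: "verts G = side K A \<union> side K B" and disj: "side K A \<inter> side K B = {}"
    and sub0: "subgraph G\<^sub>0 G"
    and inner: "subgraph (graph_plus (induced G (A 0)) (induced G (B 0))) G\<^sub>0"
    and cross0: "real (e_between G\<^sub>0 (side K A) (side K B)) \<le> F"
    and deg0: "\<And>v. v \<in> A 0 \<union> B 0 \<Longrightarrow> real (deg G\<^sub>0 v) = F"
    and Gd: "Gd = graph_minus (graph_minus (graph_minus G (induced G (clusters K A)))
                                      (induced G (clusters K B))) G\<^sub>0"
    and clA: "A 0 \<inter> clusters K A = {}" and clB: "B 0 \<inter> clusters K B = {}"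
begin

abbreviation "E \<equiv> edges (bip G (side K A) (side K B))"
abbreviation "H \<equiv> edges (bip Gd (side K A) (side K B))"

lemma edges_Gd: "edges Gd = {e \<in> edges G. \<not> e \<subseteq> clusters K A \<and> \<not> e \<subseteq> clusters K B \<and> e \<notin> edges G\<^sub>0}"
  unfolding Gd graph_minus_def induced_def by auto

lemma verts_Gd: "verts Gd = verts G"
  unfolding Gd graph_minus_def by simp

lemma simple_Gd: "simple_graph Gd"
  using simple unfolding simple_graph_def verts_Gd edges_Gd by simp

lemma simple_G0: "simple_graph G\<^sub>0"
  using sub0 unfolding subgraph_def by simp

text \<open>Edges inside \<open>A\<close> and \<open>B\<close> are deleted, and those inside \<open>A\<^sub>0\<close> and \<open>B\<^sub>0\<close> belong to \<open>G\<^sub>0\<close>.\<close>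

lemma no_inner_edges:
  assumes "e \<in> edges Gd"
  shows "\<not> e \<subseteq> clusters K A" "\<not> e \<subseteq> clusters K B" "\<not> e \<subseteq> A 0" "\<not> e \<subseteq> B 0"
proof -
  have "edges (induced G (A 0)) \<union> edges (induced G (B 0)) \<subseteq> edges G\<^sub>0"
    using inner unfolding subgraph_def graph_plus_def by simp
  then show "\<not> e \<subseteq> clusters K A" "\<not> e \<subseteq> clusters K B" "\<not> e \<subseteq> A 0" "\<not> e \<subseteq> B 0"
    using assms unfolding edges_Gd induced_def by auto
qed

text \<open>No edge inside \<open>A\<close> or \<open>B\<close> contains an exceptional vertex, so only the edges of \<open>G\<^sub>0\<close> are lost.\<close>

lemma exceptional_degree:
  assumes v: "v \<in> A 0 \<union> B 0"
  shows "real (deg Gd v) = real D - F"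
proof -
  have disj': "A 0 \<inter> side K B = {}" "B 0 \<inter> side K A = {}" using disj unfolding side_def by auto
  have nc: "v \<notin> clusters K A" "v \<notin> clusters K B"
    using v clA clB disj' unfolding side_def by auto
  have vG: "v \<in> verts G" using v unfolding V side_def by auto
  have sub: "edges G\<^sub>0 \<subseteq> edges G" using sub0 unfolding subgraph_def by simp
  have "edges Gd \<inter> {e. v \<in> e} = {e \<in> edges G. v \<in> e} - {e \<in> edges G\<^sub>0. v \<in> e}"
    unfolding edges_Gd using nc by auto
  then have "{e \<in> edges Gd. v \<in> e} = {e \<in> edges G. v \<in> e} - {e \<in> edges G\<^sub>0. v \<in> e}" by auto
  then have "dg (edges Gd) v = card ({e \<in> edges G. v \<in> e} - {e \<in> edges G\<^sub>0. v \<in> e})"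
    unfolding dg_def by simp
  also have "\<dots> = dg (edges G) v - dg (edges G\<^sub>0) v"
    unfolding dg_def
  proof (rule card_Diff_subset)
    show "finite {e \<in> edges G\<^sub>0. v \<in> e}" using simple_graph_finite_edges[OF simple_G0] by simp
    show "{e \<in> edges G\<^sub>0. v \<in> e} \<subseteq> {e \<in> edges G. v \<in> e}" using sub by auto
  qed
  finally have 1: "dg (edges Gd) v = dg (edges G) v - dg (edges G\<^sub>0) v" .
  have "dg (edges G\<^sub>0) v \<le> dg (edges G) v" by (rule dg_mono[OF simple_graph_finite_edges[OF simple] sub])
  moreover have "dg (edges G) v = D"
    using regular vG unfolding regular_def deg_eq_dg[OF simple] by simp
  moreover have "real (dg (edges G\<^sub>0) v) = F" using deg0[OF v] unfolding deg_eq_dg[OF simple_G0] .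
  ultimately show ?thesis unfolding deg_eq_dg[OF simple_Gd] 1 by linarith
qed

lemma finite_E: "finite E"
  by (rule simple_graph_finite_edges[OF simple_graph_bip[OF simple]])

lemma finite_H: "finite H"
  by (rule simple_graph_finite_edges[OF simple_graph_bip[OF simple_Gd]])

lemma finite_cross0: "finite (edges (bip G\<^sub>0 (side K A) (side K B)))"
  by (rule simple_graph_finite_edges[OF simple_graph_bip[OF simple_G0]])

lemma H_subset_E: "H \<subseteq> E"
  unfolding edges_bip edges_Gd by blast

lemma E_subset: "E \<subseteq> H \<union> edges (bip G\<^sub>0 (side K A) (side K B))"
proof
  fix e assume e: "e \<in> E"
  then obtain x z where xz: "x \<in> side K A" "z \<in> side K B" "e = {x,z}" "e \<in> edges G" unfolding edges_bip by blast
  have "\<not> e \<subseteq> clusters K A" "\<not> e \<subseteq> clusters K B" using xz disj unfolding side_def by auto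
  then show "e \<in> H \<union> edges (bip G\<^sub>0 (side K A) (side K B))"
    using xz unfolding edges_bip edges_Gd by auto
qed

lemma card_E_le: "real (card E) \<le> real (card H) + F"
proof -
  have "card E \<le> card (H \<union> edges (bip G\<^sub>0 (side K A) (side K B)))"
    by (rule card_mono) (simp_all add: E_subset finite_H finite_cross0)
  also have "\<dots> \<le> card H + card (edges (bip G\<^sub>0 (side K A) (side K B)))" by (rule card_Un_le)
  finally show ?thesis using cross0 unfolding e_between_eq_card by linarith
qed

lemma dg_E_le: "real (dg E v) \<le> real (dg H v) + F"
proof -
  let ?C = "edges (bip G\<^sub>0 (side K A) (side K B))"
  have "dg E v \<le> card ({e \<in> H. v \<in> e} \<union> {e \<in> ?C. v \<in> e})"
    unfolding dg_def using E_subset by (intro card_mono) (auto simp: finite_H finite_cross0)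
  also have "\<dots> \<le> dg H v + dg ?C v" unfolding dg_def by (rule card_Un_le)
  also have "\<dots> \<le> dg H v + card ?C" using dg_le_card[OF finite_cross0] by simp
  finally show ?thesis using cross0 unfolding e_between_eq_card by linarith
qed

lemma dg_H_le: "dg H v \<le> dg E v"
  by (rule dg_mono[OF finite_E H_subset_E])

lemma cluster_dg_H:
  assumes v: "v \<notin> A 0 \<union> B 0" and c: "0 \<le> c"
    and a: "\<And>v. v \<in> clusters K A \<Longrightarrow> real (deg_in Gd v (side K B)) \<le> c"
    and b: "\<And>v. v \<in> clusters K B \<Longrightarrow> real (deg_in Gd v (side K A)) \<le> c"
  shows "real (dg H v) \<le> c"
proof -
  consider "v \<in> clusters K A" | "v \<in> clusters K B" | "v \<notin> verts G"
    using v unfolding V side_def by auto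
  then show ?thesis
  proof cases
    case 1
    then have "dg H v = deg_in Gd v (side K B)" by (intro dg_bip disj) (simp add: side_def)
    then show ?thesis using a[OF 1] by simp
  next
    case 2
    have "side K B \<inter> side K A = {}" using disj by (simp only: Int_commute)
    then have "dg (edges (bip Gd (side K B) (side K A))) v = deg_in Gd v (side K A)"
      by (rule dg_bip) (use 2 in \<open>simp add: side_def\<close>)
    then show ?thesis using b[OF 2] unfolding edges_bip_commute[of Gd "side K A"] by simp
  next
    case 3
    have "v \<notin> verts (bip Gd (side K A) (side K B))" using 3 unfolding bip_def verts_Gd by simp
    then have "dg H v = 0" by (rule dg_outside_verts[OF simple_graph_bip[OF simple_Gd]])
    then show ?thesis using c by simp
  qed
qed

end

section \<open>The decomposition\<close>

text \<open>It remains to choose the integers \<open>M\<close>, \<open>T\<close>, \<open>\<eta>\<close>, \<open>p\<close>, \<open>q\<close> and to identify the heavy vertices. Of these there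
  are at most three. If a vertex other than \<open>w\<^sub>1, w\<^sub>2\<close> is heavy, then so are \<open>w\<^sub>1\<close> and \<open>w\<^sub>2\<close>, by the choice of \<open>w\<^sub>1\<close> and \<open>w\<^sub>2\<close>, and it is the
  only other one. Heavy vertices are exceptional, because a cluster vertex has at most \<open>\<epsilon>\<^sub>0 n\<close> crossing neighbours
  in \<open>Gd\<close>.\<close>

lemma critical_decomposition:
  fixes n D K m :: nat and \<epsilon>\<^sub>0 \<epsilon> lam \<phi> :: real and G G\<^sub>0 Gd :: "'a graph"
    and A B :: "nat \<Rightarrow> 'a set" and w\<^sub>1 w\<^sub>2 :: 'a
  assumes n0: "0 < n" and K: "0 < K" and hier: "1 / real n \<le> \<epsilon>\<^sub>0\<^sup>2 / 1000" "\<epsilon>\<^sub>0 \<le> \<epsilon>^4" "\<epsilon> \<le> lam / 10000" "\<epsilon> \<le> 1 / real K" "lam \<le> 1 / 100"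
    and pos: "0 < \<epsilon>\<^sub>0" "0 < \<epsilon>" "0 < lam"
    and phi: "0 \<le> \<phi>" "\<phi> \<le> 1 / 100"
    and D: "int D \<ge> int n - 2 * \<lfloor>real n / 4\<rfloor> - 1"
    and natT: "lam * real n / (real K)\<^sup>2 \<in> \<nat>" and natM: "(real D - \<phi> * real n) / (400 * (real K)\<^sup>2) \<in> \<nat>"
    and simple: "simple_graph G" and cardG: "card (verts G) = n" and reg: "regular D G"
    and part: "Kme_partition K m \<epsilon>\<^sub>0 A B (verts G)"
    and cross: "D \<le> e_between G (side K A) (side K B)"
    and maxd: "real (max_deg (bip G (side K A) (side K B))) \<le> real D / 2"
    and crit: "critical G (side K A) (side K B) D"
    and sub0: "subgraph G\<^sub>0 G" and inner: "subgraph (graph_plus (induced G (A 0)) (induced G (B 0))) G\<^sub>0"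
    and cross0: "real (e_between G\<^sub>0 (side K A) (side K B)) \<le> \<phi> * real n"
    and deg0: "\<forall>v \<in> A 0 \<union> B 0. real (deg G\<^sub>0 v) = \<phi> * real n"
    and Gd: "Gd = graph_minus (graph_minus (graph_minus G (induced G (clusters K A)))
                                      (induced G (clusters K B))) G\<^sub>0"
    and evenH: "even (e_between Gd (side K A) (side K B))"
    and sch: "exceptional_scheme K m \<epsilon>\<^sub>0 \<epsilon> Gd A B"
    and w: "w\<^sub>1 \<in> verts G" "w\<^sub>2 \<in> verts G" "w\<^sub>1 \<noteq> w\<^sub>2"
    and wmax: "deg (bip G (side K A) (side K B)) w\<^sub>2 \<le> deg (bip G (side K A) (side K B)) w\<^sub>1"
      "\<forall>v \<in> verts G - {w\<^sub>1, w\<^sub>2}. deg (bip G (side K A) (side K B)) v \<le> deg (bip G (side K A) (side K B)) w\<^sub>2"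
    and wd: "real (deg (bip Gd (side K A) (side K B)) w\<^sub>1) \<le> (real D - \<phi> * real n) / 2"
      "real (deg (bip Gd (side K A) (side K B)) w\<^sub>2) \<le> (real D - \<phi> * real n) / 2"
  shows "\<exists>\<J> :: 'a graph set.
           finite \<J> \<and> real (card \<J>) = (real D - \<phi> * real n) / 2 \<and>
           (\<forall>J\<in>\<J>. subgraph J Gd \<and> HES \<epsilon>\<^sub>0 K A B J) \<and>
           (\<forall>J\<in>\<J>. \<forall>J'\<in>\<J>. J \<noteq> J' \<longrightarrow> edges J \<inter> edges J' = {}) \<and>
           (\<Union>J\<in>\<J>. edges J) = edges Gd \<and>
           (\<forall>i\<in>{1..K}. \<forall>i'\<in>{1..K}.
              \<exists>\<S> \<subseteq> \<J>.
                real (card \<S>) = (real D - (\<phi> + 2 * lam) * real n) / (2 * (real K)\<^sup>2) \<and>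
                (\<forall>J\<in>\<S>. local_HES \<epsilon>\<^sub>0 K A B i i' J) \<and>
                (\<exists>\<T> \<subseteq> \<S>.
                   real (card \<T>) = lam * real n / (real K)\<^sup>2 \<and>
                   (\<forall>J\<in>\<T>.
                      e_between J (side K A) (side K B) = 2 \<and>
                      (\<forall>w\<in>{w\<^sub>1, w\<^sub>2}. real (deg (bip G (side K A) (side K B)) w) \<ge> 11 * real D / 40
                           \<longrightarrow> deg (bip J (side K A) (side K B)) w = 1))))"
proof -
  define k where "k = (real K)\<^sup>2"
  define F where "F = \<phi> * real n"
  define e where "e = \<epsilon> * real n"
  define L where "L = lam * real n"
  have part': "verts G = side K A \<union> side K B"
    "\<And>i j. i \<le> K \<Longrightarrow> j \<le> K \<Longrightarrow> i \<noteq> j \<Longrightarrow> A i \<inter> A j = {}"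
    "\<And>i j. i \<le> K \<Longrightarrow> j \<le> K \<Longrightarrow> i \<noteq> j \<Longrightarrow> B i \<inter> B j = {}"
    "\<And>i j. i \<le> K \<Longrightarrow> j \<le> K \<Longrightarrow> A i \<inter> B j = {}"
    "real (card (A 0 \<union> B 0)) \<le> \<epsilon>\<^sub>0 * real n"
    using part cardG unfolding Kme_partition_def by simp_all
  have mem: "\<exists>i\<le>K. x \<in> S i" if "x \<in> side K S" for x and S :: "nat \<Rightarrow> 'a set"
    using that unfolding side_def clusters_def by auto
  have disj: "side K A \<inter> side K B = {}"
  proof (rule equals0I)
    fix x assume "x \<in> side K A \<inter> side K B"
    then obtain i j where "i \<le> K" "x \<in> A i" "j \<le> K" "x \<in> B j" using mem[of x A] mem[of x B] by auto
    then show False using part'(4)[of i j] by auto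
  qed
  have zero: "A 0 \<inter> clusters K A = {}" "B 0 \<inter> clusters K B = {}"
    unfolding clusters_def using part'(2,3)[of 0] by fastforce+
  interpret pruned_graph G G\<^sub>0 Gd A B K D F
    by unfold_locales (use simple reg part'(1) disj sub0 inner cross0 deg0 Gd zero in \<open>simp_all add: F_def\<close>)
  note hb = hierarchy_bounds[OF n0 K pos(1,2) hier, folded k_def e_def L_def]
  have k1: "1 \<le> k" using K unfolding k_def by simp
  have kp: "0 < k" using k1 by linarith
  have F: "0 \<le> F" "F \<le> real n / 100"
    unfolding F_def using phi mult_right_mono[OF phi(2), of "real n"] by simp_all
  have Dn: "real n / 2 - 1 \<le> real D"
  proof -
    have "real_of_int (int n - 2 * \<lfloor>real n / 4\<rfloor> - 1) \<le> real_of_int (int D)" using D by (simp only: of_int_le_iff)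
    moreover have "real_of_int \<lfloor>real n / 4\<rfloor> \<le> real n / 4" by (rule of_int_floor_le)
    ultimately show ?thesis by simp
  qed
  have finV: "finite (verts G)" using simple unfolding simple_graph_def by blast
  have Dn2: "real D \<le> real n"
  proof -
    have "D = deg G w\<^sub>1" using reg w(1) unfolding regular_def by simp
    also have "\<dots> \<le> card (verts G)" unfolding deg_def deg_in_def by (rule card_mono[OF finV]) auto
    finally show ?thesis using cardG by simp
  qed
  obtain a where a: "(real D - F) / (400 * k) = real a"
    using natM unfolding F_def[symmetric] k_def[symmetric] by (rule Nats_cases)
  \<comment> \<open>The factor \<open>400\<close> in the divisibility hypothesis is \<open>2 * 200\<close>, so \<open>K\<^sup>2 * M = N\<close>.\<close>
  define M where "M = 200 * a"
  have kM: "2 * (k * real M) = real D - F" using a kp unfolding M_def by (simp add: divide_eq_eq)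
  obtain T where T: "L / k = real T"
    using natT unfolding L_def[symmetric] k_def[symmetric] by (rule Nats_cases)
  have kT: "k * real T = L" using T kp by (simp add: divide_eq_eq)
  have ceil: "x \<le> real (nat \<lceil>x\<rceil>) \<and> real (nat \<lceil>x\<rceil>) \<le> x + 1" if "0 \<le> x" for x :: real
    using that by linarith
  have e: "0 < e" unfolding e_def using pos n0 by simp
  \<comment> \<open>Twice the total error \<open>6 * \<epsilon> n / K\<^sup>2\<close> of the cells leaves room for the terms of lower order.\<close>
  define \<eta> where "\<eta> = nat \<lceil>12 * e / k\<rceil>"
  have "12 * e / k \<le> real \<eta> \<and> real \<eta> \<le> 12 * e / k + 1"
    unfolding \<eta>_def by (rule ceil) (use e kp in simp)
  then have "12 * e \<le> k * real \<eta> \<and> k * real \<eta> \<le> 12 * e + k" using kp by (simp add: field_simps)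
  then have k\<eta>: "12 * e \<le> k * real \<eta>" "k * real \<eta> \<le> 13 * e" using hb(1) e by linarith+
  \<comment> \<open>A vertex has crossing degree at most \<open>D/2 = N + \<phi> n/2\<close>, and \<open>K\<^sup>2 * p\<close> covers the excess over \<open>N\<close>.\<close>
  define p where "p = nat \<lceil>F / (2 * k)\<rceil>"
  have "F / (2 * k) \<le> real p \<and> real p \<le> F / (2 * k) + 1"
    unfolding p_def by (rule ceil) (use F kp in simp)
  then have kpp: "F \<le> 2 * (k * real p)" "2 * (k * real p) \<le> F + 2 * k" using kp by (simp_all add: field_simps)
  note P = parameter_inequalities[OF k1 hb(1) hb(4) hb(5) F Dn Dn2 kM k\<eta> kpp]
  have dE: "deg (bip G (side K A) (side K B)) v = dg E v" for v by (rule deg_eq_dg[OF simple_graph_bip[OF simple]])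
  have dH: "deg (bip Gd (side K A) (side K B)) v = dg H v" for v by (rule deg_eq_dg[OF simple_graph_bip[OF simple_Gd]])
  have bE: "bipart (side K A) (side K B) E" by (rule bipart_bip[OF simple disj])
  have maxE: "real (dg E v) \<le> real D / 2" for v
    using dg_le_max_deg[OF simple_graph_bip[OF simple], of "side K A" "side K B" v] maxd by linarith
  have critE: "real (card H') \<le> 41 * real D / 40"
    if "H' \<subseteq> E" "\<And>v. real (dg H' v) \<le> 11 * real D / 40" for H'
    by (rule critical_dg[OF simple disj crit that])
  have few: "card {v. 11 * real D / 40 \<le> real (dg E v)} \<le> 3"
    by (rule critical_few_heavy[OF bE P(9) critE])
  have cE: "real (card E) \<le> 68 * real D / 40 + 15"
    by (rule critical_card_bound[OF bE P(9) maxE critE])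
  have cHE: "card H \<le> card E" by (rule card_mono[OF finite_E H_subset_E])
  have cH: "real (card H) \<le> 68 * real D / 40 + 15" using cE cHE by linarith
  have DE: "real D \<le> real (card E)" using cross unfolding e_between_eq_card by simp
  have nat1: "real (2 * K\<^sup>2 * M) = 2 * (k * real M)" unfolding k_def by simp
  have "real (2 * K\<^sup>2 * M) \<le> real (card H)" unfolding nat1 kM using card_E_le DE by linarith
  then have le: "2 * K\<^sup>2 * M \<le> card H" by (simp only: of_nat_le_iff)
  have "even (card H - 2 * K\<^sup>2 * M)" using evenH unfolding e_between_eq_card by simp
  then obtain q where "card H - 2 * K\<^sup>2 * M = 2 * q" by (rule evenE)
  then have q: "card H = 2 * K\<^sup>2 * M + 2 * q" using le by linarith
  have rq: "real q = (real (card H) - 2 * (k * real M)) / 2" unfolding q of_nat_add nat1 by simp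
  have cancel: "x \<le> y" if "k * real x \<le> k * real y" for x y using that kp by simp
  have ncV: "k * real (card (A 0 \<union> B 0)) \<le> k * (\<epsilon>\<^sub>0 * real n)" using part'(5) kp by (intro mult_left_mono) simp_all
  have schv: "\<And>v. v \<in> clusters K A \<Longrightarrow> real (deg_in Gd v (side K B)) < \<epsilon>\<^sub>0 * real n"
    "\<And>v. v \<in> clusters K B \<Longrightarrow> real (deg_in Gd v (side K A)) < \<epsilon>\<^sub>0 * real n"
    using sch cardG unfolding exceptional_scheme_def Let_def verts_Gd by simp_all
  have lowH: "real (dg H v) \<le> \<epsilon>\<^sub>0 * real n" if "v \<notin> A 0 \<union> B 0" for v
    by (rule cluster_dg_H[OF that]) (use schv pos in \<open>auto intro: less_imp_le\<close>)
  have e0e: "100 * (k * (\<epsilon>\<^sub>0 * real n)) \<le> e" using hb(2) by (simp only: mult.assoc)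
  have e0n: "\<epsilon>\<^sub>0 * real n \<le> k * (\<epsilon>\<^sub>0 * real n)" using mult_right_mono[OF k1, of "\<epsilon>\<^sub>0 * real n"] pos by simp
  have heavyV0: "v \<in> A 0 \<union> B 0" if heavy: "11 * real D / 40 \<le> real (dg E v)" for v
  proof (rule ccontr)
    assume "v \<notin> A 0 \<union> B 0"
    then have "real (dg E v) \<le> \<epsilon>\<^sub>0 * real n + F" using lowH[of v] dg_E_le[of v] by linarith
    moreover have "0 \<le> \<epsilon>\<^sub>0 * real n" using pos by simp
    ultimately show False using heavy P(11) e0e e0n e by linarith
  qed
  \<comment> \<open>A lighter \<open>w\<close> need not be hit by the special pairs.\<close>
  define X where "X = {w \<in> {w\<^sub>1, w\<^sub>2}. 11 * real D / 40 \<le> real (dg E w)}"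
  have heavyG: "v \<in> verts G" if "11 * real D / 40 \<le> real (dg E v)" for v
    using heavyV0[OF that] part'(1) unfolding side_def by auto
  have other: "dg E v \<le> dg E w\<^sub>2 \<and> w\<^sub>1 \<in> X \<and> w\<^sub>2 \<in> X \<and> v \<noteq> w\<^sub>1 \<and> v \<noteq> w\<^sub>2"
    if v: "11 * real D / 40 \<le> real (dg E v)" "v \<notin> X" for v
  proof -
    have ne: "v \<noteq> w\<^sub>1" "v \<noteq> w\<^sub>2" using v unfolding X_def by auto
    then have "dg E v \<le> dg E w\<^sub>2" using wmax(2) heavyG[OF v(1)] unfolding dE by simp
    moreover have "dg E w\<^sub>2 \<le> dg E w\<^sub>1" using wmax(1) unfolding dE .
    ultimately show ?thesis using ne v(1) unfolding X_def by simp
  qed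
  obtain y where y: "y \<notin> X" "\<And>v. v \<notin> X \<Longrightarrow> v \<noteq> y \<Longrightarrow> real (dg E v) < 11 * real D / 40"
  proof (cases "\<exists>y. y \<notin> X \<and> 11 * real D / 40 \<le> real (dg E y)")
    case True
    then obtain y where y: "y \<notin> X" "11 * real D / 40 \<le> real (dg E y)" by blast
    have "real (dg E v) < 11 * real D / 40" if v: "v \<notin> X" "v \<noteq> y" for v
    proof (rule ccontr)
      assume "\<not> ?thesis"
      then have hv: "11 * real D / 40 \<le> real (dg E v)" by simp
      have "{w\<^sub>1, w\<^sub>2, y, v} \<subseteq> {v. 11 * real D / 40 \<le> real (dg E v)}"
        using other[OF y(2,1)] y(2) hv unfolding X_def by simp
      moreover have "finite {v. 11 * real D / 40 \<le> real (dg E v)}"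
        by (rule finite_subset[OF _ finV]) (use heavyG in auto)
      ultimately have "card {w\<^sub>1, w\<^sub>2, y, v} \<le> card {v. 11 * real D / 40 \<le> real (dg E v)}" by (intro card_mono)
      moreover have "card {w\<^sub>1, w\<^sub>2, y, v} = 4" using w(3) other[OF y(2,1)] other[OF hv v(1)] v(2) by auto
      ultimately show False using few by simp
    qed
    then show thesis using that[of y] y(1) by blast
  next
    case False
    \<comment> \<open>Then any vertex besides \<open>w\<^sub>1\<close> and \<open>w\<^sub>2\<close> can serve as \<open>y\<close>.\<close>
    have n3: "2 < card (verts G)" using hb(6) k1 cardG by simp
    have "\<exists>y. y \<in> verts G - {w\<^sub>1, w\<^sub>2}"
    proof (rule ccontr)
      assume "\<not> ?thesis"
      then have "verts G \<subseteq> {w\<^sub>1, w\<^sub>2}" by auto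
      then have "card (verts G) \<le> card {w\<^sub>1, w\<^sub>2}" by (intro card_mono) simp_all
      then show False using n3 w(3) by simp
    qed
    then obtain y where "y \<noteq> w\<^sub>1" "y \<noteq> w\<^sub>2" by auto
    then have "y \<notin> X" unfolding X_def by auto
    then show thesis using that[of y] False by force
  qed
  have e2: "real (card (edges (bip Gd (side K A) (side K B)))) \<le> 2 * real (card (verts Gd))"
    unfolding verts_Gd cardG using cH P(10) by linarith
  note sb = scheme_bounds[OF sch K pos(2) simple_Gd e2, unfolded verts_Gd cardG]
  define \<rho> where "\<rho> = 2 * \<epsilon> * real n / (real K)\<^sup>2"
  have k\<rho>: "k * \<rho> = 2 * e" using kp unfolding \<rho>_def e_def k_def by simp
  have V0G: "v \<in> verts G" if "v \<in> A 0 \<union> B 0" for v using that part'(1) unfolding side_def by auto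
  have small: "dg H v + K\<^sup>2 * (2 * T + \<eta>) \<le> K\<^sup>2 * M" if "real (dg E v) \<le> 11 * real D / 40" for v
  proof -
    have "real (dg H v) \<le> 11 * real D / 40" using that dg_H_le[of v] by linarith
    then have "real (dg H v) + 2 * L + k * real \<eta> \<le> k * real M" by (rule P(5))
    then have "real (dg H v + K\<^sup>2 * (2 * T + \<eta>)) \<le> real (K\<^sup>2 * M)"
      unfolding kT[symmetric] k_def by (simp add: algebra_simps)
    then show ?thesis by (simp only: of_nat_le_iff)
  qed
  have config: "hes_setup Gd A B K M T \<eta> p q (card (A 0 \<union> B 0)) \<rho> \<epsilon>\<^sub>0 X y"
  proof
    show "0 < K" by fact
    show "simple_graph Gd" by (rule simple_Gd)
    show "verts Gd = side K A \<union> side K B" unfolding verts_Gd by fact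
    show "A i \<inter> A j = {}" if "i \<le> K" "j \<le> K" "i \<noteq> j" for i j by (rule part'(2)[OF that])
    show "B i \<inter> B j = {}" if "i \<le> K" "j \<le> K" "i \<noteq> j" for i j by (rule part'(3)[OF that])
    show "A i \<inter> B j = {}" if "i \<le> K" "j \<le> K" for i j by (rule part'(4)[OF that])
    show "\<not> f \<subseteq> clusters K A" "\<not> f \<subseteq> clusters K B" "\<not> f \<subseteq> A 0" "\<not> f \<subseteq> B 0" if "f \<in> edges Gd" for f
      by (rule no_inner_edges[OF that])+
    show "deg Gd v = 2 * (K\<^sup>2 * M)" if "v \<in> A 0 \<union> B 0" for v
    proof -
      have "real (deg Gd v) = real (2 * (K\<^sup>2 * M))"
        unfolding exceptional_degree[OF that] kM[symmetric] k_def by simp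
      then show ?thesis by (simp only: of_nat_eq_iff)
    qed
    show "0 \<le> \<rho>" unfolding \<rho>_def using pos by simp
    have "k * (3 * \<rho> + 2 * real (card (A 0 \<union> B 0)) + 1) = 6 * e + 2 * (k * real (card (A 0 \<union> B 0))) + k"
      using k\<rho> by (simp add: algebra_simps)
    also have "\<dots> \<le> k * real \<eta>" using ncV e0e hb(1) k\<eta>(1) e by linarith
    finally show "3 * \<rho> + 2 * real (card (A 0 \<union> B 0)) + 1 \<le> real \<eta>" using kp by (simp only: mult_le_cancel_left_pos)
    show "\<bar>real (e_between Gd (A i) (B j)) - real (e_between Gd (clusters K A) (clusters K B)) / (real K)\<^sup>2\<bar> \<le> \<rho>"
      if "i \<in> {1..K}" "j \<in> {1..K}" for i j unfolding \<rho>_def by (rule sb(1)[OF that])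
    show "\<bar>real (e_between Gd (A 0) (B j)) - real (e_between Gd (A 0) (clusters K B)) / real K\<bar> \<le> \<rho> * real K"
      if "j \<in> {1..K}" for j unfolding \<rho>_def by (rule sb(2)[OF that])
    show "\<bar>real (e_between Gd (B 0) (A i)) - real (e_between Gd (B 0) (clusters K A)) / real K\<bar> \<le> \<rho> * real K"
      if "i \<in> {1..K}" for i unfolding \<rho>_def by (rule sb(3)[OF that])
    show "\<bar>real (deg_in Gd v (A i)) - real (deg_in Gd v (clusters K A)) / real K\<bar> \<le> \<rho> * real K"
      if "v \<in> A 0 \<union> B 0" "i \<in> {1..K}" for v i unfolding \<rho>_def by (rule sb(4)[OF V0G[OF that(1)] that(2)])
    show "\<bar>real (deg_in Gd v (B i)) - real (deg_in Gd v (clusters K B)) / real K\<bar> \<le> \<rho> * real K"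
      if "v \<in> A 0 \<union> B 0" "i \<in> {1..K}" for v i unfolding \<rho>_def by (rule sb(5)[OF V0G[OF that(1)] that(2)])
    show "card H = 2 * K\<^sup>2 * M + 2 * q" by (rule q)
    show "dg H v \<le> \<eta>" if "v \<notin> A 0 \<union> B 0" for v
    proof (rule cancel)
      have "k * real (dg H v) \<le> k * (\<epsilon>\<^sub>0 * real n)" using lowH[OF that] kp by (intro mult_left_mono) simp_all
      then show "k * real (dg H v) \<le> k * real \<eta>" using e0e k\<eta>(1) e by linarith
    qed
    show "finite X" unfolding X_def by simp
    have "card X \<le> card {w\<^sub>1, w\<^sub>2}" unfolding X_def by (rule card_mono) auto
    then show "card X \<le> 2" using w(3) by simp
    show "y \<notin> X" by (rule y(1))
    show "X \<subseteq> A 0 \<union> B 0" using heavyV0 unfolding X_def by blast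
    show "dg H v \<le> K\<^sup>2 * M" if "v \<in> X" for v
    proof -
      have "v = w\<^sub>1 \<or> v = w\<^sub>2" using that unfolding X_def by simp
      then have "real (dg H v) \<le> (real D - F) / 2" using wd unfolding dH F_def by auto
      then have "real (dg H v) \<le> real (K\<^sup>2 * M)" unfolding kM[symmetric] k_def by simp
      then show ?thesis by (simp only: of_nat_le_iff)
    qed
    show "K\<^sup>2 * (T + 2 + \<eta>) \<le> dg H v" if "v \<in> X" for v
    proof -
      have "11 * real D / 40 \<le> real (dg E v)" using that unfolding X_def by simp
      then have "L + 2 * k + k * real \<eta> \<le> real (dg E v) - F" by (rule P(6))
      then have "L + 2 * k + k * real \<eta> \<le> real (dg H v)" using dg_E_le[of v] by linarith
      then have "real (K\<^sup>2 * (T + 2 + \<eta>)) \<le> real (dg H v)"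
        unfolding kT[symmetric] k_def by (simp add: algebra_simps)
      then show ?thesis by (simp only: of_nat_le_iff)
    qed
    show "dg H v + K\<^sup>2 * (2 * T + \<eta>) \<le> K\<^sup>2 * M" if "v \<notin> X" "v \<noteq> y" for v
      by (rule small[OF less_imp_le[OF y(2)[OF that]]])
    show "dg H v \<le> K\<^sup>2 * M + K\<^sup>2 * p" for v
    proof -
      have "real (dg H v) \<le> k * real M + k * real p" using maxE[of v] dg_H_le[of v] P(4) by linarith
      then have "real (dg H v) \<le> real (K\<^sup>2 * M + K\<^sup>2 * p)" unfolding k_def by simp
      then show ?thesis by (simp only: of_nat_le_iff)
    qed
    show "dg H y + K\<^sup>2 * (2 * T + \<eta>) \<le> K\<^sup>2 * M \<or> K\<^sup>2 * (p + 2 * T + 6 * \<eta> + 2) \<le> q"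
    proof (unfold disj_imp, rule impI)
      assume n: "\<not> dg H y + K\<^sup>2 * (2 * T + \<eta>) \<le> K\<^sup>2 * M"
      then have hy: "11 * real D / 40 \<le> real (dg E y)" using small[of y] by linarith
      \<comment> \<open>The degrees of \<open>w\<^sub>1\<close>, \<open>w\<^sub>2\<close> and \<open>y\<close> in \<open>G\<close> are all at least that of \<open>y\<close> in \<open>H\<close>, which is nearly \<open>N\<close>.\<close>
      note o = other[OF hy y(1)]
      have "real (K\<^sup>2 * M) < real (dg H y + K\<^sup>2 * (2 * T + \<eta>))" using n by (simp only: of_nat_less_iff not_le)
      then have lt: "k * real M < real (dg H y) + 2 * L + k * real \<eta>"
        unfolding kT[symmetric] k_def by (simp add: algebra_simps)
      have "dg E w\<^sub>1 + dg E w\<^sub>2 + dg E y \<le> card E + 2" by (rule dg_sum3[OF bE w(3)]) (use o in auto)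
      moreover have "dg E w\<^sub>2 \<le> dg E w\<^sub>1" using wmax(1) unfolding dE .
      ultimately have "3 * dg H y \<le> card E + 2" using o dg_H_le[of y] by linarith
      then have "3 * real (dg H y) \<le> real (card H) + F + 2" using card_E_le by linarith
      from P(8)[OF lt this] have "k * real p + 2 * L + 6 * (k * real \<eta>) + 2 * k \<le> real q" unfolding rq .
      then have "real (K\<^sup>2 * (p + 2 * T + 6 * \<eta> + 2)) \<le> real q"
        unfolding kT[symmetric] k_def by (simp add: algebra_simps)
      then show "K\<^sup>2 * (p + 2 * T + 6 * \<eta> + 2) \<le> q" by (simp only: of_nat_le_iff)
    qed
    show "10 \<le> \<eta>" by (rule cancel) (use P(1) in simp)
    show "100 * \<eta> \<le> T" by (rule cancel) (use P(2) kT in simp)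
    show "4 * T + p \<le> M" by (rule cancel) (use P(3) kT in \<open>simp add: distrib_left\<close>)
    show "q + K\<^sup>2 * (2 * T) \<le> K\<^sup>2 * M"
    proof -
      have "real q + 2 * L \<le> k * real M" unfolding rq by (rule P(7)[OF cH])
      then have "real (q + K\<^sup>2 * (2 * T)) \<le> real (K\<^sup>2 * M)" unfolding kT[symmetric] k_def by simp
      then show ?thesis by (simp only: of_nat_le_iff)
    qed
    show "4 \<le> sqrt \<epsilon>\<^sub>0 * real (card (verts Gd))" unfolding verts_Gd cardG by (rule hb(3))
  qed (rule order_refl)
  have TM: "T \<le> M" using hes_setup.par(3)[OF config] by linarith
  have r1: "real (K\<^sup>2 * M) = (real D - \<phi> * real n) / 2"
    unfolding F_def[symmetric] kM[symmetric] k_def by simp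
  have r2: "real (M - T) = (real D - (\<phi> + 2 * lam) * real n) / (2 * (real K)\<^sup>2)"
  proof -
    have "real D - (\<phi> + 2 * lam) * real n = 2 * (k * real M) - 2 * (k * real T)"
      unfolding kM kT F_def L_def by (simp add: algebra_simps)
    also have "\<dots> = real (M - T) * (2 * k)" using TM by (simp add: of_nat_diff algebra_simps)
    finally show ?thesis using kp unfolding k_def by simp
  qed
  have r3: "real T = lam * real n / (real K)\<^sup>2" using T unfolding L_def k_def by simp
  have X: "w \<in> X" if "w \<in> {w\<^sub>1, w\<^sub>2}" "11 * real D / 40 \<le> real (deg (bip G (side K A) (side K B)) w)" for w
    using that unfolding dE X_def by simp
  obtain \<J> :: "'a graph set" where J: "finite \<J>" "card \<J> = K\<^sup>2 * M"
    "\<forall>J\<in>\<J>. subgraph J Gd \<and> HES \<epsilon>\<^sub>0 K A B J"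
    "\<forall>J\<in>\<J>. \<forall>J'\<in>\<J>. J \<noteq> J' \<longrightarrow> edges J \<inter> edges J' = {}" "(\<Union>J\<in>\<J>. edges J) = edges Gd"
    and S: "\<forall>i\<in>{1..K}. \<forall>i'\<in>{1..K}. \<exists>\<S> \<subseteq> \<J>. card \<S> = M - T \<and>
        (\<forall>J\<in>\<S>. local_HES \<epsilon>\<^sub>0 K A B i i' J) \<and>
        (\<exists>\<T> \<subseteq> \<S>. card \<T> = T \<and>
           (\<forall>J\<in>\<T>. e_between J (side K A) (side K B) = 2 \<and> (\<forall>w\<in>X. deg (bip J (side K A) (side K B)) w = 1)))"
    using hes_setup.systems_exist[OF config] by (elim exE conjE) (rule that)
  show ?thesis
  proof (rule exI[of _ \<J>], intro conjI ballI)
    show "real (card \<J>) = (real D - \<phi> * real n) / 2" unfolding J(2) by (rule r1)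
    fix i i' assume i: "i \<in> {1..K}" and i': "i' \<in> {1..K}"
    obtain \<S> \<T> where S': "\<S> \<subseteq> \<J>" "card \<S> = M - T" "\<forall>J\<in>\<S>. local_HES \<epsilon>\<^sub>0 K A B i i' J"
      and T': "\<T> \<subseteq> \<S>" "card \<T> = T"
        "\<forall>J\<in>\<T>. e_between J (side K A) (side K B) = 2 \<and> (\<forall>w\<in>X. deg (bip J (side K A) (side K B)) w = 1)"
      using bspec[OF bspec[OF S i] i'] by (elim exE conjE) (rule that)
    show "\<exists>\<S> \<subseteq> \<J>.
                real (card \<S>) = (real D - (\<phi> + 2 * lam) * real n) / (2 * (real K)\<^sup>2) \<and>
                (\<forall>J\<in>\<S>. local_HES \<epsilon>\<^sub>0 K A B i i' J) \<and>
                (\<exists>\<T> \<subseteq> \<S>.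
                   real (card \<T>) = lam * real n / (real K)\<^sup>2 \<and>
                   (\<forall>J\<in>\<T>.
                      e_between J (side K A) (side K B) = 2 \<and>
                      (\<forall>w\<in>{w\<^sub>1, w\<^sub>2}. real (deg (bip G (side K A) (side K B)) w) \<ge> 11 * real D / 40
                           \<longrightarrow> deg (bip J (side K A) (side K B)) w = 1)))"
    proof (rule exI[of _ \<S>], intro conjI)
      show "real (card \<S>) = (real D - (\<phi> + 2 * lam) * real n) / (2 * (real K)\<^sup>2)" unfolding S'(2) by (rule r2)
      show "\<exists>\<T> \<subseteq> \<S>.
                   real (card \<T>) = lam * real n / (real K)\<^sup>2 \<and>
                   (\<forall>J\<in>\<T>.
                      e_between J (side K A) (side K B) = 2 \<and>
                      (\<forall>w\<in>{w\<^sub>1, w\<^sub>2}. real (deg (bip G (side K A) (side K B)) w) \<ge> 11 * real D / 40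
                           \<longrightarrow> deg (bip J (side K A) (side K B)) w = 1))"
        by (rule exI[of _ \<T>], intro conjI ballI impI) (use T' r3 X in auto)
    qed (use S' in auto)
  qed (use J in auto)
qed

theorem lemma4p10:
  "\<exists>c\<^sub>l c\<^sub>K c\<^sub>p :: real. \<exists>f\<^sub>l f\<^sub>K g h :: real \<Rightarrow> real.
     c\<^sub>l \<in> {0<..1} \<and> c\<^sub>K \<in> {0<..1} \<and> c\<^sub>p \<in> {0<..1} \<and>
     hierarchy_fun f\<^sub>l \<and> hierarchy_fun f\<^sub>K \<and> hierarchy_fun g \<and> hierarchy_fun h \<and>
     (\<forall>(n::nat) (D::nat) (K::nat) (m::nat) (\<epsilon>\<^sub>0::real) (\<epsilon>::real) (lam::real) (\<phi>::real)
       (G::'a graph) (G\<^sub>0::'a graph) (Gd::'a graph)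
       (A::nat \<Rightarrow> 'a set) (B::nat \<Rightarrow> 'a set) (A'::'a set) (B'::'a set) (w\<^sub>1::'a) (w\<^sub>2::'a).
        0 < n \<and> 0 < K \<and> 0 < \<epsilon>\<^sub>0 \<and> 0 < \<epsilon> \<and> 0 < lam \<and>
        1 / real n \<le> h \<epsilon>\<^sub>0 \<and> \<epsilon>\<^sub>0 \<le> g \<epsilon> \<and> \<epsilon> \<le> f\<^sub>l lam \<and> \<epsilon> \<le> f\<^sub>K (1 / real K) \<and>
        lam \<le> c\<^sub>l \<and> 1 / real K \<le> c\<^sub>K \<and>
        0 \<le> \<phi> \<and> \<phi> \<le> c\<^sub>p \<and>
        int D \<ge> int n - 2 * \<lfloor>real n / 4\<rfloor> - 1 \<and>
        lam * real n / (real K)\<^sup>2 \<in> \<nat> \<and>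
        (real D - \<phi> * real n) / (400 * (real K)\<^sup>2) \<in> \<nat> \<and>
        A' = side K A \<and> B' = side K B \<and>
        simple_graph G \<and> card (verts G) = n \<and> regular D G \<and>
        Kme_partition K m \<epsilon>\<^sub>0 A B (verts G) \<and>
        e_between G A' B' \<ge> D \<and>
        real (max_deg (bip G A' B')) \<le> real D / 2 \<and>
        critical G A' B' D \<and>
        subgraph G\<^sub>0 G \<and>
        subgraph (graph_plus (induced G (A 0)) (induced G (B 0))) G\<^sub>0 \<and>
        real (e_between G\<^sub>0 A' B') \<le> \<phi> * real n \<and>
        (\<forall>v \<in> A 0 \<union> B 0. real (deg G\<^sub>0 v) = \<phi> * real n) \<and>
        Gd = graph_minus (graph_minus (graph_minus G (induced G (clusters K A)))
                                      (induced G (clusters K B))) G\<^sub>0 \<and>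
        even (e_between Gd A' B') \<and>
        exceptional_scheme K m \<epsilon>\<^sub>0 \<epsilon> Gd A B \<and>
        w\<^sub>1 \<in> verts G \<and> w\<^sub>2 \<in> verts G \<and> w\<^sub>1 \<noteq> w\<^sub>2 \<and>
        deg (bip G A' B') w\<^sub>1 \<ge> deg (bip G A' B') w\<^sub>2 \<and>
        (\<forall>v \<in> verts G - {w\<^sub>1, w\<^sub>2}. deg (bip G A' B') w\<^sub>2 \<ge> deg (bip G A' B') v) \<and>
        real (deg (bip Gd A' B') w\<^sub>1) \<le> (real D - \<phi> * real n) / 2 \<and>
        real (deg (bip Gd A' B') w\<^sub>2) \<le> (real D - \<phi> * real n) / 2
        \<longrightarrow>
        (\<exists>\<J> :: 'a graph set.
           finite \<J> \<and> real (card \<J>) = (real D - \<phi> * real n) / 2 \<and>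
           (\<forall>J\<in>\<J>. subgraph J Gd \<and> HES \<epsilon>\<^sub>0 K A B J) \<and>
           (\<forall>J\<in>\<J>. \<forall>J'\<in>\<J>. J \<noteq> J' \<longrightarrow> edges J \<inter> edges J' = {}) \<and>
           (\<Union>J\<in>\<J>. edges J) = edges Gd \<and>
           (\<forall>i\<in>{1..K}. \<forall>i'\<in>{1..K}.
              \<exists>\<S> \<subseteq> \<J>.
                real (card \<S>) = (real D - (\<phi> + 2 * lam) * real n) / (2 * (real K)\<^sup>2) \<and>
                (\<forall>J\<in>\<S>. local_HES \<epsilon>\<^sub>0 K A B i i' J) \<and>
                (\<exists>\<T> \<subseteq> \<S>.
                   real (card \<T>) = lam * real n / (real K)\<^sup>2 \<and>
                   (\<forall>J\<in>\<T>.
                      e_between J A' B' = 2 \<and>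
                      (\<forall>w\<in>{w\<^sub>1, w\<^sub>2}. real (deg (bip G A' B') w) \<ge> 11 * real D / 40
                           \<longrightarrow> deg (bip J A' B') w = 1))))))"
  \<comment> \<open>The constant bounds on \<open>\<lambda>\<close> and \<open>\<phi>\<close> leave slack in all linear conditions. The hypothesis \<open>\<epsilon> \<le> 1 / K\<close> alone ties \<open>K\<close> to the hierarchy.\<close>
  apply (rule exI[of _ "1/100"], rule exI[of _ 1], rule exI[of _ "1/100"])
  apply (rule exI[of _ "\<lambda>x. x / 10000"], rule exI[of _ "\<lambda>x. x"], rule exI[of _ "\<lambda>x. x^4"],
      rule exI[of _ "\<lambda>x. x\<^sup>2 / 1000"])
  apply (intro conjI hierarchy_funs allI impI)
     apply simp_all[3]
  apply (elim conjE)
  apply hypsubst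
  apply (rule critical_decomposition)
  apply (assumption | rule refl)+
  done

end
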